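(* Let $k\in\mathbb{N}$, $k\ge1$. (1) Let $f\in L^\infty(\mathbb{C})$. Then $T_{f,(k)}\in\mathcal{K}(F^2_{(k)})$ if and only if $\widetilde{T_{f,(k)}}\in C_0(\mathbb{C})$. (2) Let $A\in\mathcal{L}(F^2_{(k)})$. Then $\widetilde A\in C_0(\mathbb{C})$ if and only if $T_{\widetilde A,(k)}\in\mathcal{K}(F^2_{(k)})$.
   Context: Let $\mathrm{d}\mu(z)=\frac1\pi e^{-|z|^2}\,\mathrm{d}z$ on $\mathbb{C}\cong\mathbb{R}^2$. For $n\ge1$, $F_n^2$ is the closed subspace of $L^2(\mathbb{C},\mu)$ of smooth functions $f$ with $\partial^n f/\partial\overline z^n=0$; $F^2_{(1)}:=F^2_1$ and $F^2_{(k)}:=F^2_k\ominus F^2_{k-1}$ for $k\ge2$; $P_{(k)}$ is the orthogonal projection of $L^2(\mathbb{C},\mu)$ onto $F^2_{(k)}$. $\mathcal{L}(H)$ and $\mathcal{K}(H)$ denote the bounded and compact operators on $H$; $C_0(\mathbb{C})$ is the space of continuous functions vanishing at infinity. For $f\in L^\infty(\mathbb{C})$, the Toeplitz operator on $F^2_{(k)}$ is $T_{f,(k)}g=P_{(k)}(fg)$. $L^0_m(x)=\sum_{j=0}^m(-1)^j\binom{m}{m-j}\frac{x^j}{j!}$. The normalized reproducing kernels of $F^2_{(k)}$ are $k_{z,(k)}(w)=L^0_{k-1}(|w-z|^2)e^{w\overline z-|z|^2/2}$, and the Berezin transform of $A\in\mathcal{L}(F^2_{(k)})$ is $\widetilde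 A(z)=\langle Ak_{z,(k)},k_{z,(k)}\rangle$, $z\in\mathbb{C}$. *)

theory Defs
  imports "HOL-Analysis.Analysis"
begin

definition gauss :: "complex measure" where
  "gauss = density lborel (\<lambda>z. ennreal (exp (- (norm z)\<^sup>2) / pi))"

(* Members of L2 and Linfty are Borel functions, not classes. Every Lebesgue class has a Borel
   representative, and all integrals below depend on the class only. *)

definition L2 :: "(complex \<Rightarrow> complex) set" where
  "L2 = {f \<in> borel_measurable gauss. integrable gauss (\<lambda>z. (norm (f z))\<^sup>2)}"

definition L2_inner :: "(complex \<Rightarrow> complex) \<Rightarrow> (complex \<Rightarrow> complex) \<Rightarrow> complex" where
  "L2_inner f g = (LINT z|gauss. f z * cnj (g z))"

definition L2_norm :: "(complex \<Rightarrow> complex) \<Rightarrow> real" where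
  "L2_norm f = sqrt (LINT z|gauss. (norm (f z))\<^sup>2)"

definition Linfty :: "(complex \<Rightarrow> complex) set" where
  "Linfty = {f \<in> borel_measurable lborel. \<exists>C. AE z in lborel. norm (f z) \<le> C}"

definition C0 :: "(complex \<Rightarrow> complex) set" where
  "C0 = {f. continuous_on UNIV f \<and> (f \<longlongrightarrow> 0) at_infinity}"

(* Differentiability and the derivative are over the reals, on the plane. *)

definition dx :: "(complex \<Rightarrow> complex) \<Rightarrow> complex \<Rightarrow> complex" where
  "dx f z = frechet_derivative f (at z) 1"

definition dy :: "(complex \<Rightarrow> complex) \<Rightarrow> complex \<Rightarrow> complex" where
  "dy f z = frechet_derivative f (at z) \<i>"

definition dbar :: "(complex \<Rightarrow> complex) \<Rightarrow> complex \<Rightarrow> complex" where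
  "dbar f z = (dx f z + \<i> * dy f z) / 2"

primrec Ck :: "nat \<Rightarrow> (complex \<Rightarrow> complex) \<Rightarrow> bool" where
  "Ck 0 f \<longleftrightarrow> continuous_on UNIV f"
| "Ck (Suc n) f \<longleftrightarrow> (\<forall>z. f differentiable (at z)) \<and> Ck n (dx f) \<and> Ck n (dy f)"

definition smooth :: "(complex \<Rightarrow> complex) \<Rightarrow> bool" where
  "smooth f \<longleftrightarrow> (\<forall>n. Ck n f)"

(* Each element of the polyanalytic Fock space is given by its unique smooth representative, so
   equality in these spaces is pointwise equality of functions and L2_norm is a genuine norm. *)

definition fock :: "nat \<Rightarrow> (complex \<Rightarrow> complex) set" where
  "fock n = {f \<in> L2. smooth f \<and> (dbar ^^ n) f = (\<lambda>z. 0)}"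

definition true_fock :: "nat \<Rightarrow> (complex \<Rightarrow> complex) set" where
  "true_fock k =
     (if k = 1 then fock 1 else {f \<in> fock k. \<forall>g \<in> fock (k - 1). L2_inner f g = 0})"

(* For g in L2, the smooth representative of the orthogonal projection of g. *)

definition fock_proj :: "nat \<Rightarrow> (complex \<Rightarrow> complex) \<Rightarrow> complex \<Rightarrow> complex" where
  "fock_proj k g =
     (THE h. h \<in> true_fock k \<and> (\<forall>u \<in> true_fock k. L2_inner (\<lambda>z. g z - h z) u = 0))"

type_synonym oper = "(complex \<Rightarrow> complex) \<Rightarrow> complex \<Rightarrow> complex"

(* An operator on H = true_fock k is a total HOL function of which only the values on H matter. *)

definition bounded_ops :: "nat \<Rightarrow> oper set" where
  "bounded_ops k = {A.
     (\<forall>f \<in> true_fock k. A f \<in> true_fock k) \<and>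
     (\<forall>f \<in> true_fock k. \<forall>g \<in> true_fock k. A (\<lambda>z. f z + g z) = (\<lambda>z. A f z + A g z)) \<and>
     (\<forall>c. \<forall>f \<in> true_fock k. A (\<lambda>z. c * f z) = (\<lambda>z. c * A f z)) \<and>
     (\<exists>C. \<forall>f \<in> true_fock k. L2_norm (A f) \<le> C * L2_norm f)}"

definition fock_topology :: "nat \<Rightarrow> (complex \<Rightarrow> complex) topology" where
  "fock_topology k = Metric_space.mtopology (true_fock k) (\<lambda>f g. L2_norm (\<lambda>z. f z - g z))"

definition compact_ops :: "nat \<Rightarrow> oper set" where
  "compact_ops k = {A \<in> bounded_ops k.
     compactin (fock_topology k)
       (fock_topology k closure_of (A ` {f \<in> true_fock k. L2_norm f \<le> 1}))}"

definition toeplitz :: "nat \<Rightarrow> (complex \<Rightarrow> complex) \<Rightarrow> oper" where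
  "toeplitz k f g = fock_proj k (\<lambda>w. f w * g w)"

definition laguerre0 :: "nat \<Rightarrow> real \<Rightarrow> real" where
  "laguerre0 m x = (\<Sum>j\<le>m. (- 1) ^ j * real (m choose (m - j)) * x ^ j / fact j)"

definition nkernel :: "nat \<Rightarrow> complex \<Rightarrow> complex \<Rightarrow> complex" where
  "nkernel k z w = of_real (laguerre0 (k - 1) ((norm (w - z))\<^sup>2))
     * exp (w * cnj z - of_real ((norm z)\<^sup>2 / 2))"

definition berezin :: "nat \<Rightarrow> oper \<Rightarrow> complex \<Rightarrow> complex" where
  "berezin k A z = L2_inner (A (nkernel k z)) (nkernel k z)"

end

theory Submission
  imports Defs "HOL-Complex_Analysis.Complex_Analysis" "HOL-Probability.Distributions"
    "HOL-Computational_Algebra.Fundamental_Theorem_Algebra"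
begin

text \<open>
  Let \<open>k = n + 1\<close> and let \<open>Wt z\<close> be the Weyl operators. For a bounded sesquilinear form \<open>B\<close> the function
  \<open>z \<mapsto> B (Wt z u) (Wt z v)\<close> is bounded with all its derivatives; its Wirtinger derivatives are functions
  of the same kind, with creation and annihilation operators applied to \<open>u\<close> and \<open>v\<close>. Along the orthogonal
  basis \<open>Efun n i\<close> of the true Fock space this is a three-term recurrence for the Laplacian \<open>Lap = dz dbar\<close>.
  It follows that the Berezin transform of an operator is \<open>p(Lap) h\<close> for the symbol \<open>h\<close> of the vector
  \<open>Efun n 0\<close>, with a polynomial \<open>p\<close> that depends on \<open>n\<close> only. For \<open>T\<^sub>f\<close> the same recurrence, run over the
  vectors \<open>(cnj w)^j\<close>, gives \<open>h = p(Lap) u\<close>, where \<open>u\<close> is the convolution of \<open>f\<close> with the Gaussian.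

  The analytic core is Tauberian: if \<open>u\<close> is bounded with all its derivatives and \<open>p(Lap)\<^sup>2 u\<close> vanishes at
  infinity, then so does \<open>p(Lap) u\<close>. This is reduced to linear factors and proved with Gaussian energy
  estimates. So if the Berezin transform of \<open>T\<^sub>f\<close> vanishes at infinity, then so do all the functions
  \<open>\<langle>f Wt z e\<^sub>i, Wt z e\<^sub>j\<rangle>\<close>, and by the completeness of the \<open>e\<^sub>i\<close> and dominated convergence the integrals
  \<open>\<integral> \<bar>\<langle>T\<^sub>f k\<^sub>w, k\<^sub>z\<rangle>\<bar> dw\<close> tend to \<open>0\<close> as \<open>z \<rightarrow> \<infinity>\<close>. Schur's test turns this into uniformly small tails of the
  image of the unit ball, that is, compactness.

  In part (2), if \<open>T\<^sub>a\<close> is compact for the Berezin transform \<open>a = p(Lap) h\<close> of \<open>A\<close>, two applications of the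
  Tauberian theorem show that the Gaussian averages of \<open>a\<close> vanish at infinity. The recurrence extends this to
  all radial moments, and a Taylor expansion of the exponential narrows the Gaussian until \<open>a\<close> itself is
  recovered, since \<open>a\<close> is Lipschitz.
\<close>

section \<open>The Gaussian measure on the plane\<close>

text \<open>The three-term recurrence is that of the Laguerre polynomials, so \<open>p\<close> is
  the Laguerre polynomial of degree \<open>n\<close> at minus its argument. Its zeros are negative
  reals, and for such \<open>\<mu>\<close> the equation \<open>Lap u = \<mu> u\<close> has bounded
  plane-wave solutions, which do not vanish at infinity. So \<open>p(Lap) u\<close> may vanish at
  infinity while \<open>u\<close> does not, and a single factor cannot be cancelled. A repetition
  can: a solution of \<open>(Lap - \<mu>)^2 u = 0\<close> that is bounded with its derivatives
  already solves \<open>(Lap - \<mu>) u = 0\<close>. The proof is arranged to produce repetitions.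
  For a Toeplitz operator one factor \<open>p(Lap)\<close> arises from the Fock basis and one from
  the powers of \<open>cnj w\<close>. In part (2) the symbol \<open>a = p(Lap) h\<close> brings a
  third factor, so that two cancellations still leave \<open>p(Lap)\<close> of the Gaussian average
  of \<open>h\<close>, which is the average of \<open>a\<close>. This average can be sharpened
  because the other radial moments follow from it by applying \<open>Lap\<close>, an operation that
  preserves vanishing at infinity for functions with bounded derivatives.\<close>

lemma lborel_complex_pair:
  "distr (lborel \<Otimes>\<^sub>M lborel) borel (\<lambda>(x, y). Complex x y) = lborel"
proof (rule lborel_eqI[symmetric])
  have [measurable]: "(\<lambda>(x, y). Complex x y) \<in> borel_measurable (lborel \<Otimes>\<^sub>M lborel)"
    by (simp add: borel_measurable_complex_iff split_beta')
  fix l u :: complex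
  assume le: "\<And>b. b \<in> Basis \<Longrightarrow> l \<bullet> b \<le> u \<bullet> b"
  have vim: "(\<lambda>(x, y). Complex x y) -` box l u = {Re l<..<Re u} \<times> {Im l<..<Im u}"
    by (auto simp: box_def Basis_complex_def)
  from le[of 1] le[of \<i>] have "Re l \<le> Re u" "Im l \<le> Im u"
    by (auto simp: Basis_complex_def)
  then show "emeasure (distr (lborel \<Otimes>\<^sub>M lborel) borel (\<lambda>(x, y). Complex x y)) (box l u)
      = ennreal (\<Prod>b\<in>Basis. (u - l) \<bullet> b)"
    by (subst emeasure_distr)
      (auto simp: vim lborel.emeasure_pair_measure_Times Basis_complex_def ennreal_mult space_pair_measure)
qed simp

text \<open>Both orders of iteration are stated because each of the two shears below needs the inner
  integral over the coordinate that it moves.\<close>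

lemma nn_integral_complex:
  assumes [measurable]: "f \<in> borel_measurable borel"
  shows "(\<integral>\<^sup>+z. f z \<partial>lborel) = (\<integral>\<^sup>+x. \<integral>\<^sup>+y. f (Complex x y) \<partial>lborel \<partial>lborel)"
    and "(\<integral>\<^sup>+z. f z \<partial>lborel) = (\<integral>\<^sup>+y. \<integral>\<^sup>+x. f (Complex x y) \<partial>lborel \<partial>lborel)"
proof -
  have [measurable]: "(\<lambda>(x, y). Complex x y) \<in> borel_measurable (lborel \<Otimes>\<^sub>M lborel)"
    by (simp add: borel_measurable_complex_iff split_beta')
  have *: "(\<integral>\<^sup>+z. f z \<partial>lborel) = (\<integral>\<^sup>+p. f (Complex (fst p) (snd p)) \<partial>(lborel \<Otimes>\<^sub>M lborel))"
    by (subst lborel_complex_pair[symmetric], subst nn_integral_distr)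
      (auto simp: split_beta')
  have [measurable]: "(\<lambda>p. f (Complex (fst p) (snd p))) \<in> borel_measurable (lborel \<Otimes>\<^sub>M lborel)"
    using measurable_compose[of "\<lambda>(x, y). Complex x y" "lborel \<Otimes>\<^sub>M lborel" borel f borel]
    by (simp add: split_beta')
  show "(\<integral>\<^sup>+z. f z \<partial>lborel) = (\<integral>\<^sup>+x. \<integral>\<^sup>+y. f (Complex x y) \<partial>lborel \<partial>lborel)"
    by (subst *, subst lborel.nn_integral_fst[symmetric]) auto
  show "(\<integral>\<^sup>+z. f z \<partial>lborel) = (\<integral>\<^sup>+y. \<integral>\<^sup>+x. f (Complex x y) \<partial>lborel \<partial>lborel)"
    by (subst *, subst lborel_pair.nn_integral_snd[symmetric]) auto
qed

lemma nn_integral_translate: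
  assumes [measurable]: "f \<in> borel_measurable borel"
  shows "(\<integral>\<^sup>+x. f (t + x) \<partial>lborel) = (\<integral>\<^sup>+x. f x \<partial>(lborel :: 'a::euclidean_space measure))"
  by (subst (2) lborel_distr_plus[of t, symmetric], subst nn_integral_distr) auto

text \<open>On each line where the other coordinate is fixed a shear is a translation, so Fubini and
  \<open>nn_integral_translate\<close> suffice.\<close>

lemma nn_integral_shear:
  assumes [measurable]: "f \<in> borel_measurable (borel :: complex measure)"
  shows "(\<integral>\<^sup>+z. f (Complex (Re z + t * Im z) (Im z)) \<partial>lborel) = (\<integral>\<^sup>+z. f z \<partial>lborel)"
    and "(\<integral>\<^sup>+z. f (Complex (Re z) (Im z + t * Re z)) \<partial>lborel) = (\<integral>\<^sup>+z. f z \<partial>lborel)"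
proof -
  have [measurable]: "(\<lambda>z. Complex (Re z + t * Im z) (Im z)) \<in> borel_measurable borel"
    "(\<lambda>z. Complex (Re z) (Im z + t * Re z)) \<in> borel_measurable borel"
    "\<And>y. (\<lambda>x. Complex x y) \<in> borel_measurable borel"
    "\<And>x. (\<lambda>y. Complex x y) \<in> borel_measurable borel"
    by (simp_all add: borel_measurable_complex_iff)
  show "(\<integral>\<^sup>+z. f (Complex (Re z + t * Im z) (Im z)) \<partial>lborel) = (\<integral>\<^sup>+z. f z \<partial>lborel)"
    using nn_integral_translate[where f = "\<lambda>x. f (Complex x y)" and t = "t * y" for y]
    by (simp add: nn_integral_complex(2) add.commute)
  show "(\<integral>\<^sup>+z. f (Complex (Re z) (Im z + t * Re z)) \<partial>lborel) = (\<integral>\<^sup>+z. f z \<partial>lborel)"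
    using nn_integral_translate[where f = "\<lambda>y. f (Complex x y)" and t = "t * x" for x]
    by (simp add: nn_integral_complex(1) add.commute)
qed

text \<open>A rotation is a product of three shears unless it is the half-turn.\<close>

lemma nn_integral_rotate:
  assumes [measurable]: "f \<in> borel_measurable borel" and c: "norm (c::complex) = 1"
  shows "(\<integral>\<^sup>+z. f (c * z) \<partial>lborel) = (\<integral>\<^sup>+z. f z \<partial>lborel)"
proof -
  have *: "(\<integral>\<^sup>+z. g (d * z) \<partial>lborel) = (\<integral>\<^sup>+z. g z \<partial>lborel)"
    if [measurable]: "g \<in> borel_measurable borel" and d: "norm d = 1" "Re d \<ge> 0"
    for g :: "complex \<Rightarrow> ennreal" and d
  proof -
    \<comment> \<open>Minus the tangent of half the angle of \<open>d\<close>. The assumption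
      \<open>Re d \<ge> 0\<close> keeps the denominator positive.\<close>
    define t where "t = - Im d / (1 + Re d)"
    have d2: "(Re d)\<^sup>2 + (Im d)\<^sup>2 = 1"
      using d by (metis cmod_power2 one_power2)
    have t1: "1 + t * Im d = Re d"
      using d2 d by (simp add: t_def field_simps power2_eq_square)
    have t2: "t * (1 + Re d) = - Im d"
      using d by (simp add: t_def)
    let ?S = "\<lambda>z. Complex (Re z + t * Im z) (Im z)"
    let ?R = "\<lambda>z. Complex (Re z) (Im z + Im d * Re z)"
    have [measurable]: "?S \<in> borel_measurable borel" "?R \<in> borel_measurable borel"
      by (simp_all add: borel_measurable_complex_iff)
    have "?S (?R (?S z)) = d * z" for z
    proof -
      have "Im z + Im d * (Re z + t * Im z) = Im d * Re z + (1 + t * Im d) * Im z"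
        by (simp add: algebra_simps)
      also have "\<dots> = Im (d * z)"
        by (simp add: t1)
      finally have im: "Im z + Im d * (Re z + t * Im z) = Im (d * z)" .
      have "Re z + t * Im z + t * Im (d * z) = (1 + t * Im d) * Re z + t * (1 + Re d) * Im z"
        by (simp add: algebra_simps)
      also have "\<dots> = Re (d * z)"
        by (simp add: t1 t2)
      finally show ?thesis
        using im by (simp add: complex_eq_iff)
    qed
    then have "(\<integral>\<^sup>+z. g (d * z) \<partial>lborel) = (\<integral>\<^sup>+z. g (?S (?R (?S z))) \<partial>lborel)"
      by simp
    also have "\<dots> = (\<integral>\<^sup>+z. g (?S (?R z)) \<partial>lborel)"
      by (rule nn_integral_shear(1)[of "\<lambda>z. g (?S (?R z))"]) measurable
    also have "\<dots> = (\<integral>\<^sup>+z. g (?S z) \<partial>lborel)"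
      by (rule nn_integral_shear(2)[of "\<lambda>z. g (?S z)"]) measurable
    also have "\<dots> = (\<integral>\<^sup>+z. g z \<partial>lborel)"
      by (rule nn_integral_shear(1)) measurable
    finally show ?thesis .
  qed
  \<comment> \<open>The principal square root lies in the closed right half-plane, so any rotation,
    the half-turn included, is the square of one treated above.\<close>
  define d where "d = csqrt c"
  have d: "norm d = 1" "Re d \<ge> 0" "c = d * d"
    using c csqrt_principal[of c] by (auto simp: d_def norm_csqrt power2_eq_square[symmetric])
  have "(\<integral>\<^sup>+z. f (c * z) \<partial>lborel) = (\<integral>\<^sup>+z. f (d * (d * z)) \<partial>lborel)"
    by (simp add: d(3) mult.assoc)
  also have "\<dots> = (\<integral>\<^sup>+z. f (d * z) \<partial>lborel)"
    by (rule *[of "\<lambda>z. f (d * z)"]) (use d in auto)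
  also have "\<dots> = (\<integral>\<^sup>+z. f z \<partial>lborel)"
    by (rule *) (use d in auto)
  finally show ?thesis .
qed

lemma nn_integral_scale_complex:
  assumes [measurable]: "f \<in> borel_measurable borel" and r: "r > 0"
  shows "(\<integral>\<^sup>+z. f z \<partial>lborel) = ennreal (r\<^sup>2) * (\<integral>\<^sup>+z. f (of_real r * z) \<partial>(lborel :: complex measure))"
proof -
  have "(\<integral>\<^sup>+z. f z \<partial>lborel) = (\<integral>\<^sup>+z. f z \<partial>(density (distr lborel borel (\<lambda>x. 0 + r *\<^sub>R x)) (\<lambda>_. \<bar>r\<bar>^DIM(complex))))"
    using lborel_affine[of r "0::complex"] r by simp
  also have "\<dots> = (\<integral>\<^sup>+z. ennreal (r\<^sup>2) * f (of_real r * z) \<partial>lborel)"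
    by (subst nn_integral_density) (auto simp: nn_integral_distr scaleR_conv_of_real)
  also have "\<dots> = ennreal (r\<^sup>2) * (\<integral>\<^sup>+z. f (of_real r * z) \<partial>lborel)"
    by (rule nn_integral_cmult) auto
  finally show ?thesis .
qed

lemma nn_integral_gaussian_real: "(\<integral>\<^sup>+x. ennreal (exp (- x\<^sup>2)) \<partial>lborel) = ennreal (sqrt pi)"
proof -
  have "has_bochner_integral lborel (\<lambda>x. exp (- x\<^sup>2) :: real) (2 *\<^sub>R (sqrt pi / 2))"
    by (rule has_bochner_integral_even_function[OF gaussian_moment_0]) simp
  then show ?thesis
    by (simp add: has_bochner_integral_iff nn_integral_eq_integral)
qed

lemma nn_integral_gaussian_complex:
  "(\<integral>\<^sup>+z. ennreal (exp (- (norm z)\<^sup>2)) \<partial>(lborel :: complex measure)) = ennreal pi"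
proof -
  have "(\<integral>\<^sup>+z. ennreal (exp (- (norm z)\<^sup>2)) \<partial>(lborel :: complex measure))
     = (\<integral>\<^sup>+x. \<integral>\<^sup>+y. ennreal (exp (- x\<^sup>2)) * ennreal (exp (- y\<^sup>2)) \<partial>lborel \<partial>lborel)"
    by (subst nn_integral_complex(1)) (auto simp: cmod_power2 exp_add[symmetric] ennreal_mult[symmetric])
  also have "\<dots> = ennreal (sqrt pi) * ennreal (sqrt pi)"
    by (simp add: nn_integral_cmult nn_integral_multc nn_integral_gaussian_real)
  finally show ?thesis
    by (simp add: ennreal_mult[symmetric])
qed

lemma sets_gauss [simp, measurable_cong]: "sets gauss = sets borel"
  by (simp add: gauss_def)

lemma space_gauss [simp]: "space gauss = UNIV"
  by (simp add: gauss_def)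

lemma measurable_gauss [simp]: "borel_measurable gauss = borel_measurable borel"
  by (rule measurable_cong_sets) auto

lemma nn_integral_gauss:
  assumes [measurable]: "f \<in> borel_measurable borel"
  shows "(\<integral>\<^sup>+z. f z \<partial>gauss) = (\<integral>\<^sup>+z. ennreal (exp (- (norm z)\<^sup>2) / pi) * f z \<partial>lborel)"
  unfolding gauss_def by (rule nn_integral_density) auto

lemma integral_gauss:
  fixes f :: "complex \<Rightarrow> 'a::{banach, second_countable_topology}"
  assumes [measurable]: "f \<in> borel_measurable borel"
  shows "(LINT z|gauss. f z) = (LINT z|lborel. (exp (- (norm z)\<^sup>2) / pi) *\<^sub>R f z)"
  unfolding gauss_def by (rule integral_density) auto

lemma integrable_gauss_iff:
  fixes f :: "complex \<Rightarrow> 'a::{banach, second_countable_topology}"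
  assumes [measurable]: "f \<in> borel_measurable borel"
  shows "integrable gauss f \<longleftrightarrow> integrable lborel (\<lambda>z. (exp (- (norm z)\<^sup>2) / pi) *\<^sub>R f z)"
  unfolding gauss_def by (rule integrable_density) auto

interpretation gauss: prob_space gauss
proof
  have "emeasure gauss UNIV = (\<integral>\<^sup>+z. ennreal (1 / pi) * ennreal (exp (- (norm (z::complex))\<^sup>2)) \<partial>lborel)"
    unfolding gauss_def by (subst emeasure_density) (auto simp: ennreal_mult[symmetric])
  also have "\<dots> = 1"
    by (subst nn_integral_cmult) (auto simp: nn_integral_gaussian_complex ennreal_mult[symmetric])
  finally show "emeasure gauss (space gauss) = 1"
    by simp
qed

lemma nn_integral_gaussian_scaled:
  assumes "a > 0"
  shows "(\<integral>\<^sup>+z. ennreal (exp (- (a * (norm z)\<^sup>2))) \<partial>(lborel :: complex measure)) = ennreal (pi / a)"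
proof -
  define r where "r = 1 / sqrt a"
  have r: "r > 0" "r\<^sup>2 = 1 / a"
    using assms by (auto simp: r_def power_divide)
  then have ar: "a * r\<^sup>2 = 1"
    using assms by simp
  have "exp (- (a * (norm (of_real r * z :: complex))\<^sup>2)) = exp (- (norm z)\<^sup>2)" for z
    using ar by (simp add: norm_mult power_mult_distrib mult.assoc[symmetric])
  then show ?thesis
    using r by (subst nn_integral_scale_complex[of _ r])
      (auto simp: nn_integral_gaussian_complex ennreal_mult''[symmetric])
qed

lemma gaussian_scaled:
  assumes "a > 0"
  shows "integrable (lborel :: complex measure) (\<lambda>z. exp (- (a * (norm z)\<^sup>2)))"
    and "(LINT z|(lborel :: complex measure). exp (- (a * (norm z)\<^sup>2))) = pi / a"
proof -
  show *: "integrable (lborel :: complex measure) (\<lambda>z. exp (- (a * (norm z)\<^sup>2)))"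
    by (rule integrableI_nonneg) (auto simp: nn_integral_gaussian_scaled[OF assms])
  have "ennreal (LINT z|(lborel :: complex measure). exp (- (a * (norm z)\<^sup>2))) = ennreal (pi / a)"
    by (subst nn_integral_eq_integral[OF *, symmetric]) (auto simp: nn_integral_gaussian_scaled[OF assms])
  then show "(LINT z|(lborel :: complex measure). exp (- (a * (norm z)\<^sup>2))) = pi / a"
    using assms by (subst (asm) ennreal_inj) auto
qed

lemma gauss_rotate:
  assumes c: "norm c = 1"
  shows "distr gauss borel (\<lambda>z. c * z) = gauss"
proof (rule measure_eqI)
  fix A assume "A \<in> sets (distr gauss borel (\<lambda>z. c * z))"
  then have [measurable]: "A \<in> sets borel" by simp
  have "emeasure (distr gauss borel (\<lambda>z. c * z)) A = (\<integral>\<^sup>+z. indicator A (c * z) \<partial>gauss)"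
    by (subst nn_integral_indicator[symmetric], simp, subst nn_integral_distr) auto
  also have "\<dots> = (\<integral>\<^sup>+z. (\<lambda>z. ennreal (exp (- (norm z)\<^sup>2) / pi) * indicator A z) (c * z) \<partial>lborel)"
    by (simp add: nn_integral_gauss c norm_mult)
  also have "\<dots> = (\<integral>\<^sup>+z. ennreal (exp (- (norm z)\<^sup>2) / pi) * indicator A z \<partial>lborel)"
    by (rule nn_integral_rotate) (use c in auto)
  also have "\<dots> = (\<integral>\<^sup>+z. indicator A z \<partial>gauss)"
    by (rule nn_integral_gauss[symmetric]) simp
  finally show "emeasure (distr gauss borel (\<lambda>z. c * z)) A = emeasure gauss A"
    by simp
qed simp

text \<open>Completing the square in the exponent. The density is the squared modulus of the
  exponential factor of the Weyl operators, which is why they are isometries of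
  \<open>L2\<close>.\<close>

lemma gauss_translate:
  "distr gauss borel (\<lambda>w. z + w) = density gauss (\<lambda>w. ennreal (exp (2 * Re (w * cnj z) - (norm z)\<^sup>2)))"
proof (rule measure_eqI)
  fix A assume "A \<in> sets (distr gauss borel (\<lambda>w. z + w))"
  then have [measurable]: "A \<in> sets borel" by simp
  have sq: "- (norm (z + w))\<^sup>2 + (2 * Re ((z + w) * cnj z) - (norm z)\<^sup>2) = - (norm w)\<^sup>2" for w
    by (simp only: cmod_power2) (simp add: algebra_simps power2_eq_square)
  have e: "exp (- (norm (z + w))\<^sup>2) / pi * exp (2 * Re ((z + w) * cnj z) - (norm z)\<^sup>2) = exp (- (norm w)\<^sup>2) / pi" for w
    by (subst times_divide_eq_left, subst exp_add[symmetric], simp only: sq)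
  have "emeasure (distr gauss borel (\<lambda>w. z + w)) A = (\<integral>\<^sup>+w. indicator A (z + w) \<partial>gauss)"
    by (subst nn_integral_indicator[symmetric], simp, subst nn_integral_distr) auto
  also have "\<dots> = (\<integral>\<^sup>+w. (\<lambda>w. ennreal (exp (- (norm w)\<^sup>2) / pi) *
      (ennreal (exp (2 * Re (w * cnj z) - (norm z)\<^sup>2)) * indicator A w)) (z + w) \<partial>lborel)"
    by (subst nn_integral_gauss, simp, rule nn_integral_cong)
      (simp only: mult.assoc[symmetric] ennreal_mult''[symmetric] exp_ge_zero e)
  also have "\<dots> = (\<integral>\<^sup>+w. ennreal (exp (- (norm w)\<^sup>2) / pi) *
      (ennreal (exp (2 * Re (w * cnj z) - (norm z)\<^sup>2)) * indicator A w) \<partial>lborel)"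
    by (rule nn_integral_translate) measurable
  also have "\<dots> = (\<integral>\<^sup>+w. ennreal (exp (2 * Re (w * cnj z) - (norm z)\<^sup>2)) * indicator A w \<partial>gauss)"
    by (subst nn_integral_gauss) auto
  finally show "emeasure (distr gauss borel (\<lambda>w. z + w)) A
      = emeasure (density gauss (\<lambda>w. ennreal (exp (2 * Re (w * cnj z) - (norm z)\<^sup>2)))) A"
    by (simp add: emeasure_density)
qed simp

section \<open>Square-integrable functions and Weyl operators\<close>

lemma borel_measurable_cnj [measurable (raw)]:
  "f \<in> borel_measurable M \<Longrightarrow> (\<lambda>w. cnj (f w)) \<in> borel_measurable M"
  by (rule borel_measurable_continuous_on[OF continuous_on_cnj[OF continuous_on_id]])

text \<open>The working class of test functions: it contains the polynomials, is stable under
  products, conjugation, translation and the Weyl operators, and the Gaussian makes all its members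
  integrable. One constant serves as factor and as rate; \<open>egrowI\<close> allows two.\<close>

definition egrow :: "(complex \<Rightarrow> complex) \<Rightarrow> bool" where
  "egrow f \<longleftrightarrow> f \<in> borel_measurable borel \<and> (\<exists>C\<ge>0. \<forall>w. norm (f w) \<le> C * exp (C * norm w))"

lemma egrowI:
  assumes "f \<in> borel_measurable borel" "\<And>w. norm (f w) \<le> C * exp (C' * norm w)"
  shows "egrow f"
proof -
  let ?M = "max (max C C') 0"
  have "norm (f w) \<le> ?M * exp (?M * norm w)" for w
  proof -
    have "norm (f w) \<le> C * exp (C' * norm w)" by fact
    also have "\<dots> \<le> ?M * exp (?M * norm w)"
      by (intro mult_mono) (auto intro!: mult_right_mono)
    finally show ?thesis .
  qed
  then show ?thesis
    using assms(1) unfolding egrow_def by (intro conjI exI[of _ ?M]) auto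
qed

lemma egrow_measurable [measurable_dest]: "egrow f \<Longrightarrow> f \<in> borel_measurable borel"
  by (simp add: egrow_def)

lemma egrow_mult:
  assumes "egrow f" "egrow g" shows "egrow (\<lambda>w. f w * g w)"
proof -
  obtain C D where C: "C \<ge> 0" "\<And>w. norm (f w) \<le> C * exp (C * norm w)"
    and D: "D \<ge> 0" "\<And>w. norm (g w) \<le> D * exp (D * norm w)"
    using assms unfolding egrow_def by metis
  have "norm (f w * g w) \<le> (C * D) * exp ((C + D) * norm w)" for w
  proof -
    have "norm (f w * g w) \<le> (C * exp (C * norm w)) * (D * exp (D * norm w))"
      unfolding norm_mult by (intro mult_mono C D) (auto simp: C D)
    also have "\<dots> = (C * D) * exp ((C + D) * norm w)"
      by (simp add: algebra_simps exp_add)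
    finally show ?thesis .
  qed
  moreover have "(\<lambda>w. f w * g w) \<in> borel_measurable borel"
    using assms by measurable
  ultimately show ?thesis by (rule egrowI[rotated])
qed

lemma egrow_add:
  assumes "egrow f" "egrow g" shows "egrow (\<lambda>w. f w + g w)"
proof -
  obtain C D where C: "C \<ge> 0" "\<And>w. norm (f w) \<le> C * exp (C * norm w)"
    and D: "D \<ge> 0" "\<And>w. norm (g w) \<le> D * exp (D * norm w)"
    using assms unfolding egrow_def by metis
  have "norm (f w + g w) \<le> (C + D) * exp ((C + D) * norm w)" for w
  proof -
    have "norm (f w + g w) \<le> C * exp (C * norm w) + D * exp (D * norm w)"
      using C(2)[of w] D(2)[of w] norm_triangle_ineq[of "f w" "g w"] by linarith
    also have "\<dots> \<le> C * exp ((C + D) * norm w) + D * exp ((C + D) * norm w)"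
      using C D by (intro add_mono mult_left_mono) (auto simp: algebra_simps)
    finally show ?thesis by (simp add: algebra_simps)
  qed
  moreover have "(\<lambda>w. f w + g w) \<in> borel_measurable borel"
    using assms by measurable
  ultimately show ?thesis by (rule egrowI[rotated])
qed

lemma egrow_const [simp]: "egrow (\<lambda>_. c)"
  by (rule egrowI[of _ "norm c" 0]) auto

lemma egrow_id [simp]: "egrow (\<lambda>w. w)"
proof (rule egrowI[of _ 1 1])
  show "norm w \<le> 1 * exp (1 * norm w)" for w :: complex
    using exp_ge_add_one_self[of "norm w"] unfolding mult_1_left by linarith
qed auto

lemma egrow_cnj: "egrow f \<Longrightarrow> egrow (\<lambda>w. cnj (f w))"
  unfolding egrow_def by (auto intro: borel_measurable_cnj)

lemma egrow_cmult: "egrow f \<Longrightarrow> egrow (\<lambda>w. c * f w)"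
  using egrow_mult[OF egrow_const] by blast

lemma egrow_minus: "egrow f \<Longrightarrow> egrow (\<lambda>w. - f w)"
  using egrow_cmult[of f "-1"] by simp

lemma egrow_diff: "egrow f \<Longrightarrow> egrow g \<Longrightarrow> egrow (\<lambda>w. f w - g w)"
  using egrow_add[OF _ egrow_minus, of f g] by simp

lemma egrow_power: "egrow f \<Longrightarrow> egrow (\<lambda>w. f w ^ n)"
  by (induction n) (auto intro: egrow_mult)

lemma egrow_sum: "(\<And>i. i \<in> I \<Longrightarrow> egrow (f i)) \<Longrightarrow> egrow (\<lambda>w. \<Sum>i\<in>I. f i w)"
  by (induction I rule: infinite_finite_induct) (auto intro: egrow_add)

lemma egrow_exp: "egrow (\<lambda>w. exp (w * c + d))"
proof (rule egrowI[of _ "exp (norm d)" "norm c"])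
  show "norm (exp (w * c + d)) \<le> exp (norm d) * exp (norm c * norm w)" for w
  proof -
    have "norm (w * c + d) \<le> norm d + norm c * norm w"
      using norm_triangle_ineq[of "w * c" d] by (simp add: norm_mult mult.commute)
    then have "norm (exp (w * c + d)) \<le> exp (norm d + norm c * norm w)"
      using norm_exp[of "w * c + d"] by (meson exp_le_cancel_iff order_trans)
    then show ?thesis unfolding exp_add[of "norm d"] .
  qed
qed measurable

lemma egrow_translate: "egrow f \<Longrightarrow> egrow (\<lambda>w. f (w - z))"
proof -
  assume f: "egrow f"
  then obtain C where C: "C \<ge> 0" "\<And>w. norm (f w) \<le> C * exp (C * norm w)"
    unfolding egrow_def by metis
  have "norm (f (w - z)) \<le> (C * exp (C * norm z)) * exp (C * norm w)" for w
  proof -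
    have "norm (f (w - z)) \<le> C * exp (C * norm (w - z))" by (rule C)
    also have "\<dots> \<le> C * exp (C * (norm w + norm z))"
      using C norm_triangle_ineq4[of w z] by (intro mult_left_mono) (auto intro!: mult_left_mono)
    finally show ?thesis by (simp add: algebra_simps exp_add)
  qed
  moreover note [measurable] = egrow_measurable[OF f]
  have "(\<lambda>w. f (w - z)) \<in> borel_measurable borel"
    by measurable
  ultimately show ?thesis by (rule egrowI[rotated])
qed

lemma integrable_exp_norm: "integrable gauss (\<lambda>w. exp (C * norm w))"
proof (subst integrable_gauss_iff)
  show "integrable lborel (\<lambda>w::complex. (exp (- (norm w)\<^sup>2) / pi) *\<^sub>R exp (C * norm w))"
  proof (rule Bochner_Integration.integrable_bound)
    show "integrable lborel (\<lambda>w::complex. (exp (C\<^sup>2 / 2) / pi) * exp (- (1/2 * (norm w)\<^sup>2)))"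
      by (intro integrable_mult_right gaussian_scaled) auto
    show "AE w in lborel. norm ((exp (- (norm w)\<^sup>2) / pi) *\<^sub>R exp (C * norm w))
        \<le> norm ((exp (C\<^sup>2 / 2) / pi) * exp (- (1/2 * (norm (w::complex))\<^sup>2)))"
    proof (rule AE_I2)
      fix w :: complex
      have "0 \<le> (C - norm w)\<^sup>2" by simp
      then have "- (norm w)\<^sup>2 + C * norm w \<le> C\<^sup>2 / 2 + - (1/2 * (norm w)\<^sup>2)"
        by (simp add: power2_eq_square algebra_simps)
      then have "exp (- (norm w)\<^sup>2) * exp (C * norm w) \<le> exp (C\<^sup>2 / 2) * exp (- (1/2 * (norm w)\<^sup>2))"
        by (simp add: exp_add[symmetric])
      then show "norm ((exp (- (norm w)\<^sup>2) / pi) *\<^sub>R exp (C * norm w))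
        \<le> norm ((exp (C\<^sup>2 / 2) / pi) * exp (- (1/2 * (norm w)\<^sup>2)))"
        by (simp add: divide_right_mono)
    qed
  qed measurable
qed measurable

lemma egrow_integrable: "egrow f \<Longrightarrow> integrable gauss f"
proof -
  assume f: "egrow f"
  then obtain C where C: "C \<ge> 0" "\<And>w. norm (f w) \<le> C * exp (C * norm w)"
    unfolding egrow_def by metis
  show ?thesis
  proof (rule Bochner_Integration.integrable_bound)
    show "integrable gauss (\<lambda>w. C * exp (C * norm w))"
      by (intro integrable_mult_right integrable_exp_norm)
    show "AE w in gauss. norm (f w) \<le> norm (C * exp (C * norm w))"
      using C by auto
  qed (use f in measurable)
qed

lemma egrow_L2: "egrow f \<Longrightarrow> f \<in> L2"
proof -
  assume f: "egrow f"
  have "integrable gauss (\<lambda>w. norm (f w * f w))"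
    using egrow_integrable[OF egrow_mult[OF f f]] by (rule integrable_norm)
  then show ?thesis
    using f by (auto simp: L2_def norm_mult power2_eq_square egrow_measurable)
qed

section \<open>Inner product and norm on \<open>L2\<close>\<close>

lemma L2D: "f \<in> L2 \<Longrightarrow> f \<in> borel_measurable borel" "f \<in> L2 \<Longrightarrow> integrable gauss (\<lambda>z. (norm (f z))\<^sup>2)"
  by (auto simp: L2_def)

lemma L2_measurable [measurable_dest]: "f \<in> L2 \<Longrightarrow> f \<in> borel_measurable borel"
  by (rule L2D)

lemma L2_bound:
  assumes "g \<in> L2" and [measurable]: "f \<in> borel_measurable borel"
    and "AE w in gauss. norm (f w) \<le> C * norm (g w)"
  shows "f \<in> L2"
proof -
  have "integrable gauss (\<lambda>w. (norm (f w))\<^sup>2)"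
  proof (rule Bochner_Integration.integrable_bound)
    show "integrable gauss (\<lambda>w. C\<^sup>2 * (norm (g w))\<^sup>2)"
      using assms by (intro integrable_mult_right L2D)
    show "AE w in gauss. norm ((norm (f w))\<^sup>2) \<le> norm (C\<^sup>2 * (norm (g w))\<^sup>2)"
      using assms(3)
      by eventually_elim (auto simp: power_mult_distrib[symmetric] intro!: power_mono)
  qed measurable
  then show ?thesis by (simp add: L2_def)
qed

lemma L2_mult_integrable:
  assumes f: "f \<in> L2" and g: "g \<in> L2"
  shows "integrable gauss (\<lambda>w. f w * cnj (g w))" "integrable gauss (\<lambda>w. norm (f w) * norm (g w))"
proof -
  note [measurable] = L2_measurable[OF f] L2_measurable[OF g]
  have *: "2 * (norm (f w) * norm (g w)) \<le> (norm (f w))\<^sup>2 + (norm (g w))\<^sup>2" for w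
    using sum_squares_bound[of "norm (f w)" "norm (g w)"] by simp
  have i: "integrable gauss (\<lambda>w. (norm (f w))\<^sup>2 + (norm (g w))\<^sup>2)"
    using f g by (intro Bochner_Integration.integrable_add L2D)
  have b: "norm (f w) * norm (g w) \<le> norm ((norm (f w))\<^sup>2 + (norm (g w))\<^sup>2)" for w
  proof -
    have "0 \<le> norm (f w) * norm (g w)" by simp
    then show ?thesis using *[of w] unfolding real_norm_def by linarith
  qed
  show "integrable gauss (\<lambda>w. f w * cnj (g w))"
    by (rule Bochner_Integration.integrable_bound[OF i]) (use b in \<open>auto simp: norm_mult\<close>)
  show "integrable gauss (\<lambda>w. norm (f w) * norm (g w))"
    by (rule Bochner_Integration.integrable_bound[OF i]) (use b in auto)
qed

lemma L2_norm_nonneg [simp]: "L2_norm f \<ge> 0"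
  by (simp add: L2_norm_def)

lemma L2_norm_square: "(L2_norm f)\<^sup>2 = (LINT z|gauss. (norm (f z))\<^sup>2)"
  by (simp add: L2_norm_def)

lemma L2_inner_self: "L2_inner f f = of_real ((L2_norm f)\<^sup>2)"
  unfolding L2_inner_def L2_norm_square integral_complex_of_real[symmetric] complex_norm_square[symmetric] by (rule refl)

lemma L2_inner_cnj: "L2_inner g f = cnj (L2_inner f g)"
proof -
  have "cnj (L2_inner f g) = (LINT z|gauss. cnj (f z * cnj (g z)))"
    unfolding L2_inner_def by (rule Bochner_Integration.integral_cnj[symmetric])
  then show ?thesis by (simp add: L2_inner_def mult.commute)
qed

lemma L2_add [intro]: "f \<in> L2 \<Longrightarrow> g \<in> L2 \<Longrightarrow> (\<lambda>w. f w + g w) \<in> L2"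
proof -
  assume f: "f \<in> L2" and g: "g \<in> L2"
  note [measurable] = L2_measurable[OF f] L2_measurable[OF g]
  have "integrable gauss (\<lambda>w. (norm (f w + g w))\<^sup>2)"
  proof (rule Bochner_Integration.integrable_bound)
    show "integrable gauss (\<lambda>w. 2 * (norm (f w))\<^sup>2 + 2 * (norm (g w))\<^sup>2)"
      using f g by (intro Bochner_Integration.integrable_add integrable_mult_right L2D)
    have "(norm (f w + g w))\<^sup>2 \<le> 2 * (norm (f w))\<^sup>2 + 2 * (norm (g w))\<^sup>2" for w
    proof -
      have "(norm (f w + g w))\<^sup>2 \<le> (norm (f w) + norm (g w))\<^sup>2"
        by (intro power_mono norm_triangle_ineq) auto
      also have "\<dots> \<le> 2 * (norm (f w))\<^sup>2 + 2 * (norm (g w))\<^sup>2"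
        using sum_squares_bound[of "norm (f w)" "norm (g w)"] by (simp add: power2_sum)
      finally show ?thesis .
    qed
    then show "AE w in gauss. norm ((norm (f w + g w))\<^sup>2) \<le> norm (2 * (norm (f w))\<^sup>2 + 2 * (norm (g w))\<^sup>2)"
      by auto
  qed measurable
  then show ?thesis by (simp add: L2_def)
qed

lemma L2_cmult [intro]: "f \<in> L2 \<Longrightarrow> (\<lambda>w. c * f w) \<in> L2"
  by (rule L2_bound[of f _ "norm c"]) (auto simp: norm_mult L2_measurable)

lemma L2_diff [intro]: "f \<in> L2 \<Longrightarrow> g \<in> L2 \<Longrightarrow> (\<lambda>w. f w - g w) \<in> L2"
  using L2_add[OF _ L2_cmult[of g "-1"], of f] by simp

lemma L2_zero [simp]: "(\<lambda>w. 0) \<in> L2"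
  by (simp add: L2_def)

lemma L2_inner_add1: "f \<in> L2 \<Longrightarrow> g \<in> L2 \<Longrightarrow> h \<in> L2 \<Longrightarrow> L2_inner (\<lambda>w. f w + g w) h = L2_inner f h + L2_inner g h"
  by (simp add: L2_inner_def distrib_right L2_mult_integrable)

lemma L2_inner_diff1: "f \<in> L2 \<Longrightarrow> g \<in> L2 \<Longrightarrow> h \<in> L2 \<Longrightarrow> L2_inner (\<lambda>w. f w - g w) h = L2_inner f h - L2_inner g h"
  by (simp add: L2_inner_def left_diff_distrib L2_mult_integrable)

lemma L2_inner_cmult1: "L2_inner (\<lambda>w. c * f w) h = c * L2_inner f h"
  by (simp add: L2_inner_def mult.assoc)

lemma L2_inner_add2: "f \<in> L2 \<Longrightarrow> g \<in> L2 \<Longrightarrow> h \<in> L2 \<Longrightarrow> L2_inner h (\<lambda>w. f w + g w) = L2_inner h f + L2_inner h g"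
  by (simp add: L2_inner_def distrib_left L2_mult_integrable)

lemma L2_inner_diff2: "f \<in> L2 \<Longrightarrow> g \<in> L2 \<Longrightarrow> h \<in> L2 \<Longrightarrow> L2_inner h (\<lambda>w. f w - g w) = L2_inner h f - L2_inner h g"
  by (simp add: L2_inner_def right_diff_distrib L2_mult_integrable)

lemma L2_inner_cmult2: "L2_inner h (\<lambda>w. c * f w) = cnj c * L2_inner h f"
  by (simp add: L2_inner_def mult.left_commute)

lemma L2_norm_cmult: "L2_norm (\<lambda>w. c * f w) = norm c * L2_norm f"
  by (simp add: L2_norm_def norm_mult power_mult_distrib real_sqrt_mult)

lemma L2_inner_zero [simp]: "L2_inner (\<lambda>w. 0) g = 0" "L2_inner g (\<lambda>w. 0) = 0" "L2_norm (\<lambda>w. 0) = 0"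
  by (simp_all add: L2_inner_def L2_norm_def)

lemma L2_norm_product:
  assumes f: "f \<in> L2" and g: "g \<in> L2"
  shows "(LINT w|gauss. norm (f w) * norm (g w)) \<le> L2_norm f * L2_norm g"
proof -
  \<comment> \<open>Weighted arithmetic-geometric mean with free weights;
    \<open>s = L2_norm g\<close> and \<open>t = L2_norm f\<close> give the claim once both norms are
    positive.\<close>
  have "2 * (s * t * (LINT w|gauss. norm (f w) * norm (g w))) \<le> s\<^sup>2 * (L2_norm f)\<^sup>2 + t\<^sup>2 * (L2_norm g)\<^sup>2" for s t
  proof -
    have "(LINT w|gauss. 2 * (s * t * (norm (f w) * norm (g w))))
       \<le> (LINT w|gauss. s\<^sup>2 * (norm (f w))\<^sup>2 + t\<^sup>2 * (norm (g w))\<^sup>2)"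
    proof (rule integral_mono)
      show "2 * (s * t * (norm (f w) * norm (g w))) \<le> s\<^sup>2 * (norm (f w))\<^sup>2 + t\<^sup>2 * (norm (g w))\<^sup>2" for w
        using sum_squares_bound[of "s * norm (f w)" "t * norm (g w)"]
        by (simp add: power_mult_distrib mult.assoc mult.left_commute)
    qed (auto intro!: Bochner_Integration.integrable_add integrable_mult_right L2_mult_integrable L2D f g)
    then show ?thesis
      using f g by (simp add: L2_mult_integrable L2D L2_norm_square)
  qed note * = this
  have z: "(LINT w|gauss. norm (f w) * norm (g w)) \<le> 0" if "L2_norm f = 0 \<or> L2_norm g = 0"
  proof -
    have 0: "(LINT w|gauss. (norm (h w))\<^sup>2) = 0 \<longleftrightarrow> (AE w in gauss. h w = 0)" if "h \<in> L2" for h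
      by (subst integral_nonneg_eq_0_iff_AE) (use that in \<open>auto intro: L2D\<close>)
    have "(AE w in gauss. f w = 0) \<or> (AE w in gauss. g w = 0)"
      using that 0[OF f] 0[OF g] unfolding L2_norm_def real_sqrt_eq_0_iff by blast
    then have "AE w in gauss. norm (f w) * norm (g w) = 0"
      by (auto elim: eventually_mono)
    then show ?thesis
      by (simp add: integral_eq_zero_AE)
  qed
  show ?thesis
  proof (cases "L2_norm f = 0 \<or> L2_norm g = 0")
    case True
    then show ?thesis using z by auto
  next
    case False
    then have pos: "L2_norm f > 0" "L2_norm g > 0"
      using L2_norm_nonneg by (metis less_eq_real_def)+
    have "2 * (L2_norm f * L2_norm g * (LINT w|gauss. norm (f w) * norm (g w)))
       \<le> 2 * (L2_norm f * L2_norm g * (L2_norm f * L2_norm g))"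
      using *[of "L2_norm g" "L2_norm f"] by (simp add: power2_eq_square algebra_simps)
    then show ?thesis
      using pos by simp
  qed
qed

lemma L2_cauchy_schwarz:
  assumes f: "f \<in> L2" and g: "g \<in> L2"
  shows "norm (L2_inner f g) \<le> L2_norm f * L2_norm g"
proof -
  have "norm (L2_inner f g) \<le> (LINT w|gauss. norm (f w * cnj (g w)))"
    unfolding L2_inner_def by (rule integral_norm_bound)
  also have "\<dots> \<le> L2_norm f * L2_norm g"
    using L2_norm_product[OF f g] by (simp add: norm_mult)
  finally show ?thesis .
qed

lemma L2_norm_triangle:
  assumes f: "f \<in> L2" and g: "g \<in> L2"
  shows "L2_norm (\<lambda>w. f w + g w) \<le> L2_norm f + L2_norm g"
proof (rule power2_le_imp_le)
  have "complex_of_real ((L2_norm (\<lambda>w. f w + g w))\<^sup>2)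
      = L2_inner f f + L2_inner g g + (L2_inner f g + cnj (L2_inner f g))"
    unfolding L2_inner_self[symmetric]
    using f g by (simp add: L2_inner_add1 L2_inner_add2 L2_add L2_inner_cnj[of g f] algebra_simps)
  also have "\<dots> = of_real ((L2_norm f)\<^sup>2 + (L2_norm g)\<^sup>2 + 2 * Re (L2_inner f g))"
    by (simp add: L2_inner_self complex_add_cnj)
  finally have "(L2_norm (\<lambda>w. f w + g w))\<^sup>2 = (L2_norm f)\<^sup>2 + (L2_norm g)\<^sup>2 + 2 * Re (L2_inner f g)"
    using of_real_eq_iff by blast
  also have "\<dots> \<le> (L2_norm f + L2_norm g)\<^sup>2"
    using L2_cauchy_schwarz[OF f g] complex_Re_le_cmod[of "L2_inner f g"] by (simp add: power2_sum)
  finally show "(L2_norm (\<lambda>w. f w + g w))\<^sup>2 \<le> (L2_norm f + L2_norm g)\<^sup>2" .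
qed simp

lemma L2_norm_uminus: "L2_norm (\<lambda>w. f w - g w) = L2_norm (\<lambda>w. g w - f w)"
  by (simp add: L2_norm_def norm_minus_commute)

lemma L2_norm_eq_0:
  assumes "f \<in> L2" "L2_norm f = 0" shows "AE w in gauss. f w = 0"
  using assms by (subst (asm) L2_norm_def, subst (asm) real_sqrt_eq_0_iff,
      subst (asm) integral_nonneg_eq_0_iff_AE) (auto intro: L2D)

lemma AE_gauss_iff: 
  assumes "Measurable.pred borel P"
  shows "(AE w in gauss. P w) \<longleftrightarrow> (AE w in lborel. P w)"
  using assms unfolding gauss_def by (subst AE_density) auto

lemma AE_gaussI: "(AE w in lborel. P w) \<Longrightarrow> (AE w in gauss. P w)"
  unfolding gauss_def by (subst AE_density) auto

text \<open>A nonempty open set is not null. This turns norm zero into pointwise zero for the smooth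
  representatives in the Fock spaces.\<close>

lemma continuous_AE_zero:
  fixes f :: "complex \<Rightarrow> complex"
  assumes "continuous_on UNIV f" "AE w in gauss. f w = 0"
  shows "f w = 0"
proof (rule ccontr)
  assume "f w \<noteq> 0"
  have "AE w in lborel. f w = 0"
    using assms(2) borel_measurable_continuous_onI[OF assms(1)] by (subst (asm) AE_gauss_iff) auto
  moreover have "open {w. f w \<noteq> 0}"
    using assms(1) by (simp add: open_Collect_neq)
  ultimately have "{w. f w \<noteq> 0} = {}"
    using open_not_negligible[of "{w. f w \<noteq> 0}"]
    by (auto simp: negligible_iff_null_sets AE_iff_null intro: null_sets_completionI)
  with \<open>f w \<noteq> 0\<close> show False by auto
qed

text \<open>The Weyl operators, a projective unitary representation of the translations of the
  plane. The normalized kernel at \<open>z\<close> is the kernel at the origin moved by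
  \<open>Wt z\<close> (\<open>nkernel_Wt\<close>), so statements about a point \<open>z\<close> can
  be transported to \<open>0\<close>.\<close>

definition Wt :: "complex \<Rightarrow> (complex \<Rightarrow> complex) \<Rightarrow> complex \<Rightarrow> complex" where
  "Wt z g w = g (w - z) * exp (w * cnj z - of_real ((norm z)\<^sup>2 / 2))"

lemma Wt_0 [simp]: "Wt 0 g = g"
  by (simp add: Wt_def fun_eq_iff)

lemma Wt_add: "Wt z (\<lambda>w. f w + g w) = (\<lambda>w. Wt z f w + Wt z g w)"
  and Wt_cmult: "Wt z (\<lambda>w. c * f w) = (\<lambda>w. c * Wt z f w)"
  by (simp_all add: Wt_def fun_eq_iff algebra_simps)

lemma Wt_egrow: "egrow g \<Longrightarrow> egrow (Wt z g)"
  unfolding Wt_def[abs_def]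
  using egrow_mult[OF egrow_translate egrow_exp[of "cnj z" "- of_real ((norm z)\<^sup>2 / 2)"], of g z] by simp

lemma Wt_measurable [measurable (raw)]:
  assumes [measurable]: "g \<in> borel_measurable borel"
  shows "Wt z g \<in> borel_measurable borel"
  unfolding Wt_def[abs_def] by measurable

lemma norm_weyl_factor:
  "norm (exp (w * cnj z - of_real ((norm z)\<^sup>2 / 2))) ^ 2 = exp (2 * Re (w * cnj z) - (norm z)\<^sup>2)"
  by (simp add: norm_exp_eq_Re power2_eq_square exp_add[symmetric])

lemma Wt_mult_cnj: "Wt z f w * cnj (Wt z g w) =
   exp (2 * Re (w * cnj z) - (norm z)\<^sup>2) *\<^sub>R (f (w - z) * cnj (g (w - z)))"
proof -
  have "Wt z f w * cnj (Wt z g w) = (f (w - z) * cnj (g (w - z))) *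
     (exp (w * cnj z - of_real ((norm z)\<^sup>2 / 2)) * cnj (exp (w * cnj z - of_real ((norm z)\<^sup>2 / 2))))"
    by (simp add: Wt_def)
  also have "\<dots> = (f (w - z) * cnj (g (w - z))) * of_real (exp (2 * Re (w * cnj z) - (norm z)\<^sup>2))"
    by (simp only: complex_norm_square[symmetric] norm_weyl_factor)
  finally show ?thesis by (simp add: scaleR_conv_of_real mult.commute)
qed

lemma integral_gauss_translate:
  fixes F :: "complex \<Rightarrow> 'a::{banach, second_countable_topology}"
  assumes [measurable]: "F \<in> borel_measurable borel"
  shows "(LINT w|gauss. F (z + w)) = (LINT w|gauss. exp (2 * Re (w * cnj z) - (norm z)\<^sup>2) *\<^sub>R F w)"
    and "integrable gauss (\<lambda>w. F (z + w)) \<longleftrightarrow> integrable gauss (\<lambda>w. exp (2 * Re (w * cnj z) - (norm z)\<^sup>2) *\<^sub>R F w)"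
  using arg_cong[OF gauss_translate[of z], of "\<lambda>M. integral\<^sup>L M F"]
    arg_cong[OF gauss_translate[of z], of "\<lambda>M. integrable M F"]
  by (simp_all add: integral_distr integral_density integrable_distr_eq integrable_density)

text \<open>The two exponential factors multiply to the density in \<open>gauss_translate\<close>.
  Conjugation by \<open>Wt z\<close> thus moves the base point from the vectors to the
  multiplier.\<close>

lemma integral_mult_Wt:
  assumes [measurable]: "F \<in> borel_measurable borel" "u \<in> borel_measurable borel" "v \<in> borel_measurable borel"
  shows "(LINT w|gauss. F w * (Wt z u w * cnj (Wt z v w))) = (LINT w|gauss. F (z + w) * (u w * cnj (v w)))"
proof -
  have "(LINT w|gauss. (\<lambda>w. F w * (u (w - z) * cnj (v (w - z)))) (z + w))
     = (LINT w|gauss. exp (2 * Re (w * cnj z) - (norm z)\<^sup>2) *\<^sub>R (F w * (u (w - z) * cnj (v (w - z)))))"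
    by (rule integral_gauss_translate) measurable
  also have "\<dots> = (LINT w|gauss. F w * (Wt z u w * cnj (Wt z v w)))"
    by (simp add: Wt_mult_cnj scaleR_conv_of_real algebra_simps)
  finally show ?thesis by simp
qed

lemma Wt_L2: "f \<in> L2 \<Longrightarrow> Wt z f \<in> L2"
proof -
  assume f: "f \<in> L2"
  note [measurable] = L2_measurable[OF f]
  have sq: "exp (2 * Re (w * cnj z) - (norm z)\<^sup>2) *\<^sub>R (norm (f (w - z)))\<^sup>2 = (norm (Wt z f w))\<^sup>2" for w
    unfolding Wt_def norm_mult power_mult_distrib norm_weyl_factor real_scaleR_def by (rule mult.commute)
  have "integrable gauss (\<lambda>w. (\<lambda>w. (norm (f (w - z)))\<^sup>2) (z + w))"
    using L2D(2)[OF f] by simp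
  then have "integrable gauss (\<lambda>w. (norm (Wt z f w))\<^sup>2)"
    unfolding sq[symmetric] by (subst (asm) integral_gauss_translate) auto
  then show ?thesis by (simp add: L2_def)
qed

lemma L2_inner_Wt:
  assumes "f \<in> L2" "g \<in> L2"
  shows "L2_inner (Wt z f) (Wt z g) = L2_inner f g"
  using integral_mult_Wt[of "\<lambda>_. 1" f g z] assms L2_measurable by (simp add: L2_inner_def)

lemma L2_norm_Wt:
  assumes "f \<in> L2" shows "L2_norm (Wt z f) = L2_norm f"
  using L2_inner_Wt[OF assms assms, of z] unfolding L2_inner_self of_real_eq_iff
  by (metis L2_norm_nonneg power2_eq_iff_nonneg)

text \<open>The phase is unimodular, so it disappears whenever the same operators act on both
  arguments of a sesquilinear form, and whenever only a modulus is taken.\<close>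

lemma Wt_Wt: "Wt z (Wt d u) w = exp (of_real (Im (z * cnj d)) * - \<i>) * Wt (z + d) u w"
proof -
  have "(norm (z + d))\<^sup>2 = (norm z)\<^sup>2 + (norm d)\<^sup>2 + 2 * Re (z * cnj d)"
    by (simp add: cmod_power2) (simp add: power2_eq_square algebra_simps)
  then have n: "complex_of_real ((norm (z + d))\<^sup>2 / 2)
     = of_real ((norm z)\<^sup>2 / 2) + of_real ((norm d)\<^sup>2 / 2) + of_real (Re (z * cnj d))"
    by simp
  have zd: "z * cnj d = of_real (Re (z * cnj d)) + of_real (Im (z * cnj d)) * \<i>"
    by (metis complex_eq mult.commute)
  let ?c = "of_real (Im (z * cnj d)) * - \<i>" and ?D = "w * cnj (z + d) - of_real ((norm (z + d))\<^sup>2 / 2)"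
  have e: "(w - z) * cnj d - of_real ((norm d)\<^sup>2 / 2) + (w * cnj z - of_real ((norm z)\<^sup>2 / 2)) = ?c + ?D"
    unfolding n by (subst left_diff_distrib, subst zd) (simp add: algebra_simps)
  have "Wt z (Wt d u) w = u (w - z - d) * exp ((w - z) * cnj d - of_real ((norm d)\<^sup>2 / 2) + (w * cnj z - of_real ((norm z)\<^sup>2 / 2)))"
    unfolding exp_add by (simp only: Wt_def mult.assoc)
  also have "\<dots> = u (w - (z + d)) * (exp ?c * exp ?D)"
    unfolding e exp_add diff_diff_eq ..
  also have "\<dots> = exp ?c * Wt (z + d) u w"
    unfolding Wt_def by (rule mult.left_commute)
  finally show ?thesis .
qed

section \<open>Wirtinger derivatives and functions vanishing at infinity\<close>

lemma measure_gauss_UNIV [simp]: "measure gauss UNIV = 1"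
  using gauss.prob_space by simp

definition dz :: "(complex \<Rightarrow> complex) \<Rightarrow> complex \<Rightarrow> complex" where
  "dz f z = (dx f z - \<i> * dy f z) / 2"

text \<open>A relational encoding of the real derivative by its two Wirtinger coefficients. It
  carries differentiability with it, whereas \<open>dz\<close> and \<open>dbar\<close> are total
  functions without meaning where \<open>f\<close> is not differentiable.\<close>

definition wirt :: "(complex \<Rightarrow> complex) \<Rightarrow> complex \<Rightarrow> complex \<Rightarrow> complex \<Rightarrow> bool" where
  "wirt f a b z \<longleftrightarrow> (f has_derivative (\<lambda>\<delta>. a * \<delta> + b * cnj \<delta>)) (at z)"

lemma wirt_differentiable: "f differentiable (at z) \<Longrightarrow> wirt f (dz f z) (dbar f z) z"
proof -
  assume f: "f differentiable (at z)"
  let ?F = "frechet_derivative f (at z)"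
  have F: "(f has_derivative ?F) (at z)"
    using f frechet_derivative_works by blast
  then have lin: "linear ?F" by (rule has_derivative_linear)
  have "?F \<delta> = dz f z * \<delta> + dbar f z * cnj \<delta>" for \<delta>
  proof -
    have "\<delta> = Re \<delta> *\<^sub>R 1 + Im \<delta> *\<^sub>R \<i>"
      by (simp add: complex_eq_iff)
    then have "?F \<delta> = ?F (Re \<delta> *\<^sub>R 1 + Im \<delta> *\<^sub>R \<i>)"
      by simp
    also have "\<dots> = Re \<delta> *\<^sub>R dx f z + Im \<delta> *\<^sub>R dy f z"
      using lin by (simp only: linear_add linear_scale dx_def dy_def)
    also have "\<dots> = dz f z * \<delta> + dbar f z * cnj \<delta>"
      unfolding dz_def dbar_def by (simp add: complex_eq_iff field_simps)
    finally show ?thesis .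
  qed
  with F show ?thesis unfolding wirt_def by (metis (no_types, lifting) ext)
qed

lemma wirtD:
  assumes "wirt f a b z"
  shows "f differentiable (at z)" "dz f z = a" "dbar f z = b" "dx f z = a + b" "dy f z = \<i> * (a - b)"
proof -
  have d: "(f has_derivative (\<lambda>\<delta>. a * \<delta> + b * cnj \<delta>)) (at z)"
    using assms by (simp add: wirt_def)
  then show "f differentiable (at z)" by (auto simp: differentiable_def)
  have e: "frechet_derivative f (at z) = (\<lambda>\<delta>. a * \<delta> + b * cnj \<delta>)"
    by (rule frechet_derivative_at[symmetric]) (rule d)
  show *: "dx f z = a + b" "dy f z = \<i> * (a - b)"
    by (simp_all add: dx_def dy_def e algebra_simps)
  show "dz f z = a" "dbar f z = b"
    unfolding dz_def dbar_def * by (simp_all add: algebra_simps mult.assoc[symmetric])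
qed

lemma wirt_funD:
  assumes "\<And>z. wirt f (a z) (b z) z"
  shows "dz f = a" "dbar f = b"
  using wirtD(2,3)[OF assms] by auto

lemma wirt_const: "wirt (\<lambda>_. c) 0 0 z"
  by (simp add: wirt_def)

lemma wirt_add: "wirt f a b z \<Longrightarrow> wirt g a' b' z \<Longrightarrow> wirt (\<lambda>z. f z + g z) (a + a') (b + b') z"
  unfolding wirt_def by (auto intro!: derivative_eq_intros simp: algebra_simps)

lemma wirt_mult: "wirt f a b z \<Longrightarrow> wirt g a' b' z \<Longrightarrow>
    wirt (\<lambda>z. f z * g z) (a * g z + f z * a') (b * g z + f z * b') z"
  unfolding wirt_def
  by (drule (1) has_derivative_mult) (simp add: algebra_simps)

lemma wirt_cmult: "wirt f a b z \<Longrightarrow> wirt (\<lambda>z. c * f z) (c * a) (c * b) z"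
  using wirt_mult[OF wirt_const, of f a b z c] by simp

lemma wirt_diff: "wirt f a b z \<Longrightarrow> wirt g a' b' z \<Longrightarrow> wirt (\<lambda>z. f z - g z) (a - a') (b - b') z"
  using wirt_add[of f a b z, OF _ wirt_cmult[of g a' b' z "-1"]] by simp

lemma wirt_cnj: "wirt f a b z \<Longrightarrow> wirt (\<lambda>z. cnj (f z)) (cnj b) (cnj a) z"
proof -
  assume "wirt f a b z"
  then have "((\<lambda>z. cnj (f z)) has_derivative (\<lambda>\<delta>. cnj (a * \<delta> + b * cnj \<delta>))) (at z)"
    unfolding wirt_def by (rule bounded_linear.has_derivative[OF bounded_linear_cnj])
  then show ?thesis by (simp add: wirt_def add.commute)
qed

lemma wirt_affine:
  assumes "wirt f a b (z + of_real r * y)"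
  shows "wirt (\<lambda>y. f (z + of_real r * y)) (of_real r * a) (of_real r * b) y"
proof -
  have "((\<lambda>y. z + of_real r * y) has_derivative (\<lambda>\<delta>. of_real r * \<delta>)) (at y)"
    by (auto intro!: derivative_eq_intros)
  from has_derivative_compose[OF this assms[unfolded wirt_def]] show ?thesis
    unfolding wirt_def by (rule has_derivative_eq_rhs) (simp add: fun_eq_iff algebra_simps)
qed

lemma wirt_id: "wirt (\<lambda>z. z) 1 0 z" "wirt cnj 0 1 z"
proof -
  show "wirt (\<lambda>z. z) 1 0 z"
    by (simp add: wirt_def)
  then have "wirt (\<lambda>z. cnj z) (cnj 0) (cnj 1) z"
    by (rule wirt_cnj)
  then show "wirt cnj 0 1 z"
    by simp
qed

text \<open>Global bounds are part of the notion because Taylor remainders and finite differences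
  must be uniform in the base point.\<close>

primrec Bs :: "nat \<Rightarrow> (complex \<Rightarrow> complex) \<Rightarrow> bool" where
  "Bs 0 f \<longleftrightarrow> continuous_on UNIV f \<and> bounded (range f)"
| "Bs (Suc n) f \<longleftrightarrow> bounded (range f) \<and> (\<forall>z. f differentiable (at z)) \<and> Bs n (dz f) \<and> Bs n (dbar f)"

lemma Bs_SucI:
  assumes "bounded (range f)" "\<And>z. wirt f (a z) (b z) z" "Bs n a" "Bs n b"
  shows "Bs (Suc n) f"
  using assms wirtD(1)[OF assms(2)] by (simp add: wirt_funD[OF assms(2)])

lemma Bs_wirt: "Bs (Suc n) f \<Longrightarrow> wirt f (dz f z) (dbar f z) z"
  by (simp add: wirt_differentiable)

lemma Bs_bounded: "Bs n f \<Longrightarrow> bounded (range f)"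
  by (cases n) auto

lemma Bs_bound: assumes "Bs n f" obtains M where "M \<ge> 0" "\<And>z. norm (f z) \<le> M"
proof -
  from Bs_bounded[OF assms] obtain M where M: "\<And>z. norm (f z) \<le> M"
    by (auto simp: bounded_iff)
  with norm_ge_zero[of "f 0"] order_trans have "M \<ge> 0" by blast
  with M that show ?thesis by blast
qed

lemma Bs_continuous: "Bs n f \<Longrightarrow> continuous_on UNIV f"
  by (cases n) (auto intro!: differentiable_imp_continuous_on simp: differentiable_on_def)

lemma Bs_SucD: "Bs (Suc n) f \<Longrightarrow> Bs n f"
proof (induction n arbitrary: f)
  case 0
  show ?case unfolding Bs.simps(1) using Bs_continuous[OF 0] Bs_bounded[OF 0] by (rule conjI)
next
  case (Suc n)
  from Suc.prems[unfolded Bs.simps(2)[of "Suc n" f]] have p: "bounded (range f)" "\<forall>z. f differentiable (at z)" "Bs (Suc n) (dz f)" "Bs (Suc n) (dbar f)"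
    by blast+
  then show ?case
    unfolding Bs.simps(2)[of n] using Suc.IH[OF p(3)] Suc.IH[OF p(4)] by blast
qed

lemma Bs_const: "Bs n (\<lambda>_. c)"
proof (induction n arbitrary: c)
  case (Suc n)
  show ?case by (rule Bs_SucI[of _ "\<lambda>_. 0" "\<lambda>_. 0"]) (auto intro: wirt_const Suc)
qed auto

lemma bounded_range_add: "bounded (range f) \<Longrightarrow> bounded (range g) \<Longrightarrow> bounded (range (\<lambda>z. f z + g z :: complex))"
  by (rule bounded_subset[OF bounded_plus[of "range f" "range g"]]) auto

lemma bounded_range_mult: "bounded (range f) \<Longrightarrow> bounded (range g) \<Longrightarrow> bounded (range (\<lambda>z. f z * g z :: complex))"
proof -
  assume "bounded (range f)" "bounded (range g)"
  then obtain A B where "\<And>z. norm (f z) \<le> A" "\<And>z. norm (g z) \<le> B"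
    by (auto simp: bounded_iff)
  then have "norm (f z * g z) \<le> A * B" for z
    unfolding norm_mult by (intro mult_mono) (auto intro: order_trans[OF norm_ge_zero])
  then show ?thesis by (auto simp: bounded_iff)
qed

lemma Bs_add: "Bs n f \<Longrightarrow> Bs n g \<Longrightarrow> Bs n (\<lambda>z. f z + g z)"
proof (induction n arbitrary: f g)
  case 0
  then show ?case by (auto intro!: continuous_intros bounded_range_add)
next
  case (Suc n)
  show ?case
    by (rule Bs_SucI[OF _ wirt_add[OF Bs_wirt[OF Suc.prems(1)] Bs_wirt[OF Suc.prems(2)]]])
      (use Suc.prems in \<open>auto intro!: bounded_range_add Suc.IH\<close>)
qed

lemma Bs_mult: "Bs n f \<Longrightarrow> Bs n g \<Longrightarrow> Bs n (\<lambda>z. f z * g z)"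
proof (induction n arbitrary: f g)
  case 0
  then show ?case by (auto intro!: continuous_intros bounded_range_mult)
next
  case (Suc n)
  note fg = Bs_SucD[OF Suc.prems(1)] Bs_SucD[OF Suc.prems(2)]
  show ?case
    by (rule Bs_SucI[OF _ wirt_mult[OF Bs_wirt[OF Suc.prems(1)] Bs_wirt[OF Suc.prems(2)]]])
      (use Suc.prems fg in \<open>auto intro!: bounded_range_mult Bs_add Suc.IH simp del: Bs.simps dest: Bs_bounded\<close>, auto intro: Suc.IH)
qed

lemma Bs_cmult: "Bs n f \<Longrightarrow> Bs n (\<lambda>z. c * f z)"
  by (rule Bs_mult[OF Bs_const])

lemma Bs_diff: "Bs n f \<Longrightarrow> Bs n g \<Longrightarrow> Bs n (\<lambda>z. f z - g z)"
  using Bs_add[of n f, OF _ Bs_cmult[of n g "-1"]] by simp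

lemma Bs_cnj: "Bs n f \<Longrightarrow> Bs n (\<lambda>z. cnj (f z))"
proof (induction n arbitrary: f)
  case 0
  then show ?case by (auto intro!: continuous_intros simp: bounded_iff)
next
  case (Suc n)
  show ?case
    by (rule Bs_SucI[OF _ wirt_cnj[OF Bs_wirt[OF Suc.prems(1)]]])
      (use Suc.prems in \<open>auto simp: bounded_iff intro: Suc.IH\<close>)
qed

lemma bounded_range_affine: "bounded (range f) \<Longrightarrow> bounded (range (\<lambda>y. f (z + of_real r * y :: complex)))"
  by (erule bounded_subset) auto

lemma Bs_affine: "Bs n f \<Longrightarrow> Bs n (\<lambda>y. f (z + of_real r * y))"
proof (induction n arbitrary: f)
  case 0
  then have f: "continuous_on UNIV f" "bounded (range f)" by auto
  have "continuous_on UNIV (\<lambda>y. f (z + of_real r * y))"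
    by (rule continuous_on_compose2[OF f(1)]) (intro continuous_intros, simp)
  then show ?case
    using bounded_range_affine[OF f(2)] by simp
next
  case (Suc n)
  from Suc.prems have p: "bounded (range f)" "Bs n (dz f)" "Bs n (dbar f)" by auto
  show ?case
    by (rule Bs_SucI[OF bounded_range_affine[OF p(1)] wirt_affine[OF Bs_wirt[OF Suc.prems(1)]]
          Bs_cmult[OF Suc.IH[OF p(2)]] Bs_cmult[OF Suc.IH[OF p(3)]]])
qed

definition Binf :: "(complex \<Rightarrow> complex) \<Rightarrow> bool" where
  "Binf f \<longleftrightarrow> (\<forall>n. Bs n f)"

lemma BinfD: "Binf f \<Longrightarrow> Bs n f"
  by (simp add: Binf_def)

lemma Binf_wirt: "Binf f \<Longrightarrow> wirt f (dz f z) (dbar f z) z"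
  using Bs_wirt BinfD by blast

lemma Binf_dz: "Binf f \<Longrightarrow> Binf (dz f)" and Binf_dbar: "Binf f \<Longrightarrow> Binf (dbar f)"
  unfolding Binf_def using Bs.simps(2) by blast+

lemma Binf_add: "Binf f \<Longrightarrow> Binf g \<Longrightarrow> Binf (\<lambda>z. f z + g z)"
  and Binf_mult: "Binf f \<Longrightarrow> Binf g \<Longrightarrow> Binf (\<lambda>z. f z * g z)"
  and Binf_diff: "Binf f \<Longrightarrow> Binf g \<Longrightarrow> Binf (\<lambda>z. f z - g z)"
  and Binf_cmult: "Binf f \<Longrightarrow> Binf (\<lambda>z. c * f z)"
  and Binf_cnj: "Binf f \<Longrightarrow> Binf (\<lambda>z. cnj (f z))"
  by (simp_all add: Binf_def Bs_add Bs_mult Bs_diff Bs_cmult Bs_cnj del: Bs.simps)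

definition Lap :: "(complex \<Rightarrow> complex) \<Rightarrow> complex \<Rightarrow> complex" where
  "Lap f = dz (dbar f)"

lemma Binf_Lap: "Binf f \<Longrightarrow> Binf (Lap f)"
  by (simp add: Lap_def Binf_dz Binf_dbar)

lemma dz_add: "Binf f \<Longrightarrow> Binf g \<Longrightarrow> dz (\<lambda>z. f z + g z) = (\<lambda>z. dz f z + dz g z)"
  and dbar_add: "Binf f \<Longrightarrow> Binf g \<Longrightarrow> dbar (\<lambda>z. f z + g z) = (\<lambda>z. dbar f z + dbar g z)"
  using wirt_funD[OF wirt_add[OF Binf_wirt Binf_wirt], of f g] by auto

lemma dz_cmult: "Binf f \<Longrightarrow> dz (\<lambda>z. c * f z) = (\<lambda>z. c * dz f z)"
  and dbar_cmult: "Binf f \<Longrightarrow> dbar (\<lambda>z. c * f z) = (\<lambda>z. c * dbar f z)"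
  using wirt_funD[OF wirt_cmult[OF Binf_wirt], of f c] by auto

lemma Lap_add: "Binf f \<Longrightarrow> Binf g \<Longrightarrow> Lap (\<lambda>z. f z + g z) = (\<lambda>z. Lap f z + Lap g z)"
  by (simp add: Lap_def dbar_add dz_add Binf_dbar)

lemma Lap_cmult: "Binf f \<Longrightarrow> Lap (\<lambda>z. c * f z) = (\<lambda>z. c * Lap f z)"
  by (simp add: Lap_def dbar_cmult dz_cmult Binf_dbar)

lemma onorm_wirt: "onorm (\<lambda>\<delta>. a * \<delta> + b * cnj \<delta>) \<le> norm a + norm b"
proof (rule onorm_le)
  show "norm (a * \<delta> + b * cnj \<delta>) \<le> (norm a + norm b) * norm \<delta>" for \<delta>
    using norm_triangle_ineq[of "a * \<delta>" "b * cnj \<delta>"] by (simp add: norm_mult algebra_simps)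
qed

lemma Bs_lipschitz:
  assumes "Bs 1 f"
  obtains L where "L \<ge> 0" "\<And>z w. norm (f z - f w) \<le> L * norm (z - w)"
proof -
  from assms have d: "Bs 0 (dz f)" "Bs 0 (dbar f)" by simp_all
  obtain A where A: "A \<ge> 0" "\<And>z. norm (dz f z) \<le> A" using Bs_bound[OF d(1)] by blast
  obtain B where B: "B \<ge> 0" "\<And>z. norm (dbar f z) \<le> B" using Bs_bound[OF d(2)] by blast
  have "norm (f z - f w) \<le> (A + B) * norm (z - w)" for z w
  proof (rule differentiable_bound[of UNIV])
    show "(f has_derivative (\<lambda>\<delta>. dz f x * \<delta> + dbar f x * cnj \<delta>)) (at x within UNIV)" for x
      using Bs_wirt[of 0 f x] assms by (simp add: wirt_def)
    show "onorm (\<lambda>\<delta>. dz f x * \<delta> + dbar f x * cnj \<delta>) \<le> A + B" for x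
      using onorm_wirt[of "dz f x" "dbar f x"] A(2)[of x] B(2)[of x] by linarith
  qed auto
  then show ?thesis using that[of "A + B"] A(1) B(1) by simp
qed

lemma Bs_taylor:
  assumes f: "Bs 2 f"
  obtains M where "M \<ge> 0" "\<And>z \<delta>. norm (f (z + \<delta>) - f z - (dz f z * \<delta> + dbar f z * cnj \<delta>)) \<le> M * (norm \<delta>)\<^sup>2"
proof -
  have f2: "Bs (Suc 1) f" using f by (simp add: numeral_2_eq_2)
  then have d: "Bs 1 (dz f)" "Bs 1 (dbar f)" by simp_all
  obtain A where A: "A \<ge> 0" "\<And>z w. norm (dz f z - dz f w) \<le> A * norm (z - w)" using Bs_lipschitz[OF d(1)] by blast
  obtain B where B: "B \<ge> 0" "\<And>z w. norm (dbar f z - dbar f w) \<le> B * norm (z - w)" using Bs_lipschitz[OF d(2)] by blast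
  have *: "norm (f (z + \<delta>) - f z - (dz f z * \<delta> + dbar f z * cnj \<delta>)) \<le> (A + B) * (norm \<delta>)\<^sup>2" for z \<delta> :: complex
  proof -
    \<comment> \<open>After subtraction of the linear part, the derivative of \<open>g\<close> at
      \<open>e\<close> is an increment of the derivatives of \<open>f\<close>, hence at most
      \<open>(A + B) * norm \<delta>\<close> on the ball. The factor \<open>of_real 1\<close> only
      matches \<open>wirt_affine\<close>.\<close>
    define g where "g = (\<lambda>e :: complex. f (z + of_real 1 * e) - (dz f z * e + dbar f z * cnj e))"
    have "norm (g \<delta> - g 0) \<le> ((A + B) * norm \<delta>) * norm (\<delta> - 0)"
    proof (rule differentiable_bound[of "cball 0 (norm \<delta>)"])
      fix e :: complex assume e: "e \<in> cball 0 (norm \<delta>)"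
      have "wirt g (dz f (z + e) - dz f z) (dbar f (z + e) - dbar f z) e"
        unfolding g_def using wirt_diff[OF wirt_affine[OF Bs_wirt[OF f2], of z 1]
            wirt_add[OF wirt_cmult[OF wirt_id(1)] wirt_cmult[OF wirt_id(2)]], of "dz f z" "dbar f z" e]
        by simp
      then show "(g has_derivative (\<lambda>h. (dz f (z + e) - dz f z) * h + (dbar f (z + e) - dbar f z) * cnj h))
          (at e within cball 0 (norm \<delta>))"
        unfolding wirt_def by (rule has_derivative_at_withinI)
      have "onorm (\<lambda>h. (dz f (z + e) - dz f z) * h + (dbar f (z + e) - dbar f z) * cnj h)
         \<le> A * norm e + B * norm e"
        using onorm_wirt[of "dz f (z + e) - dz f z" "dbar f (z + e) - dbar f z"]
          A(2)[of "z + e" z] B(2)[of "z + e" z] by simp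
      also have "\<dots> \<le> (A + B) * norm \<delta>"
        using e A(1) B(1) by (auto simp: distrib_right intro!: add_mono mult_left_mono)
      finally show "onorm (\<lambda>h. (dz f (z + e) - dz f z) * h + (dbar f (z + e) - dbar f z) * cnj h)
         \<le> (A + B) * norm \<delta>" .
    qed auto
    then show ?thesis by (simp add: g_def power2_eq_square algebra_simps)
  qed
  show ?thesis by (rule that[OF _ *]) (use A(1) B(1) in simp)
qed

section \<open>Functions vanishing at infinity\<close>

definition van :: "(complex \<Rightarrow> complex) \<Rightarrow> bool" where
  "van f \<longleftrightarrow> (\<forall>e>0. \<exists>R. \<forall>z. norm z \<ge> R \<longrightarrow> norm (f z) \<le> e)"

lemma vanD: "van f \<Longrightarrow> e > 0 \<Longrightarrow> \<exists>R. \<forall>z. norm z \<ge> R \<longrightarrow> norm (f z) \<le> e"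
  by (simp add: van_def)

lemma van_iff_tendsto: "van f \<longleftrightarrow> (f \<longlongrightarrow> 0) at_infinity"
proof
  assume f: "van f"
  show "(f \<longlongrightarrow> 0) at_infinity"
    unfolding Lim_at_infinity
  proof (intro allI impI)
    fix e :: real assume "e > 0"
    then obtain R where "\<forall>z. norm z \<ge> R \<longrightarrow> norm (f z) \<le> e / 2"
      using vanD[OF f, of "e / 2"] by auto
    with \<open>e > 0\<close> show "\<exists>b. \<forall>x. b \<le> norm x \<longrightarrow> dist (f x) 0 < e"
      by (intro exI[of _ R]) fastforce
  qed
next
  assume "(f \<longlongrightarrow> 0) at_infinity"
  then show "van f"
    unfolding Lim_at_infinity van_def by (auto simp: dist_norm) (meson less_imp_le)
qed

lemma van_add: "van f \<Longrightarrow> van g \<Longrightarrow> van (\<lambda>z. f z + g z)"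
  and van_diff: "van f \<Longrightarrow> van g \<Longrightarrow> van (\<lambda>z. f z - g z)"
  and van_cmult: "van f \<Longrightarrow> van (\<lambda>z. c * f z)"
  unfolding van_iff_tendsto
  using tendsto_add[of f 0 at_infinity g 0] tendsto_diff[of f 0 at_infinity g 0]
    tendsto_mult_right_zero[of f at_infinity c]
  by auto

lemma van_cmult_iff: "c \<noteq> 0 \<Longrightarrow> van (\<lambda>z. c * f z) \<longleftrightarrow> van f"
  using van_cmult[of f c] van_cmult[of "\<lambda>z. c * f z" "1 / c"] by auto

text \<open>A failure yields a sequence that escapes to infinity while the values stay above some
  \<open>e\<close>, and so they do along every subsequence. This form admits weak compactness
  arguments, as in \<open>tkern_integral_van\<close>.\<close>

lemma van_subseqI:
  assumes "\<And>\<zeta>. filterlim (\<lambda>n. norm (\<zeta> n)) at_top sequentially \<Longrightarrow> \<exists>r. strict_mono (r :: nat \<Rightarrow> nat) \<and> (\<lambda>n. f (\<zeta> (r n))) \<longlonglongrightarrow> 0"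
  shows "van f"
proof (rule ccontr)
  assume "\<not> van f"
  then obtain e where e: "e > 0" "\<forall>R. \<exists>z. norm z \<ge> R \<and> norm (f z) > e"
    unfolding van_def by (meson not_le)
  then have "\<forall>n::nat. \<exists>z. norm z \<ge> real n \<and> norm (f z) > e" by blast
  then obtain \<zeta> where \<zeta>: "\<And>n::nat. norm (\<zeta> n) \<ge> real n" "\<And>n. norm (f (\<zeta> n)) > e"
    by metis
  have "filterlim (\<lambda>n. norm (\<zeta> n)) at_top sequentially"
    by (rule filterlim_at_top_mono[OF filterlim_real_sequentially]) (use \<zeta> in auto)
  then obtain r where "(\<lambda>n. f (\<zeta> (r n))) \<longlonglongrightarrow> 0" using assms by blast
  then have "eventually (\<lambda>n. norm (f (\<zeta> (r n))) < e) sequentially"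
    using e(1) by (simp add: tendsto_iff)
  then obtain N where "norm (f (\<zeta> (r N))) < e"
    by (auto simp: eventually_sequentially)
  with \<zeta>(2)[of "r N"] show False by simp
qed

lemma van_seqI:
  assumes "\<And>\<zeta>. filterlim (\<lambda>n. norm (\<zeta> n)) at_top sequentially \<Longrightarrow> (\<lambda>n. f (\<zeta> n)) \<longlonglongrightarrow> 0"
  shows "van f"
  by (rule van_subseqI) (use assms strict_mono_id in \<open>force simp: id_def\<close>)

lemma van_seqD:
  assumes "van f" "filterlim (\<lambda>n. norm (\<zeta> n)) at_top sequentially"
  shows "(\<lambda>n. f (\<zeta> n)) \<longlonglongrightarrow> 0"
  using filterlim_compose[of f "nhds 0" at_infinity \<zeta>] assms
  by (simp add: van_iff_tendsto filterlim_norm_at_top_imp_at_infinity)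

lemma norm_le_three:
  fixes p q D :: complex
  assumes "norm (p - q - D) \<le> m" shows "norm D \<le> norm p + norm q + m"
  using norm_triangle_ineq4[of "p - q" "p - q - D"] norm_triangle_ineq4[of p q] assms by simp

text \<open>A Landau-type interpolation: with second-order remainder constant \<open>M\<close>, a
  difference over a fixed step \<open>t\<close> determines the directional derivative up to
  \<open>M * t\<close>, while the two function values tend to zero at infinity.\<close>

lemma van_deriv:
  assumes f: "Bs 2 f" and v: "van f"
  shows "van (dz f)" "van (dbar f)"
proof -
  obtain M where M: "M \<ge> 0" "\<And>z \<delta>. norm (f (z + \<delta>) - f z - (dz f z * \<delta> + dbar f z * cnj \<delta>)) \<le> M * (norm \<delta>)\<^sup>2"
    using Bs_taylor[OF f] by blast
  have *: "\<exists>R. \<forall>z. norm z \<ge> R \<longrightarrow> norm (dz f z * c + dbar f z * cnj c) \<le> e" if e: "e > 0" and c: "norm c = 1" for c e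
  proof -
    \<comment> \<open>After division by \<open>t\<close> the remainder contributes
      \<open>M * t \<le> e / 2\<close>; the two values of \<open>f\<close> are then made at most
      \<open>t * (e / 4)\<close> each.\<close>
    define t where "t = e / (2 * (M + 1))"
    have t: "t > 0" "M * t \<le> e / 2" using e M(1) by (auto simp: t_def field_simps)
    obtain R where R: "\<And>z. norm z \<ge> R \<Longrightarrow> norm (f z) \<le> t * (e / 4)"
      using vanD[OF v, of "t * (e / 4)"] t e by auto
    have "norm (dz f z * c + dbar f z * cnj c) \<le> e" if z: "norm z \<ge> R + t" for z
    proof -
      have n: "norm (of_real t * c) = t" using c t by (simp add: norm_mult)
      have z1: "norm (f z) \<le> t * (e / 4)" using z t by (intro R) auto
      have "norm (z + of_real t * c) \<ge> R"
        using norm_diff_ineq[of z "of_real t * c"] z n by linarith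
      then have z2: "norm (f (z + of_real t * c)) \<le> t * (e / 4)" by (rule R)
      let ?D = "dz f z * (of_real t * c) + dbar f z * cnj (of_real t * c)"
      have "norm (f (z + of_real t * c) - f z - ?D) \<le> M * t\<^sup>2"
        using M(2)[of z "of_real t * c"] n by simp
      then have "norm ?D \<le> t * (e / 4) + t * (e / 4) + M * t\<^sup>2"
        using norm_le_three[of "f (z + of_real t * c)" "f z" ?D "M * t\<^sup>2"] z1 z2 by linarith
      also have "\<dots> \<le> t * e"
      proof -
        have "M * t\<^sup>2 \<le> t * (e / 2)"
          using mult_left_mono[OF t(2), of t] t(1) by (simp only: power2_eq_square mult.left_commute less_imp_le)
        moreover have "t * (e / 4) = t * e / 4" "t * (e / 2) = t * e / 2" by simp_all
        ultimately show ?thesis by linarith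
      qed
      finally have "norm ?D \<le> t * e" .
      moreover have "?D = of_real t * (dz f z * c + dbar f z * cnj c)"
        by (simp add: algebra_simps)
      ultimately show ?thesis using t by (simp add: norm_mult del: mult_cancel_left)
    qed
    then show ?thesis by blast
  qed
  have "van (\<lambda>z. dz f z * 1 + dbar f z * cnj 1)" "van (\<lambda>z. dz f z * \<i> + dbar f z * cnj \<i>)"
    unfolding van_def using *[of _ 1] *[of _ \<i>] by auto
  note ab = this
  \<comment> \<open>The directional derivatives along \<open>1\<close> and \<open>\<i>\<close>
    recombine to \<open>dz f\<close> and \<open>dbar f\<close>.\<close>
  have "van (\<lambda>z. (1/2) * ((dz f z * 1 + dbar f z * cnj 1) - \<i> * (dz f z * \<i> + dbar f z * cnj \<i>)))"
    "van (\<lambda>z. (1/2) * ((dz f z * 1 + dbar f z * cnj 1) + \<i> * (dz f z * \<i> + dbar f z * cnj \<i>)))"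
    by (intro van_cmult van_diff van_add ab)+
  then show "van (dz f)" "van (dbar f)"
    by (simp_all add: algebra_simps)
qed

section \<open>Integration by parts against the Gaussian\<close>

lemma Bs_egrow_affine: "Bs n f \<Longrightarrow> egrow (\<lambda>y. f (z + of_real r * y))"
proof -
  assume f: "Bs n f"
  obtain M where M: "\<And>z. norm (f z) \<le> M" using Bs_bound[OF f] by blast
  have "continuous_on UNIV (\<lambda>y. f (z + of_real r * y))"
    using Bs_continuous[OF Bs_affine[OF f]] .
  then show ?thesis
    by (intro egrowI[of _ M 0]) (auto intro: borel_measurable_continuous_onI M)
qed

lemma Bs_egrow: "Bs n f \<Longrightarrow> egrow f"
  using Bs_egrow_affine[of n f 0 1] by simp

text \<open>Divide by the length of \<open>\<delta>\<close> and let it tend to zero. This serves to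
  equate the linear terms of two expansions of one quantity, as in \<open>gauss_ibp\<close>.\<close>

lemma linear_wirt_zero:
  assumes "\<And>\<delta>. norm \<delta> \<le> 1 \<Longrightarrow> norm (a * \<delta> + b * cnj \<delta>) \<le> K * (norm \<delta>)\<^sup>2"
  shows "a = 0" "b = 0"
proof -
  have *: "a * c + b * cnj c = 0" if c: "norm c = 1" for c
  proof -
    have "norm (a * c + b * cnj c) \<le> K * t" if t: "0 < t" "t \<le> 1" for t
    proof -
      have "norm (a * (of_real t * c) + b * cnj (of_real t * c)) \<le> K * (norm (of_real t * c))\<^sup>2"
        by (rule assms) (use t c in \<open>auto simp: norm_mult\<close>)
      moreover have "a * (of_real t * c) + b * cnj (of_real t * c) = of_real t * (a * c + b * cnj c)"
        by (simp add: algebra_simps)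
      moreover have "norm (of_real t * c) = t" "norm (of_real t * (a * c + b * cnj c)) = t * norm (a * c + b * cnj c)"
        using t c by (simp_all add: norm_mult)
      ultimately have "t * norm (a * c + b * cnj c) \<le> t * (K * t)"
        by (simp add: power2_eq_square mult.left_commute)
      then show ?thesis using t by simp
    qed
    then have "eventually (\<lambda>t. norm (a * c + b * cnj c) \<le> K * t) (at_right 0)"
      unfolding eventually_at_right_field by (intro exI[of _ 1]) auto
    moreover have "((\<lambda>t. K * t) \<longlongrightarrow> K * 0) (at_right 0)"
      by (intro tendsto_intros)
    ultimately have "norm (a * c + b * cnj c) \<le> K * 0"
      by (intro tendsto_le[OF trivial_limit_at_right_real _ tendsto_const]) auto
    then show ?thesis by simp
  qed
  from *[of 1] *[of \<i>] have "a + b = 0" "a - b = 0" by (auto simp: algebra_simps)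
  then show "a = 0" "b = 0"
    by (simp_all add: eq_neg_iff_add_eq_0[symmetric])
qed

lemma exp_second_order: "norm (exp s - 1 - s) \<le> (norm s)\<^sup>2 * exp (norm s)" for s :: complex
proof -
  have "norm (exp s - (\<Sum>k\<le>1. s ^ k / fact k)) \<le> exp \<bar>Re s\<bar> * (norm s ^ Suc 1) / fact 1"
    by (rule Taylor_exp)
  also have "\<dots> \<le> exp (norm s) * (norm s)\<^sup>2"
    using abs_Re_le_cmod[of s] by (auto simp: power2_eq_square intro!: mult_right_mono)
  finally show ?thesis by (simp add: algebra_simps)
qed

text \<open>With \<open>x = 2 * norm w + 1\<close> the remainder is at most
  \<open>(norm \<delta>)\<^sup>2\<close> times \<open>x\<^sup>2 * exp x\<close>. Since
  \<open>x\<^sup>2 \<le> exp (2 * x)\<close>, this leaves \<open>exp (3 * x)\<close>, which is the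
  product of the two exponentials.\<close>

lemma weyl_second_order:
  fixes \<delta> s w :: complex
  assumes d: "norm \<delta> \<le> 1" and s: "norm s \<le> norm \<delta> * (2 * norm w + 1)"
  shows "norm (exp s - 1 - s) \<le> (norm \<delta>)\<^sup>2 * (exp 3 * exp (6 * norm w))"
proof -
  let ?x = "2 * norm w + 1"
  have x: "?x \<ge> 0" by simp
  have s2: "norm s \<le> ?x"
    using s mult_right_mono[OF d x] by (simp only: mult_1_left)
  have x2: "?x\<^sup>2 \<le> exp (2 * ?x)"
  proof -
    have "?x \<le> exp ?x" using exp_ge_add_one_self[of ?x] by linarith
    then have "?x\<^sup>2 \<le> (exp ?x)\<^sup>2" using x by (intro power_mono) auto
    then show ?thesis unfolding exp_double .
  qed
  have "norm (exp s - 1 - s) \<le> (norm s)\<^sup>2 * exp (norm s)" by (rule exp_second_order)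
  also have "\<dots> \<le> ((norm \<delta>)\<^sup>2 * ?x\<^sup>2) * exp ?x"
    using s s2 by (intro mult_mono) (auto simp: power_mult_distrib[symmetric] intro!: power_mono)
  also have "\<dots> \<le> ((norm \<delta>)\<^sup>2 * exp (2 * ?x)) * exp ?x"
    using x2 by (intro mult_right_mono mult_left_mono) auto
  also have "\<dots> = (norm \<delta>)\<^sup>2 * exp (3 * ?x)"
    by (simp add: exp_add[symmetric] mult.assoc)
  also have "exp (3 * ?x) = exp 3 * exp (6 * norm w)"
    by (simp add: exp_add[symmetric])
  finally show ?thesis .
qed

text \<open>The Gaussian average of \<open>F (\<delta> + y)\<close> is expanded to first order in
  \<open>\<delta>\<close> twice: through the Taylor formula for \<open>F\<close>, and through the
  density of the translated Gaussian. Comparing the linear terms is integration by parts, with no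
  boundary terms to estimate.\<close>

lemma gauss_ibp:
  assumes F: "Bs 2 F"
  shows "(LINT y|gauss. dz F y) = (LINT y|gauss. cnj y * F y)"
    and "(LINT y|gauss. dbar F y) = (LINT y|gauss. y * F y)"
proof -
  have F1: "Bs (Suc 1) F" using F by (simp add: numeral_2_eq_2)
  then have dF: "Bs 1 (dz F)" "Bs 1 (dbar F)" by auto
  note eg = Bs_egrow[OF F] Bs_egrow[OF dF(1)] Bs_egrow[OF dF(2)]
  note [measurable] = eg[THEN egrow_measurable]
  obtain M where M: "M \<ge> 0" "\<And>z \<delta>. norm (F (z + \<delta>) - F z - (dz F z * \<delta> + dbar F z * cnj \<delta>)) \<le> M * (norm \<delta>)\<^sup>2"
    using Bs_taylor[OF F] by blast
  obtain N where N: "N \<ge> 0" "\<And>z. norm (F z) \<le> N" using Bs_bound[OF F] by blast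
  define K where "K = N * (exp 3 + 1) * (LINT w|gauss. exp (6 * norm w))"
  let ?I = "\<lambda>\<delta>. LINT y|gauss. F (\<delta> + y)"
  have egt: "egrow (\<lambda>y. F (\<delta> + y))" for \<delta>
    using Bs_egrow_affine[OF F, of \<delta> 1] by simp
  have 1: "norm (?I \<delta> - ?I 0 - ((LINT y|gauss. dz F y) * \<delta> + (LINT y|gauss. dbar F y) * cnj \<delta>)) \<le> M * (norm \<delta>)\<^sup>2" for \<delta>
  proof -
    have "?I \<delta> - ?I 0 - ((LINT y|gauss. dz F y) * \<delta> + (LINT y|gauss. dbar F y) * cnj \<delta>)
      = (LINT y|gauss. F (y + \<delta>) - F y - (dz F y * \<delta> + dbar F y * cnj \<delta>))"
      using egrow_integrable[OF eg(1)] egrow_integrable[OF eg(2)] egrow_integrable[OF eg(3)] egrow_integrable[OF egt[of \<delta>]]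
      by (simp add: add.commute)
    also have "norm \<dots> \<le> (LINT y|gauss. M * (norm \<delta>)\<^sup>2)"
    proof (rule Bochner_Integration.integral_norm_bound_integral)
      have "integrable gauss (\<lambda>y. F (y + \<delta>))"
        using egrow_integrable[OF egt[of \<delta>]] by (simp add: add.commute)
      then show "integrable gauss (\<lambda>y. F (y + \<delta>) - F y - (dz F y * \<delta> + dbar F y * cnj \<delta>))"
        using egrow_integrable[OF eg(1)] egrow_integrable[OF eg(2)] egrow_integrable[OF eg(3)]
        by (intro Bochner_Integration.integrable_diff Bochner_Integration.integrable_add integrable_mult_left)
    qed (use M(2) in auto)
    finally show ?thesis by simp
  qed
  \<comment> \<open>Expansion through the weight: \<open>?s w\<close> is the logarithm of the
    density, with linear part \<open>cnj w * \<delta> + w * cnj \<delta>\<close>.\<close>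
  have 2: "norm (?I \<delta> - ?I 0 - ((LINT y|gauss. cnj y * F y) * \<delta> + (LINT y|gauss. y * F y) * cnj \<delta>)) \<le> K * (norm \<delta>)\<^sup>2"
    if d: "norm \<delta> \<le> 1" for \<delta>
  proof -
    let ?s = "\<lambda>w. complex_of_real (2 * Re (w * cnj \<delta>) - (norm \<delta>)\<^sup>2)"
    have E: "(\<lambda>w. exp (2 * Re (w * cnj \<delta>) - (norm \<delta>)\<^sup>2) *\<^sub>R F w) = (\<lambda>w. exp (?s w) * F w)"
      unfolding scaleR_conv_of_real exp_of_real ..
    have int: "integrable gauss (\<lambda>w. exp (?s w) * F w)"
      using integral_gauss_translate(2)[of F \<delta>] egrow_integrable[OF egt[of \<delta>]] unfolding E by simp
    have int2: "integrable gauss (\<lambda>y. cnj y * F y)" "integrable gauss (\<lambda>y. y * F y)" "integrable gauss F"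
      by (intro egrow_integrable egrow_mult egrow_cnj egrow_id eg)+
    have "?I \<delta> = (LINT w|gauss. exp (?s w) * F w)"
      using integral_gauss_translate(1)[of F \<delta>] unfolding E by simp
    then have "?I \<delta> - ?I 0 - ((LINT y|gauss. cnj y * F y) * \<delta> + (LINT y|gauss. y * F y) * cnj \<delta>)
       = (LINT w|gauss. exp (?s w) * F w - F w - (cnj w * F w * \<delta> + w * F w * cnj \<delta>))"
      using int int2 by simp
    also have "norm \<dots> \<le> (LINT w|gauss. (N * (exp 3 + 1) * (norm \<delta>)\<^sup>2) * exp (6 * norm w))"
    proof (rule Bochner_Integration.integral_norm_bound_integral)
      fix w
      have re: "?s w = w * cnj \<delta> + cnj w * \<delta> - of_real ((norm \<delta>)\<^sup>2)"
      proof -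
        have "w * cnj \<delta> + cnj w * \<delta> = of_real (2 * Re (w * cnj \<delta>))"
          using complex_add_cnj[of "w * cnj \<delta>"] by simp
        then show ?thesis by simp
      qed
      have "\<bar>2 * Re (w * cnj \<delta>) - (norm \<delta>)\<^sup>2\<bar> \<le> 2 * (norm w * norm \<delta>) + norm \<delta> * norm \<delta>"
      proof -
        have "\<bar>Re (w * cnj \<delta>)\<bar> \<le> norm w * norm \<delta>"
          using abs_Re_le_cmod[of "w * cnj \<delta>"] by (simp only: norm_mult complex_mod_cnj)
        then show ?thesis
          using zero_le_square[of "norm \<delta>"] unfolding power2_eq_square by (simp only: abs_le_iff) linarith
      qed
      also have "\<dots> \<le> norm \<delta> * (2 * norm w + 1)"
        using d mult_left_mono[OF d, of "norm \<delta>"] by (simp add: algebra_simps)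
      finally have s: "norm (?s w) \<le> norm \<delta> * (2 * norm w + 1)"
        unfolding norm_of_real .
      have "norm (exp (?s w) - 1 - ?s w) \<le> (norm \<delta>)\<^sup>2 * (exp 3 * exp (6 * norm w))"
        by (rule weyl_second_order[OF d s])
      note 1 = this
      have 2: "exp (?s w) - 1 - (cnj w * \<delta> + w * cnj \<delta>) = (exp (?s w) - 1 - ?s w) - of_real ((norm \<delta>)\<^sup>2)"
        unfolding re by simp
      have 3: "norm (complex_of_real ((norm \<delta>)\<^sup>2)) = (norm \<delta>)\<^sup>2"
        unfolding norm_of_real by simp
      have "norm (exp (?s w) - 1 - (cnj w * \<delta> + w * cnj \<delta>)) \<le> (norm \<delta>)\<^sup>2 * (exp 3 * exp (6 * norm w)) + (norm \<delta>)\<^sup>2"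
        unfolding 2 using 1 3 norm_triangle_ineq4[of "exp (?s w) - 1 - ?s w" "of_real ((norm \<delta>)\<^sup>2)"]
        by linarith
      also have "\<dots> \<le> (norm \<delta>)\<^sup>2 * ((exp 3 + 1) * exp (6 * norm w))"
        using mult_left_mono[of 1 "exp (6 * norm w)" "(norm \<delta>)\<^sup>2"] by (simp add: algebra_simps)
      finally have b: "norm (exp (?s w) - 1 - (cnj w * \<delta> + w * cnj \<delta>)) \<le> (norm \<delta>)\<^sup>2 * ((exp 3 + 1) * exp (6 * norm w))" .
      have "exp (?s w) * F w - F w - (cnj w * F w * \<delta> + w * F w * cnj \<delta>) = F w * (exp (?s w) - 1 - (cnj w * \<delta> + w * cnj \<delta>))"
        by (simp add: algebra_simps)
      then have "norm (exp (?s w) * F w - F w - (cnj w * F w * \<delta> + w * F w * cnj \<delta>)) \<le> N * ((norm \<delta>)\<^sup>2 * ((exp 3 + 1) * exp (6 * norm w)))"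
        using b N by (simp only: norm_mult) (rule mult_mono, auto)
      then show "norm (exp (?s w) * F w - F w - (cnj w * F w * \<delta> + w * F w * cnj \<delta>))
         \<le> (N * (exp 3 + 1) * (norm \<delta>)\<^sup>2) * exp (6 * norm w)"
        by (simp only: mult.assoc mult.left_commute[of "(norm \<delta>)\<^sup>2"])
    qed (use int int2 in \<open>auto intro!: integrable_exp_norm\<close>)
    also have "\<dots> = K * (norm \<delta>)\<^sup>2" by (simp add: K_def)
    finally show ?thesis .
  qed
  let ?a = "(LINT y|gauss. dz F y) - (LINT y|gauss. cnj y * F y)"
  let ?b = "(LINT y|gauss. dbar F y) - (LINT y|gauss. y * F y)"
  have 3: "norm (?a * \<delta> + ?b * cnj \<delta>) \<le> (M + K) * (norm \<delta>)\<^sup>2" if d: "norm \<delta> \<le> 1" for \<delta>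
  proof -
    have "?a * \<delta> + ?b * cnj \<delta> = (?I \<delta> - ?I 0 - ((LINT y|gauss. cnj y * F y) * \<delta> + (LINT y|gauss. y * F y) * cnj \<delta>))
       - (?I \<delta> - ?I 0 - ((LINT y|gauss. dz F y) * \<delta> + (LINT y|gauss. dbar F y) * cnj \<delta>))"
      by (simp add: algebra_simps)
    then show ?thesis
      using norm_triangle_ineq4[of "?I \<delta> - ?I 0 - ((LINT y|gauss. cnj y * F y) * \<delta> + (LINT y|gauss. y * F y) * cnj \<delta>)"
         "?I \<delta> - ?I 0 - ((LINT y|gauss. dz F y) * \<delta> + (LINT y|gauss. dbar F y) * cnj \<delta>)"] 1[of \<delta>] 2[OF d]
      by (simp only: distrib_right)
  qed
  show "(LINT y|gauss. dz F y) = (LINT y|gauss. cnj y * F y)" "(LINT y|gauss. dbar F y) = (LINT y|gauss. y * F y)"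
    using linear_wirt_zero[OF 3] by auto
qed

section \<open>A Tauberian theorem for polynomials in the Laplacian\<close>

text \<open>Dominated convergence along a sequence that escapes to infinity. The average is wrapped
  in \<open>of_real\<close> because \<open>van\<close> speaks of complex functions.\<close>

lemma integral_van:
  assumes h: "Bs 0 h" and v: "van h" and r: "r > 0"
  shows "van (\<lambda>z. of_real (LINT y|gauss. norm (h (z + of_real r * y))))"
proof (rule van_seqI)
  fix \<zeta> assume \<zeta>: "filterlim (\<lambda>n. norm (\<zeta> n :: complex)) at_top sequentially"
  obtain M where M: "\<And>z. norm (h z) \<le> M" using Bs_bound[OF h] by blast
  note [measurable] = egrow_measurable[OF Bs_egrow_affine[OF h]]
  have "(\<lambda>n. LINT y|gauss. norm (h (\<zeta> n + of_real r * y))) \<longlonglongrightarrow> (LINT y|gauss. 0)"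
  proof (rule integral_dominated_convergence[where w = "\<lambda>_. M"])
    show "AE y in gauss. (\<lambda>n. norm (h (\<zeta> n + of_real r * y))) \<longlonglongrightarrow> 0"
    proof (rule AE_I2)
      fix y :: complex
      have "filterlim (\<lambda>n. - norm (of_real r * y) + norm (\<zeta> n)) at_top sequentially"
        by (rule filterlim_tendsto_add_at_top[OF tendsto_const \<zeta>])
      then have "filterlim (\<lambda>n. norm (\<zeta> n + of_real r * y)) at_top sequentially"
        by (rule filterlim_at_top_mono) (use norm_diff_ineq[of "\<zeta> n" "of_real r * y" for n] in \<open>auto simp: algebra_simps\<close>)
      from van_seqD[OF v this] show "(\<lambda>n. norm (h (\<zeta> n + of_real r * y))) \<longlonglongrightarrow> 0"
        by (rule tendsto_norm_zero)
    qed
  qed (use M in auto)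
  then show "(\<lambda>n. complex_of_real (LINT y|gauss. norm (h (\<zeta> n + of_real r * y)))) \<longlonglongrightarrow> 0"
    using tendsto_of_real by fastforce
qed

section \<open>Gaussian mass at a given scale\<close>

lemma gauss_distr_scale:
  assumes r: "r > 0"
  shows "distr gauss borel (\<lambda>y. of_real r * y) = density lborel (\<lambda>z. ennreal (exp (- ((norm z)\<^sup>2 / r\<^sup>2)) / (pi * r\<^sup>2)))"
proof (rule measure_eqI)
  fix A assume "A \<in> sets (distr gauss borel (\<lambda>y. of_real r * y))"
  then have [measurable]: "A \<in> sets borel" by simp
  let ?k = "\<lambda>z::complex. ennreal (exp (- ((norm z)\<^sup>2 / r\<^sup>2)) / (pi * r\<^sup>2))"
  have k: "ennreal (r\<^sup>2) * ?k (of_real r * z) = ennreal (exp (- (norm z)\<^sup>2) / pi)" for z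
    using r by (simp add: ennreal_mult''[symmetric] norm_mult power_mult_distrib)
  have "emeasure (distr gauss borel (\<lambda>y. of_real r * y)) A = (\<integral>\<^sup>+y. indicator A (of_real r * y) \<partial>gauss)"
    by (subst nn_integral_indicator[symmetric], simp, subst nn_integral_distr) auto
  also have "\<dots> = (\<integral>\<^sup>+z. ennreal (exp (- (norm z)\<^sup>2) / pi) * indicator A (of_real r * z) \<partial>lborel)"
    by (rule nn_integral_gauss) measurable
  also have "\<dots> = (\<integral>\<^sup>+z. ennreal (r\<^sup>2) * (?k (of_real r * z) * indicator A (of_real r * z)) \<partial>lborel)"
    unfolding mult.assoc[symmetric] k ..
  also have "\<dots> = ennreal (r\<^sup>2) * (\<integral>\<^sup>+z. ?k (of_real r * z) * indicator A (of_real r * z) \<partial>lborel)"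
    by (rule nn_integral_cmult) measurable
  also have "\<dots> = (\<integral>\<^sup>+z. ?k z * indicator A z \<partial>lborel)"
    by (rule nn_integral_scale_complex[symmetric]) (use r in auto)
  finally show "emeasure (distr gauss borel (\<lambda>y. of_real r * y)) A = emeasure (density lborel ?k) A"
    by (simp add: emeasure_density)
qed simp

lemma integral_gauss_scale:
  fixes G :: "complex \<Rightarrow> real"
  assumes [measurable]: "G \<in> borel_measurable borel" and r: "r > 0"
  shows "r\<^sup>2 * (LINT y|gauss. G (of_real r * y)) = (LINT z|lborel. exp (- ((norm z)\<^sup>2 / r\<^sup>2)) / pi * G z)"
    and "integrable gauss (\<lambda>y. G (of_real r * y)) \<longleftrightarrow> integrable lborel (\<lambda>z. exp (- ((norm z)\<^sup>2 / r\<^sup>2)) / pi * G z)"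
proof -
  have e: "exp (- ((norm z)\<^sup>2 / r\<^sup>2)) / (pi * r\<^sup>2) * G z = (1 / r\<^sup>2) * (exp (- ((norm z)\<^sup>2 / r\<^sup>2)) / pi * G z)" for z
    by simp
  have "(LINT y|gauss. G (of_real r * y)) = (LINT z|lborel. exp (- ((norm z)\<^sup>2 / r\<^sup>2)) / (pi * r\<^sup>2) * G z)"
    using arg_cong[OF gauss_distr_scale[OF r], of "\<lambda>M. integral\<^sup>L M G"]
    by (subst (asm) integral_distr, simp, simp, subst (asm) integral_density) auto
  then show "r\<^sup>2 * (LINT y|gauss. G (of_real r * y)) = (LINT z|lborel. exp (- ((norm z)\<^sup>2 / r\<^sup>2)) / pi * G z)"
    unfolding e using r by (subst (asm) integral_mult_right_zero) simp
  have "integrable gauss (\<lambda>y. G (of_real r * y)) \<longleftrightarrow> integrable lborel (\<lambda>z. exp (- ((norm z)\<^sup>2 / r\<^sup>2)) / (pi * r\<^sup>2) * G z)"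
    using arg_cong[OF gauss_distr_scale[OF r], of "\<lambda>M. integrable M G"]
    by (subst (asm) integrable_distr_eq, simp, simp, subst (asm) integrable_density) auto
  then show "integrable gauss (\<lambda>y. G (of_real r * y)) \<longleftrightarrow> integrable lborel (\<lambda>z. exp (- ((norm z)\<^sup>2 / r\<^sup>2)) / pi * G z)"
    unfolding e integrable_mult_left_iff using r by simp
qed

text \<open>The factor \<open>r\<^sup>2\<close> undoes the normalization of the scaled Gaussian: the
  kernel becomes \<open>exp (- ((norm w)\<^sup>2 / r\<^sup>2)) / pi\<close>, which grows pointwise
  with \<open>r\<close>. Hence the mass is monotone in the scale.\<close>

definition gmass :: "(complex \<Rightarrow> real) \<Rightarrow> complex \<Rightarrow> real \<Rightarrow> real" where
  "gmass E z r = r\<^sup>2 * (LINT y|gauss. E (z + of_real r * y))"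

context
  fixes E :: "complex \<Rightarrow> real" and M :: real
  assumes E_cont: "continuous_on UNIV E" and E_nonneg: "\<And>z. E z \<ge> 0" and E_le: "\<And>z. E z \<le> M"
begin

lemma E_measurable [measurable]: "E \<in> borel_measurable borel"
  using E_cont by (rule borel_measurable_continuous_onI)

lemma E_integrable: "integrable gauss (\<lambda>y. E (z + of_real r * y))"
  by (rule gauss.integrable_const_bound[of _ M]) (use E_nonneg E_le in \<open>auto simp: abs_of_nonneg\<close>)

lemma norm_E_integrable: "integrable gauss (\<lambda>y. (norm y)\<^sup>2 * E (z + of_real r * y))"
proof (rule Bochner_Integration.integrable_bound)
  show "integrable gauss (\<lambda>y. M * norm (y * y :: complex))"
    by (intro integrable_mult_right integrable_norm egrow_integrable egrow_mult egrow_id)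
  show "AE y in gauss. norm ((norm y)\<^sup>2 * E (z + of_real r * y)) \<le> norm (M * norm (y * y))"
  proof (rule AE_I2)
    fix y
    have "E (z + of_real r * y) \<le> \<bar>M\<bar>" using E_le[of "z + of_real r * y"] by linarith
    then have "(norm y)\<^sup>2 * E (z + of_real r * y) \<le> (norm y)\<^sup>2 * \<bar>M\<bar>"
      by (intro mult_left_mono) auto
    then show "norm ((norm y)\<^sup>2 * E (z + of_real r * y)) \<le> norm (M * norm (y * y))"
      using E_nonneg[of "z + of_real r * y"] by (simp add: abs_mult norm_mult power2_eq_square mult.commute)
  qed
qed measurable

lemma gmass_lborel:
  assumes r: "r > 0"
  shows "gmass E z r = (LINT w|lborel. exp (- ((norm w)\<^sup>2 / r\<^sup>2)) / pi * E (z + w))"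
    and "integrable lborel (\<lambda>w. exp (- ((norm w)\<^sup>2 / r\<^sup>2)) / pi * E (z + w))"
  using integral_gauss_scale[OF _ r, of "\<lambda>w. E (z + w)"] E_integrable[of z r]
  by (simp_all add: gmass_def)

lemma gmass_mono:
  assumes "0 < r" "r \<le> s"
  shows "gmass E z r \<le> gmass E z s"
proof -
  have "s > 0" using assms by simp
  show ?thesis
    unfolding gmass_lborel(1)[OF assms(1)] gmass_lborel(1)[OF \<open>s > 0\<close>]
  proof (rule integral_mono)
    fix w :: complex
    have "(norm w)\<^sup>2 / s\<^sup>2 \<le> (norm w)\<^sup>2 / r\<^sup>2"
      using assms by (intro divide_left_mono power_mono) auto
    then show "exp (- ((norm w)\<^sup>2 / r\<^sup>2)) / pi * E (z + w) \<le> exp (- ((norm w)\<^sup>2 / s\<^sup>2)) / pi * E (z + w)"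
      by (intro mult_right_mono divide_right_mono E_nonneg) auto
  qed (use gmass_lborel(2) assms \<open>s > 0\<close> in auto)
qed

text \<open>The factor \<open>4 / 3\<close> comes from \<open>exp (3s/4) - 1 \<ge> 3s/4\<close>; this is what makes the scales telescope.\<close>

lemma gmass_moment:
  assumes r: "r > 0"
  shows "r\<^sup>2 * (LINT y|gauss. (norm y)\<^sup>2 * E (z + of_real r * y)) \<le> 4 / 3 * (gmass E z (2 * r) - gmass E z r)"
proof -
  let ?G = "\<lambda>w. (norm w)\<^sup>2 / r\<^sup>2 * E (z + w)"
  have G: "?G (of_real r * y) = (norm y)\<^sup>2 * E (z + of_real r * y)" for y
    using r by (simp add: norm_mult power_mult_distrib)
  have 1: "r\<^sup>2 * (LINT y|gauss. (norm y)\<^sup>2 * E (z + of_real r * y)) = (LINT w|lborel. exp (- ((norm w)\<^sup>2 / r\<^sup>2)) / pi * ?G w)"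
    using integral_gauss_scale(1)[OF _ r, of ?G] unfolding G by simp
  have i1: "integrable lborel (\<lambda>w. exp (- ((norm w)\<^sup>2 / r\<^sup>2)) / pi * ?G w)"
    using integral_gauss_scale(2)[OF _ r, of ?G] norm_E_integrable[of z r] unfolding G by simp
  have r2: "2 * r > 0" using r by simp
  note i2 = gmass_lborel(2)[OF r, of z] gmass_lborel(2)[OF r2, of z]
  have "(LINT w|lborel. exp (- ((norm w)\<^sup>2 / r\<^sup>2)) / pi * ?G w)
     \<le> (LINT w|lborel. 4 / 3 * (exp (- ((norm w)\<^sup>2 / (2 * r)\<^sup>2)) / pi * E (z + w) - exp (- ((norm w)\<^sup>2 / r\<^sup>2)) / pi * E (z + w)))"
  proof (rule integral_mono[OF i1])
    show "integrable lborel (\<lambda>w. 4 / 3 * (exp (- ((norm w)\<^sup>2 / (2 * r)\<^sup>2)) / pi * E (z + w) - exp (- ((norm w)\<^sup>2 / r\<^sup>2)) / pi * E (z + w)))"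
      by (intro integrable_mult_right Bochner_Integration.integrable_diff i2)
    fix w :: complex
    define s where "s = (norm w)\<^sup>2 / r\<^sup>2"
    have s4: "(norm w)\<^sup>2 / (2 * r)\<^sup>2 = s / 4" by (simp add: s_def power_mult_distrib)
    have "exp (- s) * (3 * s / 4) \<le> exp (- s) * (exp (3 * s / 4) - 1)"
    proof (rule mult_left_mono)
      show "3 * s / 4 \<le> exp (3 * s / 4) - 1"
        using exp_ge_add_one_self[of "3 * s / 4"] by linarith
    qed simp
    also have "\<dots> = exp (- (s / 4)) - exp (- s)"
      by (simp add: right_diff_distrib exp_add[symmetric])
    finally have "exp (- s) * s \<le> 4 / 3 * (exp (- (s / 4)) - exp (- s))"
      by simp
    then have "exp (- s) * s * (E (z + w) / pi) \<le> 4 / 3 * (exp (- (s / 4)) - exp (- s)) * (E (z + w) / pi)"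
      by (intro mult_right_mono) (auto intro: E_nonneg divide_nonneg_pos)
    then show "exp (- ((norm w)\<^sup>2 / r\<^sup>2)) / pi * ?G w
       \<le> 4 / 3 * (exp (- ((norm w)\<^sup>2 / (2 * r)\<^sup>2)) / pi * E (z + w) - exp (- ((norm w)\<^sup>2 / r\<^sup>2)) / pi * E (z + w))"
      unfolding s4 s_def[symmetric] by (simp add: algebra_simps diff_divide_distrib)
  qed
  also have "\<dots> = 4 / 3 * (gmass E z (2 * r) - gmass E z r)"
    unfolding gmass_lborel(1)[OF r] gmass_lborel(1)[OF r2]
    by (subst integral_mult_right_zero, subst Bochner_Integration.integral_diff[OF i2(2) i2(1)]) (rule refl)
  finally show ?thesis unfolding 1 .
qed

end

section \<open>Energy estimates and the quadratic Tauberian theorem\<close>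

lemma gauss_ibp_scaled:
  assumes F: "Bs 2 F"
  shows "of_real r * (LINT y|gauss. dz F (z + of_real r * y)) = (LINT y|gauss. cnj y * F (z + of_real r * y))"
    and "of_real r * (LINT y|gauss. dbar F (z + of_real r * y)) = (LINT y|gauss. y * F (z + of_real r * y))"
proof -
  have F1: "Bs (Suc 1) F" using F by (simp add: numeral_2_eq_2)
  have d: "dz (\<lambda>y. F (z + of_real r * y)) = (\<lambda>y. of_real r * dz F (z + of_real r * y))"
     "dbar (\<lambda>y. F (z + of_real r * y)) = (\<lambda>y. of_real r * dbar F (z + of_real r * y))"
    using wirt_funD[OF wirt_affine[OF Bs_wirt[OF F1]], of z r] by auto
  show "of_real r * (LINT y|gauss. dz F (z + of_real r * y)) = (LINT y|gauss. cnj y * F (z + of_real r * y))"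
    "of_real r * (LINT y|gauss. dbar F (z + of_real r * y)) = (LINT y|gauss. y * F (z + of_real r * y))"
    using gauss_ibp[OF Bs_affine[OF F, of z r]] unfolding d by auto
qed

text \<open>Let \<open>V\<close> and \<open>G\<close> be the Gaussian averages of the squared moduli
  of \<open>v\<close> and \<open>dbar v\<close>. The derivative \<open>dz F3\<close> yields
  \<open>G + \<mu> V\<close> up to an error, and its imaginary part controls \<open>V\<close> if
  \<open>\<mu>\<close> is not real. For real \<open>\<mu>\<close> the Green-type combination
  \<open>dz F1 - dbar F2\<close> is the squared modulus of \<open>v\<close> minus
  \<open>u * cnj h\<close>; the boundedness of \<open>u\<close> enters here, which is why the
  operator has to act twice. Integration by parts turns each derivative into an average weighted by
  \<open>norm y\<close> and divided by \<open>r\<close>.\<close>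

lemma energy_estimate:
  fixes u :: "complex \<Rightarrow> complex" and \<mu> :: complex
  assumes u: "Binf u" and v_def: "v = (\<lambda>z. Lap u z - \<mu> * u z)" and h_def: "h = (\<lambda>z. Lap v z - \<mu> * v z)"
  shows "\<exists>K\<ge>0. \<forall>z r. r > 0 \<longrightarrow>
    (LINT y|gauss. (norm (v (z + of_real r * y)) + norm (dbar v (z + of_real r * y)))\<^sup>2)
    \<le> K * ((LINT y|gauss. norm y * (norm (v (z + of_real r * y)) + norm (dbar v (z + of_real r * y)))) / r
       + (LINT y|gauss. norm (h (z + of_real r * y))))"
proof -
  have v: "Binf v" unfolding v_def by (intro Binf_diff Binf_Lap Binf_cmult u)
  have h: "Binf h" unfolding h_def by (intro Binf_diff Binf_Lap Binf_cmult v)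
  obtain A1 where A1: "A1 \<ge> 0" "\<And>z. norm (u z) \<le> A1" using Bs_bound[OF BinfD[OF u]] by blast
  obtain A2 where A2: "A2 \<ge> 0" "\<And>z. norm (dbar u z) \<le> A2" using Bs_bound[OF BinfD[OF Binf_dbar[OF u]]] by blast
  obtain A3 where A3: "A3 \<ge> 0" "\<And>z. norm (v z) \<le> A3" using Bs_bound[OF BinfD[OF v]] by blast
  define M where "M = A1 + A2 + A3"
  have M: "M \<ge> 0" "\<And>z. norm (u z) \<le> M" "\<And>z. norm (dbar u z) \<le> M" "\<And>z. norm (v z) \<le> M"
    using A1 A2 A3 by (auto simp: M_def add_increasing add_increasing2)
  \<comment> \<open>\<open>K1\<close> will bound \<open>V\<close>: two integrations by parts cost
    \<open>2 * M\<close> for real \<open>\<mu>\<close>, the imaginary part costs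
    \<open>M / \<bar>Im \<mu>\<bar>\<close> otherwise. \<open>K\<close> adds the part of
    \<open>G\<close>, with the factor 2 from
    \<open>(a + b)\<^sup>2 \<le> 2 * a\<^sup>2 + 2 * b\<^sup>2\<close>.\<close>
  define K1 where "K1 = (if Im \<mu> = 0 then 2 * M else M / \<bar>Im \<mu>\<bar>)"
  have K1: "K1 \<ge> 0" using M by (simp add: K1_def)
  define K where "K = 2 * K1 + 2 * (M + norm \<mu> * K1)"
  define F1 where "F1 = (\<lambda>z. cnj (v z) * dbar u z)"
  define F2 where "F2 = (\<lambda>z. u z * cnj (dbar v z))"
  define F3 where "F3 = (\<lambda>z. cnj (v z) * dbar v z)"
  have F: "Binf F1" "Binf F2" "Binf F3"
    unfolding F1_def F2_def F3_def by (intro Binf_mult Binf_cnj Binf_dbar u v)+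
  have d1: "dz F1 z = cnj (dbar v z) * dbar u z + cnj (v z) * Lap u z" for z
    unfolding F1_def Lap_def
    by (rule wirtD(2)[OF wirt_mult[OF wirt_cnj[OF Binf_wirt[OF v]] Binf_wirt[OF Binf_dbar[OF u]]]])
  have d2: "dbar F2 z = dbar u z * cnj (dbar v z) + u z * cnj (Lap v z)" for z
    unfolding F2_def Lap_def
    by (rule wirtD(3)[OF wirt_mult[OF Binf_wirt[OF u] wirt_cnj[OF Binf_wirt[OF Binf_dbar[OF v]]]]])
  have d3: "dz F3 z = cnj (dbar v z) * dbar v z + cnj (v z) * Lap v z" for z
    unfolding F3_def Lap_def
    by (rule wirtD(2)[OF wirt_mult[OF wirt_cnj[OF Binf_wirt[OF v]] Binf_wirt[OF Binf_dbar[OF v]]]])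
  have main: "(LINT y|gauss. (norm (v (z + of_real r * y)) + norm (dbar v (z + of_real r * y)))\<^sup>2)
    \<le> K * ((LINT y|gauss. norm y * (norm (v (z + of_real r * y)) + norm (dbar v (z + of_real r * y)))) / r
       + (LINT y|gauss. norm (h (z + of_real r * y))))" if r: "r > 0" for z r
  proof -
    define p where "p y = z + of_real r * y" for y
    have eg: "egrow (\<lambda>y. f (p y))" if "Binf f" for f
      unfolding p_def using Bs_egrow_affine[OF BinfD[OF that]] .
    note egs = eg[OF u] eg[OF v] eg[OF h] eg[OF Binf_dbar[OF u]] eg[OF Binf_dbar[OF v]] eg[OF F(1)] eg[OF F(2)] eg[OF F(3)]
    define V where "V = (LINT y|gauss. (norm (v (p y)))\<^sup>2)"
    define G where "G = (LINT y|gauss. (norm (dbar v (p y)))\<^sup>2)"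
    define Y where "Y = (LINT y|gauss. norm y * (norm (v (p y)) + norm (dbar v (p y))))"
    define H where "H = (LINT y|gauss. norm (h (p y)))"
    have int_sq: "integrable gauss (\<lambda>y. (norm (v (p y)))\<^sup>2)" "integrable gauss (\<lambda>y. (norm (dbar v (p y)))\<^sup>2)"
      using L2D(2)[OF egrow_L2] egs by auto
    have int_Y: "integrable gauss (\<lambda>y. norm y * (norm (v (p y)) + norm (dbar v (p y))))"
    proof -
      have "integrable gauss (\<lambda>y. norm (y * v (p y)) + norm (y * dbar v (p y)))"
        by (intro Bochner_Integration.integrable_add integrable_norm egrow_integrable egrow_mult egrow_id egs)
      then show ?thesis by (simp add: norm_mult distrib_left)
    qed
    have int_H: "integrable gauss (\<lambda>y. norm (h (p y)))"
      by (intro integrable_norm egrow_integrable egs)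
    have nonneg: "V \<ge> 0" "G \<ge> 0" "Y \<ge> 0" "H \<ge> 0"
      by (auto simp: V_def G_def Y_def H_def intro!: Bochner_Integration.integral_nonneg)
    have bdY: "norm (LINT y|gauss. a y * f (p y)) \<le> M * Y"
      if f: "Binf f" and a: "egrow a" "\<And>y. norm (a y) = norm y"
        and le: "\<And>w. norm (f w) \<le> M * (norm (v w) + norm (dbar v w))" for a f
    proof -
      have "norm (LINT y|gauss. a y * f (p y)) \<le> (LINT y|gauss. M * (norm y * (norm (v (p y)) + norm (dbar v (p y)))))"
      proof (rule Bochner_Integration.integral_norm_bound_integral)
        show "integrable gauss (\<lambda>y. a y * f (p y))"
          by (intro egrow_integrable egrow_mult a eg f)
        show "norm (a y * f (p y)) \<le> M * (norm y * (norm (v (p y)) + norm (dbar v (p y))))" for y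
          using mult_left_mono[OF le[of "p y"], of "norm y"] by (simp add: norm_mult a(2) mult.left_commute)
      qed (intro integrable_mult_right int_Y)
      then show ?thesis by (simp add: Y_def)
    qed
    have bdH: "norm (LINT y|gauss. f (p y) * b (h (p y))) \<le> M * H"
      if f: "Binf f" "\<And>w. norm (f w) \<le> M" and b: "b = (\<lambda>w. w) \<or> b = cnj" for f b
    proof -
      have "norm (LINT y|gauss. f (p y) * b (h (p y))) \<le> (LINT y|gauss. M * norm (h (p y)))"
      proof (rule Bochner_Integration.integral_norm_bound_integral)
        have "egrow (\<lambda>y. b (h (p y)))" using b egs egrow_cnj by auto
        then show "integrable gauss (\<lambda>y. f (p y) * b (h (p y)))"
          using eg[OF f(1)] by (intro egrow_integrable egrow_mult)
        have "norm (b w) = norm w" for w using b by auto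
        then show "norm (f (p y) * b (h (p y))) \<le> M * norm (h (p y))" for y
          using mult_right_mono[OF f(2)[of "p y"], of "norm (h (p y))"] by (simp add: norm_mult)
      qed (intro integrable_mult_right int_H)
      then show ?thesis by (simp add: H_def)
    qed
    have le1: "norm (F1 w) \<le> M * (norm (v w) + norm (dbar v w))" for w
    proof -
      have "norm (F1 w) \<le> norm (v w) * M" unfolding F1_def norm_mult complex_mod_cnj by (intro mult_left_mono M) auto
      also have "\<dots> \<le> M * (norm (v w) + norm (dbar v w))" using M(1) by (simp add: algebra_simps)
      finally show ?thesis .
    qed
    have le2: "norm (F2 w) \<le> M * (norm (v w) + norm (dbar v w))" for w
    proof -
      have "norm (F2 w) \<le> M * norm (dbar v w)" unfolding F2_def norm_mult complex_mod_cnj by (intro mult_right_mono M) auto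
      also have "\<dots> \<le> M * (norm (v w) + norm (dbar v w))" using M(1) by (simp add: algebra_simps)
      finally show ?thesis .
    qed
    have le3: "norm (F3 w) \<le> M * (norm (v w) + norm (dbar v w))" for w
    proof -
      have "norm (F3 w) \<le> M * norm (dbar v w)" unfolding F3_def norm_mult complex_mod_cnj by (intro mult_right_mono M) auto
      also have "\<dots> \<le> M * (norm (v w) + norm (dbar v w))" using M(1) by (simp add: algebra_simps)
      finally show ?thesis .
    qed
    have egc: "egrow cnj" using egrow_cnj[OF egrow_id] .
    have Y1: "norm (LINT y|gauss. cnj y * F1 (p y)) \<le> M * Y" by (rule bdY) (use F le1 egc in auto)
    have Y2: "norm (LINT y|gauss. y * F2 (p y)) \<le> M * Y" by (rule bdY) (use F le2 in auto)
    have Y3: "norm (LINT y|gauss. cnj y * F3 (p y)) \<le> M * Y" by (rule bdY) (use F le3 egc in auto)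
    have H1: "norm (LINT y|gauss. u (p y) * cnj (h (p y))) \<le> M * H" by (rule bdH) (use u M in auto)
    have H3: "norm (LINT y|gauss. cnj (v (p y)) * h (p y)) \<le> M * H"
      using bdH[of "\<lambda>z. cnj (v z)" "\<lambda>w. w"] M Binf_cnj[OF v] by auto
    have Vc: "(LINT y|gauss. cnj (v (p y)) * v (p y)) = of_real V"
      unfolding V_def integral_complex_of_real[symmetric] complex_norm_square by (simp add: mult.commute)
    have Gc: "(LINT y|gauss. cnj (dbar v (p y)) * dbar v (p y)) = of_real G"
      unfolding G_def integral_complex_of_real[symmetric] complex_norm_square by (simp add: mult.commute)
    have Lu: "Lap u w = v w + \<mu> * u w" for w by (simp add: v_def)
    have Lv: "Lap v w = h w + \<mu> * v w" for w by (simp add: h_def)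
    define q where "q = Y / r + H"
    have q: "q \<ge> 0" using nonneg r by (simp add: q_def)
    have GV: "norm (of_real G + \<mu> * of_real V) \<le> M * q"
    proof -
      have "dz F3 (p y) = cnj (dbar v (p y)) * dbar v (p y) + (\<mu> * (cnj (v (p y)) * v (p y)) + cnj (v (p y)) * h (p y))" for y
        by (simp add: d3 Lv algebra_simps)
      then have "(LINT y|gauss. dz F3 (p y)) = of_real G + (\<mu> * of_real V + (LINT y|gauss. cnj (v (p y)) * h (p y)))"
        unfolding Gc[symmetric] Vc[symmetric] using egs
        by (simp add: egrow_integrable egrow_mult egrow_cnj)
      then have "of_real r * (of_real G + \<mu> * of_real V) = (LINT y|gauss. cnj y * F3 (p y)) - of_real r * (LINT y|gauss. cnj (v (p y)) * h (p y))"
        using gauss_ibp_scaled(1)[OF BinfD[OF F(3)], of r z] unfolding p_def[symmetric] by (simp add: algebra_simps)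
      then have "norm (of_real r * (of_real G + \<mu> * of_real V)) =
          norm ((LINT y|gauss. cnj y * F3 (p y)) - of_real r * (LINT y|gauss. cnj (v (p y)) * h (p y)))"
        by (simp only:)
      moreover have rI3: "norm (of_real r * (LINT y|gauss. cnj (v (p y)) * h (p y))) \<le> r * (M * H)"
        using H3 r unfolding norm_mult by (intro mult_mono) auto
      ultimately have "norm (of_real r * (of_real G + \<mu> * of_real V)) \<le> M * Y + r * (M * H)"
        using norm_triangle_ineq4[of "LINT y|gauss. cnj y * F3 (p y)" "of_real r * (LINT y|gauss. cnj (v (p y)) * h (p y))"]
          Y3 rI3 by linarith
      moreover have "norm (of_real r * (of_real G + \<mu> * of_real V)) = r * norm (of_real G + \<mu> * of_real V)"
        unfolding norm_mult using r by simp
      moreover have "M * Y + r * (M * H) = r * (M * q)"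
        using r by (simp add: q_def field_simps)
      ultimately have "r * norm (of_real G + \<mu> * of_real V) \<le> r * (M * q)"
        by (simp only:)
      then show ?thesis using r by simp
    qed
    have V: "V \<le> K1 * q"
    proof (cases "Im \<mu> = 0")
      case True
      then have cm: "cnj \<mu> = \<mu>" by (simp add: complex_eq_iff)
      \<comment> \<open>The products of two first derivatives cancel, and so do the terms with
        \<open>\<mu>\<close>, because \<open>\<mu>\<close> is real.\<close>
      have "dz F1 (p y) - dbar F2 (p y) = cnj (v (p y)) * v (p y) - u (p y) * cnj (h (p y))" for y
        by (simp add: d1 d2 Lu Lv cm algebra_simps)
      then have "(LINT y|gauss. dz F1 (p y) - dbar F2 (p y)) = of_real V - (LINT y|gauss. u (p y) * cnj (h (p y)))"
        unfolding Vc[symmetric] using egs by (simp add: egrow_integrable egrow_mult egrow_cnj)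
      moreover have "(LINT y|gauss. dz F1 (p y) - dbar F2 (p y)) = (LINT y|gauss. dz F1 (p y)) - (LINT y|gauss. dbar F2 (p y))"
        using eg[OF Binf_dz[OF F(1)]] eg[OF Binf_dbar[OF F(2)]] by (simp add: egrow_integrable)
      ultimately have "complex_of_real V = (LINT y|gauss. dz F1 (p y)) - (LINT y|gauss. dbar F2 (p y)) + (LINT y|gauss. u (p y) * cnj (h (p y)))"
        by (metis diff_add_cancel)
      then have "of_real r * complex_of_real V = of_real r * (LINT y|gauss. dz F1 (p y)) - of_real r * (LINT y|gauss. dbar F2 (p y))
          + of_real r * (LINT y|gauss. u (p y) * cnj (h (p y)))"
        by (simp only: distrib_left right_diff_distrib)
      also have "\<dots> = (LINT y|gauss. cnj y * F1 (p y)) - (LINT y|gauss. y * F2 (p y))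
          + of_real r * (LINT y|gauss. u (p y) * cnj (h (p y)))"
        using gauss_ibp_scaled(1)[OF BinfD[OF F(1)], of r z] gauss_ibp_scaled(2)[OF BinfD[OF F(2)], of r z]
        unfolding p_def[symmetric] by simp
      finally have eqV: "norm (of_real r * complex_of_real V) = norm ((LINT y|gauss. cnj y * F1 (p y)) - (LINT y|gauss. y * F2 (p y))
          + of_real r * (LINT y|gauss. u (p y) * cnj (h (p y))))" by (simp only:)
      have rI1: "norm (of_real r * (LINT y|gauss. u (p y) * cnj (h (p y)))) \<le> r * (M * H)"
        using H1 r unfolding norm_mult by (intro mult_mono) auto
      have "norm (of_real r * complex_of_real V) \<le> M * Y + M * Y + r * (M * H)"
        unfolding eqV using norm_triangle_ineq[of "(LINT y|gauss. cnj y * F1 (p y)) - (LINT y|gauss. y * F2 (p y))" "of_real r * (LINT y|gauss. u (p y) * cnj (h (p y)))"]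
          norm_triangle_ineq4[of "LINT y|gauss. cnj y * F1 (p y)" "LINT y|gauss. y * F2 (p y)"]
          Y1 Y2 rI1 by linarith
      then have "r * V \<le> M * Y + M * Y + r * (M * H)"
        using r nonneg by (simp add: norm_mult)
      also have "\<dots> \<le> r * (2 * M * q)"
      proof -
        have "r * (2 * M * q) = 2 * (M * Y) + 2 * (r * (M * H))" using r by (simp add: q_def algebra_simps)
        moreover have "0 \<le> r * (M * H)" using r M nonneg by simp
        ultimately show ?thesis by linarith
      qed
      finally show ?thesis using r True by (simp add: K1_def)
    next
      case False
      \<comment> \<open>\<open>G\<close> and \<open>V\<close> are real, so in \<open>GV\<close> only
        \<open>\<mu>\<close> contributes an imaginary part.\<close>
      have "\<bar>Im \<mu>\<bar> * V = \<bar>Im (of_real G + \<mu> * of_real V)\<bar>"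
        using nonneg by (simp add: abs_mult)
      also have "\<dots> \<le> M * q" using abs_Im_le_cmod GV order_trans by blast
      finally show ?thesis using False by (simp add: K1_def field_simps)
    qed
    have "G = norm (complex_of_real G)" using nonneg by simp
    also have "\<dots> \<le> norm (of_real G + \<mu> * of_real V) + norm (\<mu> * complex_of_real V)"
      using norm_triangle_ineq4[of "of_real G + \<mu> * of_real V" "\<mu> * complex_of_real V"] by simp
    also have "\<dots> \<le> M * q + norm \<mu> * (K1 * q)"
      using GV V nonneg by (simp add: norm_mult add_mono mult_left_mono)
    finally have G: "G \<le> (M + norm \<mu> * K1) * q" by (simp add: algebra_simps)
    have "(LINT y|gauss. (norm (v (p y)) + norm (dbar v (p y)))\<^sup>2) \<le> (LINT y|gauss. 2 * (norm (v (p y)))\<^sup>2 + 2 * (norm (dbar v (p y)))\<^sup>2)"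
    proof (rule integral_mono')
      show "(norm (v (p y)) + norm (dbar v (p y)))\<^sup>2 \<le> 2 * (norm (v (p y)))\<^sup>2 + 2 * (norm (dbar v (p y)))\<^sup>2" for y
        using sum_squares_bound[of "norm (v (p y))" "norm (dbar v (p y))"] by (simp add: power2_sum)
    qed (use int_sq in auto)
    also have "\<dots> = 2 * V + 2 * G" using int_sq by (simp add: V_def G_def)
    also have "\<dots> \<le> K * q" using V G by (simp add: K_def algebra_simps)
    finally show ?thesis by (simp add: q_def Y_def H_def p_def)
  qed
  have "K \<ge> 0" using K1 M by (simp add: K_def)
  then show ?thesis by (intro exI[of _ K] conjI allI impI main)
qed


lemma gauss_integral_sq:
  assumes f: "f \<in> L2" shows "(LINT y|gauss. norm (f y)) \<le> L2_norm f"
proof -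
  have "L2_norm (\<lambda>_. 1) = 1" by (simp add: L2_norm_def)
  then show ?thesis
    using L2_norm_product[OF f egrow_L2[OF egrow_const[of 1]]] by simp
qed

text \<open>If \<open>X\<close> is the Gaussian mass of \<open>(|v| + |dbar v|)\<^sup>2\<close> at scale \<open>r\<close>, the energy estimate gives both
  \<open>X \<le> C (sqrt X + \<delta>)\<close>, hence a bound uniform in \<open>r\<close>, and \<open>X(r) \<le> C (sqrt (X(2r) - X(r)) + \<delta>)\<close>;
  by pigeonhole over dyadic scales \<open>X(1)\<close> is small.\<close>

lemma tauber_quadratic:
  fixes u :: "complex \<Rightarrow> complex" and \<mu> :: complex
  assumes u: "Binf u" and v_def: "v = (\<lambda>z. Lap u z - \<mu> * u z)"
    and h_van: "van (\<lambda>z. Lap v z - \<mu> * v z)"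
  shows "van v"
proof -
  define h where "h = (\<lambda>z. Lap v z - \<mu> * v z)"
  have v: "Binf v" unfolding v_def by (intro Binf_diff Binf_Lap Binf_cmult u)
  have h: "Binf h" unfolding h_def by (intro Binf_diff Binf_Lap Binf_cmult v)
  note dv = Binf_dbar[OF v]
  define e where "e z = norm (v z) + norm (dbar v z)" for z
  define E where "E z = (e z)\<^sup>2" for z
  obtain A where A: "A \<ge> 0" "\<And>z. norm (v z) \<le> A" using Bs_bound[OF BinfD[OF v]] by blast
  obtain B where B: "B \<ge> 0" "\<And>z. norm (dbar v z) \<le> B" using Bs_bound[OF BinfD[OF dv]] by blast
  have e0: "e z \<ge> 0" for z by (simp add: e_def)
  have e_cont: "continuous_on UNIV e"
    unfolding e_def[abs_def] using Bs_continuous[OF BinfD[OF v]] Bs_continuous[OF BinfD[OF dv]]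
    by (intro continuous_intros)
  have E_cont: "continuous_on UNIV E"
    unfolding E_def[abs_def] by (intro continuous_intros e_cont)
  have E0: "E z \<ge> 0" for z by (simp add: E_def)
  have E_le: "E z \<le> (A + B)\<^sup>2" for z
    unfolding E_def using A(2)[of z] B(2)[of z] by (intro power_mono) (auto simp: e_def)
  have eC: "egrow (\<lambda>y. complex_of_real (e (z + of_real r * y)))" for z r
  proof (rule egrowI[of _ "A + B" 0])
    show "norm (complex_of_real (e (z + of_real r * y))) \<le> (A + B) * exp (0 * norm y)" for y
      using A(2)[of "z + of_real r * y"] B(2)[of "z + of_real r * y"]
      unfolding norm_of_real abs_of_nonneg[OF e0] e_def by simp
    have "continuous_on UNIV (\<lambda>y. e (z + of_real r * y))"
      by (rule continuous_on_compose2[OF e_cont]) (intro continuous_intros, simp)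
    then show "(\<lambda>y. complex_of_real (e (z + of_real r * y))) \<in> borel_measurable borel"
      by (intro borel_measurable_continuous_onI continuous_intros)
  qed
  let ?X = "gmass E"
  let ?H = "\<lambda>z r. LINT y|gauss. norm (h (z + of_real r * y))"
  have "\<exists>K\<ge>0. \<forall>z r. r > 0 \<longrightarrow> (LINT y|gauss. E (z + of_real r * y))
      \<le> K * ((LINT y|gauss. norm y * e (z + of_real r * y)) / r + ?H z r)"
    using energy_estimate[OF u v_def h_def] unfolding E_def e_def .
  then obtain K where K0: "K \<ge> 0" and K1: "\<forall>z r. r > 0 \<longrightarrow> (LINT y|gauss. E (z + of_real r * y))
      \<le> K * ((LINT y|gauss. norm y * e (z + of_real r * y)) / r + ?H z r)"
    by (elim exE conjE) (rule that)
  note K = K0 K1[rule_format]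
  define m where "m = max 1 (L2_norm (\<lambda>y. y))"
  \<comment> \<open>The maxima with 1 give \<open>C \<ge> 1\<close>, so that one constant dominates
    \<open>K\<close>, \<open>K * m\<close> and later \<open>\<delta>\<close>.\<close>
  define C where "C = max 1 K * m"
  have m: "m \<ge> 1" "L2_norm (\<lambda>y. y) \<le> m" by (auto simp: m_def)
  have C: "C \<ge> 1" "K \<le> C" "K * m \<le> C"
    using mult_mono[of 1 "max 1 K" 1 m] mult_mono[of K "max 1 K" 1 m] mult_right_mono[of K "max 1 K" m] m K(1)
    by (auto simp: C_def)
  have X: "?X z r \<le> K * (r * (LINT y|gauss. norm y * e (z + of_real r * y)) + r\<^sup>2 * ?H z r)" if r: "r > 0" for z r
  proof -
    have "?X z r \<le> r\<^sup>2 * (K * ((LINT y|gauss. norm y * e (z + of_real r * y)) / r + ?H z r))"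
      unfolding gmass_def by (intro mult_left_mono K r) auto
    also have "\<dots> = K * (r * (LINT y|gauss. norm y * e (z + of_real r * y)) + r\<^sup>2 * ?H z r)"
      using r by (simp add: field_simps power2_eq_square)
    finally show ?thesis .
  qed
  have X0: "?X z r \<ge> 0" for z r
    unfolding gmass_def by (intro mult_nonneg_nonneg Bochner_Integration.integral_nonneg) (auto simp: E0)
  have H0: "?H z r \<ge> 0" for z r by (intro Bochner_Integration.integral_nonneg) auto
  have nsq: "L2_norm (\<lambda>y. complex_of_real (e (z + of_real r * y))) = sqrt (LINT y|gauss. E (z + of_real r * y))" for z r
    by (simp add: L2_norm_def E_def)
  \<comment> \<open>Cauchy-Schwarz against the fixed weight \<open>norm y\<close>.\<close>
  have XA: "?X z r \<le> C * (sqrt (?X z r) + r\<^sup>2 * ?H z r)" if r: "r > 0" for z r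
  proof -
    have "(LINT y|gauss. norm y * e (z + of_real r * y)) \<le> L2_norm (\<lambda>y. y) * sqrt (LINT y|gauss. E (z + of_real r * y))"
      using L2_norm_product[OF egrow_L2[OF egrow_id] egrow_L2[OF eC[of z r]]] e0 unfolding nsq by simp
    also have "\<dots> \<le> m * sqrt (LINT y|gauss. E (z + of_real r * y))"
      by (intro mult_right_mono m) (auto intro!: Bochner_Integration.integral_nonneg E0)
    finally have "r * (LINT y|gauss. norm y * e (z + of_real r * y)) \<le> r * (m * sqrt (LINT y|gauss. E (z + of_real r * y)))"
      using r by simp
    also have "\<dots> = m * sqrt (?X z r)"
      using r by (simp add: gmass_def real_sqrt_mult)
    finally have "?X z r \<le> K * (m * sqrt (?X z r) + r\<^sup>2 * ?H z r)"
      using X[OF r, of z] K(1) by (meson add_right_mono mult_left_mono order_trans)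
    also have "\<dots> = (K * m) * sqrt (?X z r) + K * (r\<^sup>2 * ?H z r)" by (simp add: algebra_simps)
    also have "\<dots> \<le> C * sqrt (?X z r) + C * (r\<^sup>2 * ?H z r)"
      by (intro add_mono mult_right_mono C) (auto simp: X0 H0)
    finally show ?thesis by (simp add: distrib_left)
  qed
  \<comment> \<open>Here the weight \<open>norm y\<close> stays inside the square, and
    \<open>gmass_moment\<close> trades it for the growth of the mass from scale \<open>r\<close> to
    \<open>2 * r\<close>.\<close>
  have XB: "?X z r \<le> C * (sqrt (4 / 3 * (?X z (2 * r) - ?X z r)) + r\<^sup>2 * ?H z r)" if r: "r > 0" for z r
  proof -
    have "(LINT y|gauss. norm y * e (z + of_real r * y)) \<le> L2_norm (\<lambda>y. y * complex_of_real (e (z + of_real r * y)))"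
      using gauss_integral_sq[OF egrow_L2[OF egrow_mult[OF egrow_id eC[of z r]]]] e0 by (simp add: norm_mult)
    also have "\<dots> = sqrt (LINT y|gauss. (norm y)\<^sup>2 * E (z + of_real r * y))"
      by (simp add: L2_norm_def E_def norm_mult power_mult_distrib)
    finally have "r * (LINT y|gauss. norm y * e (z + of_real r * y)) \<le> r * sqrt (LINT y|gauss. (norm y)\<^sup>2 * E (z + of_real r * y))"
      using r by simp
    also have "\<dots> = sqrt (r\<^sup>2 * (LINT y|gauss. (norm y)\<^sup>2 * E (z + of_real r * y)))"
      using r by (simp add: real_sqrt_mult)
    also have "\<dots> \<le> sqrt (4 / 3 * (?X z (2 * r) - ?X z r))"
      by (intro real_sqrt_le_mono gmass_moment[OF E_cont E0 E_le r])
    finally have "?X z r \<le> K * (sqrt (4 / 3 * (?X z (2 * r) - ?X z r)) + r\<^sup>2 * ?H z r)"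
      using X[OF r, of z] K(1) by (meson add_right_mono mult_left_mono order_trans)
    also have "\<dots> \<le> C * (sqrt (4 / 3 * (?X z (2 * r) - ?X z r)) + r\<^sup>2 * ?H z r)"
      using gmass_mono[OF E_cont E0 E_le r, of "2 * r" z] r H0[of z r]
      by (intro mult_right_mono C) auto
    finally show ?thesis .
  qed
  have mono: "0 < r \<Longrightarrow> r \<le> s \<Longrightarrow> ?X z r \<le> ?X z s" for z r s
    by (rule gmass_mono[OF E_cont E0 E_le])
  have X1: "\<exists>R. \<forall>z. norm z \<ge> R \<longrightarrow> ?X z 1 \<le> \<eta>" if \<eta>: "\<eta> > 0" for \<eta>
  proof -
    define Q where "Q = 4 / 3 * (4 * C\<^sup>2)"
    have Q: "Q > 0" using C(1) by (simp add: Q_def)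
    \<comment> \<open>The number of dyadic scales: the root of \<open>4 / 3\<close> times an
      increment of at most \<open>4 * C\<^sup>2 / N\<close> has to lie below
      \<open>\<eta> / (2 * C)\<close>.\<close>
    obtain N :: nat where N: "Q * (2 * C / \<eta>)\<^sup>2 < real N"
      using reals_Archimedean2 by blast
    have "0 \<le> Q * (2 * C / \<eta>)\<^sup>2" using Q by simp
    then have N0: "N > 0" using N by (metis not_gr_zero of_nat_0 not_less)
    define \<delta> where "\<delta> = min 1 (\<eta> / (2 * C))"
    have \<delta>: "\<delta> > 0" "\<delta> \<le> 1" "C * \<delta> \<le> \<eta> / 2"
      using \<eta> C(1) by (auto simp: \<delta>_def min_def field_simps)
    have "\<exists>R. \<forall>z. norm z \<ge> R \<longrightarrow> (2 ^ j)\<^sup>2 * ?H z (2 ^ j) \<le> \<delta>" for j :: nat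
    proof -
      have p: "(2::real) ^ j > 0" by simp
      obtain R where "\<forall>z. norm z \<ge> R \<longrightarrow> norm (complex_of_real (?H z (2 ^ j))) \<le> \<delta> / (2 ^ j)\<^sup>2"
        using vanD[OF integral_van[OF BinfD[OF h] h_van[folded h_def] p], of "\<delta> / (2 ^ j)\<^sup>2"] \<delta>(1) by auto
      then show ?thesis
        by (intro exI[of _ R]) (auto simp: field_simps H0 abs_of_nonneg simp del: of_real_power)
    qed
    then obtain R where R: "\<And>j z. norm z \<ge> R j \<Longrightarrow> (2 ^ j)\<^sup>2 * ?H z (2 ^ j) \<le> \<delta>"
      by metis
    define R' where "R' = Max (R ` {..N})"
    have "?X z 1 \<le> \<eta>" if z: "norm z \<ge> R'" for z
    proof -
      have Hj: "(2 ^ j)\<^sup>2 * ?H z (2 ^ j) \<le> \<delta>" if "j \<le> N" for j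
        by (rule R) (use z that Max_ge[of "R ` {..N}" "R j"] in \<open>auto simp: R'_def\<close>)
      \<comment> \<open>If the root \<open>?x\<close> exceeded \<open>2 * C\<close>, it would also
        exceed \<open>\<delta>\<close>, and \<open>XA\<close> would give
        \<open>?x * ?x \<le> 2 * C * ?x\<close>.\<close>
      have XN: "?X z (2 ^ j) \<le> 4 * C\<^sup>2" if j: "j \<le> N" for j
      proof (rule ccontr)
        let ?x = "sqrt (?X z (2 ^ j))"
        assume "\<not> ?X z (2 ^ j) \<le> 4 * C\<^sup>2"
        then have x: "2 * C < ?x"
          by (intro real_less_rsqrt) (simp add: power_mult_distrib)
        have "?x * ?x \<le> C * (?x + \<delta>)"
        proof -
          have "?x * ?x = ?X z (2 ^ j)" using X0 by simp
          also have "\<dots> \<le> C * (?x + (2 ^ j)\<^sup>2 * ?H z (2 ^ j))"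
            by (rule XA) simp
          also have "\<dots> \<le> C * (?x + \<delta>)"
            using Hj[OF j] C(1) by (intro mult_left_mono add_left_mono) auto
          finally show ?thesis .
        qed
        also have "\<dots> \<le> C * (?x + ?x)"
          using x C(1) \<delta> by (intro mult_left_mono add_left_mono) auto
        also have "\<dots> = (2 * C) * ?x" by simp
        finally have xx: "?x * ?x \<le> (2 * C) * ?x" .
        have "0 < ?x" using x C(1) by linarith
        then have "?x \<le> 2 * C" by (rule mult_right_le_imp_le[OF xx])
        with x show False by linarith
      qed
      define D where "D j = ?X z (2 ^ Suc j) - ?X z (2 ^ j)" for j
      \<comment> \<open>The increments telescope to at most \<open>4 * C\<^sup>2\<close>, so one of
        them is at most this bound divided by \<open>N\<close>.\<close>
      have "\<exists>j<N. D j \<le> 4 * C\<^sup>2 / N"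
      proof (rule ccontr)
        assume "\<not> ?thesis"
        then have "(\<Sum>j<N. 4 * C\<^sup>2 / N) < (\<Sum>j<N. D j)"
          using N0 by (intro sum_strict_mono) (auto simp: not_le)
        also have "\<dots> = ?X z (2 ^ N) - ?X z (2 ^ 0)"
          unfolding D_def by (rule sum_lessThan_telescope)
        also have "\<dots> \<le> 4 * C\<^sup>2" using XN[of N] X0[of z "2 ^ 0"] by simp
        finally show False using N0 by simp
      qed
      then obtain j where j: "j < N" "D j \<le> 4 * C\<^sup>2 / N" by blast
      have "?X z 1 \<le> ?X z (2 ^ j)" by (rule mono) auto
      also have "\<dots> \<le> C * (sqrt (4 / 3 * (?X z (2 * 2 ^ j) - ?X z (2 ^ j))) + (2 ^ j)\<^sup>2 * ?H z (2 ^ j))"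
        by (rule XB) simp
      also have "\<dots> \<le> C * (\<eta> / (2 * C) + \<delta>)"
      proof (intro mult_left_mono add_mono)
        have "4 / 3 * (?X z (2 * 2 ^ j) - ?X z (2 ^ j)) \<le> Q / N"
          using j(2) by (simp add: D_def Q_def)
        also have "\<dots> \<le> (\<eta> / (2 * C))\<^sup>2"
          using N N0 \<eta> C(1) by (simp add: field_simps power2_eq_square)
        finally have "sqrt (4 / 3 * (?X z (2 * 2 ^ j) - ?X z (2 ^ j))) \<le> sqrt ((\<eta> / (2 * C))\<^sup>2)"
          by (rule real_sqrt_le_mono)
        then show "sqrt (4 / 3 * (?X z (2 * 2 ^ j) - ?X z (2 ^ j))) \<le> \<eta> / (2 * C)"
          using \<eta> C(1) by simp
        show "(2 ^ j)\<^sup>2 * ?H z (2 ^ j) \<le> \<delta>" using Hj[of j] j by simp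
      qed (use C(1) in auto)
      also have "\<dots> = \<eta> / 2 + C * \<delta>" using C(1) by (simp add: distrib_left)
      also have "\<dots> \<le> \<eta>" using \<delta>(3) by simp
      finally show ?thesis .
    qed
    then show ?thesis by blast
  qed
  obtain L where L: "L \<ge> 0" "\<And>z w. norm (v z - v w) \<le> L * norm (z - w)"
    using Bs_lipschitz[OF BinfD[OF v]] by blast
  define P where "P = (LINT y|gauss. norm (y :: complex))"
  have P0: "P \<ge> 0" unfolding P_def by (intro Bochner_Integration.integral_nonneg) auto
  have iP: "integrable gauss (\<lambda>y. norm (y :: complex))"
    by (intro integrable_norm egrow_integrable egrow_id)
  \<comment> \<open>The average at a small scale \<open>r\<close> recovers the point value up to a
    Lipschitz error, and the mass at scale \<open>r\<close> is at most that at scale 1.\<close>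
  have pw: "norm (v z) \<le> sqrt (?X z 1) / r + L * r * P" if r: "0 < r" "r \<le> 1" for z r
  proof -
    have ev: "egrow (\<lambda>y. v (z + of_real r * y))" by (rule Bs_egrow_affine[OF BinfD[OF v]])
    have "norm (v z) = (LINT y|gauss. norm (v z))" by simp
    also have "\<dots> \<le> (LINT y|gauss. e (z + of_real r * y) + L * r * norm y)"
    proof (rule integral_mono)
      have "integrable gauss (\<lambda>y. norm (complex_of_real (e (z + of_real r * y))))"
        by (intro integrable_norm egrow_integrable eC)
      then show "integrable gauss (\<lambda>y. e (z + of_real r * y) + L * r * norm y)"
        using iP e0 by (intro Bochner_Integration.integrable_add integrable_mult_right) auto
      fix y
      have "norm (v z) \<le> norm (v (z + of_real r * y)) + norm (v z - v (z + of_real r * y))"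
        by (metis add.commute diff_add_cancel norm_triangle_ineq)
      also have "norm (v z - v (z + of_real r * y)) \<le> L * (r * norm y)"
        using L(2)[of z "z + of_real r * y"] r by (simp add: norm_mult)
      finally have t: "norm (v z) \<le> norm (v (z + of_real r * y)) + L * (r * norm y)" by simp
      show "norm (v z) \<le> e (z + of_real r * y) + L * r * norm y"
        using t norm_ge_zero[of "dbar v (z + of_real r * y)"] unfolding e_def mult.assoc by linarith
    qed simp
    also have "\<dots> = (LINT y|gauss. e (z + of_real r * y)) + L * r * P"
    proof -
      have "integrable gauss (\<lambda>y. norm (complex_of_real (e (z + of_real r * y))))"
        by (intro integrable_norm egrow_integrable eC)
      then show ?thesis using iP e0 by (simp add: P_def)
    qed
    also have "(LINT y|gauss. e (z + of_real r * y)) \<le> sqrt (LINT y|gauss. E (z + of_real r * y))"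
      using gauss_integral_sq[OF egrow_L2[OF eC[of z r]]] e0 unfolding nsq by simp
    also have "\<dots> = sqrt (?X z r) / r"
      using r by (simp add: gmass_def real_sqrt_mult)
    also have "\<dots> \<le> sqrt (?X z 1) / r"
      using mono[OF r, of z] r by (intro divide_right_mono real_sqrt_le_mono) auto
    finally show ?thesis by simp
  qed
  show "van v"
    unfolding van_def
  proof (intro allI impI)
    fix \<epsilon> :: real assume \<epsilon>: "\<epsilon> > 0"
    define r where "r = min 1 (\<epsilon> / (2 * (L * P + 1)))"
    have LP: "L * P \<ge> 0" using L P0 by simp
    have r: "0 < r" "r \<le> 1" using \<epsilon> LP by (auto simp: r_def)
    have "r * (L * P + 1) \<le> \<epsilon> / (2 * (L * P + 1)) * (L * P + 1)"
      using LP by (intro mult_right_mono) (auto simp: r_def)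
    also have "\<dots> = \<epsilon> / 2" using LP by (simp add: field_simps)
    finally have rL: "L * r * P \<le> \<epsilon> / 2" using r by (simp add: algebra_simps)
    obtain R where R: "\<And>z. norm z \<ge> R \<Longrightarrow> ?X z 1 \<le> (r * \<epsilon> / 2)\<^sup>2"
      using X1[of "(r * \<epsilon> / 2)\<^sup>2"] r \<epsilon> by auto
    have "norm (v z) \<le> \<epsilon>" if z: "norm z \<ge> R" for z
    proof -
      have "sqrt (?X z 1) \<le> sqrt ((r * \<epsilon> / 2)\<^sup>2)" by (intro real_sqrt_le_mono R z)
      then have "sqrt (?X z 1) \<le> r * \<epsilon> / 2" using r \<epsilon> by simp
      then have "sqrt (?X z 1) / r \<le> \<epsilon> / 2" using r by (simp add: field_simps)
      then show ?thesis using pw[OF r, of z] rL by linarith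
    qed
    then show "\<exists>R. \<forall>z. R \<le> norm z \<longrightarrow> norm (v z) \<le> \<epsilon>" by blast
  qed
qed

section \<open>Polynomials in the Laplacian\<close>

definition lapoly :: "complex poly \<Rightarrow> (complex \<Rightarrow> complex) \<Rightarrow> complex \<Rightarrow> complex" where
  "lapoly p u z = (\<Sum>i\<le>degree p. coeff p i * (Lap ^^ i) u z)"

lemma Binf_Lap_pow: "Binf u \<Longrightarrow> Binf ((Lap ^^ i) u)"
  by (induction i) (auto intro: Binf_Lap)

lemma Binf_const: "Binf (\<lambda>_. c)"
  by (simp add: Binf_def Bs_const del: Bs.simps)

lemma Binf_sum: "(\<And>i. i \<in> I \<Longrightarrow> Binf (f i)) \<Longrightarrow> Binf (\<lambda>z. \<Sum>i\<in>I. f i z)"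
  by (induction I rule: infinite_finite_induct) (auto intro: Binf_add Binf_const)

lemma Lap_sum: "(\<And>i. i \<in> I \<Longrightarrow> Binf (f i)) \<Longrightarrow> finite I \<Longrightarrow> Lap (\<lambda>z. \<Sum>i\<in>I. f i z) = (\<lambda>z. \<Sum>i\<in>I. Lap (f i) z)"
proof (induction I rule: infinite_finite_induct)
  case empty
  have "Lap (\<lambda>z. 0) = (\<lambda>z. 0)"
    using Lap_cmult[of "\<lambda>_. 0" 0] by (simp add: Binf_const)
  then show ?case by simp
next
  case (insert x F)
  then show ?case by (simp add: Lap_add Binf_sum)
qed simp

lemma Binf_lapoly: "Binf u \<Longrightarrow> Binf (lapoly p u)"
  unfolding lapoly_def[abs_def] by (intro Binf_sum Binf_cmult Binf_Lap_pow)

lemma lapoly_ge: "degree p \<le> n \<Longrightarrow> lapoly p u z = (\<Sum>i\<le>n. coeff p i * (Lap ^^ i) u z)"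
  unfolding lapoly_def by (rule sum.mono_neutral_left) (auto simp: coeff_eq_0)

lemma lapoly_add: "lapoly (p + q) u z = lapoly p u z + lapoly q u z"
proof -
  let ?n = "max (degree p) (degree q)"
  show ?thesis
    by (simp add: lapoly_ge[of _ ?n] degree_add_le sum.distrib algebra_simps)
qed

lemma lapoly_smult: "lapoly (smult c p) u z = c * lapoly p u z"
  by (subst lapoly_ge[of _ "degree p"]) (auto simp: lapoly_def sum_distrib_left mult.assoc)

lemma lapoly_0 [simp]: "lapoly 0 u z = 0"
  by (simp add: lapoly_def)

lemma lapoly_pCons:
  assumes u: "Binf u"
  shows "lapoly (pCons a p) u z = a * u z + Lap (lapoly p u) z"
proof -
  have "Lap (lapoly p u) z = (\<Sum>i\<le>degree p. coeff p i * (Lap ^^ Suc i) u z)"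
    unfolding lapoly_def[abs_def]
    by (subst Lap_sum) (auto simp: Lap_cmult u Binf_Lap_pow Binf_cmult)
  moreover have "lapoly (pCons a p) u z = (\<Sum>i\<le>Suc (degree p). coeff (pCons a p) i * (Lap ^^ i) u z)"
    by (rule lapoly_ge) (simp add: degree_pCons_le)
  ultimately show ?thesis
    unfolding sum.atMost_Suc_shift by simp
qed

lemma lapoly_linear: "Binf u \<Longrightarrow> lapoly [:- \<mu>, 1:] u z = Lap u z - \<mu> * u z"
proof -
  assume u: "Binf u"
  have c: "lapoly [:1:] u = u"
    by (simp add: lapoly_def fun_eq_iff)
  show ?thesis by (subst lapoly_pCons[OF u]) (simp add: c)
qed

text \<open>Makes \<open>lapoly\<close> an action of the polynomial ring, so that factors can be
  reordered and removed one at a time. \<open>Binf\<close> ensures that \<open>Lap\<close> is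
  additive on everything that occurs.\<close>

lemma lapoly_mult: "Binf u \<Longrightarrow> lapoly (p * q) u = lapoly p (lapoly q u)"
proof (induction p)
  case 0
  then show ?case by (simp add: fun_eq_iff)
next
  case (pCons a p)
  have b: "Binf (lapoly q u)" using pCons by (intro Binf_lapoly)
  have "lapoly (pCons a p * q) u z = lapoly (pCons a p) (lapoly q u) z" for z
    using pCons by (simp add: mult_pCons_left lapoly_add lapoly_smult lapoly_pCons[OF b] lapoly_pCons[OF pCons.prems])
  then show ?case by blast
qed

lemma lapoly_lapoly_commute: "Binf u \<Longrightarrow> lapoly p (lapoly q u) = lapoly q (lapoly p u)"
  by (metis lapoly_mult mult.commute)

text \<open>A root splits \<open>p\<close> into a linear factor \<open>l\<close> and a cofactor
  \<open>q\<close>. \<open>tauber_quadratic\<close>, applied to the function with \<open>q\<close>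
  acting twice on \<open>u\<close>, removes one copy of \<open>l\<close>; the induction hypothesis,
  applied to \<open>lapoly l u\<close>, then removes one copy of \<open>q\<close>. Constant
  \<open>p\<close>, zero included, is the base case.\<close>

lemma tauber_poly:
  "Binf u \<Longrightarrow> van (lapoly p (lapoly p u)) \<Longrightarrow> van (lapoly p u)"
proof (induction "degree p" arbitrary: p u)
  case 0
  then obtain a where p: "p = [:a:]" by (metis degree_eq_zeroE)
  have l: "lapoly p w = (\<lambda>z. a * w z)" for w
    by (simp add: p lapoly_def fun_eq_iff)
  show ?case
  proof (cases "a = 0")
    case True
    then show ?thesis unfolding l by (simp add: van_def)
  next
    case False
    show ?thesis using 0(3) unfolding l van_cmult_iff[OF False] .
  qed
next
  case (Suc n)
  have "\<not> constant (poly p)" using Suc.hyps(2) by (simp add: constant_degree)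
  then obtain \<mu> where "poly p \<mu> = 0" using fundamental_theorem_of_algebra by blast
  then obtain q where p: "p = [:- \<mu>, 1:] * q" by (metis poly_eq_0_iff_dvd dvdE)
  have q0: "q \<noteq> 0" using p Suc.hyps(2) by auto
  have dq: "n = degree q" using Suc.hyps(2) unfolding p by (subst (asm) degree_mult_eq) (use q0 in auto)
  let ?l = "[:- \<mu>, 1:]"
  note u = Suc.prems(1)
  define w where "w = lapoly q (lapoly q u)"
  have w: "Binf w" unfolding w_def by (intro Binf_lapoly u)
  have "lapoly p (lapoly p u) = lapoly ?l (lapoly ?l w)"
    unfolding p w_def using u
    by (simp only: lapoly_mult Binf_lapoly lapoly_lapoly_commute[of _ q ?l])
  then have "van (lapoly ?l (lapoly ?l w))" using Suc.prems(2) by simp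
  moreover have l: "lapoly ?l f = (\<lambda>z. Lap f z - \<mu> * f z)" if "Binf f" for f
    using lapoly_linear[OF that] by blast
  ultimately have "van (lapoly ?l w)"
    using tauber_quadratic[OF w refl, of \<mu>] unfolding l[OF w] l[OF Binf_lapoly[OF w, of ?l], unfolded l[OF w]] by blast
  then have "van (lapoly q (lapoly q (lapoly ?l u)))"
    unfolding w_def using u by (simp only: Binf_lapoly lapoly_lapoly_commute[of _ ?l q])
  then have "van (lapoly q (lapoly ?l u))"
    by (rule Suc.hyps(1)[OF dq Binf_lapoly[OF u]])
  then show ?case
    unfolding p using u by (simp only: lapoly_mult lapoly_lapoly_commute[of _ q ?l])
qed

section \<open>Symbols of bounded forms\<close>

text \<open>A remainder that is quadratic in the shift and whose growth in \<open>w\<close> the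
  Gaussian absorbs, so that a pointwise estimate becomes one in \<open>L2_norm\<close>
  (\<open>O2_L2_norm\<close>). Shifts of length at most 1 are enough for derivatives.\<close>

definition O2 :: "(complex \<Rightarrow> complex \<Rightarrow> complex) \<Rightarrow> bool" where
  "O2 R \<longleftrightarrow> (\<exists>C\<ge>0. \<forall>\<delta> w. norm \<delta> \<le> 1 \<longrightarrow> norm (R \<delta> w) \<le> (norm \<delta>)\<^sup>2 * (C * exp (C * norm w)))"

lemma O2I:
  assumes "\<And>\<delta> w. norm \<delta> \<le> 1 \<Longrightarrow> norm (R \<delta> w) \<le> (norm \<delta>)\<^sup>2 * (C * exp (C' * norm w))"
  shows "O2 R"
proof -
  let ?M = "max (max C C') 0"
  have "norm (R \<delta> w) \<le> (norm \<delta>)\<^sup>2 * (?M * exp (?M * norm w))" if "norm \<delta> \<le> 1" for \<delta> w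
  proof -
    have "norm (R \<delta> w) \<le> (norm \<delta>)\<^sup>2 * (C * exp (C' * norm w))" using assms that by blast
    also have "\<dots> \<le> (norm \<delta>)\<^sup>2 * (?M * exp (?M * norm w))"
      by (intro mult_left_mono mult_mono) (auto intro!: mult_right_mono)
    finally show ?thesis .
  qed
  then show ?thesis unfolding O2_def by (intro exI[of _ ?M]) auto
qed

lemma O2_add:
  assumes "O2 R" "O2 S" shows "O2 (\<lambda>\<delta> w. R \<delta> w + S \<delta> w)"
proof -
  obtain C D where C: "C \<ge> 0" "\<And>\<delta> w. norm \<delta> \<le> 1 \<Longrightarrow> norm (R \<delta> w) \<le> (norm \<delta>)\<^sup>2 * (C * exp (C * norm w))"
    and D: "D \<ge> 0" "\<And>\<delta> w. norm \<delta> \<le> 1 \<Longrightarrow> norm (S \<delta> w) \<le> (norm \<delta>)\<^sup>2 * (D * exp (D * norm w))"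
    using assms unfolding O2_def by blast
  show ?thesis
  proof (rule O2I)
    fix \<delta> w :: complex assume d: "norm \<delta> \<le> 1"
    have "norm (R \<delta> w + S \<delta> w) \<le> (norm \<delta>)\<^sup>2 * (C * exp (C * norm w)) + (norm \<delta>)\<^sup>2 * (D * exp (D * norm w))"
      using C(2)[OF d, of w] D(2)[OF d, of w] norm_triangle_ineq[of "R \<delta> w" "S \<delta> w"] by linarith
    also have "\<dots> \<le> (norm \<delta>)\<^sup>2 * (C * exp ((C + D) * norm w)) + (norm \<delta>)\<^sup>2 * (D * exp ((C + D) * norm w))"
      using C(1) D(1) by (intro add_mono mult_left_mono) (auto simp: algebra_simps)
    also have "\<dots> = (norm \<delta>)\<^sup>2 * ((C + D) * exp ((C + D) * norm w))"
      by (simp add: algebra_simps)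
    finally show "norm (R \<delta> w + S \<delta> w) \<le> (norm \<delta>)\<^sup>2 * ((C + D) * exp ((C + D) * norm w))" .
  qed
qed

lemma O2_mult:
  assumes "O2 R" "egrow f" shows "O2 (\<lambda>\<delta> w. f w * R \<delta> w)"
proof -
  obtain C where C: "C \<ge> 0" "\<And>\<delta> w. norm \<delta> \<le> 1 \<Longrightarrow> norm (R \<delta> w) \<le> (norm \<delta>)\<^sup>2 * (C * exp (C * norm w))"
    using assms unfolding O2_def by blast
  obtain D where D: "D \<ge> 0" "\<And>w. norm (f w) \<le> D * exp (D * norm w)"
    using assms unfolding egrow_def by blast
  show ?thesis
  proof (rule O2I)
    fix \<delta> w :: complex assume d: "norm \<delta> \<le> 1"
    have "norm (f w * R \<delta> w) \<le> (D * exp (D * norm w)) * ((norm \<delta>)\<^sup>2 * (C * exp (C * norm w)))"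
      unfolding norm_mult using C(2)[OF d, of w] D by (intro mult_mono) auto
    also have "\<dots> = (norm \<delta>)\<^sup>2 * ((D * C) * exp ((D + C) * norm w))"
      by (simp add: algebra_simps exp_add)
    finally show "norm (f w * R \<delta> w) \<le> (norm \<delta>)\<^sup>2 * ((D * C) * exp ((D + C) * norm w))" .
  qed
qed

lemma O2_scale:
  assumes R: "O2 R" and c: "\<And>\<delta>. norm \<delta> \<le> 1 \<Longrightarrow> norm (c \<delta>) \<le> 1" shows "O2 (\<lambda>\<delta> w. c \<delta> * R \<delta> w)"
proof -
  obtain C where C: "C \<ge> 0" "\<And>\<delta> w. norm \<delta> \<le> 1 \<Longrightarrow> norm (R \<delta> w) \<le> (norm \<delta>)\<^sup>2 * (C * exp (C * norm w))"
    using R unfolding O2_def by blast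
  show ?thesis
  proof (rule O2I)
    fix \<delta> w :: complex assume d: "norm \<delta> \<le> 1"
    have "norm (c \<delta> * R \<delta> w) \<le> 1 * norm (R \<delta> w)"
      unfolding norm_mult using c[OF d] by (intro mult_right_mono) auto
    then show "norm (c \<delta> * R \<delta> w) \<le> (norm \<delta>)\<^sup>2 * (C * exp (C * norm w))"
      using C(2)[OF d, of w] by simp
  qed
qed

lemma O2_square:
  assumes f: "egrow f" and c: "\<And>\<delta>. norm (c \<delta>) \<le> (norm \<delta>)\<^sup>2" shows "O2 (\<lambda>\<delta> w. c \<delta> * f w)"
proof -
  obtain D where D: "D \<ge> 0" "\<And>w. norm (f w) \<le> D * exp (D * norm w)"
    using f unfolding egrow_def by blast
  show ?thesis
    by (rule O2I[where C = D and C' = D]) (use c D in \<open>auto simp: norm_mult intro!: mult_mono\<close>)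
qed

lemma L2_norm_mono:
  assumes g: "g \<in> L2" and [measurable]: "f \<in> borel_measurable borel" and le: "\<And>w. norm (f w) \<le> norm (g w)"
  shows "L2_norm f \<le> L2_norm g"
proof -
  have "f \<in> L2" by (rule L2_bound[OF g, of f 1]) (auto simp: le)
  then show ?thesis
    unfolding L2_norm_def using g
    by (intro real_sqrt_le_mono integral_mono) (auto intro: L2D power_mono le)
qed

lemma O2_L2_norm:
  assumes R: "O2 R" and [measurable]: "\<And>\<delta>. R \<delta> \<in> borel_measurable borel"
  shows "\<exists>K\<ge>0. \<forall>\<delta>. norm \<delta> \<le> 1 \<longrightarrow> L2_norm (R \<delta>) \<le> K * (norm \<delta>)\<^sup>2"
proof -
  obtain C where C: "C \<ge> 0" "\<And>\<delta> w. norm \<delta> \<le> 1 \<Longrightarrow> norm (R \<delta> w) \<le> (norm \<delta>)\<^sup>2 * (C * exp (C * norm w))"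
    using R unfolding O2_def by blast
  let ?g = "\<lambda>w. complex_of_real (C * exp (C * norm (w :: complex)))"
  have g: "?g \<in> L2"
    by (intro egrow_L2 egrowI[of _ C C]) (use C in \<open>auto simp: norm_mult\<close>)
  have "L2_norm (R \<delta>) \<le> L2_norm ?g * (norm \<delta>)\<^sup>2" if d: "norm \<delta> \<le> 1" for \<delta>
  proof -
    have "L2_norm (R \<delta>) \<le> L2_norm (\<lambda>w. of_real ((norm \<delta>)\<^sup>2) * ?g w)"
      by (rule L2_norm_mono[OF L2_cmult[OF g]]) (use C d in \<open>auto simp: norm_mult norm_power\<close>)
    also have "\<dots> = (norm \<delta>)\<^sup>2 * L2_norm ?g"
      by (subst L2_norm_cmult) (simp add: norm_power)
    finally show ?thesis by (simp add: mult.commute)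
  qed
  then show ?thesis by (intro exI[of _ "L2_norm ?g"]) auto
qed

text \<open>The infinitesimal Weyl action on \<open>u\<close>: \<open>p\<close> and \<open>q\<close> are the images of \<open>u\<close> under the creation
  operator \<open>w - dbar\<close> and the annihilation operator \<open>d/dw\<close>.\<close>

definition lad :: "(complex \<Rightarrow> complex) \<Rightarrow> (complex \<Rightarrow> complex) \<Rightarrow> (complex \<Rightarrow> complex) \<Rightarrow> bool" where
  "lad u p q \<longleftrightarrow> egrow u \<and> egrow p \<and> egrow q \<and> O2 (\<lambda>\<delta> w. Wt \<delta> u w - u w - (cnj \<delta> * p w - \<delta> * q w))"

lemma ladD: "lad u p q \<Longrightarrow> egrow u" "lad u p q \<Longrightarrow> egrow p" "lad u p q \<Longrightarrow> egrow q"
  by (auto simp: lad_def)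

lemma lad_one: "lad (\<lambda>_. 1) (\<lambda>w. w) (\<lambda>_. 0)"
proof -
  \<comment> \<open>The summand \<open>(norm \<delta>)\<^sup>2 / 2\<close> of the exponent is itself
    of second order and moves to the remainder.\<close>
  have "O2 (\<lambda>\<delta> w. (Wt \<delta> (\<lambda>_. 1) w - 1 - (w * cnj \<delta> - of_real ((norm \<delta>)\<^sup>2 / 2))) + - of_real ((norm \<delta>)\<^sup>2 / 2) * 1)"
  proof (rule O2_add)
    show "O2 (\<lambda>\<delta> w. Wt \<delta> (\<lambda>_. 1) w - 1 - (w * cnj \<delta> - of_real ((norm \<delta>)\<^sup>2 / 2)))"
    proof (rule O2I)
      fix \<delta> w :: complex assume d: "norm \<delta> \<le> 1"
      have "norm (w * cnj \<delta> - of_real ((norm \<delta>)\<^sup>2 / 2)) \<le> norm (w * cnj \<delta>) + norm (complex_of_real ((norm \<delta>)\<^sup>2 / 2))"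
        by (rule norm_triangle_ineq4)
      also have "\<dots> = norm w * norm \<delta> + (norm \<delta> * norm \<delta>) / 2"
        by (simp add: norm_mult norm_divide norm_power power2_eq_square)
      also have "\<dots> \<le> norm \<delta> * (2 * norm w + 1)"
      proof -
        have "norm \<delta> * (2 * norm w + 1) = 2 * (norm w * norm \<delta>) + norm \<delta>"
          by (simp add: algebra_simps)
        moreover have "norm \<delta> * norm \<delta> \<le> norm \<delta>" "0 \<le> norm w * norm \<delta>" "0 \<le> norm \<delta>"
          using mult_left_mono[OF d, of "norm \<delta>"] by simp_all
        ultimately show ?thesis by linarith
      qed
      finally have "norm (exp (w * cnj \<delta> - of_real ((norm \<delta>)\<^sup>2 / 2)) - 1 - (w * cnj \<delta> - of_real ((norm \<delta>)\<^sup>2 / 2)))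
        \<le> (norm \<delta>)\<^sup>2 * (exp 3 * exp (6 * norm w))"
        by (rule weyl_second_order[OF d])
      then show "norm (Wt \<delta> (\<lambda>_. 1) w - 1 - (w * cnj \<delta> - of_real ((norm \<delta>)\<^sup>2 / 2))) \<le> (norm \<delta>)\<^sup>2 * (exp 3 * exp (6 * norm w))"
        unfolding Wt_def mult_1_left .
    qed
    show "O2 (\<lambda>\<delta> w. - of_real ((norm \<delta>)\<^sup>2 / 2) * 1)"
      by (rule O2_square) (auto simp: norm_divide norm_power)
  qed
  moreover have "(Wt \<delta> (\<lambda>_. 1) w - 1 - (w * cnj \<delta> - of_real ((norm \<delta>)\<^sup>2 / 2))) + - of_real ((norm \<delta>)\<^sup>2 / 2) * 1
      = Wt \<delta> (\<lambda>_. 1) w - 1 - (cnj \<delta> * w - \<delta> * 0)" for \<delta> w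
    by (simp add: mult.commute)
  ultimately have "O2 (\<lambda>\<delta> w. Wt \<delta> (\<lambda>_. 1) w - 1 - (cnj \<delta> * w - \<delta> * 0))"
    by (simp only:)
  then show ?thesis unfolding lad_def by (intro conjI egrow_const egrow_id)
qed

lemma lad_add: "lad u p q \<Longrightarrow> lad u' p' q' \<Longrightarrow> lad (\<lambda>w. u w + u' w) (\<lambda>w. p w + p' w) (\<lambda>w. q w + q' w)"
  unfolding lad_def
proof (elim conjE, intro conjI)
  assume "O2 (\<lambda>\<delta> w. Wt \<delta> u w - u w - (cnj \<delta> * p w - \<delta> * q w))" "O2 (\<lambda>\<delta> w. Wt \<delta> u' w - u' w - (cnj \<delta> * p' w - \<delta> * q' w))"
  from O2_add[OF this] show "O2 (\<lambda>\<delta> w. Wt \<delta> (\<lambda>w. u w + u' w) w - (u w + u' w) - (cnj \<delta> * (p w + p' w) - \<delta> * (q w + q' w)))"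
    by (simp add: Wt_add algebra_simps)
qed (auto intro: egrow_add)

lemma lad_cmult: "lad u p q \<Longrightarrow> lad (\<lambda>w. c * u w) (\<lambda>w. c * p w) (\<lambda>w. c * q w)"
  unfolding lad_def
proof (elim conjE, intro conjI)
  assume "O2 (\<lambda>\<delta> w. Wt \<delta> u w - u w - (cnj \<delta> * p w - \<delta> * q w))"
  from O2_mult[OF this egrow_const[of c]] show "O2 (\<lambda>\<delta> w. Wt \<delta> (\<lambda>w. c * u w) w - c * u w - (cnj \<delta> * (c * p w) - \<delta> * (c * q w)))"
    by (simp add: Wt_cmult algebra_simps)
qed (auto intro: egrow_cmult)

lemma lad_zero: "lad (\<lambda>_. 0) (\<lambda>_. 0) (\<lambda>_. 0)"
  using lad_cmult[OF lad_one, of 0] by simp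

lemma lad_sum: "(\<And>i. i \<in> I \<Longrightarrow> lad (u i) (p i) (q i)) \<Longrightarrow> lad (\<lambda>w. \<Sum>i\<in>I. u i w) (\<lambda>w. \<Sum>i\<in>I. p i w) (\<lambda>w. \<Sum>i\<in>I. q i w)"
  by (induction I rule: infinite_finite_induct) (auto intro: lad_zero lad_add)

text \<open>Treats multiplication by \<open>w\<close> and by \<open>cnj w\<close> together:
  \<open>m\<close> is real-linear with coefficients \<open>a\<close> and \<open>b\<close>.
  Translation replaces \<open>m w\<close> by \<open>m w - m \<delta>\<close>, and the term
  \<open>- m \<delta> * u w\<close> is the commutator that corrects \<open>p\<close> and
  \<open>q\<close>.\<close>

lemma lad_mult_affine:
  assumes l: "lad u p q" and m: "m = (\<lambda>w. w) \<and> a = 1 \<and> b = 0 \<or> m = cnj \<and> a = 0 \<and> b = (1 :: complex)"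
  shows "lad (\<lambda>w. m w * u w) (\<lambda>w. m w * p w - b * u w) (\<lambda>w. m w * q w + a * u w)"
proof -
  have u: "egrow u" "egrow p" "egrow q" using l by (auto simp: lad_def)
  have m_eg: "egrow m" using m egrow_cnj[OF egrow_id] by auto
  define R where "R = (\<lambda>\<delta> w. Wt \<delta> u w - u w - (cnj \<delta> * p w - \<delta> * q w))"
  have R: "O2 R" using l by (auto simp: lad_def R_def)
  have m_sub: "m (w - \<delta>) = m w - m \<delta>" for w \<delta> using m by auto
  have m_norm: "norm (m \<delta>) = norm \<delta>" for \<delta> using m by auto
  have m_lin: "m \<delta> = a * \<delta> + b * cnj \<delta>" for \<delta> using m by auto
  have "O2 (\<lambda>\<delta> w. (m w * R \<delta> w + (- m \<delta>) * R \<delta> w) + ((- (m \<delta> * cnj \<delta>)) * p w + (m \<delta> * \<delta>) * q w))"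
    by (intro O2_add O2_mult[OF R m_eg] O2_scale[OF R] O2_square u) (auto simp: m_norm norm_mult power2_eq_square)
  moreover have "(m w * R \<delta> w + (- m \<delta>) * R \<delta> w) + ((- (m \<delta> * cnj \<delta>)) * p w + (m \<delta> * \<delta>) * q w)
     = Wt \<delta> (\<lambda>w. m w * u w) w - m w * u w - (cnj \<delta> * (m w * p w - b * u w) - \<delta> * (m w * q w + a * u w))" for \<delta> w
  proof -
    have W: "Wt \<delta> (\<lambda>w. m w * u w) w = (m w - m \<delta>) * Wt \<delta> u w"
      by (simp add: Wt_def m_sub)
    have Wu: "Wt \<delta> u w = R \<delta> w + u w + (cnj \<delta> * p w - \<delta> * q w)"
      by (simp add: R_def)
    have "m \<delta> * u w = (a * \<delta> + b * cnj \<delta>) * u w" by (simp add: m_lin)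
    then show ?thesis unfolding W Wu by (simp add: algebra_simps)
  qed
  ultimately have "O2 (\<lambda>\<delta> w. Wt \<delta> (\<lambda>w. m w * u w) w - m w * u w - (cnj \<delta> * (m w * p w - b * u w) - \<delta> * (m w * q w + a * u w)))"
    by simp
  then show ?thesis
    unfolding lad_def using u m_eg by (auto intro!: egrow_mult egrow_add egrow_diff egrow_cmult)
qed

lemmas lad_mult_id = lad_mult_affine[of _ _ _ "\<lambda>w. w" 1 0, simplified]
lemmas lad_mult_cnj = lad_mult_affine[of _ _ _ cnj 0 1, simplified]

lemma lad_cnj_power: "lad (\<lambda>w. cnj w ^ b) (\<lambda>w. w * cnj w ^ b - of_nat b * cnj w ^ (b - 1)) (\<lambda>_. 0)"
proof (induction b)
  case 0
  then show ?case using lad_one by simp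
next
  case (Suc b)
  have e: "cnj w * (w * cnj w ^ b - of_nat b * cnj w ^ (b - 1)) - cnj w ^ b = w * cnj w ^ Suc b - of_nat (Suc b) * cnj w ^ b" for w
    by (cases b) (simp_all add: algebra_simps)
  show ?case using lad_mult_cnj[OF Suc.IH] unfolding e by simp
qed

lemma lad_monomial: "lad (\<lambda>w. cnj w ^ b * w ^ a)
   (\<lambda>w. cnj w ^ b * w ^ Suc a - of_nat b * (cnj w ^ (b - 1) * w ^ a)) (\<lambda>w. of_nat a * (cnj w ^ b * w ^ (a - 1)))"
proof (induction a)
  case 0
  then show ?case using lad_cnj_power[of b] by (simp add: mult.commute)
next
  case (Suc a)
  have e: "w * (of_nat a * (cnj w ^ b * w ^ (a - 1))) + cnj w ^ b * w ^ a = of_nat (Suc a) * (cnj w ^ b * w ^ a)" for w :: complex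
    by (cases a) (simp_all add: algebra_simps)
  have e2: "w * (cnj w ^ b * w ^ Suc a - of_nat b * (cnj w ^ (b - 1) * w ^ a)) = cnj w ^ b * w ^ Suc (Suc a) - of_nat b * (cnj w ^ (b - 1) * w ^ Suc a)" for w :: complex
    by (simp add: algebra_simps)
  have e3: "w * (cnj w ^ b * w ^ a) = cnj w ^ b * w ^ Suc a" for w :: complex by simp
  show ?case using lad_mult_id[OF Suc.IH] unfolding e e2 e3 by simp
qed

text \<open>\<open>Efun n i\<close> is the coefficient of \<open>(cnj z)^i\<close> in \<open>(cnj w - cnj z)^n exp (w cnj z)\<close>. For fixed \<open>n\<close> these
  functions form an orthogonal basis of \<open>true_fock (Suc n)\<close>, on which the Weyl action is a weighted shift.\<close>

definition Efun :: "nat \<Rightarrow> nat \<Rightarrow> complex \<Rightarrow> complex" where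
  "Efun n i w = (\<Sum>l\<le>i. ((-1) ^ l * of_nat (n choose l) / fact (i - l)) * (cnj w ^ (n - l) * w ^ (i - l)))"

lemma Efun_0: "Efun n 0 = (\<lambda>w. cnj w ^ n)"
  by (simp add: Efun_def fun_eq_iff)

lemma egrow_Efun: "egrow (Efun n i)"
  unfolding Efun_def[abs_def]
  by (intro egrow_sum egrow_cmult egrow_mult egrow_power egrow_cnj egrow_id)

lemma binomial_shift: "Suc l * (n choose Suc l) = (n - l) * (n choose l)"
  by (cases n) (simp_all only: Suc_times_binomial binomial_absorb_comp diff_Suc_1, simp)

text \<open>On the generating function \<open>(cnj w - cnj z)^n exp (w cnj z)\<close> creation is
  differentiation with respect to \<open>cnj z\<close>, hence the weight \<open>Suc i\<close>;
  annihilation is multiplication by \<open>cnj z\<close>, hence the weight 1. The proof checks this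
  on coefficients.\<close>

lemma lad_Efun: "lad (Efun n i) (\<lambda>w. of_nat (Suc i) * Efun n (Suc i) w) (\<lambda>w. if i = 0 then 0 else Efun n (i - 1) w)"
proof -
  let ?c = "\<lambda>l. (-1) ^ l * of_nat (n choose l) :: complex"
  have L: "lad (Efun n i)
    (\<lambda>w. \<Sum>l\<le>i. (?c l / fact (i - l)) * (cnj w ^ (n - l) * w ^ Suc (i - l) - of_nat (n - l) * (cnj w ^ (n - l - 1) * w ^ (i - l))))
    (\<lambda>w. \<Sum>l\<le>i. (?c l / fact (i - l)) * (of_nat (i - l) * (cnj w ^ (n - l) * w ^ (i - l - 1))))"
    unfolding Efun_def[abs_def] by (intro lad_sum lad_cmult lad_monomial)
  have A: "(\<Sum>l\<le>i. (?c l / fact (i - l)) * (cnj w ^ (n - l) * w ^ Suc (i - l) - of_nat (n - l) * (cnj w ^ (n - l - 1) * w ^ (i - l))))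
      = of_nat (Suc i) * Efun n (Suc i) w" for w
  proof -
    \<comment> \<open>The first part carries the weight \<open>Suc i - l\<close>, and the second,
      after the index shift by \<open>binomial_shift\<close>, the weight \<open>l\<close>; together
      they give \<open>Suc i\<close> for every \<open>l\<close>. The terms added at the ends of the
      ranges have weight 0.\<close>
    have s1: "(\<Sum>l\<le>i. (?c l / fact (i - l)) * (cnj w ^ (n - l) * w ^ Suc (i - l)))
      = (\<Sum>l\<le>Suc i. of_nat (Suc i - l) * ((?c l / fact (Suc i - l)) * (cnj w ^ (n - l) * w ^ (Suc i - l))))"
    proof -
      have "(?c l / fact (i - l)) * (cnj w ^ (n - l) * w ^ Suc (i - l))
         = of_nat (Suc i - l) * ((?c l / fact (Suc i - l)) * (cnj w ^ (n - l) * w ^ (Suc i - l)))" if "l \<le> i" for l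
      proof -
        have "Suc i - l = Suc (i - l)" using that by simp
        then show ?thesis by (simp add: field_simps del: of_nat_Suc)
      qed
      then show ?thesis by simp
    qed
    have s2: "(\<Sum>l\<le>i. (?c l / fact (i - l)) * (of_nat (n - l) * (cnj w ^ (n - l - 1) * w ^ (i - l))))
      = - (\<Sum>l\<le>Suc i. of_nat l * ((?c l / fact (Suc i - l)) * (cnj w ^ (n - l) * w ^ (Suc i - l))))"
    proof -
      have "of_nat (Suc l) * (?c (Suc l) / fact (Suc i - Suc l)) = - (of_nat (n - l) * (?c l / fact (i - l)))" for l
      proof -
        have "of_nat (Suc l) * ?c (Suc l) = - ((-1) ^ l * of_nat (Suc l * (n choose Suc l)))" by (simp add: algebra_simps)
        also have "\<dots> = - (of_nat (n - l) * ?c l)" unfolding binomial_shift by simp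
        finally show ?thesis by (simp only: times_divide_eq_right minus_divide_left diff_Suc_Suc)
      qed
      then have "of_nat (Suc l) * ((?c (Suc l) / fact (Suc i - Suc l)) * (cnj w ^ (n - Suc l) * w ^ (Suc i - Suc l)))
          = - ((?c l / fact (i - l)) * (of_nat (n - l) * (cnj w ^ (n - l - 1) * w ^ (i - l))))" for l
        by (simp only: mult.assoc[symmetric]) (simp add: algebra_simps)
      then show ?thesis
        by (subst sum.atMost_Suc_shift) (simp only: of_nat_0 mult_zero_left add_0_left sum_negf minus_minus)
    qed
    have "(\<Sum>l\<le>i. (?c l / fact (i - l)) * (cnj w ^ (n - l) * w ^ Suc (i - l) - of_nat (n - l) * (cnj w ^ (n - l - 1) * w ^ (i - l))))
      = (\<Sum>l\<le>Suc i. of_nat (Suc i - l) * ((?c l / fact (Suc i - l)) * (cnj w ^ (n - l) * w ^ (Suc i - l))))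
        + (\<Sum>l\<le>Suc i. of_nat l * ((?c l / fact (Suc i - l)) * (cnj w ^ (n - l) * w ^ (Suc i - l))))"
      unfolding right_diff_distrib sum_subtractf s1 s2 by simp
    also have "\<dots> = (\<Sum>l\<le>Suc i. of_nat (Suc i) * ((?c l / fact (Suc i - l)) * (cnj w ^ (n - l) * w ^ (Suc i - l))))"
      unfolding sum.distrib[symmetric] distrib_right[symmetric] of_nat_add[symmetric] by (intro sum.cong) auto
    finally show ?thesis unfolding Efun_def sum_distrib_left[symmetric] .
  qed
  have B: "(\<Sum>l\<le>i. (?c l / fact (i - l)) * (of_nat (i - l) * (cnj w ^ (n - l) * w ^ (i - l - 1))))
      = (if i = 0 then 0 else Efun n (i - 1) w)" for w
  proof (cases i)
    case (Suc j)
    have "(?c l / fact (Suc j - l)) * (of_nat (Suc j - l) * (cnj w ^ (n - l) * w ^ (Suc j - l - 1)))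
        = (?c l / fact (j - l)) * (cnj w ^ (n - l) * w ^ (j - l))" if "l \<le> j" for l
    proof -
      have "Suc j - l = Suc (j - l)" using that by simp
      then show ?thesis by (simp add: field_simps del: of_nat_Suc)
    qed
    then show ?thesis unfolding Suc by (simp add: Efun_def)
  qed simp
  show ?thesis using L unfolding A B .
qed

section \<open>Sesquilinear forms along Weyl orbits\<close>

lemma wirtI_second_order:
  assumes "\<And>\<delta>. norm \<delta> \<le> 1 \<Longrightarrow> norm (h (z + \<delta>) - h z - (a * \<delta> + b * cnj \<delta>)) \<le> K * (norm \<delta>)\<^sup>2"
  shows "wirt h a b z"
  unfolding wirt_def
proof (rule has_derivativeI_sandwich[of 1])
  show "bounded_linear (\<lambda>\<delta>. a * \<delta> + b * cnj \<delta>)"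
    by (intro bounded_linear_add bounded_linear_mult_right bounded_linear_compose[OF bounded_linear_mult_right bounded_linear_cnj])
  show "norm (h y - h z - (a * (y - z) + b * cnj (y - z))) / norm (y - z) \<le> K * norm (y - z)" if "y \<noteq> z" "dist y z < 1" for y
  proof -
    have "norm (h y - h z - (a * (y - z) + b * cnj (y - z))) \<le> K * (norm (y - z))\<^sup>2"
      using assms[of "y - z"] that by (simp add: dist_norm)
    then show ?thesis using that by (simp add: divide_le_eq power2_eq_square mult.assoc)
  qed
  have "((\<lambda>y. K * norm (y - z)) \<longlongrightarrow> K * norm (z - z)) (at z within UNIV)"
    by (intro tendsto_intros)
  then show "((\<lambda>y. K * norm (y - z)) \<longlongrightarrow> 0) (at z within UNIV)" by simp
qed auto

text \<open>Stated abstractly because three instances occur: the inner product itself,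
  multiplication by a symbol on \<open>L2\<close>, and an operator on the true Fock space.
  Differentiation of symbols rests on the Weyl invariance of \<open>X\<close> and the bound on
  \<open>B\<close>.\<close>

locale bounded_form =
  fixes X :: "(complex \<Rightarrow> complex) set" and B :: "(complex \<Rightarrow> complex) \<Rightarrow> (complex \<Rightarrow> complex) \<Rightarrow> complex" and M :: real
  assumes X_L2: "X \<subseteq> L2"
    and X_add: "f \<in> X \<Longrightarrow> g \<in> X \<Longrightarrow> (\<lambda>w. f w + g w) \<in> X"
    and X_cmult: "f \<in> X \<Longrightarrow> (\<lambda>w. c * f w) \<in> X"
    and X_Wt: "f \<in> X \<Longrightarrow> Wt z f \<in> X"
    and B_add1: "f \<in> X \<Longrightarrow> g \<in> X \<Longrightarrow> h \<in> X \<Longrightarrow> B (\<lambda>w. f w + g w) h = B f h + B g h"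
    and B_add2: "f \<in> X \<Longrightarrow> g \<in> X \<Longrightarrow> h \<in> X \<Longrightarrow> B h (\<lambda>w. f w + g w) = B h f + B h g"
    and B_cmult1: "f \<in> X \<Longrightarrow> h \<in> X \<Longrightarrow> B (\<lambda>w. c * f w) h = c * B f h"
    and B_cmult2: "f \<in> X \<Longrightarrow> h \<in> X \<Longrightarrow> B h (\<lambda>w. c * f w) = cnj c * B h f"
    and B_bound: "f \<in> X \<Longrightarrow> g \<in> X \<Longrightarrow> norm (B f g) \<le> M * L2_norm f * L2_norm g"
    and M_nonneg: "M \<ge> 0"
begin

definition sym :: "(complex \<Rightarrow> complex) \<Rightarrow> (complex \<Rightarrow> complex) \<Rightarrow> complex \<Rightarrow> complex" where
  "sym u v z = B (Wt z u) (Wt z v)"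

lemma X_diff: "f \<in> X \<Longrightarrow> g \<in> X \<Longrightarrow> (\<lambda>w. f w - g w) \<in> X"
  using X_add[OF _ X_cmult[of g "-1"], of f] by simp

lemma XL2: "f \<in> X \<Longrightarrow> f \<in> L2" using X_L2 by blast

lemma sym_add1: "f \<in> X \<Longrightarrow> g \<in> X \<Longrightarrow> h \<in> X \<Longrightarrow> sym (\<lambda>w. f w + g w) h z = sym f h z + sym g h z"
  and sym_add2: "f \<in> X \<Longrightarrow> g \<in> X \<Longrightarrow> h \<in> X \<Longrightarrow> sym h (\<lambda>w. f w + g w) z = sym h f z + sym h g z"
  and sym_cmult1: "f \<in> X \<Longrightarrow> h \<in> X \<Longrightarrow> sym (\<lambda>w. c * f w) h z = c * sym f h z"
  and sym_cmult2: "f \<in> X \<Longrightarrow> h \<in> X \<Longrightarrow> sym h (\<lambda>w. c * f w) z = cnj c * sym h f z"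
  by (simp_all add: sym_def Wt_add Wt_cmult B_add1 B_add2 B_cmult1 B_cmult2 X_Wt)

lemma sym_diff1: "f \<in> X \<Longrightarrow> g \<in> X \<Longrightarrow> h \<in> X \<Longrightarrow> sym (\<lambda>w. f w - g w) h z = sym f h z - sym g h z"
  using sym_add1[OF X_diff, of f g g h z] by simp

lemma sym_diff2: "f \<in> X \<Longrightarrow> g \<in> X \<Longrightarrow> h \<in> X \<Longrightarrow> sym h (\<lambda>w. f w - g w) z = sym h f z - sym h g z"
  using sym_add2[OF X_diff, of f g g h z] by simp

lemma sym_bound: "f \<in> X \<Longrightarrow> g \<in> X \<Longrightarrow> norm (sym f g z) \<le> M * L2_norm f * L2_norm g"
  unfolding sym_def using B_bound[OF X_Wt X_Wt, of f g z z] by (simp add: L2_norm_Wt XL2)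

text \<open>The phases from \<open>Wt_Wt\<close> in the two arguments are conjugate to each other
  and cancel. Differentiation at any base point thereby reduces to a small shift of the vectors,
  where the expansions \<open>lad\<close> apply.\<close>

lemma sym_shift:
  assumes "u \<in> X" "v \<in> X"
  shows "sym u v (z + \<delta>) = sym (Wt \<delta> u) (Wt \<delta> v) z"
proof -
  define c where "c = exp (of_real (Im (z * cnj \<delta>)) * - \<i>)"
  have "norm c = 1" unfolding c_def by (simp add: norm_exp_eq_Re)
  then have c: "c * cnj c = 1" by (metis complex_norm_square of_real_1 one_power2)
  have W: "Wt z (Wt \<delta> f) = (\<lambda>w. c * Wt (z + \<delta>) f w)" for f
    unfolding c_def by (rule ext) (rule Wt_Wt)
  show ?thesis
    unfolding sym_def W using assms c by (simp add: B_cmult1 B_cmult2 X_Wt X_cmult mult.assoc[symmetric])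
qed

text \<open>The product rule for \<open>Wt \<delta> u\<close> and \<open>Wt \<delta> v\<close>.
  Since \<open>B\<close> is antilinear in its second argument, \<open>\<delta>\<close> and
  \<open>cnj \<delta>\<close> change places there, which pairs creation on one side with
  annihilation on the other.\<close>

lemma sym_wirt:
  assumes lu: "lad u u1 u2" and lv: "lad v v1 v2"
    and X: "u \<in> X" "u1 \<in> X" "u2 \<in> X" "v \<in> X" "v1 \<in> X" "v2 \<in> X"
  shows "wirt (sym u v) (sym u v1 z - sym u2 v z) (sym u1 v z - sym u v2 z) z"
proof -
  \<comment> \<open>One constant for two facts: the remainder is of second order and the whole
    increment of first order. The latter handles the product of the two increments.\<close>
  have ex: "\<exists>K\<ge>0. \<forall>\<delta>. norm \<delta> \<le> 1 \<longrightarrow>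
      L2_norm (\<lambda>w. Wt \<delta> f w - f w - (cnj \<delta> * p w - \<delta> * q w)) \<le> K * (norm \<delta>)\<^sup>2 \<and>
      L2_norm (\<lambda>w. Wt \<delta> f w - f w) \<le> K * norm \<delta>" if l: "lad f p q" for f p q
  proof -
    have eg: "egrow f" "egrow p" "egrow q" and O: "O2 (\<lambda>\<delta> w. Wt \<delta> f w - f w - (cnj \<delta> * p w - \<delta> * q w))"
      using l by (auto simp: lad_def)
    have egR: "egrow (\<lambda>w. Wt \<delta> f w - f w - (cnj \<delta> * p w - \<delta> * q w))" for \<delta>
      by (intro egrow_diff egrow_cmult Wt_egrow eg)
    obtain K where K: "K \<ge> 0" "\<And>\<delta>. norm \<delta> \<le> 1 \<Longrightarrow> L2_norm (\<lambda>w. Wt \<delta> f w - f w - (cnj \<delta> * p w - \<delta> * q w)) \<le> K * (norm \<delta>)\<^sup>2"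
      using O2_L2_norm[OF O egrow_measurable[OF egR]] by blast
    define K' where "K' = K + (L2_norm p + L2_norm q)"
    have "L2_norm (\<lambda>w. Wt \<delta> f w - f w) \<le> K' * norm \<delta>" if d: "norm \<delta> \<le> 1" for \<delta>
    proof -
      have L: "p \<in> L2" "q \<in> L2" using eg egrow_L2 by auto
      have "L2_norm (\<lambda>w. Wt \<delta> f w - f w) = L2_norm (\<lambda>w. (Wt \<delta> f w - f w - (cnj \<delta> * p w - \<delta> * q w)) + (cnj \<delta> * p w + (- \<delta>) * q w))"
        by simp
      also have "\<dots> \<le> L2_norm (\<lambda>w. Wt \<delta> f w - f w - (cnj \<delta> * p w - \<delta> * q w)) + L2_norm (\<lambda>w. cnj \<delta> * p w + (- \<delta>) * q w)"
        by (intro L2_norm_triangle egrow_L2 egR egrow_add egrow_cmult eg)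
      also have "\<dots> \<le> K * (norm \<delta>)\<^sup>2 + (L2_norm (\<lambda>w. cnj \<delta> * p w) + L2_norm (\<lambda>w. (- \<delta>) * q w))"
        by (intro add_mono K d L2_norm_triangle L2_cmult L)
      also have "\<dots> \<le> K * norm \<delta> + (norm \<delta> * L2_norm p + norm \<delta> * L2_norm q)"
        unfolding L2_norm_cmult using d K(1) mult_left_mono[OF d, of "norm \<delta>"]
        by (intro add_mono mult_left_mono) (auto simp: power2_eq_square)
      finally show ?thesis by (simp add: K'_def algebra_simps)
    qed
    moreover have "L2_norm (\<lambda>w. Wt \<delta> f w - f w - (cnj \<delta> * p w - \<delta> * q w)) \<le> K' * (norm \<delta>)\<^sup>2" if d: "norm \<delta> \<le> 1" for \<delta>
    proof -
      have "K * (norm \<delta>)\<^sup>2 \<le> K' * (norm \<delta>)\<^sup>2" by (intro mult_right_mono) (auto simp: K'_def)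
      then show ?thesis using K(2)[OF d] by linarith
    qed
    ultimately show ?thesis using K(1) by (intro exI[of _ K']) (auto simp: K'_def)
  qed
  obtain K1 where K1: "K1 \<ge> 0" "\<And>\<delta>. norm \<delta> \<le> 1 \<Longrightarrow> L2_norm (\<lambda>w. Wt \<delta> u w - u w - (cnj \<delta> * u1 w - \<delta> * u2 w)) \<le> K1 * (norm \<delta>)\<^sup>2"
      "\<And>\<delta>. norm \<delta> \<le> 1 \<Longrightarrow> L2_norm (\<lambda>w. Wt \<delta> u w - u w) \<le> K1 * norm \<delta>"
    using ex[OF lu] by blast
  obtain K2 where K2: "K2 \<ge> 0" "\<And>\<delta>. norm \<delta> \<le> 1 \<Longrightarrow> L2_norm (\<lambda>w. Wt \<delta> v w - v w - (cnj \<delta> * v1 w - \<delta> * v2 w)) \<le> K2 * (norm \<delta>)\<^sup>2"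
      "\<And>\<delta>. norm \<delta> \<le> 1 \<Longrightarrow> L2_norm (\<lambda>w. Wt \<delta> v w - v w) \<le> K2 * norm \<delta>"
    using ex[OF lv] by blast
  show ?thesis
  proof (rule wirtI_second_order)
    fix \<delta> :: complex assume d: "norm \<delta> \<le> 1"
    define Du where "Du = (\<lambda>w. Wt \<delta> u w - u w)"
    define Dv where "Dv = (\<lambda>w. Wt \<delta> v w - v w)"
    define Ru where "Ru = (\<lambda>w. Wt \<delta> u w - u w - (cnj \<delta> * u1 w - \<delta> * u2 w))"
    define Rv where "Rv = (\<lambda>w. Wt \<delta> v w - v w - (cnj \<delta> * v1 w - \<delta> * v2 w))"
    have XD: "Du \<in> X" "Dv \<in> X" "Ru \<in> X" "Rv \<in> X"
      unfolding Du_def Dv_def Ru_def Rv_def by (intro X_diff X_cmult X_Wt X)+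
    have Wu: "Wt \<delta> u = (\<lambda>w. u w + Du w)" "Wt \<delta> v = (\<lambda>w. v w + Dv w)"
      by (simp_all add: Du_def Dv_def)
    define Lu where "Lu = (\<lambda>w. cnj \<delta> * u1 w - \<delta> * u2 w)"
    define Lv where "Lv = (\<lambda>w. cnj \<delta> * v1 w - \<delta> * v2 w)"
    have XL: "Lu \<in> X" "Lv \<in> X"
      unfolding Lu_def Lv_def by (intro X_diff X_cmult X)+
    have Du: "Du = (\<lambda>w. Lu w + Ru w)" "Dv = (\<lambda>w. Lv w + Rv w)"
      by (simp_all add: Du_def Dv_def Ru_def Rv_def Lu_def Lv_def)
    have "sym Lu v z = sym (\<lambda>w. cnj \<delta> * u1 w) v z - sym (\<lambda>w. \<delta> * u2 w) v z"
      unfolding Lu_def by (rule sym_diff1[OF X_cmult[OF X(2)] X_cmult[OF X(3)] X(4)])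
    then have e1: "sym Du v z = cnj \<delta> * sym u1 v z - \<delta> * sym u2 v z + sym Ru v z"
      unfolding sym_cmult1[OF X(2) X(4)] sym_cmult1[OF X(3) X(4)] Du(1) sym_add1[OF XL(1) XD(3) X(4)] by (simp only:)
    have "sym u Lv z = sym u (\<lambda>w. cnj \<delta> * v1 w) z - sym u (\<lambda>w. \<delta> * v2 w) z"
      unfolding Lv_def by (rule sym_diff2[OF X_cmult[OF X(5)] X_cmult[OF X(6)] X(1)])
    then have e2: "sym u Dv z = \<delta> * sym u v1 z - cnj \<delta> * sym u v2 z + sym u Rv z"
      unfolding sym_cmult2[OF X(5) X(1)] sym_cmult2[OF X(6) X(1)] Du(2) sym_add2[OF XL(2) XD(4) X(1)] complex_cnj_cnj by (simp only:)
    have "sym u v (z + \<delta>) = sym u v z + sym Du v z + (sym u Dv z + sym Du Dv z)"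
      unfolding sym_shift[OF X(1,4)] unfolding Wu by (simp add: sym_add1 sym_add2 X XD X_add)
    then have eq: "sym u v (z + \<delta>) - sym u v z - ((sym u v1 z - sym u2 v z) * \<delta> + (sym u1 v z - sym u v2 z) * cnj \<delta>)
        = sym Ru v z + sym u Rv z + sym Du Dv z"
      unfolding e1 e2 by (simp add: algebra_simps)
    have "norm (sym Ru v z + sym u Rv z + sym Du Dv z) \<le> norm (sym Ru v z) + norm (sym u Rv z) + norm (sym Du Dv z)"
      using norm_triangle_ineq[of "sym Ru v z + sym u Rv z" "sym Du Dv z"] norm_triangle_ineq[of "sym Ru v z" "sym u Rv z"]
      by linarith
    also have "\<dots> \<le> M * L2_norm Ru * L2_norm v + M * L2_norm u * L2_norm Rv + M * L2_norm Du * L2_norm Dv"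
      by (intro add_mono sym_bound X XD)
    also have "\<dots> \<le> M * (K1 * (norm \<delta>)\<^sup>2) * L2_norm v + M * L2_norm u * (K2 * (norm \<delta>)\<^sup>2) + M * (K1 * norm \<delta>) * (K2 * norm \<delta>)"
    proof -
      note K = K1(2,3)[OF d, folded Du_def Ru_def] K2(2,3)[OF d, folded Dv_def Rv_def]
      have "M * L2_norm Ru * L2_norm v \<le> M * (K1 * (norm \<delta>)\<^sup>2) * L2_norm v"
        by (rule mult_right_mono[OF mult_left_mono[OF K(1) M_nonneg] L2_norm_nonneg])
      moreover have "M * L2_norm u * L2_norm Rv \<le> M * L2_norm u * (K2 * (norm \<delta>)\<^sup>2)"
        by (rule mult_left_mono[OF K(3)]) (simp add: M_nonneg)
      moreover have "M * L2_norm Du * L2_norm Dv \<le> M * (K1 * norm \<delta>) * (K2 * norm \<delta>)"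
        by (rule mult_mono[OF mult_left_mono[OF K(2) M_nonneg] K(4)]) (simp_all add: M_nonneg K1(1))
      ultimately show ?thesis by linarith
    qed
    also have "\<dots> = (M * K1 * L2_norm v + M * L2_norm u * K2 + M * K1 * K2) * (norm \<delta>)\<^sup>2"
      by (simp add: algebra_simps power2_eq_square)
    finally show "norm (sym u v (z + \<delta>) - sym u v z - ((sym u v1 z - sym u2 v z) * \<delta> + (sym u1 v z - sym u v2 z) * cnj \<delta>))
      \<le> (M * K1 * L2_norm v + M * L2_norm u * K2 + M * K1 * K2) * (norm \<delta>)\<^sup>2"
      unfolding eq .
  qed
qed

text \<open>On a set closed under both ladder operators the Wirtinger derivatives of a symbol are
  differences of symbols of the same kind, and all symbols are bounded by \<open>sym_bound\<close>;
  induction on the order does the rest.\<close>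

lemma sym_Binf:
  assumes V: "V \<subseteq> X" "\<And>f. f \<in> V \<Longrightarrow> \<exists>f1\<in>V. \<exists>f2\<in>V. lad f f1 f2" and u: "u \<in> V" and v: "v \<in> V"
  shows "Binf (sym u v)"
proof -
  have bd: "bounded (range (sym f g))" if "f \<in> X" "g \<in> X" for f g
    using sym_bound[OF that] by (auto simp: bounded_iff)
  have "Bs n (sym f g)" if "f \<in> V" "g \<in> V" for n f g
    using that
  proof (induction n arbitrary: f g)
    case 0
    obtain f1 f2 g1 g2 where l: "lad f f1 f2" "lad g g1 g2" "f1 \<in> V" "f2 \<in> V" "g1 \<in> V" "g2 \<in> V"
      using V(2)[OF 0(1)] V(2)[OF 0(2)] by metis
    have "sym f g differentiable (at z)" for z
      by (rule wirtD(1)[OF sym_wirt[OF l(1,2)]]) (use l 0 V(1) in auto)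
    then have "continuous_on UNIV (sym f g)"
      by (auto intro!: differentiable_imp_continuous_on simp: differentiable_on_def)
    then show ?case using bd 0 V(1) by auto
  next
    case (Suc n)
    obtain f1 f2 g1 g2 where l: "lad f f1 f2" "lad g g1 g2" "f1 \<in> V" "f2 \<in> V" "g1 \<in> V" "g2 \<in> V"
      using V(2)[OF Suc.prems(1)] V(2)[OF Suc.prems(2)] by metis
    show ?case
    proof (rule Bs_SucI)
      show "wirt (sym f g) (sym f g1 z - sym f2 g z) (sym f1 g z - sym f g2 z) z" for z
        by (rule sym_wirt[OF l(1,2)]) (use l Suc.prems V(1) in auto)
    qed (use bd Suc.prems V(1) l in \<open>auto intro!: Bs_diff Suc.IH\<close>)
  qed
  then show ?thesis using u v by (simp add: Binf_def)
qed

end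

section \<open>Polyanalytic Fock spaces\<close>

lemma Ck_Suc_wirt: "Ck (Suc n) f \<Longrightarrow> wirt f (dz f z) (dbar f z) z"
  by (rule wirt_differentiable) simp

lemma Ck_continuous: "Ck n f \<Longrightarrow> continuous_on UNIV f"
  by (cases n) (auto intro!: differentiable_imp_continuous_on simp: differentiable_on_def)

lemma Ck_SucI:
  assumes w: "\<And>z. wirt f (a z) (b z) z" and ab: "Ck n (\<lambda>z. a z + b z)" "Ck n (\<lambda>z. \<i> * (a z - b z))"
  shows "Ck (Suc n) f"
proof -
  have "dx f = (\<lambda>z. a z + b z)" "dy f = (\<lambda>z. \<i> * (a z - b z))"
    using wirtD(4,5)[OF w] by auto
  then show ?thesis using wirtD(1)[OF w] ab by simp
qed

lemma dx_dy_of_wirt: "Ck (Suc n) f \<Longrightarrow> dx f = (\<lambda>z. dz f z + dbar f z)"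
  "Ck (Suc n) f \<Longrightarrow> dy f = (\<lambda>z. \<i> * (dz f z - dbar f z))"
  using wirtD(4,5)[OF Ck_Suc_wirt] by blast+

lemma Ck_add: "Ck n f \<Longrightarrow> Ck n g \<Longrightarrow> Ck n (\<lambda>z. f z + g z)"
proof (induction n arbitrary: f g)
  case 0
  then show ?case by (auto intro!: continuous_intros)
next
  case (Suc n)
  have d: "Ck n (dx f)" "Ck n (dy f)" "Ck n (dx g)" "Ck n (dy g)"
    using Suc.prems by simp_all
  have "Ck n (\<lambda>z. dx f z + dx g z)" "Ck n (\<lambda>z. dy f z + dy g z)"
    by (rule Suc.IH[OF d(1,3)], rule Suc.IH[OF d(2,4)])
  then show ?case
    unfolding dx_dy_of_wirt[OF Suc.prems(1)] dx_dy_of_wirt[OF Suc.prems(2)]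
    by (intro Ck_SucI[OF wirt_add[OF Ck_Suc_wirt[OF Suc.prems(1)] Ck_Suc_wirt[OF Suc.prems(2)]]])
      (simp_all add: algebra_simps)
qed

lemma Ck_cmult: "Ck n f \<Longrightarrow> Ck n (\<lambda>z. c * f z)"
proof (induction n arbitrary: f)
  case 0
  then show ?case by (auto intro!: continuous_intros)
next
  case (Suc n)
  have d: "Ck n (dx f)" "Ck n (dy f)"
    using Suc.prems by simp_all
  have "Ck n (\<lambda>z. c * dx f z)" "Ck n (\<lambda>z. c * dy f z)"
    by (rule Suc.IH[OF d(1)], rule Suc.IH[OF d(2)])
  then show ?case
    unfolding dx_dy_of_wirt[OF Suc.prems]
    by (intro Ck_SucI[OF wirt_cmult[OF Ck_Suc_wirt[OF Suc.prems]]])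
      (simp_all add: algebra_simps)
qed

text \<open>Lets the Wirtinger coefficients stand in for the partial derivatives that define
  \<open>Ck\<close>.\<close>

lemma Ck_SucI':
  assumes w: "\<And>z. wirt f (a z) (b z) z" and ab: "Ck n a" "Ck n b"
  shows "Ck (Suc n) f"
proof (rule Ck_SucI[OF w])
  show "Ck n (\<lambda>z. a z + b z)" by (rule Ck_add[OF ab])
  show "Ck n (\<lambda>z. \<i> * (a z - b z))"
    using Ck_cmult[OF Ck_add[OF ab(1) Ck_cmult[OF ab(2), of "-1"]], of \<i>] by simp
qed

lemma Ck_SucD: "Ck (Suc n) f \<Longrightarrow> Ck n f"
proof (induction n arbitrary: f)
  case 0
  show ?case unfolding Ck.simps(1) using Ck_continuous[OF 0] .
next
  case (Suc n)
  from Suc.prems[unfolded Ck.simps(2)[of "Suc n" f]]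
  have p: "\<forall>z. f differentiable (at z)" "Ck (Suc n) (dx f)" "Ck (Suc n) (dy f)" by blast+
  then show ?case
    unfolding Ck.simps(2)[of n] using Suc.IH[OF p(2)] Suc.IH[OF p(3)] by blast
qed

lemma Ck_dz_dbar:
  assumes "Ck (Suc n) f" shows "Ck n (dz f)" "Ck n (dbar f)"
proof -
  from assms have d: "Ck n (dx f)" "Ck n (dy f)" by auto
  show "Ck n (dz f)"
    using Ck_cmult[OF Ck_add[OF d(1) Ck_cmult[OF d(2), of "- \<i>"]], of "1/2"] by (simp add: dz_def[abs_def])
  show "Ck n (dbar f)"
    using Ck_cmult[OF Ck_add[OF d(1) Ck_cmult[OF d(2), of "\<i>"]], of "1/2"] by (simp add: dbar_def[abs_def])
qed

lemma Ck_mult: "Ck n f \<Longrightarrow> Ck n g \<Longrightarrow> Ck n (\<lambda>z. f z * g z)"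
proof (induction n arbitrary: f g)
  case 0
  then show ?case by (auto intro!: continuous_intros)
next
  case (Suc n)
  note fg = Suc.prems Ck_SucD[OF Suc.prems(1)] Ck_SucD[OF Suc.prems(2)]
  show ?case
    by (rule Ck_SucI'[OF wirt_mult[OF Ck_Suc_wirt[OF fg(1)] Ck_Suc_wirt[OF fg(2)]]])
      (intro Ck_add Suc.IH fg(3,4) Ck_dz_dbar fg(1,2))+
qed

lemma Ck_const: "Ck n (\<lambda>_. c)"
proof (induction n arbitrary: c)
  case (Suc n)
  show ?case by (rule Ck_SucI'[OF wirt_const Suc.IH Suc.IH])
qed auto

lemma smoothI: "(\<And>n. Ck n f) \<Longrightarrow> smooth f"
  by (simp add: smooth_def)

lemma smoothD: "smooth f \<Longrightarrow> Ck n f"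
  by (simp add: smooth_def)

lemma smooth_add: "smooth f \<Longrightarrow> smooth g \<Longrightarrow> smooth (\<lambda>z. f z + g z)"
  and smooth_mult: "smooth f \<Longrightarrow> smooth g \<Longrightarrow> smooth (\<lambda>z. f z * g z)"
  and smooth_cmult: "smooth f \<Longrightarrow> smooth (\<lambda>z. c * f z)"
  and smooth_const: "smooth (\<lambda>_. c)"
  unfolding smooth_def by (blast intro: Ck_add Ck_mult Ck_cmult Ck_const)+

lemma smooth_wirt: "smooth f \<Longrightarrow> wirt f (dz f z) (dbar f z) z"
  by (rule Ck_Suc_wirt[OF smoothD])

lemma smooth_dbar: "smooth f \<Longrightarrow> smooth (dbar f)"
  by (rule smoothI, rule Ck_dz_dbar(2)[OF smoothD])

lemma smooth_continuous: "smooth f \<Longrightarrow> continuous_on UNIV f"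
  by (rule Ck_continuous[OF smoothD])

lemma smooth_sum: "(\<And>i. i \<in> I \<Longrightarrow> smooth (f i)) \<Longrightarrow> smooth (\<lambda>z. \<Sum>i\<in>I. f i z)"
  by (induction I rule: infinite_finite_induct) (auto intro: smooth_add smooth_const)

lemma smooth_cnj_id: "smooth cnj"
proof (rule smoothI)
  show "Ck n cnj" for n
  proof (cases n)
    case 0
    then show ?thesis by (simp add: continuous_on_cnj[OF continuous_on_id])
  next
    case (Suc m)
    show ?thesis unfolding Suc by (rule Ck_SucI'[OF wirt_id(2) Ck_const Ck_const])
  qed
qed

lemma smooth_power: "smooth f \<Longrightarrow> smooth (\<lambda>z. f z ^ n)"
  by (induction n) (auto intro: smooth_mult smooth_const)

lemma wirt_holomorphic:
  assumes "(h has_field_derivative d) (at z)" shows "wirt h d 0 z"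
  using assms by (simp add: wirt_def has_field_derivative_def)

lemma smooth_holomorphic: "h holomorphic_on UNIV \<Longrightarrow> smooth h"
proof (rule smoothI)
  show "h holomorphic_on UNIV \<Longrightarrow> Ck n h" for n
  proof (induction n arbitrary: h)
    case 0
    then show ?case by (simp add: holomorphic_on_imp_continuous_on)
  next
    case (Suc n)
    have "wirt h (deriv h z) 0 z" for z
      by (rule wirt_holomorphic) (rule holomorphic_derivI[OF Suc.prems open_UNIV UNIV_I])
    then show ?case
      by (rule Ck_SucI') (rule Suc.IH[OF holomorphic_deriv[OF Suc.prems open_UNIV]], rule Ck_const)
  qed
qed

section \<open>Structure of \<open>fock\<close> and \<open>true_fock\<close>\<close>

lemma dbar_smooth_add: "smooth f \<Longrightarrow> smooth g \<Longrightarrow> dbar (\<lambda>z. f z + g z) = (\<lambda>z. dbar f z + dbar g z)"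
  using wirt_funD(2)[OF wirt_add[OF smooth_wirt smooth_wirt]] by blast

lemma dbar_smooth_cmult: "smooth f \<Longrightarrow> dbar (\<lambda>z. c * f z) = (\<lambda>z. c * dbar f z)"
  using wirt_funD(2)[OF wirt_cmult[OF smooth_wirt]] by blast

lemma dbar_pow_add: "smooth f \<Longrightarrow> smooth g \<Longrightarrow> (dbar ^^ n) (\<lambda>z. f z + g z) = (\<lambda>z. (dbar ^^ n) f z + (dbar ^^ n) g z)"
  by (induction n arbitrary: f g) (simp_all add: funpow_Suc_right dbar_smooth_add smooth_dbar del: funpow.simps)

lemma dbar_pow_cmult: "smooth f \<Longrightarrow> (dbar ^^ n) (\<lambda>z. c * f z) = (\<lambda>z. c * (dbar ^^ n) f z)"
  by (induction n arbitrary: f) (simp_all add: funpow_Suc_right dbar_smooth_cmult smooth_dbar del: funpow.simps)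

lemma fock_L2: "f \<in> fock n \<Longrightarrow> f \<in> L2" and fock_smooth: "f \<in> fock n \<Longrightarrow> smooth f"
  and fock_dbar: "f \<in> fock n \<Longrightarrow> (dbar ^^ n) f = (\<lambda>z. 0)"
  by (auto simp: fock_def)

lemma fock_add: "f \<in> fock n \<Longrightarrow> g \<in> fock n \<Longrightarrow> (\<lambda>z. f z + g z) \<in> fock n"
  by (auto simp: fock_def smooth_add dbar_pow_add)

lemma fock_cmult: "f \<in> fock n \<Longrightarrow> (\<lambda>z. c * f z) \<in> fock n"
  by (auto simp: fock_def smooth_cmult dbar_pow_cmult)

lemma fock_zero: "(\<lambda>z. 0) \<in> fock n"
proof -
  have "(dbar ^^ n) (\<lambda>z. 0) = (\<lambda>z. 0)"
    using dbar_pow_cmult[OF smooth_const[of 0], of n 0] by simp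
  then show ?thesis by (simp add: fock_def smooth_const)
qed

lemma fock_sum: "(\<And>i. i \<in> I \<Longrightarrow> f i \<in> fock n) \<Longrightarrow> (\<lambda>z. \<Sum>i\<in>I. f i z) \<in> fock n"
  by (induction I rule: infinite_finite_induct) (auto intro: fock_add fock_zero)

text \<open>\<open>fock 0\<close> contains only the zero function, since the zeroth power of
  \<open>dbar\<close> is the identity; so the special case in the definition agrees with the general
  formula.\<close>

lemma true_fock_iff:
  assumes "k \<ge> 1"
  shows "f \<in> true_fock k \<longleftrightarrow> f \<in> fock k \<and> (\<forall>g\<in>fock (k - 1). L2_inner f g = 0)"
proof (cases "k = 1")
  case True
  have "L2_inner f g = 0" if "g \<in> fock 0" for g
    using fock_dbar[OF that] by simp
  then show ?thesis using True by (auto simp: true_fock_def)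
next
  case False
  then show ?thesis by (simp add: true_fock_def)
qed

lemma true_fock_add: "f \<in> true_fock (Suc n) \<Longrightarrow> g \<in> true_fock (Suc n) \<Longrightarrow> (\<lambda>z. f z + g z) \<in> true_fock (Suc n)"
  by (auto simp: true_fock_iff fock_add L2_inner_add1 fock_L2)

lemma true_fock_cmult: "f \<in> true_fock (Suc n) \<Longrightarrow> (\<lambda>z. c * f z) \<in> true_fock (Suc n)"
  by (auto simp: true_fock_iff fock_cmult L2_inner_cmult1)

lemma true_fock_diff: "f \<in> true_fock (Suc n) \<Longrightarrow> g \<in> true_fock (Suc n) \<Longrightarrow> (\<lambda>z. f z - g z) \<in> true_fock (Suc n)"
  using true_fock_add[OF _ true_fock_cmult[of g n "-1"], of f] by simp

lemma true_fock_fock: "f \<in> true_fock (Suc n) \<Longrightarrow> f \<in> fock (Suc n)"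
  and true_fock_orth: "f \<in> true_fock (Suc n) \<Longrightarrow> g \<in> fock n \<Longrightarrow> L2_inner f g = 0"
  by (auto simp: true_fock_iff)

lemma true_fock_L2: "f \<in> true_fock (Suc n) \<Longrightarrow> f \<in> L2"
  and true_fock_continuous: "f \<in> true_fock (Suc n) \<Longrightarrow> continuous_on UNIV f"
  by (auto dest!: true_fock_fock intro: fock_L2 smooth_continuous fock_smooth)

lemma wirt_cnj_power: "wirt (\<lambda>w. cnj w ^ Suc j) 0 (of_nat (Suc j) * cnj w ^ j) w"
proof (induction j)
  case 0
  then show ?case using wirt_id(2)[of w] by simp
next
  case (Suc j)
  have "cnj w * (of_nat (Suc j) * cnj w ^ j) + cnj w ^ Suc j = of_nat (Suc (Suc j)) * cnj w ^ Suc j"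
    by (simp add: algebra_simps)
  then show ?case using wirt_mult[OF wirt_id(2) Suc] by (simp add: add.commute)
qed

lemma dbar_cnj_power_mult:
  assumes h: "h holomorphic_on UNIV"
  shows "dbar (\<lambda>w. cnj w ^ Suc j * h w) = (\<lambda>w. cnj w ^ j * (of_nat (Suc j) * h w))"
    and "dbar h = (\<lambda>w. 0)"
proof -
  have w: "wirt h (deriv h w) 0 w" for w
    by (intro wirt_holomorphic holomorphic_derivI[OF h]) auto
  show "dbar (\<lambda>w. cnj w ^ Suc j * h w) = (\<lambda>w. cnj w ^ j * (of_nat (Suc j) * h w))"
    using wirt_funD(2)[OF wirt_mult[OF wirt_cnj_power w], of j] by (simp add: mult.assoc mult.left_commute)
  show "dbar h = (\<lambda>w. 0)" using wirt_funD(2)[OF w] by simp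
qed

lemma smooth_cnj_power_mult: "h holomorphic_on UNIV \<Longrightarrow> smooth (\<lambda>w. cnj w ^ j * h w)"
  by (intro smooth_mult smooth_power smooth_cnj_id smooth_holomorphic)

lemma dbar_pow_cnj_power:
  "h holomorphic_on UNIV \<Longrightarrow> j < m \<Longrightarrow> (dbar ^^ m) (\<lambda>w. cnj w ^ j * h w) = (\<lambda>w. 0)"
proof (induction m arbitrary: j h)
  case (Suc m)
  have z: "(dbar ^^ m) (\<lambda>z. 0) = (\<lambda>z. 0)"
    using dbar_pow_cmult[OF smooth_const[of 0], of m 0] by simp
  show ?case
  proof (cases j)
    case 0
    then show ?thesis using Suc.prems by (simp add: funpow_Suc_right dbar_cnj_power_mult z del: funpow.simps)
  next
    case (Suc i)
    have "(\<lambda>w. of_nat (Suc i) * h w) holomorphic_on UNIV" using Suc.prems by (intro holomorphic_intros)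
    from Suc.IH[OF this, of i] show ?thesis
      using Suc.prems Suc by (simp add: funpow_Suc_right dbar_cnj_power_mult del: funpow.simps power_Suc of_nat_Suc)
  qed
qed simp

lemma cnj_power_mult_fock:
  assumes "h holomorphic_on UNIV" "j < m" "(\<lambda>w. cnj w ^ j * h w) \<in> L2"
  shows "(\<lambda>w. cnj w ^ j * h w) \<in> fock m"
  using assms by (simp add: fock_def smooth_cnj_power_mult dbar_pow_cnj_power)

lemma monomial_fock: "j < m \<Longrightarrow> (\<lambda>w. cnj w ^ j * w ^ a) \<in> fock m"
proof (rule cnj_power_mult_fock)
  show "(\<lambda>w. cnj w ^ j * w ^ a) \<in> L2"
    by (intro egrow_L2 egrow_mult egrow_power egrow_cnj egrow_id)
qed (auto intro: holomorphic_intros)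

lemma Efun_fock: "Efun n i \<in> fock (Suc n)"
  unfolding Efun_def[abs_def] by (intro fock_sum fock_cmult monomial_fock) simp

text \<open>Induction through \<open>dbar u\<close>. Each of its terms
  \<open>cnj w ^ j * h j w\<close> has the \<open>dbar\<close>-primitive
  \<open>cnj w ^ Suc j * h j w / Suc j\<close>. Subtracting the sum of these from \<open>u\<close>
  leaves a function with \<open>dbar\<close> zero, which is entire and becomes the coefficient of
  index 0.\<close>

lemma polyanalytic_repr:
  "smooth u \<Longrightarrow> (dbar ^^ m) u = (\<lambda>z. 0) \<Longrightarrow>
    \<exists>h. (\<forall>j. h j holomorphic_on UNIV) \<and> (\<forall>w. u w = (\<Sum>j<m. cnj w ^ j * h j w))"
proof (induction m arbitrary: u)
  case 0
  then show ?case by (intro exI[of _ "\<lambda>_ _. 0"]) auto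
next
  case (Suc m)
  have "(dbar ^^ m) (dbar u) = (\<lambda>z. 0)"
    using Suc.prems(2) by (simp add: funpow_Suc_right del: funpow.simps)
  then obtain h where h: "\<And>j. h j holomorphic_on UNIV" "\<And>w. dbar u w = (\<Sum>j<m. cnj w ^ j * h j w)"
    using Suc.IH[OF smooth_dbar[OF Suc.prems(1)]] by blast
  define H where "H j w = (1 / of_nat (Suc j)) * h j w" for j w
  have H: "H j holomorphic_on UNIV" for j
    unfolding H_def using h(1) by (intro holomorphic_intros)
  define s where "s w = (\<Sum>j<m. cnj w ^ Suc j * H j w)" for w
  define g where "g w = u w + (-1) * s w" for w
  have s: "smooth s"
    unfolding s_def[abs_def] using H by (intro smooth_sum smooth_cnj_power_mult)
  have "dbar s w = dbar u w" for w
  proof -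
    have fin: "(\<And>j. j \<in> I \<Longrightarrow> smooth (f j)) \<Longrightarrow> dbar (\<lambda>w. \<Sum>j\<in>I. f j w) = (\<lambda>w. \<Sum>j\<in>I. dbar (f j) w)" if "finite I" for I :: "nat set" and f
      using that
    proof (induction I)
      case empty
      then show ?case using dbar_smooth_cmult[OF smooth_const[of 0], of 0] by simp
    next
      case (insert x F)
      then show ?case by (simp add: dbar_smooth_add smooth_sum)
    qed
    have "dbar s = (\<lambda>w. \<Sum>j<m. dbar (\<lambda>w. cnj w ^ Suc j * H j w) w)"
      unfolding s_def[abs_def] by (rule fin) (use H smooth_cnj_power_mult in blast)+
    moreover have "of_nat (Suc j) * H j w = h j w" for j w
      unfolding H_def by (simp del: of_nat_Suc)
    ultimately show ?thesis
      unfolding h(2) dbar_cnj_power_mult(1)[OF H] by simp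
  qed
  moreover have "dbar g = (\<lambda>w. dbar u w + (-1) * dbar s w)"
    unfolding g_def[abs_def] dbar_smooth_add[OF Suc.prems(1) smooth_cmult[OF s]] dbar_smooth_cmult[OF s] ..
  ultimately have dg: "dbar g w = 0" for w
    by simp
  have g: "smooth g" unfolding g_def[abs_def] by (intro smooth_add smooth_cmult Suc.prems s)
  have "(g has_field_derivative dz g w) (at w)" for w
    using smooth_wirt[OF g, of w] by (simp add: dg wirt_def has_field_derivative_def)
  then have gh: "g holomorphic_on UNIV"
    by (auto simp: holomorphic_on_def field_differentiable_def)
  define h' where "h' j = (case j of 0 \<Rightarrow> g | Suc i \<Rightarrow> H i)" for j
  have "h' j holomorphic_on UNIV" for j
    by (cases j) (auto simp: h'_def gh H)
  moreover have "u w = (\<Sum>j<Suc m. cnj w ^ j * h' j w)" for w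
    by (simp add: sum.lessThan_Suc_shift h'_def g_def s_def del: sum.lessThan_Suc power_Suc)
  ultimately show ?case by blast
qed

section \<open>Weyl invariance of the Fock spaces\<close>

lemma wirt_translate:
  assumes "wirt u a b (z - c)" shows "wirt (\<lambda>w. u (w - c)) a b z"
proof -
  have "((\<lambda>y. y - c) has_derivative (\<lambda>\<delta>. \<delta>)) (at z)"
    by (auto intro!: derivative_eq_intros)
  from has_derivative_compose[OF this assms[unfolded wirt_def]] show ?thesis
    unfolding wirt_def .
qed

lemma wirt_exp_affine: "wirt (\<lambda>w. exp (w * c - d)) (c * exp (w * c - d)) 0 w"
  by (rule wirt_holomorphic) (auto intro!: derivative_eq_intros)

lemma wirt_Wt:
  assumes "wirt u a b (w - z)"
  shows "wirt (Wt z u) (a * exp (w * cnj z - of_real ((norm z)\<^sup>2 / 2)) + cnj z * Wt z u w)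
    (b * exp (w * cnj z - of_real ((norm z)\<^sup>2 / 2))) w"
  using wirt_mult[OF wirt_translate[OF assms] wirt_exp_affine[of "cnj z" "of_real ((norm z)\<^sup>2 / 2)" w]]
  by (simp add: Wt_def[abs_def] mult.left_commute del: of_real_divide of_real_power)

lemma Ck_Wt: "Ck n u \<Longrightarrow> Ck n (Wt z u)"
proof (induction n arbitrary: u)
  case 0
  then have c: "continuous_on UNIV u" by simp
  have "continuous_on UNIV (\<lambda>w. u (w - z))"
    by (rule continuous_on_compose2[OF c]) (intro continuous_intros, simp)
  then show ?case unfolding Wt_def[abs_def] by (auto intro!: continuous_intros)
next
  case (Suc n)
  have "wirt (Wt z u) (Wt z (dz u) w + cnj z * Wt z u w) (Wt z (dbar u) w) w" for w
    using wirt_Wt[OF Ck_Suc_wirt[OF Suc.prems], of z w] by (simp add: Wt_def)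
  then show ?case
    by (rule Ck_SucI') (rule Ck_add[OF Suc.IH[OF Ck_dz_dbar(1)[OF Suc.prems]] Ck_cmult[OF Suc.IH[OF Ck_SucD[OF Suc.prems]]]],
        rule Suc.IH[OF Ck_dz_dbar(2)[OF Suc.prems]])
qed

lemma smooth_Wt: "smooth u \<Longrightarrow> smooth (Wt z u)"
  unfolding smooth_def by (blast intro: Ck_Wt)

lemma dbar_Wt:
  assumes u: "smooth u" shows "dbar (Wt z u) = Wt z (dbar u)"
proof -
  have "wirt (Wt z u) (Wt z (dz u) w + cnj z * Wt z u w) (Wt z (dbar u) w) w" for w
    using wirt_Wt[OF smooth_wirt[OF u], of z w] by (simp add: Wt_def)
  then show ?thesis by (rule wirt_funD(2))
qed

text \<open>The exponential factor of \<open>Wt\<close> is holomorphic in \<open>w\<close>, so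
  \<open>Wt z\<close> commutes with \<open>dbar\<close> and its powers.\<close>

lemma Wt_fock: "u \<in> fock n \<Longrightarrow> Wt z u \<in> fock n"
proof -
  assume u: "u \<in> fock n"
  have "smooth u \<Longrightarrow> (dbar ^^ m) (Wt z u) = Wt z ((dbar ^^ m) u)" for m u
    by (induction m arbitrary: u) (simp_all add: funpow_Suc_right dbar_Wt smooth_dbar del: funpow.simps)
  then show ?thesis
    using u by (simp add: fock_def Wt_L2 smooth_Wt) (simp add: Wt_def fun_eq_iff)
qed

lemma Wt_inverse: "Wt z (Wt (- z) u) = u"
proof
  fix w
  have "Im (z * cnj (- z)) = 0" by simp
  then show "Wt z (Wt (- z) u) w = u w" unfolding Wt_Wt by simp
qed

lemma L2_inner_Wt_left:
  assumes "f \<in> L2" "g \<in> L2"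
  shows "L2_inner (Wt z f) g = L2_inner f (Wt (- z) g)"
  using L2_inner_Wt[OF assms(1) Wt_L2[OF assms(2)], of z "- z"] by (simp add: Wt_inverse)

lemma L2_inner_Wt_right:
  assumes "f \<in> L2" "g \<in> L2"
  shows "L2_inner f (Wt z g) = L2_inner (Wt (- z) f) g"
  using L2_inner_Wt_left[OF assms, of "- z"] by simp

lemma Wt_true_fock: "u \<in> true_fock (Suc n) \<Longrightarrow> Wt z u \<in> true_fock (Suc n)"
  using L2_inner_Wt_left[OF true_fock_L2 fock_L2, of u n _ n z] by (auto simp: true_fock_iff Wt_fock)

section \<open>Averages over the unit circle\<close>

definition expi :: "real \<Rightarrow> complex" where "expi t = exp (2 * of_real pi * \<i> * of_real t)"

lemma norm_expi [simp]: "norm (expi t) = 1"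
  by (simp add: expi_def norm_exp_eq_Re)

lemma expi_nz [simp]: "expi t \<noteq> 0"
  by (simp add: expi_def)

lemma cnj_expi: "cnj (expi t) = 1 / expi t"
proof -
  have "cnj (expi t) * expi t = 1"
    using complex_norm_square[of "expi t"] by (simp add: mult.commute)
  then show ?thesis by (simp add: field_simps)
qed

lemma continuous_expi [continuous_intros]: "continuous_on A f \<Longrightarrow> continuous_on A (\<lambda>t. expi (f t))"
  unfolding expi_def by (intro continuous_intros)

lemma contour_integral_unit_circle:
  "contour_integral (circlepath 0 1) f = integral {0..1} (\<lambda>t. f (expi t) * (2 * of_real pi * \<i> * expi t))"
  unfolding contour_integral_integral
  by (intro integral_cong) (simp add: vector_derivative_circlepath, simp add: circlepath expi_def)

text \<open>Cauchy's formula for the derivative of order \<open>j\<close> at 0 of the entire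
  function sending \<open>\<zeta>\<close> to \<open>h (w * \<zeta>)\<close>. Averages over rotations
  thus read off Taylor coefficients.\<close>

lemma circle_mean_coeff:
  assumes h: "h holomorphic_on UNIV"
  shows "integral {0..1} (\<lambda>t. h (expi t * w) / expi t ^ j) = ((deriv ^^ j) h 0 / fact j) * w ^ j"
proof -
  have hol: "(\<lambda>\<zeta>. h (w * \<zeta>)) holomorphic_on UNIV"
    by (rule holomorphic_on_compose_gen[of "\<lambda>\<zeta>. w * \<zeta>" UNIV h UNIV, unfolded o_def]) (auto intro!: holomorphic_intros h)
  have c: "continuous_on (cball 0 1) (\<lambda>\<zeta>. h (w * \<zeta>))" "(\<lambda>\<zeta>. h (w * \<zeta>)) holomorphic_on ball 0 1"
    by (intro holomorphic_on_imp_continuous_on holomorphic_on_subset[OF hol] subset_UNIV)+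
  have "contour_integral (circlepath 0 1) (\<lambda>u. h (w * u) / (u - 0) ^ Suc j)
     = (2 * of_real pi * \<i>) / fact j * (deriv ^^ j) (\<lambda>\<zeta>. h (w * \<zeta>)) 0"
    using Cauchy_contour_integral_circlepath[OF c, of 0 j] by simp
  also have "(deriv ^^ j) (\<lambda>\<zeta>. h (w * \<zeta>)) 0 = w ^ j * (deriv ^^ j) h 0"
    using higher_deriv_compose_linear[of h UNIV UNIV 0 w j] h by simp
  finally have "integral {0..1} (\<lambda>t. h (w * expi t) / expi t ^ Suc j * (2 * of_real pi * \<i> * expi t))
     = (2 * of_real pi * \<i>) / fact j * (w ^ j * (deriv ^^ j) h 0)"
    unfolding contour_integral_unit_circle by simp
  moreover have "(\<lambda>t. h (w * expi t) / expi t ^ Suc j * (2 * of_real pi * \<i> * expi t))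
     = (\<lambda>t. (2 * of_real pi * \<i>) * (h (expi t * w) / expi t ^ j))"
    by (simp add: field_simps)
  ultimately have "integral {0..1} (\<lambda>t. (2 * of_real pi * \<i>) * (h (expi t * w) / expi t ^ j))
     = (2 * of_real pi * \<i>) / fact j * (w ^ j * (deriv ^^ j) h 0)"
    by (simp only:)
  then have "(2 * of_real pi * \<i>) * integral {0..1} (\<lambda>t. h (expi t * w) / expi t ^ j)
     = (2 * of_real pi * \<i>) * ((deriv ^^ j) h 0 / fact j * w ^ j)"
    unfolding integral_mult_right by simp
  then show ?thesis by (rule mult_left_cancel[THEN iffD1, rotated]) simp
qed

lemma circle_mean_zero:
  assumes h: "h holomorphic_on UNIV"
  shows "integral {0..1} (\<lambda>t. expi t ^ Suc p * h (expi t * w)) = 0"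
proof -
  have "(\<lambda>\<zeta>. h (\<zeta> * w)) holomorphic_on UNIV"
    by (rule holomorphic_on_compose_gen[of "\<lambda>\<zeta>. \<zeta> * w" UNIV h UNIV, unfolded o_def]) (auto intro!: holomorphic_intros h)
  then have "(\<lambda>\<zeta>. \<zeta> ^ Suc p * h (\<zeta> * w)) holomorphic_on UNIV"
    by (intro holomorphic_intros)
  from circle_mean_coeff[OF this, of 1 0] show ?thesis by simp
qed

section \<open>Reproducing kernels\<close>

lemma expi_measurable [measurable]: "expi \<in> borel_measurable borel"
  by (intro borel_measurable_continuous_onI continuous_expi continuous_on_id)

definition unif :: "real measure" where
  "unif = density lborel (\<lambda>t. ennreal (indicator {0..1} t))"

lemma sets_unif [simp, measurable_cong]: "sets unif = sets borel"
  by (simp add: unif_def)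

lemma space_unif [simp]: "space unif = UNIV"
  by (simp add: unif_def)

lemma prob_space_unif: "prob_space unif"
proof
  show "emeasure unif (space unif) = 1"
    unfolding unif_def by (simp add: emeasure_density ennreal_indicator)
qed

lemma integral_unif:
  fixes f :: "real \<Rightarrow> complex"
  assumes "continuous_on UNIV f"
  shows "(LINT t|unif. f t) = integral {0..1} f"
proof -
  have [measurable]: "f \<in> borel_measurable borel" by (rule borel_measurable_continuous_onI[OF assms])
  have "set_integrable lborel {0..1} f"
    by (rule borel_integrable_atLeastAtMost') (rule continuous_on_subset[OF assms], simp)
  from set_borel_integral_eq_integral(2)[OF this]
  show ?thesis unfolding unif_def set_lebesgue_integral_def by (subst integral_density) auto
qed

lemma integral_gauss_rotate:
  fixes F :: "complex \<Rightarrow> 'a::{banach, second_countable_topology}"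
  assumes [measurable]: "F \<in> borel_measurable borel" and c: "norm c = 1"
  shows "(LINT w|gauss. F (c * w)) = (LINT w|gauss. F w)" "integrable gauss (\<lambda>w. F (c * w)) \<longleftrightarrow> integrable gauss F"
  using arg_cong[OF gauss_rotate[OF c], of "\<lambda>M. integral\<^sup>L M F"] arg_cong[OF gauss_rotate[OF c], of "\<lambda>M. integrable M F"]
  by (simp_all add: integral_distr integrable_distr_eq)

text \<open>Fubini over the circle and the rotation invariance of the Gaussian. Only the angular
  frequency of \<open>u\<close> opposite to that of \<open>G\<close> survives.\<close>

lemma rotation_average:
  assumes u: "u \<in> L2" "continuous_on UNIV u" and G: "egrow G"
    and rot: "\<And>t w. G (expi t * w) = expi t ^ m * G w"
  shows "(LINT w|gauss. u w * G w) = (LINT w|gauss. integral {0..1} (\<lambda>t. expi t ^ m * u (expi t * w)) * G w)"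
proof -
  interpret U: prob_space unif by (rule prob_space_unif)
  interpret P: pair_sigma_finite unif gauss ..
  note [measurable] = L2_measurable[OF u(1)] egrow_measurable[OF G]
  define F where "F t w = (expi t ^ m * u (expi t * w)) * G w" for t w
  have [measurable]: "case_prod F \<in> borel_measurable (unif \<Otimes>\<^sub>M gauss)"
    unfolding F_def[abs_def] by measurable
  have int: "integrable gauss (\<lambda>w. u w * G w)"
    using L2_mult_integrable(1)[OF u(1) egrow_L2[OF egrow_cnj[OF G]]] by simp
  have F: "F t w = (\<lambda>w. u w * G w) (expi t * w)" for t w
    unfolding F_def rot by (simp only: mult.assoc mult.left_commute)
  have 1: "(LINT w|gauss. F t w) = (LINT w|gauss. u w * G w)" "integrable gauss (F t)" for t
    unfolding F using integral_gauss_rotate[of "\<lambda>w. u w * G w" "expi t"] int by auto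
  have 2: "(LINT w|gauss. norm (F t w)) = (LINT w|gauss. norm (u w * G w))" for t
    unfolding F using integral_gauss_rotate(1)[of "\<lambda>w. norm (u w * G w)" "expi t"] by auto
  have "integrable (unif \<Otimes>\<^sub>M gauss) (case_prod F)"
    by (rule P.Fubini_integrable) (simp_all add: 1 2)
  then have "(LINT w|gauss. LINT t|unif. F t w) = (LINT t|unif. LINT w|gauss. F t w)"
    by (rule P.Fubini_integral)
  moreover have "(LINT t|unif. F t w) = integral {0..1} (\<lambda>t. expi t ^ m * u (expi t * w)) * G w" for w
  proof -
    have "continuous_on UNIV (\<lambda>t. u (expi t * w))"
      by (rule continuous_on_compose2[OF u(2)]) (intro continuous_intros, simp)
    then have "continuous_on UNIV (\<lambda>t. expi t ^ m * u (expi t * w))"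
      by (intro continuous_intros)
    then show ?thesis unfolding F_def by (simp add: integral_unif)
  qed
  moreover have "(LINT t|unif. LINT w|gauss. F t w) = (LINT w|gauss. u w * G w)"
    unfolding 1 using U.prob_space by simp
  ultimately show ?thesis by simp
qed

lemma continuous_circle: "h holomorphic_on UNIV \<Longrightarrow> continuous_on A (\<lambda>t. h (expi t * w))"
  by (rule continuous_on_compose2[OF holomorphic_on_imp_continuous_on[of h UNIV]]) (auto intro!: continuous_intros)

text \<open>In the representation of \<open>u\<close> only powers \<open>cnj w ^ j\<close> with
  \<open>j < n\<close> occur, times entire functions, so all angular frequencies of \<open>u\<close>
  exceed \<open>- n\<close>, while that of \<open>cnj w ^ n\<close> is \<open>- n\<close>.\<close>

lemma fock_orth_cnj_power:
  assumes u: "u \<in> fock n"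
  shows "L2_inner u (\<lambda>w. cnj w ^ n) = 0"
proof -
  obtain h where h: "\<And>j. h j holomorphic_on UNIV" "\<And>w. u w = (\<Sum>j<n. cnj w ^ j * h j w)"
    using polyanalytic_repr[OF fock_smooth[OF u] fock_dbar[OF u]] by blast
  have A: "integral {0..1} (\<lambda>t. expi t ^ n * u (expi t * w)) = 0" for w
  proof -
    \<comment> \<open>The exponent \<open>Suc (n - Suc j)\<close> is \<open>n - j\<close>, written
      so as to be visibly positive for \<open>circle_mean_zero\<close>.\<close>
    have e: "expi t ^ n * u (expi t * w) = (\<Sum>j<n. cnj w ^ j * (expi t ^ Suc (n - Suc j) * h j (expi t * w)))" for t
    proof -
      have "expi t ^ n * (cnj (expi t * w) ^ j * h j (expi t * w)) = cnj w ^ j * (expi t ^ Suc (n - Suc j) * h j (expi t * w))"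
        if j: "j < n" for j
      proof -
        have "n = Suc (n - Suc j) + j" using j by simp
        then have "expi t ^ n = expi t ^ Suc (n - Suc j) * expi t ^ j" by (metis power_add)
        then have "expi t ^ n * cnj (expi t) ^ j = expi t ^ Suc (n - Suc j)"
          by (simp add: cnj_expi power_divide)
        then show ?thesis by (simp add: power_mult_distrib algebra_simps)
      qed
      then show ?thesis unfolding h(2) sum_distrib_left by (intro sum.cong) auto
    qed
    have "integral {0..1} (\<lambda>t. expi t ^ n * u (expi t * w))
        = (\<Sum>j<n. integral {0..1} (\<lambda>t. cnj w ^ j * (expi t ^ Suc (n - Suc j) * h j (expi t * w))))"
      unfolding e
      by (rule integral_sum) (auto intro!: integrable_continuous_interval continuous_intros continuous_circle h)
    also have "\<dots> = 0"
      unfolding integral_mult_right circle_mean_zero[OF h(1)] by simp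
    finally show ?thesis .
  qed
  have "L2_inner u (\<lambda>w. cnj w ^ n) = (LINT w|gauss. u w * w ^ n)"
    by (simp add: L2_inner_def)
  also have "\<dots> = 0"
    by (subst rotation_average[OF fock_L2[OF u] smooth_continuous[OF fock_smooth[OF u]], of _ n])
      (auto simp: A power_mult_distrib intro!: egrow_power)
  finally show ?thesis .
qed

text \<open>Polynomials in the squared norm; the bound \<open>j < n\<close> on the exponent keeps
  them in \<open>fock n\<close>.\<close>

definition radpoly :: "nat \<Rightarrow> (nat \<Rightarrow> complex) \<Rightarrow> complex \<Rightarrow> complex" where
  "radpoly n c w = (\<Sum>j<n. c j * (cnj w ^ j * w ^ j))"

lemma radpoly_fock: "radpoly n c \<in> fock n"
  unfolding radpoly_def[abs_def] by (intro fock_sum fock_cmult monomial_fock) simp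

lemma egrow_radpoly: "egrow (radpoly n c)"
  unfolding radpoly_def[abs_def] by (intro egrow_sum egrow_cmult egrow_mult egrow_power egrow_cnj egrow_id)

lemma radpoly_rot: "radpoly n c (expi t * w) = radpoly n c w"
proof -
  have "cnj (expi t * w) ^ j * (expi t * w) ^ j = cnj w ^ j * w ^ j" for j
  proof -
    have "cnj (expi t * w) * (expi t * w) = cnj w * w" by (simp add: cnj_expi)
    then show ?thesis by (simp only: power_mult_distrib[symmetric])
  qed
  then show ?thesis unfolding radpoly_def by simp
qed

lemma radpoly_0: "radpoly (Suc n) c 0 = c 0"
  unfolding radpoly_def by (simp add: sum.lessThan_Suc_shift del: sum.lessThan_Suc)

text \<open>Averaging \<open>u\<close> over rotations retains from \<open>cnj w ^ j * h j w\<close>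
  just the Taylor term of degree \<open>j\<close> of \<open>h j\<close>, so the average is a radial
  polynomial. Radial test functions cannot tell \<open>u\<close> from it, and the value at 0 is the
  same.\<close>

lemma radial_part:
  assumes u: "u \<in> fock (Suc n)"
  obtains c where "u 0 = c 0" "\<And>m d. L2_inner u (radpoly m d) = L2_inner (radpoly (Suc n) c) (radpoly m d)"
proof -
  obtain h where h: "\<And>j. h j holomorphic_on UNIV" "\<And>w. u w = (\<Sum>j<Suc n. cnj w ^ j * h j w)"
    using polyanalytic_repr[OF fock_smooth[OF u] fock_dbar[OF u]] by blast
  define c where "c j = (deriv ^^ j) (h j) 0 / fact j" for j
  have A: "integral {0..1} (\<lambda>t. expi t ^ 0 * u (expi t * w)) = radpoly (Suc n) c w" for w
  proof -
    have e: "expi t ^ 0 * u (expi t * w) = (\<Sum>j<Suc n. cnj w ^ j * (h j (expi t * w) / expi t ^ j))" for t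
      unfolding h(2) by (simp add: cnj_expi power_divide)
    have "integral {0..1} (\<lambda>t. expi t ^ 0 * u (expi t * w))
        = (\<Sum>j<Suc n. integral {0..1} (\<lambda>t. cnj w ^ j * (h j (expi t * w) / expi t ^ j)))"
      unfolding e
    proof (rule integral_sum)
      fix j
      have "continuous_on {0..1} (\<lambda>t. cnj w ^ j * (h j (expi t * w) / expi t ^ j))"
        by (intro continuous_on_mult continuous_on_const continuous_on_divide continuous_circle h continuous_on_power
            continuous_expi continuous_on_id ballI) simp
      then show "(\<lambda>t. cnj w ^ j * (h j (expi t * w) / expi t ^ j)) integrable_on {0..1}"
        by (rule integrable_continuous_interval)
    qed simp
    also have "\<dots> = (\<Sum>j<Suc n. c j * (cnj w ^ j * w ^ j))"
      unfolding integral_mult_right circle_mean_coeff[OF h(1)] c_def by (intro sum.cong) auto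
    finally show ?thesis unfolding radpoly_def .
  qed
  show ?thesis
  proof (rule that)
    have "u 0 = h 0 0" unfolding h(2) by (simp add: sum.lessThan_Suc_shift del: sum.lessThan_Suc)
    then show "u 0 = c 0" by (simp add: c_def)
    show "L2_inner u (radpoly m d) = L2_inner (radpoly (Suc n) c) (radpoly m d)" for m d
      unfolding L2_inner_def
      by (subst rotation_average[OF fock_L2[OF u] smooth_continuous[OF fock_smooth[OF u]], of _ 0])
        (auto simp only: A[unfolded power_0 mult_1_left] radpoly_rot power_0 mult_1_left intro!: egrow_cnj egrow_radpoly)
  qed
qed

lemma lad_inner:
  assumes l: "lad u p q" and g: "g \<in> L2"
  shows "\<exists>K. \<forall>\<delta>. norm \<delta> \<le> 1 \<longrightarrow>
    norm (L2_inner g (Wt \<delta> u) - L2_inner g u - (L2_inner g p * \<delta> + - L2_inner g q * cnj \<delta>)) \<le> K * (norm \<delta>)\<^sup>2"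
proof -
  have eg: "egrow u" "egrow p" "egrow q" and O: "O2 (\<lambda>\<delta> w. Wt \<delta> u w - u w - (cnj \<delta> * p w - \<delta> * q w))"
    using l by (auto simp: lad_def)
  note L = egrow_L2[OF eg(1)] egrow_L2[OF eg(2)] egrow_L2[OF eg(3)]
  have egR: "egrow (\<lambda>w. Wt \<delta> u w - u w - (cnj \<delta> * p w - \<delta> * q w))" for \<delta>
    by (intro egrow_diff egrow_cmult Wt_egrow eg)
  obtain K where K: "K \<ge> 0" "\<And>\<delta>. norm \<delta> \<le> 1 \<Longrightarrow> L2_norm (\<lambda>w. Wt \<delta> u w - u w - (cnj \<delta> * p w - \<delta> * q w)) \<le> K * (norm \<delta>)\<^sup>2"
    using O2_L2_norm[OF O egrow_measurable[OF egR]] by blast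
  have "norm (L2_inner g (Wt \<delta> u) - L2_inner g u - (L2_inner g p * \<delta> + - L2_inner g q * cnj \<delta>)) \<le> (L2_norm g * K) * (norm \<delta>)\<^sup>2"
    if d: "norm \<delta> \<le> 1" for \<delta>
  proof -
    have "L2_inner g (\<lambda>w. Wt \<delta> u w - u w - (cnj \<delta> * p w - \<delta> * q w))
       = L2_inner g (\<lambda>w. Wt \<delta> u w - u w) - L2_inner g (\<lambda>w. cnj \<delta> * p w - \<delta> * q w)"
      by (rule L2_inner_diff2[OF L2_diff[OF Wt_L2[OF L(1)] L(1)] L2_diff[OF L2_cmult[OF L(2)] L2_cmult[OF L(3)]] g])
    also have "\<dots> = (L2_inner g (Wt \<delta> u) - L2_inner g u) - (L2_inner g (\<lambda>w. cnj \<delta> * p w) - L2_inner g (\<lambda>w. \<delta> * q w))"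
      by (simp only: L2_inner_diff2[OF Wt_L2[OF L(1)] L(1) g] L2_inner_diff2[OF L2_cmult[OF L(2)] L2_cmult[OF L(3)] g])
    also have "\<dots> = L2_inner g (Wt \<delta> u) - L2_inner g u - (L2_inner g p * \<delta> + - L2_inner g q * cnj \<delta>)"
      unfolding L2_inner_cmult2 by simp
    finally have "L2_inner g (Wt \<delta> u) - L2_inner g u - (L2_inner g p * \<delta> + - L2_inner g q * cnj \<delta>)
       = L2_inner g (\<lambda>w. Wt \<delta> u w - u w - (cnj \<delta> * p w - \<delta> * q w))" by simp
    moreover have "norm (L2_inner g (\<lambda>w. Wt \<delta> u w - u w - (cnj \<delta> * p w - \<delta> * q w))) \<le> L2_norm g * (K * (norm \<delta>)\<^sup>2)"
      using L2_cauchy_schwarz[OF g egrow_L2[OF egR[of \<delta>]]] mult_left_mono[OF K(2)[OF d] L2_norm_nonneg[of g]] by linarith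
    ultimately show ?thesis by (simp only: mult.assoc)
  qed
  then show ?thesis by blast
qed

text \<open>Since \<open>fock n\<close> is Weyl-invariant, the induction hypothesis makes the inner
  product of \<open>g\<close> with \<open>Wt \<delta> (Efun n i)\<close> zero for all
  \<open>\<delta>\<close>. Its linear term in \<open>\<delta>\<close> contains
  \<open>Efun n (Suc i)\<close>.\<close>

lemma Efun_orth_fock: "g \<in> fock n \<Longrightarrow> L2_inner g (Efun n i) = 0"
proof (induction i arbitrary: g)
  case 0
  then show ?case using fock_orth_cnj_power by (simp add: Efun_0)
next
  case (Suc i)
  have gL: "g \<in> L2" by (rule fock_L2[OF Suc.prems])
  have EL: "Efun n j \<in> L2" for j by (rule egrow_L2[OF egrow_Efun])
  have z: "L2_inner g (Wt \<delta> (Efun n i)) = 0" for \<delta>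
    using L2_inner_Wt_right[OF gL EL, of \<delta> i] Suc.IH[OF Wt_fock[OF Suc.prems]] by simp
  obtain K where K: "\<And>\<delta>. norm \<delta> \<le> 1 \<Longrightarrow> norm (L2_inner g (Wt \<delta> (Efun n i)) - L2_inner g (Efun n i)
     - (L2_inner g (\<lambda>w. of_nat (Suc i) * Efun n (Suc i) w) * \<delta> + - L2_inner g (\<lambda>w. if i = 0 then 0 else Efun n (i - 1) w) * cnj \<delta>)) \<le> K * (norm \<delta>)\<^sup>2"
    using lad_inner[OF lad_Efun[of n i] gL] by blast
  have "- L2_inner g (\<lambda>w. of_nat (Suc i) * Efun n (Suc i) w) = 0"
  proof (rule linear_wirt_zero(1))
    show "norm (- L2_inner g (\<lambda>w. of_nat (Suc i) * Efun n (Suc i) w) * \<delta> + L2_inner g (\<lambda>w. if i = 0 then 0 else Efun n (i - 1) w) * cnj \<delta>)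
       \<le> K * (norm \<delta>)\<^sup>2" if "norm \<delta> \<le> 1" for \<delta>
      using K[OF that] unfolding z Suc.IH[OF Suc.prems] by (simp add: algebra_simps)
  qed
  then show ?case unfolding L2_inner_cmult2 by (simp del: of_nat_Suc)
qed

lemma Efun_true_fock: "Efun n i \<in> true_fock (Suc n)"
proof -
  have "L2_inner (Efun n i) g = 0" if "g \<in> fock n" for g
    using Efun_orth_fock[OF that, of i] L2_inner_cnj[of "Efun n i" g] by simp
  then show ?thesis by (simp add: true_fock_iff Efun_fock)
qed

interpretation inner_form: bounded_form L2 L2_inner 1
  by unfold_locales
    (auto simp: L2_inner_add1 L2_inner_add2 L2_inner_cmult1 L2_inner_cmult2 Wt_L2 L2_cauchy_schwarz)

text \<open>The Weyl operators preserve the inner product, so its symbol is constant with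
  \<open>dbar\<close> zero; \<open>sym_wirt\<close> reads this as the adjointness of creation and
  annihilation.\<close>

lemma lad_inner_adjoint:
  assumes lu: "lad u u1 u2" and lv: "lad v v1 v2"
  shows "L2_inner u1 v = L2_inner u v2"
proof -
  have L: "u \<in> L2" "u1 \<in> L2" "u2 \<in> L2" "v \<in> L2" "v1 \<in> L2" "v2 \<in> L2"
    using ladD[OF lu] ladD[OF lv] egrow_L2 by auto
  have s: "inner_form.sym f g z = L2_inner f g" if "f \<in> L2" "g \<in> L2" for f g z
    unfolding inner_form.sym_def by (rule L2_inner_Wt[OF that])
  have "wirt (inner_form.sym u v) (L2_inner u v1 - L2_inner u2 v) (L2_inner u1 v - L2_inner u v2) 0"
    using inner_form.sym_wirt[OF lu lv L, of 0] by (simp only: s L)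
  moreover have "inner_form.sym u v = (\<lambda>z. L2_inner u v)" using s L by auto
  ultimately have "L2_inner u1 v - L2_inner u v2 = 0"
    using wirtD(3) wirtD(3)[OF wirt_const] by metis
  then show ?thesis by simp
qed

lemma Efun_norm_step: "of_nat (Suc i) * L2_inner (Efun n (Suc i)) (Efun n (Suc i)) = L2_inner (Efun n i) (Efun n i)"
  using lad_inner_adjoint[OF lad_Efun[of n i] lad_Efun[of n "Suc i"]] by (simp add: L2_inner_cmult1 del: of_nat_Suc)

definition moment :: "nat \<Rightarrow> complex" where "moment j = L2_inner (\<lambda>w. cnj w ^ j) (\<lambda>w. cnj w ^ j)"

lemma L2_inner_monomials:
  "L2_inner (\<lambda>w. w * cnj w ^ j) (\<lambda>w. w * cnj w ^ j) = moment (Suc j)"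
  "j > 0 \<Longrightarrow> L2_inner (\<lambda>w. w * cnj w ^ j) (\<lambda>w. cnj w ^ (j - 1)) = moment j"
  "j > 0 \<Longrightarrow> L2_inner (\<lambda>w. cnj w ^ (j - 1)) (\<lambda>w. w * cnj w ^ j) = moment j"
  unfolding moment_def L2_inner_def
  by (simp add: mult_ac) (cases j; simp add: mult_ac)+

lemma Efun_1: "Efun j 1 w = w * cnj w ^ j - of_nat j * cnj w ^ (j - 1)"
  by (simp add: Efun_def)

text \<open>By \<open>Efun_norm_step\<close> the vectors \<open>Efun j 0\<close> and
  \<open>Efun j 1\<close> have the same norm; expanding the second one gives the recurrence. So the
  Gaussian moments come out algebraically, without polar coordinates. For \<open>j = 0\<close> the
  term at \<open>j - 1\<close> has coefficient 0.\<close>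

lemma moment_rec: "moment (Suc j) = of_nat (2 * j + 1) * moment j - of_nat (j * j) * moment (j - 1)"
proof -
  have L: "(\<lambda>w. w * cnj w ^ j) \<in> L2" "(\<lambda>w. cnj w ^ (j - 1)) \<in> L2"
    by (intro egrow_L2 egrow_mult egrow_power egrow_cnj egrow_id)+
  define b where "b = (\<lambda>w. of_nat j * cnj w ^ (j - 1) :: complex)"
  have b: "b \<in> L2" unfolding b_def by (rule L2_cmult[OF L(2)])
  have E1: "Efun j 1 = (\<lambda>w. w * cnj w ^ j - b w)" by (rule ext) (simp only: Efun_1 b_def)
  have "moment j = L2_inner (Efun j 1) (Efun j 1)"
    using Efun_norm_step[of 0 j] by (simp add: moment_def Efun_0)
  also have "\<dots> = moment (Suc j) - L2_inner (\<lambda>w. w * cnj w ^ j) b - (L2_inner b (\<lambda>w. w * cnj w ^ j) - L2_inner b b)"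
    unfolding E1 by (simp only: L2_inner_diff1[OF L(1) b L2_diff[OF L(1) b]] L2_inner_diff2[OF L(1) b L(1)] L2_inner_diff2[OF L(1) b b] L2_inner_monomials(1))
  also have "\<dots> = moment (Suc j) - of_nat j * moment j - (of_nat j * moment j - of_nat j * of_nat j * moment (j - 1))"
  proof (cases "j > 0")
    case True
    then show ?thesis
      unfolding b_def L2_inner_cmult1 L2_inner_cmult2 L2_inner_monomials(2)[OF True] L2_inner_monomials(3)[OF True]
      by (simp add: moment_def)
  next
    case False
    then show ?thesis by (simp add: b_def)
  qed
  finally show ?thesis by (simp add: algebra_simps)
qed

lemma moment_fact: "moment j = fact j"
proof (induction j rule: less_induct)
  case (less j)
  show ?case
  proof (cases j)
    case 0
    then show ?thesis by (simp add: moment_def L2_inner_def)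
  next
    case (Suc i)
    show ?thesis
    proof (cases i)
      case 0
      then show ?thesis using less[of 0] Suc moment_rec[of 0] by simp
    next
      case (Suc l)
      have "moment i = fact i" "moment l = fact l" using less \<open>j = Suc i\<close> Suc by auto
      then have "moment j = of_nat (2 * i + 1) * fact i - of_nat (i * i) * fact l"
        using moment_rec[of i] \<open>j = Suc i\<close> Suc by simp
      also have "\<dots> = fact (Suc i)"
        unfolding Suc by (simp add: algebra_simps)
      finally show ?thesis using \<open>j = Suc i\<close> by simp
    qed
  qed
qed

lemma Efun_norm: "L2_inner (Efun n i) (Efun n i) = fact n / fact i"
proof (induction i)
  case 0
  then show ?case using moment_fact[of n] by (simp add: moment_def Efun_0)
next
  case (Suc i)
  have "of_nat (Suc i) * L2_inner (Efun n (Suc i)) (Efun n (Suc i)) = fact n / fact i"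
    using Efun_norm_step[of i n] Suc by simp
  then show ?case by (simp add: field_simps del: of_nat_Suc)
qed

section \<open>The kernel at the origin and the reproducing property\<close>

definition K0 :: "nat \<Rightarrow> complex \<Rightarrow> complex" where
  "K0 n w = of_real (laguerre0 n ((norm w)\<^sup>2))"

lemma nkernel_Wt: "nkernel (Suc n) z = Wt z (K0 n)"
  by (simp add: nkernel_def Wt_def K0_def fun_eq_iff)

lemma K0_radpoly: "K0 n = radpoly (Suc n) (\<lambda>j. (-1) ^ j * of_nat (n choose (n - j)) / fact j)"
proof
  fix w :: complex
  have "cnj w ^ j * w ^ j = complex_of_real (((norm w)\<^sup>2) ^ j)" for j
  proof -
    have "cnj w * w = complex_of_real ((norm w)\<^sup>2)" using complex_norm_square[of w] by (simp add: mult.commute)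
    then show ?thesis by (metis of_real_power power_mult_distrib)
  qed
  then show "K0 n w = radpoly (Suc n) (\<lambda>j. (-1) ^ j * of_nat (n choose (n - j)) / fact j) w"
    unfolding K0_def laguerre0_def radpoly_def lessThan_Suc_atMost by (simp only: of_real_sum) simp
qed

text \<open>\<open>Efun n n\<close> is the radial member of the basis, so it has to be the kernel at
  the origin up to a factor; reversing the order of summation identifies the sign.\<close>

lemma K0_Efun: "K0 n w = (-1) ^ n * Efun n n w"
proof -
  have "Efun n n w = (\<Sum>j\<le>n. ((-1) ^ (n - j) * of_nat (n choose (n - j)) / fact j) * (cnj w ^ j * w ^ j))"
    unfolding Efun_def by (subst sum.nat_diff_reindex[symmetric, of _ "Suc n", unfolded lessThan_Suc_atMost]) (auto intro!: sum.cong)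
  then have "(-1) ^ n * Efun n n w = (\<Sum>j\<le>n. ((-1) ^ n * (-1) ^ (n - j)) * (of_nat (n choose (n - j)) / fact j) * (cnj w ^ j * w ^ j))"
    by (simp add: sum_distrib_left mult.assoc)
  also have "\<dots> = (\<Sum>j\<le>n. ((-1) ^ j * of_nat (n choose (n - j)) / fact j) * (cnj w ^ j * w ^ j))"
  proof (rule sum.cong)
    fix j assume "j \<in> {..n}"
    then have "n + (n - j) = j + 2 * (n - j)" by auto
    then have "(-1 :: complex) ^ n * (-1) ^ (n - j) = (-1) ^ j"
      by (metis minus_one_power_iff even_add even_mult_iff even_numeral power_add)
    then show "((-1) ^ n * (-1) ^ (n - j)) * (of_nat (n choose (n - j)) / fact j) * (cnj w ^ j * w ^ j)
       = ((-1) ^ j * of_nat (n choose (n - j)) / fact j) * (cnj w ^ j * w ^ j)" by simp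
  qed simp
  finally show ?thesis unfolding K0_radpoly radpoly_def lessThan_Suc_atMost by simp
qed

lemma K0_true_fock: "K0 n \<in> true_fock (Suc n)"
proof -
  have "K0 n = (\<lambda>w. (-1) ^ n * Efun n n w)" by (rule ext) (rule K0_Efun)
  then show ?thesis using true_fock_cmult[OF Efun_true_fock, of "(-1) ^ n" n n] by simp
qed

lemma egrow_K0: "egrow (K0 n)"
  unfolding K0_radpoly by (rule egrow_radpoly)

lemma K0_norm: "L2_inner (K0 n) (K0 n) = 1"
proof -
  have "K0 n = (\<lambda>w. (-1) ^ n * Efun n n w)" by (rule ext) (rule K0_Efun)
  then have "L2_inner (K0 n) (K0 n) = ((-1) ^ n * cnj ((-1) ^ n)) * L2_inner (Efun n n) (Efun n n)"
    by (simp only: L2_inner_cmult1 L2_inner_cmult2 mult.assoc)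
  then show ?thesis by (simp add: Efun_norm power_mult_distrib[symmetric])
qed

lemma radpoly_sub: "radpoly n (\<lambda>j. c j - g * d j) w = radpoly n c w - g * radpoly n d w"
  by (simp add: radpoly_def algebra_simps sum_subtractf sum_distrib_left)

text \<open>Only the radial part of \<open>u\<close> matters. Subtracting the multiple
  \<open>g\<close> of \<open>K0 n\<close> that cancels its top coefficient leaves a radial
  polynomial \<open>r\<close> in \<open>fock n\<close>. The radial part and \<open>K0 n\<close> both
  pair to zero with \<open>r\<close>, so \<open>r\<close> is orthogonal to itself and vanishes.
  Hence the radial part is \<open>g * K0 n\<close>, and evaluation at 0 gives
  \<open>g = u 0\<close>.\<close>

lemma reproducing_zero:
  assumes u: "u \<in> true_fock (Suc n)"
  shows "L2_inner u (K0 n) = u 0"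
proof -
  obtain c where c: "u 0 = c 0" "\<And>m d. L2_inner u (radpoly m d) = L2_inner (radpoly (Suc n) c) (radpoly m d)"
    using radial_part[OF true_fock_fock[OF u]] by blast
  define \<kappa> where "\<kappa> j = (-1) ^ j * of_nat (n choose (n - j)) / (fact j :: complex)" for j
  have K: "K0 n = radpoly (Suc n) \<kappa>" unfolding K0_radpoly \<kappa>_def ..
  have \<kappa>: "\<kappa> n \<noteq> 0" "\<kappa> 0 = 1" by (simp_all add: \<kappa>_def)
  define g where "g = c n / \<kappa> n"
  define r where "r = radpoly n (\<lambda>j. c j - g * \<kappa> j)"
  have r: "r w = radpoly (Suc n) c w - g * K0 n w" for w
  proof -
    have S: "radpoly (Suc n) d w = radpoly n d w + d n * (cnj w ^ n * w ^ n)" for d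
      by (simp add: radpoly_def)
    have "c n = g * \<kappa> n" using \<kappa>(1) by (simp add: g_def)
    then show ?thesis unfolding K r_def radpoly_sub S by (simp add: algebra_simps)
  qed
  have rf: "r \<in> fock n" unfolding r_def by (rule radpoly_fock)
  have cL: "radpoly (Suc n) c \<in> L2" by (rule egrow_L2[OF egrow_radpoly])
  have KL: "K0 n \<in> L2" by (rule egrow_L2[OF egrow_K0])
  have "L2_inner r r = L2_inner (\<lambda>w. radpoly (Suc n) c w - g * K0 n w) r"
    using r by (simp add: L2_inner_def)
  also have "\<dots> = L2_inner (radpoly (Suc n) c) r - g * L2_inner (K0 n) r"
    by (simp only: L2_inner_diff1[OF cL L2_cmult[OF KL] fock_L2[OF rf]] L2_inner_cmult1)
  also have "L2_inner (radpoly (Suc n) c) r = L2_inner u r"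
    unfolding r_def c(2) ..
  also have "L2_inner u r = 0" by (rule true_fock_orth[OF u rf])
  also have "L2_inner (K0 n) r = 0" by (rule true_fock_orth[OF K0_true_fock rf])
  finally have "L2_norm r = 0" by (simp add: L2_inner_self)
  then have r0: "r w = 0" for w
    using continuous_AE_zero[OF smooth_continuous[OF fock_smooth[OF rf]] L2_norm_eq_0[OF fock_L2[OF rf]]] by blast
  have cK: "radpoly (Suc n) c = (\<lambda>w. g * K0 n w)" using r r0 by (simp add: fun_eq_iff)
  have "c 0 = g" using fun_cong[OF cK, of 0] unfolding K radpoly_0 \<kappa> by simp
  moreover have "L2_inner u (K0 n) = L2_inner (radpoly (Suc n) c) (K0 n)"
    unfolding K c(2) ..
  moreover have "\<dots> = g" unfolding cK L2_inner_cmult1 K0_norm by simp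
  ultimately show ?thesis using c(1) by simp
qed

lemma nkernel_true_fock: "nkernel (Suc n) z \<in> true_fock (Suc n)"
  unfolding nkernel_Wt by (rule Wt_true_fock[OF K0_true_fock])

lemma nkernel_egrow: "egrow (nkernel (Suc n) z)"
  unfolding nkernel_Wt by (rule Wt_egrow[OF egrow_K0])

lemma nkernel_L2: "nkernel (Suc n) z \<in> L2"
  by (rule egrow_L2[OF nkernel_egrow])

lemma nkernel_norm: "L2_norm (nkernel (Suc n) z) = 1"
proof -
  have "complex_of_real ((L2_norm (nkernel (Suc n) z))\<^sup>2) = 1"
    unfolding L2_inner_self[symmetric] nkernel_Wt L2_inner_Wt[OF egrow_L2[OF egrow_K0] egrow_L2[OF egrow_K0]] by (rule K0_norm)
  then have "(L2_norm (nkernel (Suc n) z))\<^sup>2 = 1" by (metis of_real_1 of_real_eq_iff)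
  then show ?thesis using L2_norm_nonneg[of "nkernel (Suc n) z"] by (simp add: power2_eq_1_iff)
qed

lemma reproducing:
  assumes u: "u \<in> true_fock (Suc n)"
  shows "L2_inner u (nkernel (Suc n) z) = u z * exp (- of_real ((norm z)\<^sup>2 / 2))"
proof -
  have "L2_inner u (nkernel (Suc n) z) = L2_inner (Wt (- z) u) (K0 n)"
    unfolding nkernel_Wt by (rule L2_inner_Wt_right[OF true_fock_L2[OF u] egrow_L2[OF egrow_K0]])
  also have "\<dots> = Wt (- z) u 0" by (rule reproducing_zero[OF Wt_true_fock[OF u]])
  finally show ?thesis by (simp add: Wt_def)
qed

lemma fock_orth_nkernel: "g \<in> fock n \<Longrightarrow> L2_inner g (nkernel (Suc n) z) = 0"
  using true_fock_orth[OF nkernel_true_fock, of g n z] L2_inner_cnj[of g "nkernel (Suc n) z"] by simp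

text \<open>The exponential removes the normalization contained in \<open>Wt\<close>. With it
  \<open>coef n g 0\<close> is entire, \<open>dbar\<close> lowers the index up to sign, and
  \<open>coef n g n\<close> is up to sign the projection of \<open>g\<close>
  (\<open>fproj_coef\<close>).\<close>

definition coef :: "nat \<Rightarrow> (complex \<Rightarrow> complex) \<Rightarrow> nat \<Rightarrow> complex \<Rightarrow> complex" where
  "coef n g i z = exp (of_real ((norm z)\<^sup>2 / 2)) * L2_inner g (Wt z (Efun n i))"

lemma of_real_norm_square_add:
  "complex_of_real ((norm (z + \<delta>))\<^sup>2 / 2) = of_real ((norm z)\<^sup>2 / 2) + of_real ((norm \<delta>)\<^sup>2 / 2) + (z * cnj \<delta> + cnj z * \<delta>) / 2"
proof -
  have "complex_of_real ((norm (z + \<delta>))\<^sup>2) = (z + \<delta>) * cnj (z + \<delta>)"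
    by (rule complex_norm_square)
  also have "\<dots> = z * cnj z + \<delta> * cnj \<delta> + (z * cnj \<delta> + cnj z * \<delta>)"
    by (simp add: algebra_simps)
  also have "\<dots> = of_real ((norm z)\<^sup>2) + of_real ((norm \<delta>)\<^sup>2) + (z * cnj \<delta> + cnj z * \<delta>)"
    by (simp only: complex_norm_square)
  finally show ?thesis by (simp add: field_simps)
qed

text \<open>Recentred at \<open>z\<close>, the coefficient is a constant times
  \<open>exp (cnj z * \<delta> + \<delta> * cnj \<delta> / 2)\<close> times an inner product
  expanded by \<open>lad_inner\<close>. The exponential contributes \<open>cnj z\<close> to the
  first derivative and nothing to \<open>dbar\<close>, because
  \<open>\<delta> * cnj \<delta>\<close> is of second order.\<close>

lemma coef_wirt:
  assumes g: "g \<in> L2"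
  shows "wirt (coef n g i) (of_nat (Suc i) * coef n g (Suc i) z + cnj z * coef n g i z)
    (- (if i = 0 then 0 else coef n g (i - 1) z)) z"
proof -
  let ?E = "Efun n i"
  have EL: "Efun n j \<in> L2" for j by (rule egrow_L2[OF egrow_Efun])
  define g' where "g' = Wt (- z) g"
  have g'L: "g' \<in> L2" unfolding g'_def by (rule Wt_L2[OF g])
  have g': "L2_inner g (Wt z f) = L2_inner g' f" if "f \<in> L2" for f
    unfolding g'_def by (rule L2_inner_Wt_right[OF g that])
  define ch where "ch \<delta> = L2_inner g' (Wt \<delta> ?E)" for \<delta>
  define p where "p = L2_inner g' (\<lambda>w. of_nat (Suc i) * Efun n (Suc i) w)"
  define q where "q = L2_inner g' (\<lambda>w. if i = 0 then 0 else Efun n (i - 1) w)"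
  obtain K where K: "\<And>\<delta>. norm \<delta> \<le> 1 \<Longrightarrow> norm (ch \<delta> - L2_inner g' ?E - (p * \<delta> + - q * cnj \<delta>)) \<le> K * (norm \<delta>)\<^sup>2"
    using lad_inner[OF lad_Efun[of n i] g'L] unfolding ch_def p_def q_def by blast
  have ch0: "ch 0 = L2_inner g' ?E" by (simp add: ch_def)
  have wc: "wirt ch p (- q) 0"
    by (rule wirtI_second_order[where K = K]) (use K in \<open>simp add: ch0\<close>)
  let ?C = "exp (complex_of_real ((norm z)\<^sup>2 / 2))"
  have eq: "coef n g i (z + \<delta>) = ?C * (exp (cnj z * \<delta> + \<delta> * cnj \<delta> / 2) * ch \<delta>)" for \<delta>
  proof -
    define c where "c = exp (of_real (Im (z * cnj \<delta>)) * - \<i>)"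
    have W: "Wt z (Wt \<delta> ?E) = (\<lambda>w. c * Wt (z + \<delta>) ?E w)"
      unfolding c_def by (rule ext) (rule Wt_Wt)
    have "ch \<delta> = L2_inner g (Wt z (Wt \<delta> ?E))"
      unfolding ch_def by (rule g'[symmetric, OF Wt_L2[OF EL]])
    also have "\<dots> = cnj c * L2_inner g (Wt (z + \<delta>) ?E)"
      unfolding W L2_inner_cmult2 ..
    finally have ch: "ch \<delta> = cnj c * L2_inner g (Wt (z + \<delta>) ?E)" .
    have ib: "of_real (Im (z * cnj \<delta>)) * \<i> = (z * cnj \<delta> - cnj z * \<delta>) / 2"
      by (simp add: complex_eq_iff)
    have cc: "cnj c = exp ((z * cnj \<delta> - cnj z * \<delta>) / 2)"
      unfolding c_def exp_cnj ib[symmetric] by simp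
    have nd: "\<delta> * cnj \<delta> / 2 = complex_of_real ((norm \<delta>)\<^sup>2 / 2)"
      by (simp only: complex_norm_square[symmetric] of_real_divide of_real_numeral)
    have "?C * (exp (cnj z * \<delta> + \<delta> * cnj \<delta> / 2) * cnj c) = exp (of_real ((norm z)\<^sup>2 / 2) + (cnj z * \<delta> + \<delta> * cnj \<delta> / 2 + (z * cnj \<delta> - cnj z * \<delta>) / 2))"
      unfolding cc by (simp only: exp_add)
    also have "of_real ((norm z)\<^sup>2 / 2) + (cnj z * \<delta> + \<delta> * cnj \<delta> / 2 + (z * cnj \<delta> - cnj z * \<delta>) / 2) = complex_of_real ((norm (z + \<delta>))\<^sup>2 / 2)"
      unfolding of_real_norm_square_add nd by (simp add: field_simps)
    finally have "?C * (exp (cnj z * \<delta> + \<delta> * cnj \<delta> / 2) * cnj c) = exp (of_real ((norm (z + \<delta>))\<^sup>2 / 2))" .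
    then show ?thesis unfolding coef_def ch by (simp only: mult.assoc[symmetric])
  qed
  have we: "wirt (\<lambda>\<delta>. exp (cnj z * \<delta> + \<delta> * cnj \<delta> / 2)) (cnj z) 0 0"
  proof -
    have "wirt (\<lambda>\<delta>. cnj z * \<delta> + (1/2) * (\<delta> * cnj \<delta>)) (cnj z * 1 + (1/2) * (1 * cnj 0 + 0 * 0)) (cnj z * 0 + (1/2) * (0 * cnj 0 + 0 * 1)) 0"
      by (intro wirt_add wirt_cmult wirt_mult wirt_id)
    then have "((\<lambda>\<delta>. cnj z * \<delta> + (1/2) * (\<delta> * cnj \<delta>)) has_derivative (\<lambda>\<delta>. cnj z * \<delta>)) (at 0)"
      by (simp add: wirt_def)
    from has_derivative_compose[OF this DERIV_exp[of "cnj z * 0 + (1/2) * (0 * cnj 0)", unfolded has_field_derivative_def]]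
    show ?thesis by (simp add: wirt_def)
  qed
  have "wirt (\<lambda>\<delta>. coef n g i (z + \<delta>)) (?C * (cnj z * ch 0 + exp (cnj z * 0 + 0 * cnj 0 / 2) * p)) (?C * (0 * ch 0 + exp (cnj z * 0 + 0 * cnj 0 / 2) * - q)) 0"
    unfolding eq by (intro wirt_cmult wirt_mult we wc)
  then have "wirt (\<lambda>\<delta>. coef n g i (z + \<delta>)) (?C * (cnj z * ch 0 + p)) (?C * - q) (z - z)"
    by simp
  from wirt_translate[OF this] have "wirt (coef n g i) (?C * (cnj z * ch 0 + p)) (?C * - q) z"
    by simp
  moreover have "?C * p = of_nat (Suc i) * coef n g (Suc i) z"
    unfolding p_def coef_def g'[OF EL] L2_inner_cmult2 by simp
  moreover have "?C * q = (if i = 0 then 0 else coef n g (i - 1) z)"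
    unfolding q_def coef_def g'[OF EL] by simp
  moreover have "?C * ch 0 = coef n g i z" unfolding ch0 coef_def g'[OF EL] ..
  ultimately show ?thesis by (simp add: distrib_left mult.left_commute add.commute del: of_nat_Suc)
qed

lemma coef_smooth: "g \<in> L2 \<Longrightarrow> smooth (coef n g i)"
proof (rule smoothI)
  assume g: "g \<in> L2"
  show "Ck N (coef n g i)" for N
  proof (induction N arbitrary: i)
    case 0
    have "coef n g i differentiable (at z)" for z
      by (rule wirtD(1)[OF coef_wirt[OF g]])
    then show ?case by (auto intro!: differentiable_imp_continuous_on simp: differentiable_on_def)
  next
    case (Suc N)
    show ?case
    proof (rule Ck_SucI'[OF coef_wirt[OF g]])
      show "Ck N (\<lambda>z. of_nat (Suc i) * coef n g (Suc i) z + cnj z * coef n g i z)"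
        by (intro Ck_add Ck_cmult Ck_mult Suc.IH smoothD[OF smooth_cnj_id])
      show "Ck N (\<lambda>z. - (if i = 0 then 0 else coef n g (i - 1) z))"
        using Ck_cmult[OF Suc.IH, of "-1" "i - 1"] Ck_const[of N 0] by (cases "i = 0") simp_all
    qed
  qed
qed

lemma coef_dbar: "g \<in> L2 \<Longrightarrow> (dbar ^^ Suc i) (coef n g i) = (\<lambda>z. 0)"
proof (induction i)
  case 0
  then show ?case using wirt_funD(2)[OF coef_wirt[OF 0], of n 0] by simp
next
  case (Suc i)
  have "dbar (coef n g (Suc i)) = (\<lambda>z. (-1) * coef n g i z)"
    using wirt_funD(2)[OF coef_wirt[OF Suc.prems], of n "Suc i"] by simp
  then have "(dbar ^^ Suc (Suc i)) (coef n g (Suc i)) = (dbar ^^ Suc i) (\<lambda>z. (-1) * coef n g i z)"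
    by (subst funpow_Suc_right) simp
  also have "\<dots> = (\<lambda>z. (-1) * (dbar ^^ Suc i) (coef n g i) z)"
    by (rule dbar_pow_cmult[OF coef_smooth[OF Suc.prems]])
  finally show ?case using Suc by simp
qed

text \<open>The projection as an integral operator; the exponential turns the normalized kernel into
  the reproducing one. Agreement with \<open>fock_proj\<close> on \<open>L2\<close> is
  \<open>fock_proj_eq\<close>.\<close>

definition fproj :: "nat \<Rightarrow> (complex \<Rightarrow> complex) \<Rightarrow> complex \<Rightarrow> complex" where
  "fproj n g z = exp (of_real ((norm z)\<^sup>2 / 2)) * L2_inner g (nkernel (Suc n) z)"

lemma fproj_coef: "fproj n g = (\<lambda>z. (-1) ^ n * coef n g n z)"
proof
  fix z
  have "K0 n = (\<lambda>w. (-1) ^ n * Efun n n w)" by (rule ext) (rule K0_Efun)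
  then have "nkernel (Suc n) z = (\<lambda>w. (-1) ^ n * Wt z (Efun n n) w)" by (simp only: nkernel_Wt Wt_cmult)
  then show "fproj n g z = (-1) ^ n * coef n g n z"
    unfolding fproj_def coef_def by (simp only: L2_inner_cmult2) simp
qed

lemma fproj_smooth: "g \<in> L2 \<Longrightarrow> smooth (fproj n g)"
  unfolding fproj_coef by (intro smooth_cmult coef_smooth)

lemma fproj_dbar: "g \<in> L2 \<Longrightarrow> (dbar ^^ Suc n) (fproj n g) = (\<lambda>z. 0)"
  unfolding fproj_coef by (simp only: dbar_pow_cmult[OF coef_smooth] coef_dbar mult_zero_right)

lemma fproj_true_fock: "u \<in> true_fock (Suc n) \<Longrightarrow> fproj n u = u"
  unfolding fproj_def by (rule ext) (simp add: reproducing exp_minus)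

lemma fproj_fock: "u \<in> fock n \<Longrightarrow> fproj n u = (\<lambda>z. 0)"
  unfolding fproj_def by (simp add: fock_orth_nkernel)

section \<open>Schur's test and the Toeplitz operators\<close>

lemma weyl_exponent: "Re (w * cnj z) - (norm z)\<^sup>2 / 2 = (norm w)\<^sup>2 / 2 - (norm (w - z))\<^sup>2 / 2"
  unfolding cmod_power2 by (simp add: field_simps power2_eq_square)

lemma norm_Wt: "norm (Wt z g w) = norm (g (w - z)) * exp ((norm w)\<^sup>2 / 2 - (norm (w - z))\<^sup>2 / 2)"
proof -
  have "Re (w * cnj z - of_real ((norm z)\<^sup>2 / 2)) = Re (w * cnj z) - (norm z)\<^sup>2 / 2" by simp
  then show ?thesis unfolding Wt_def norm_mult norm_exp_eq_Re weyl_exponent by (simp only:)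
qed

text \<open>Half of the off-diagonal Gaussian decay is given up to absorb the Laguerre factor, which
  turns the denominator 2 into 4.\<close>

lemma nkernel_bound: "\<exists>C\<ge>0. \<forall>z w. norm (nkernel (Suc n) z w) \<le> C * exp ((norm w)\<^sup>2 / 2 - (norm (w - z))\<^sup>2 / 4)"
proof -
  obtain C where C: "C \<ge> 0" "\<And>w. norm (K0 n w) \<le> C * exp (C * norm w)"
    using egrow_K0[of n] unfolding egrow_def by blast
  have "norm (nkernel (Suc n) z w) \<le> (C * exp (C\<^sup>2)) * exp ((norm w)\<^sup>2 / 2 - (norm (w - z))\<^sup>2 / 4)" for z w
  proof -
    have "0 \<le> (C - norm (w - z) / 2)\<^sup>2" by simp
    then have q: "C * norm (w - z) \<le> C\<^sup>2 + (norm (w - z))\<^sup>2 / 4"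
      by (simp add: power2_eq_square algebra_simps)
    have "norm (nkernel (Suc n) z w) \<le> (C * exp (C * norm (w - z))) * exp ((norm w)\<^sup>2 / 2 - (norm (w - z))\<^sup>2 / 2)"
      unfolding nkernel_Wt norm_Wt using C by (intro mult_right_mono) auto
    also have "\<dots> = C * exp (C * norm (w - z) + ((norm w)\<^sup>2 / 2 - (norm (w - z))\<^sup>2 / 2))"
      by (simp only: exp_add mult.assoc)
    also have "\<dots> \<le> C * exp (C\<^sup>2 + ((norm w)\<^sup>2 / 2 - (norm (w - z))\<^sup>2 / 4))"
      using q C(1) by (intro mult_left_mono) auto
    finally show ?thesis by (simp only: exp_add mult.assoc)
  qed
  then show ?thesis using C(1) by (intro exI[of _ "C * exp (C\<^sup>2)"]) auto
qed

text \<open>Cauchy-Schwarz for the measure with density \<open>\<kappa> z\<close>, then Fubini.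
  Working in \<open>ennreal\<close> postpones all questions of integrability until the bound is
  known.\<close>

lemma schur_test:
  fixes \<kappa> :: "complex \<Rightarrow> complex \<Rightarrow> ennreal"
  assumes \<kappa> [measurable]: "case_prod \<kappa> \<in> borel_measurable (borel \<Otimes>\<^sub>M borel)" and [measurable]: "U \<in> borel_measurable borel"
    and A: "\<And>z. (\<integral>\<^sup>+w. \<kappa> z w \<partial>lborel) \<le> A" and B: "\<And>w. (\<integral>\<^sup>+z. \<kappa> z w \<partial>lborel) \<le> B"
  shows "(\<integral>\<^sup>+z. (\<integral>\<^sup>+w. \<kappa> z w * U w \<partial>lborel)\<^sup>2 \<partial>lborel) \<le> A * (B * (\<integral>\<^sup>+w. (U w)\<^sup>2 \<partial>lborel))"
proof -
  have m1: "\<kappa> z \<in> borel_measurable borel" for z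
    using measurable_compose[OF measurable_Pair1'[of z borel borel] \<kappa>] by simp
  have m2: "(\<lambda>z. \<kappa> z w) \<in> borel_measurable borel" for w
    using measurable_compose[OF measurable_Pair2'[of w borel borel] \<kappa>] by simp
  note [measurable] = m1 m2
  have cs: "(\<integral>\<^sup>+w. \<kappa> z w * U w \<partial>lborel)\<^sup>2 \<le> A * (\<integral>\<^sup>+w. \<kappa> z w * (U w)\<^sup>2 \<partial>lborel)" for z
  proof -
    have "(\<integral>\<^sup>+w. 1 * U w \<partial>density lborel (\<kappa> z))\<^sup>2
        \<le> (\<integral>\<^sup>+w. 1\<^sup>2 \<partial>density lborel (\<kappa> z)) * (\<integral>\<^sup>+w. (U w)\<^sup>2 \<partial>density lborel (\<kappa> z))"
      by (rule Cauchy_Schwarz_nn_integral) auto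
    then have "(\<integral>\<^sup>+w. \<kappa> z w * U w \<partial>lborel)\<^sup>2 \<le> (\<integral>\<^sup>+w. \<kappa> z w \<partial>lborel) * (\<integral>\<^sup>+w. \<kappa> z w * (U w)\<^sup>2 \<partial>lborel)"
      by (simp add: nn_integral_density emeasure_density)
    also have "\<dots> \<le> A * (\<integral>\<^sup>+w. \<kappa> z w * (U w)\<^sup>2 \<partial>lborel)"
      by (intro mult_right_mono A) simp
    finally show ?thesis .
  qed
  have "(\<integral>\<^sup>+z. (\<integral>\<^sup>+w. \<kappa> z w * U w \<partial>lborel)\<^sup>2 \<partial>lborel) \<le> (\<integral>\<^sup>+z. A * (\<integral>\<^sup>+w. \<kappa> z w * (U w)\<^sup>2 \<partial>lborel) \<partial>lborel)"
    by (intro nn_integral_mono cs)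
  also have "\<dots> = A * (\<integral>\<^sup>+z. \<integral>\<^sup>+w. \<kappa> z w * (U w)\<^sup>2 \<partial>lborel \<partial>lborel)"
    by (rule nn_integral_cmult) measurable
  also have "(\<integral>\<^sup>+z. \<integral>\<^sup>+w. \<kappa> z w * (U w)\<^sup>2 \<partial>lborel \<partial>lborel) = (\<integral>\<^sup>+w. \<integral>\<^sup>+z. \<kappa> z w * (U w)\<^sup>2 \<partial>lborel \<partial>lborel)"
    by (rule lborel_pair.Fubini'[symmetric]) measurable
  also have "\<dots> = (\<integral>\<^sup>+w. (\<integral>\<^sup>+z. \<kappa> z w \<partial>lborel) * (U w)\<^sup>2 \<partial>lborel)"
    by (intro nn_integral_cong nn_integral_multc) measurable
  also have "\<dots> \<le> (\<integral>\<^sup>+w. B * (U w)\<^sup>2 \<partial>lborel)"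
    by (intro nn_integral_mono mult_right_mono B) simp
  also have "\<dots> = B * (\<integral>\<^sup>+w. (U w)\<^sup>2 \<partial>lborel)"
    by (rule nn_integral_cmult) measurable
  finally show ?thesis by (simp add: mult_left_mono)
qed

lemma exp_half_square: "exp (- (norm (z::complex))\<^sup>2) = (exp (- ((norm z)\<^sup>2 / 2)))\<^sup>2"
  unfolding exp_double[symmetric] by simp

lemma nn_norm_gauss:
  assumes h: "h \<in> borel_measurable borel"
  shows "(\<integral>\<^sup>+z. ennreal ((norm (h z))\<^sup>2) \<partial>gauss) = ennreal (1 / pi) * (\<integral>\<^sup>+z. (ennreal (norm (h z) * exp (- ((norm z)\<^sup>2 / 2))))\<^sup>2 \<partial>lborel)"
proof -
  note [measurable] = h
  have e: "ennreal (exp (- (norm z)\<^sup>2) / pi) * ennreal ((norm (h z))\<^sup>2) = ennreal (1 / pi) * (ennreal (norm (h z) * exp (- ((norm z)\<^sup>2 / 2))))\<^sup>2" for z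
  proof -
    have 1: "ennreal (exp (- (norm z)\<^sup>2) / pi) * ennreal ((norm (h z))\<^sup>2) = ennreal (exp (- (norm z)\<^sup>2) / pi * (norm (h z))\<^sup>2)"
      by (rule ennreal_mult''[symmetric]) (rule zero_le_power2)
    have 2: "exp (- (norm z)\<^sup>2) / pi * (norm (h z))\<^sup>2 = 1 / pi * (norm (h z) * exp (- ((norm z)\<^sup>2 / 2)))\<^sup>2"
      unfolding exp_half_square power_mult_distrib by simp
    have 3: "ennreal (1 / pi * (norm (h z) * exp (- ((norm z)\<^sup>2 / 2)))\<^sup>2) = ennreal (1 / pi) * ennreal ((norm (h z) * exp (- ((norm z)\<^sup>2 / 2)))\<^sup>2)"
      by (rule ennreal_mult'') (rule zero_le_power2)
    have 4: "ennreal ((norm (h z) * exp (- ((norm z)\<^sup>2 / 2)))\<^sup>2) = (ennreal (norm (h z) * exp (- ((norm z)\<^sup>2 / 2))))\<^sup>2"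
      by (rule ennreal_power[symmetric]) (intro mult_nonneg_nonneg norm_ge_zero exp_ge_zero)
    show ?thesis unfolding 1 2 3 4 ..
  qed
  have "(\<integral>\<^sup>+z. ennreal ((norm (h z))\<^sup>2) \<partial>gauss) = (\<integral>\<^sup>+z. ennreal (exp (- (norm z)\<^sup>2) / pi) * ennreal ((norm (h z))\<^sup>2) \<partial>lborel)"
    by (rule nn_integral_gauss) measurable
  also have "\<dots> = (\<integral>\<^sup>+z. ennreal (1 / pi) * (ennreal (norm (h z) * exp (- ((norm z)\<^sup>2 / 2))))\<^sup>2 \<partial>lborel)"
    unfolding e ..
  also have "\<dots> = ennreal (1 / pi) * (\<integral>\<^sup>+z. (ennreal (norm (h z) * exp (- ((norm z)\<^sup>2 / 2))))\<^sup>2 \<partial>lborel)"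
    by (rule nn_integral_cmult) measurable
  finally show ?thesis .
qed

lemma L2I_nn:
  assumes h: "h \<in> borel_measurable borel" and le: "(\<integral>\<^sup>+z. ennreal ((norm (h z))\<^sup>2) \<partial>gauss) \<le> ennreal (M\<^sup>2)" and M: "M \<ge> 0"
  shows "h \<in> L2" "L2_norm h \<le> M"
proof -
  have hm: "h \<in> borel_measurable gauss" unfolding measurable_gauss by (rule h)
  have i: "integrable gauss (\<lambda>z. (norm (h z))\<^sup>2)"
  proof (rule integrableI_nonneg)
    show "(\<lambda>z. (norm (h z))\<^sup>2) \<in> borel_measurable gauss" using hm by measurable
    show "(\<integral>\<^sup>+z. ennreal ((norm (h z))\<^sup>2) \<partial>gauss) < \<infinity>"
      by (rule le_less_trans[OF le]) simp
    show "AE z in gauss. 0 \<le> (norm (h z))\<^sup>2" by (rule AE_I2) (rule zero_le_power2)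
  qed
  show "h \<in> L2" unfolding L2_def using hm i by blast
  have "(\<integral>\<^sup>+z. ennreal ((norm (h z))\<^sup>2) \<partial>gauss) = ennreal ((L2_norm h)\<^sup>2)"
    unfolding L2_norm_square by (rule nn_integral_eq_integral[OF i]) (rule AE_I2, rule zero_le_power2)
  then have "ennreal ((L2_norm h)\<^sup>2) \<le> ennreal (M\<^sup>2)" using le by (simp only:)
  then have "(L2_norm h)\<^sup>2 \<le> M\<^sup>2" by (subst (asm) ennreal_le_iff) (rule zero_le_power2)
  then show "L2_norm h \<le> M" using M by (rule power2_le_imp_le)
qed

lemma nn_L2_norm: "g \<in> L2 \<Longrightarrow> (\<integral>\<^sup>+z. ennreal ((norm (g z))\<^sup>2) \<partial>gauss) = ennreal ((L2_norm g)\<^sup>2)"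
  unfolding L2_norm_square by (rule nn_integral_eq_integral[OF L2D(2)]) (assumption, rule AE_I2, rule zero_le_power2)

text \<open>The factor \<open>exp (- ((norm z)\<^sup>2 / 2))\<close> passes from the Gaussian to
  Lebesgue measure, where the kernels at hand are bounded by Gaussians in
  \<open>w - z\<close>.\<close>

lemma schur_gauss:
  fixes \<kappa> :: "complex \<Rightarrow> complex \<Rightarrow> ennreal"
  assumes g: "g \<in> L2" and h: "h \<in> borel_measurable borel"
    and \<kappa>: "case_prod \<kappa> \<in> borel_measurable (borel \<Otimes>\<^sub>M borel)"
    and le: "\<And>z. ennreal (norm (h z) * exp (- ((norm z)\<^sup>2 / 2))) \<le> (\<integral>\<^sup>+w. \<kappa> z w * ennreal (norm (g w) * exp (- ((norm w)\<^sup>2 / 2))) \<partial>lborel)"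
    and A: "\<And>z. (\<integral>\<^sup>+w. \<kappa> z w \<partial>lborel) \<le> ennreal A" and B: "\<And>w. (\<integral>\<^sup>+z. \<kappa> z w \<partial>lborel) \<le> ennreal B"
    and AB: "A \<ge> 0" "B \<ge> 0"
  shows "h \<in> L2" "L2_norm h \<le> sqrt (A * B) * L2_norm g"
proof -
  note [measurable] = L2_measurable[OF g]
  define U where "U = (\<lambda>w. ennreal (norm (g w) * exp (- ((norm w)\<^sup>2 / 2))))"
  define I where "I = (\<integral>\<^sup>+w. (U w)\<^sup>2 \<partial>lborel)"
  have U: "U \<in> borel_measurable borel" unfolding U_def by measurable
  have 1: "(\<integral>\<^sup>+z. (ennreal (norm (h z) * exp (- ((norm z)\<^sup>2 / 2))))\<^sup>2 \<partial>lborel) \<le> (\<integral>\<^sup>+z. (\<integral>\<^sup>+w. \<kappa> z w * U w \<partial>lborel)\<^sup>2 \<partial>lborel)"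
    unfolding U_def by (intro nn_integral_mono power_mono le zero_le)
  have 2: "(\<integral>\<^sup>+z. (\<integral>\<^sup>+w. \<kappa> z w * U w \<partial>lborel)\<^sup>2 \<partial>lborel) \<le> ennreal A * (ennreal B * I)"
    unfolding I_def by (rule schur_test[OF \<kappa> U A B])
  have 3: "(\<integral>\<^sup>+z. ennreal ((norm (h z))\<^sup>2) \<partial>gauss) \<le> ennreal (1 / pi) * (ennreal A * (ennreal B * I))"
    unfolding nn_norm_gauss[OF h] by (rule mult_left_mono[OF order_trans[OF 1 2] zero_le])
  have 4: "ennreal (1 / pi) * I = ennreal ((L2_norm g)\<^sup>2)"
    unfolding I_def U_def nn_L2_norm[OF g, symmetric] nn_norm_gauss[OF L2_measurable[OF g]] ..
  have 5: "ennreal (1 / pi) * (ennreal A * (ennreal B * I)) = ennreal A * (ennreal B * (ennreal (1 / pi) * I))"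
    by (rule trans[OF mult.left_commute]) (rule arg_cong[where f = "times (ennreal A)"], rule mult.left_commute)
  have 6: "ennreal A * (ennreal B * ennreal ((L2_norm g)\<^sup>2)) = ennreal (A * (B * (L2_norm g)\<^sup>2))"
    unfolding ennreal_mult''[OF zero_le_power2, symmetric]
    by (rule ennreal_mult'[OF AB(1), symmetric])
  have 7: "A * (B * (L2_norm g)\<^sup>2) = (sqrt (A * B) * L2_norm g)\<^sup>2"
    unfolding power_mult_distrib using AB by simp
  have le2: "(\<integral>\<^sup>+z. ennreal ((norm (h z))\<^sup>2) \<partial>gauss) \<le> ennreal ((sqrt (A * B) * L2_norm g)\<^sup>2)"
    using 3 unfolding 5 4 6 7 .
  have M: "0 \<le> sqrt (A * B) * L2_norm g" using AB L2_norm_nonneg by (intro mult_nonneg_nonneg) auto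
  show "h \<in> L2" by (rule L2I_nn(1)[OF h le2 M])
  show "L2_norm h \<le> sqrt (A * B) * L2_norm g" by (rule L2I_nn(2)[OF h le2 M])
qed

lemma laguerre0_measurable [measurable]: "laguerre0 m \<in> borel_measurable borel"
  unfolding laguerre0_def[abs_def] by (intro borel_measurable_continuous_onI continuous_intros) simp

lemma nkernel_joint [measurable (raw)]:
  assumes [measurable]: "f \<in> borel_measurable M" "g \<in> borel_measurable M"
  shows "(\<lambda>x. nkernel k (f x) (g x)) \<in> borel_measurable M"
  unfolding nkernel_def by measurable

lemma nn_integral_gaussian_shift:
  "a > 0 \<Longrightarrow> (\<integral>\<^sup>+w. ennreal (exp (- (a * (norm (w - z :: complex))\<^sup>2))) \<partial>lborel) = ennreal (pi / a)"
  using nn_integral_translate[of "\<lambda>w. ennreal (exp (- (a * (norm (w :: complex))\<^sup>2)))" "- z"] nn_integral_gaussian_scaled[of a]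
  by simp

text \<open>Fixes one constant for each \<open>n\<close>, so that later estimates can name
  it.\<close>

definition kbound :: "nat \<Rightarrow> real" where
  "kbound n = (SOME C. C \<ge> 0 \<and> (\<forall>z w. norm (nkernel (Suc n) z w) \<le> C * exp ((norm w)\<^sup>2 / 2 - (norm (w - z))\<^sup>2 / 4)))"

lemma kbound: "kbound n \<ge> 0" "norm (nkernel (Suc n) z w) \<le> kbound n * exp ((norm w)\<^sup>2 / 2 - (norm (w - z))\<^sup>2 / 4)"
  using someI_ex[OF nkernel_bound[unfolded Bex_def, of n]] unfolding kbound_def[symmetric] by blast+

text \<open>The constant is the integral of
  \<open>kbound n / pi * exp (- (1/4 * (norm y)\<^sup>2))\<close>, as the Gaussian alone gives
  \<open>4 * pi\<close>. The majorant is symmetric, so rows and columns have the same bound.\<close>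

lemma kernel_L2_bound:
  assumes g: "g \<in> L2" and h: "h \<in> borel_measurable borel"
    and le: "\<And>z. ennreal (norm (h z) * exp (- ((norm z)\<^sup>2 / 2))) \<le> (\<integral>\<^sup>+w. ennreal (norm (g w) * norm (nkernel (Suc n) z w)) \<partial>gauss)"
  shows "h \<in> L2" "L2_norm h \<le> 4 * kbound n * L2_norm g"
proof -
  note [measurable] = L2_measurable[OF g]
  let ?\<kappa> = "\<lambda>z w :: complex. ennreal (kbound n / pi) * ennreal (exp (- (1/4 * (norm (w - z))\<^sup>2)))"
  have m: "case_prod ?\<kappa> \<in> borel_measurable (borel \<Otimes>\<^sub>M borel)" by measurable
  have i1: "(\<integral>\<^sup>+w. ?\<kappa> z w \<partial>lborel) \<le> ennreal (4 * kbound n)" for z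
    using kbound(1)[of n] by (subst nn_integral_cmult, simp, subst nn_integral_gaussian_shift) (auto simp: ennreal_mult[symmetric])
  have i2: "(\<integral>\<^sup>+z. ?\<kappa> z w \<partial>lborel) \<le> ennreal (4 * kbound n)" for w
    using i1[of w] by (simp add: norm_minus_commute)
  have pt: "ennreal (exp (- (norm w)\<^sup>2) / pi) * ennreal (norm (g w) * norm (nkernel (Suc n) z w))
     \<le> ?\<kappa> z w * ennreal (norm (g w) * exp (- ((norm w)\<^sup>2 / 2)))" for z w
  proof -
    have "exp (- (norm w)\<^sup>2) / pi * (norm (g w) * norm (nkernel (Suc n) z w))
      \<le> exp (- (norm w)\<^sup>2) / pi * (norm (g w) * (kbound n * exp ((norm w)\<^sup>2 / 2 - (norm (w - z))\<^sup>2 / 4)))"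
      by (intro mult_left_mono kbound) auto
    also have "\<dots> = kbound n / pi * (exp (- (norm w)\<^sup>2) * exp ((norm w)\<^sup>2 / 2 - (norm (w - z))\<^sup>2 / 4)) * norm (g w)"
      by simp
    also have "exp (- (norm w)\<^sup>2) * exp ((norm w)\<^sup>2 / 2 - (norm (w - z))\<^sup>2 / 4) = exp (- (1/4 * (norm (w - z))\<^sup>2)) * exp (- ((norm w)\<^sup>2 / 2))"
      by (simp add: exp_add[symmetric])
    finally have "exp (- (norm w)\<^sup>2) / pi * (norm (g w) * norm (nkernel (Suc n) z w))
       \<le> (kbound n / pi * exp (- (1/4 * (norm (w - z))\<^sup>2))) * (norm (g w) * exp (- ((norm w)\<^sup>2 / 2)))"
      by (simp only: mult_ac)
    then show ?thesis using kbound(1)[of n]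
      by (simp only: ennreal_mult''[symmetric] exp_ge_zero norm_ge_zero mult_nonneg_nonneg) (rule ennreal_leI)
  qed
  have le': "ennreal (norm (h z) * exp (- ((norm z)\<^sup>2 / 2))) \<le> (\<integral>\<^sup>+w. ?\<kappa> z w * ennreal (norm (g w) * exp (- ((norm w)\<^sup>2 / 2))) \<partial>lborel)" for z
  proof -
    have "ennreal (norm (h z) * exp (- ((norm z)\<^sup>2 / 2))) \<le> (\<integral>\<^sup>+w. ennreal (exp (- (norm w)\<^sup>2) / pi) * ennreal (norm (g w) * norm (nkernel (Suc n) z w)) \<partial>lborel)"
      using le[of z] by (subst (asm) nn_integral_gauss) auto
    also have "\<dots> \<le> (\<integral>\<^sup>+w. ?\<kappa> z w * ennreal (norm (g w) * exp (- ((norm w)\<^sup>2 / 2))) \<partial>lborel)"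
      by (intro nn_integral_mono pt)
    finally show ?thesis .
  qed
  have k0: "0 \<le> 4 * kbound n" using kbound(1) by simp
  show "h \<in> L2" by (rule schur_gauss(1)[OF g h m le' i1 i2 k0 k0])
  have "L2_norm h \<le> sqrt ((4 * kbound n) * (4 * kbound n)) * L2_norm g"
    by (rule schur_gauss(2)[OF g h m le' i1 i2 k0 k0])
  then show "L2_norm h \<le> 4 * kbound n * L2_norm g"
    using k0 unfolding real_sqrt_abs2 by (simp only: abs_of_nonneg)
qed

lemma nn_L2_inner: "f \<in> L2 \<Longrightarrow> g \<in> L2 \<Longrightarrow> ennreal (norm (L2_inner f g)) \<le> (\<integral>\<^sup>+w. ennreal (norm (f w) * norm (g w)) \<partial>gauss)"
  unfolding L2_inner_def using integral_norm_bound_ennreal[OF L2_mult_integrable(1)[of f g]] by (simp add: norm_mult)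

lemma norm_fproj: "norm (fproj n g z) * exp (- ((norm z)\<^sup>2 / 2)) = norm (L2_inner g (nkernel (Suc n) z))"
  unfolding fproj_def norm_mult norm_exp_eq_Re by (simp add: exp_minus)

lemma fproj_L2:
  assumes g: "g \<in> L2"
  shows "fproj n g \<in> L2" "L2_norm (fproj n g) \<le> 4 * kbound n * L2_norm g"
proof -
  have m: "fproj n g \<in> borel_measurable borel"
    by (rule borel_measurable_continuous_onI[OF smooth_continuous[OF fproj_smooth[OF g]]])
  show "fproj n g \<in> L2" "L2_norm (fproj n g) \<le> 4 * kbound n * L2_norm g"
    using kernel_L2_bound[OF g m] nn_L2_inner[OF g nkernel_L2] unfolding norm_fproj by auto
qed

lemma nkernel_hermitian:
  "exp (of_real ((norm z)\<^sup>2 / 2)) * nkernel k z w = cnj (exp (of_real ((norm w)\<^sup>2 / 2)) * nkernel k w z)"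
proof -
  have *: "exp (of_real ((norm z)\<^sup>2 / 2)) * nkernel k z w = of_real (laguerre0 (k - 1) ((norm (w - z))\<^sup>2)) * exp (w * cnj z)" for z w
    unfolding nkernel_def by (simp add: exp_diff)
  have "cnj (exp (z * cnj w)) = exp (w * cnj z)" unfolding exp_cnj by (simp add: mult.commute)
  then show ?thesis unfolding * by (simp add: norm_minus_commute)
qed

lemma fproj_adjoint:
  assumes g: "g \<in> L2" and u: "u \<in> L2"
  shows "L2_inner (fproj n g) u = L2_inner g (fproj n u)"
proof -
  interpret P: pair_sigma_finite gauss gauss ..
  note [measurable] = L2_measurable[OF g] L2_measurable[OF u]
  define K where "K z w = exp (of_real ((norm z)\<^sup>2 / 2)) * nkernel (Suc n) z w" for z w :: complex
  have K_herm: "cnj (K z w) = K w z" for z w unfolding K_def using nkernel_hermitian[of w "Suc n" z] by simp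
  have Km [measurable]: "(\<lambda>x. K (f x) (h x)) \<in> borel_measurable M" if "f \<in> borel_measurable M" "h \<in> borel_measurable M" for f h and M :: "'a measure"
    unfolding K_def using that by measurable
  have fp: "fproj n v z = (LINT w|gauss. v w * cnj (K z w))" for v z
    unfolding fproj_def K_def L2_inner_def by (subst integral_mult_right_zero[symmetric]) (simp add: mult_ac exp_cnj)
  \<comment> \<open>The integral operator applied to moduli. That \<open>H\<close> lies in
    \<open>L2\<close> makes the double integral absolutely convergent, and Fubini with the hermitian
    kernel \<open>K\<close> finishes the proof.\<close>
  define H where "H z = (LINT w|gauss. norm (g w) * norm (K z w))" for z
  have H0: "H z \<ge> 0" for z unfolding H_def by (intro Bochner_Integration.integral_nonneg) auto
  have KL: "K z \<in> L2" for z unfolding K_def[abs_def] by (rule L2_cmult[OF nkernel_L2])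
  have Hm [measurable]: "H \<in> borel_measurable borel"
    unfolding H_def by measurable
  have Hn: "ennreal (norm (complex_of_real (H z)) * exp (- ((norm z)\<^sup>2 / 2))) \<le> (\<integral>\<^sup>+w. ennreal (norm (g w) * norm (nkernel (Suc n) z w)) \<partial>gauss)" for z
  proof -
    have "H z = (LINT w|gauss. exp ((norm z)\<^sup>2 / 2) * (norm (g w) * norm (nkernel (Suc n) z w)))"
      unfolding H_def K_def norm_mult norm_exp_eq_Re by (simp add: mult.left_commute)
    also have "\<dots> = exp ((norm z)\<^sup>2 / 2) * (LINT w|gauss. norm (g w) * norm (nkernel (Suc n) z w))"
      by (rule integral_mult_right_zero)
    finally have Hz: "H z = exp ((norm z)\<^sup>2 / 2) * (LINT w|gauss. norm (g w) * norm (nkernel (Suc n) z w))" .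
    have "norm (complex_of_real (H z)) * exp (- ((norm z)\<^sup>2 / 2)) = H z * exp (- ((norm z)\<^sup>2 / 2))"
      using H0[of z] unfolding norm_of_real by simp
    also have "\<dots> = (LINT w|gauss. norm (g w) * norm (nkernel (Suc n) z w))"
      unfolding Hz by (simp add: exp_minus)
    finally have "norm (complex_of_real (H z)) * exp (- ((norm z)\<^sup>2 / 2)) = (LINT w|gauss. norm (g w) * norm (nkernel (Suc n) z w))" .
    then show ?thesis using nn_integral_eq_integral[OF L2_mult_integrable(2)[OF g nkernel_L2[of n z]]] by simp
  qed
  have HL: "(\<lambda>z. complex_of_real (H z)) \<in> L2"
    by (rule kernel_L2_bound(1)[OF g _ Hn]) measurable
  define F where "F z w = (g w * cnj (K z w)) * cnj (u z)" for z w
  have Fm [measurable]: "case_prod F \<in> borel_measurable (gauss \<Otimes>\<^sub>M gauss)"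
    unfolding F_def[abs_def] by measurable
  have "integrable (gauss \<Otimes>\<^sub>M gauss) (case_prod F)"
  proof (rule P.Fubini_integrable)
    have "(LINT w|gauss. norm (F z w)) = norm (u z) * norm (complex_of_real (H z))" for z
      unfolding F_def H_def norm_mult using H0[of z, unfolded H_def] by (simp add: abs_of_nonneg mult.commute)
    then show "integrable gauss (\<lambda>z. LINT w|gauss. norm (case (z, w) of (x, xa) \<Rightarrow> F x xa))"
      using L2_mult_integrable(2)[OF u HL] by simp
    show "AE z in gauss. integrable gauss (\<lambda>w. case (z, w) of (x, xa) \<Rightarrow> F x xa)"
      unfolding F_def using L2_mult_integrable(1)[OF g KL] by simp
  qed simp
  then have "(LINT w|gauss. LINT z|gauss. F z w) = (LINT z|gauss. LINT w|gauss. F z w)"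
    by (rule P.Fubini_integral)
  moreover have "(LINT w|gauss. F z w) = fproj n g z * cnj (u z)" for z
    unfolding F_def fp by simp
  moreover have "(LINT z|gauss. F z w) = g w * cnj (fproj n u w)" for w
  proof -
    have "(LINT z|gauss. F z w) = (LINT z|gauss. g w * cnj (u z * cnj (K w z)))"
      unfolding F_def by (simp add: K_herm mult_ac)
    also have "\<dots> = g w * cnj (LINT z|gauss. u z * cnj (K w z))"
      unfolding integral_mult_right_zero Bochner_Integration.integral_cnj ..
    finally show ?thesis unfolding fp .
  qed
  ultimately show ?thesis unfolding L2_inner_def by simp
qed

text \<open>\<open>fproj n\<close> annihilates \<open>fock n\<close>, so by adjointness its range is
  orthogonal to \<open>fock n\<close>.\<close>

lemma fproj_in:
  assumes g: "g \<in> L2" shows "fproj n g \<in> true_fock (Suc n)"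
proof -
  have "L2_inner (fproj n g) u = 0" if "u \<in> fock n" for u
    using fproj_adjoint[OF g fock_L2[OF that], of n] fproj_fock[OF that] by simp
  moreover have "fproj n g \<in> fock (Suc n)"
    unfolding fock_def using fproj_L2(1)[OF g] fproj_smooth[OF g] fproj_dbar[OF g] by blast
  ultimately show ?thesis by (simp add: true_fock_iff)
qed

lemma fproj_inner: "g \<in> L2 \<Longrightarrow> u \<in> true_fock (Suc n) \<Longrightarrow> L2_inner (fproj n g) u = L2_inner g u"
  by (simp add: fproj_adjoint true_fock_L2 fproj_true_fock)

section \<open>The projection, Toeplitz operators and their forms\<close>

lemma true_fock_zero_norm: "u \<in> true_fock (Suc n) \<Longrightarrow> L2_norm u = 0 \<Longrightarrow> u = (\<lambda>z. 0)"
  using continuous_AE_zero[OF true_fock_continuous L2_norm_eq_0[OF true_fock_L2]] by blast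

text \<open>Uniqueness for the description operator: the difference of two candidates lies in the
  space and is orthogonal to itself, and norm zero means zero at every point there.\<close>

lemma fock_proj_eq:
  assumes g: "g \<in> L2"
  shows "fock_proj (Suc n) g = fproj n g"
  unfolding fock_proj_def
proof (rule the_equality)
  note P = fproj_in[OF g, of n]
  show "fproj n g \<in> true_fock (Suc n) \<and> (\<forall>u\<in>true_fock (Suc n). L2_inner (\<lambda>z. g z - fproj n g z) u = 0)"
    using P by (simp add: L2_inner_diff1 g true_fock_L2 fproj_inner)
  fix h assume h: "h \<in> true_fock (Suc n) \<and> (\<forall>u\<in>true_fock (Suc n). L2_inner (\<lambda>z. g z - h z) u = 0)"
  define d where "d = (\<lambda>z. h z - fproj n g z)"
  have d: "d \<in> true_fock (Suc n)" unfolding d_def using h P by (simp add: true_fock_diff)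
  have "L2_inner d d = L2_inner h d - L2_inner (fproj n g) d"
    using L2_inner_diff1[OF true_fock_L2[OF conjunct1[OF h]] true_fock_L2[OF P] true_fock_L2[OF d]] unfolding d_def .
  also have "L2_inner (fproj n g) d = L2_inner g d" by (rule fproj_inner[OF g d])
  also have "L2_inner h d - L2_inner g d = 0"
  proof -
    have "L2_inner g d - L2_inner h d = L2_inner (\<lambda>z. g z - h z) d"
      using h by (subst L2_inner_diff1) (auto simp: g true_fock_L2 true_fock_L2[OF d])
    also have "\<dots> = 0" using h d by blast
    finally show ?thesis by simp
  qed
  finally have "L2_norm d = 0" by (simp add: L2_inner_self)
  from true_fock_zero_norm[OF d this] show "h = fproj n g" unfolding d_def by (simp add: fun_eq_iff)
qed

lemma Linfty_bound:
  assumes "f \<in> Linfty"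
  obtains C where "C \<ge> 0" "AE w in gauss. norm (f w) \<le> C" "f \<in> borel_measurable borel"
proof -
  from assms obtain C where C: "AE w in lborel. norm (f w) \<le> C" and m: "f \<in> borel_measurable borel"
    by (auto simp: Linfty_def)
  have "AE w in gauss. norm (f w) \<le> max C 0"
    using AE_gaussI[OF C] by eventually_elim auto
  with m show ?thesis by (intro that[of "max C 0"]) auto
qed

lemma mult_L2:
  assumes C: "C \<ge> 0" "AE w in gauss. norm (f w) \<le> C" and [measurable]: "f \<in> borel_measurable borel" and u: "u \<in> L2"
  shows "(\<lambda>w. f w * u w) \<in> L2" "L2_norm (\<lambda>w. f w * u w) \<le> C * L2_norm u"
proof -
  note [measurable] = L2_measurable[OF u]
  have le: "AE w in gauss. norm (f w * u w) \<le> C * norm (u w)"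
    using C(2) by eventually_elim (simp add: norm_mult mult_right_mono)
  show L: "(\<lambda>w. f w * u w) \<in> L2"
    by (rule L2_bound[OF u _ le]) measurable
  have "(LINT w|gauss. (norm (f w * u w))\<^sup>2) \<le> (LINT w|gauss. (C * norm (u w))\<^sup>2)"
  proof (rule integral_mono_AE)
    show "AE w in gauss. (norm (f w * u w))\<^sup>2 \<le> (C * norm (u w))\<^sup>2"
      using le by eventually_elim (auto intro: power_mono)
  qed (use L2D(2)[OF L] L2D(2)[OF u] in \<open>auto simp: power_mult_distrib\<close>)
  also have "\<dots> = (C * L2_norm u)\<^sup>2" by (simp add: power_mult_distrib L2_norm_square)
  finally have "(L2_norm (\<lambda>w. f w * u w))\<^sup>2 \<le> (C * L2_norm u)\<^sup>2" unfolding L2_norm_square .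
  then show "L2_norm (\<lambda>w. f w * u w) \<le> C * L2_norm u"
    by (rule power2_le_imp_le) (simp add: C)
qed

lemma mult_Linfty_L2: "f \<in> Linfty \<Longrightarrow> u \<in> L2 \<Longrightarrow> (\<lambda>w. f w * u w) \<in> L2"
  by (erule Linfty_bound) (rule mult_L2)

lemma toeplitz_eq: "f \<in> Linfty \<Longrightarrow> u \<in> L2 \<Longrightarrow> toeplitz (Suc n) f u = fproj n (\<lambda>w. f w * u w)"
  unfolding toeplitz_def by (rule fock_proj_eq) (rule mult_Linfty_L2)

lemma toeplitz_inner:
  "f \<in> Linfty \<Longrightarrow> u \<in> L2 \<Longrightarrow> v \<in> true_fock (Suc n) \<Longrightarrow> L2_inner (toeplitz (Suc n) f u) v = L2_inner (\<lambda>w. f w * u w) v"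
  by (simp add: toeplitz_eq fproj_inner mult_Linfty_L2)

lemma fproj_add: "g \<in> L2 \<Longrightarrow> h \<in> L2 \<Longrightarrow> fproj n (\<lambda>w. g w + h w) = (\<lambda>z. fproj n g z + fproj n h z)"
  unfolding fproj_def by (rule ext) (simp add: L2_inner_add1 nkernel_L2 distrib_left)

lemma fproj_cmult: "fproj n (\<lambda>w. c * g w) = (\<lambda>z. c * fproj n g z)"
  unfolding fproj_def by (rule ext) (simp add: L2_inner_cmult1 mult.left_commute)

lemma toeplitz_bounded: 
  assumes f: "f \<in> Linfty"
  shows "toeplitz (Suc n) f \<in> bounded_ops (Suc n)"
proof -
  obtain C where C: "C \<ge> 0" "AE w in gauss. norm (f w) \<le> C" "f \<in> borel_measurable borel"
    using Linfty_bound[OF f] by blast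
  note L = true_fock_L2 mult_Linfty_L2[OF f true_fock_L2]
  have "L2_norm (toeplitz (Suc n) f u) \<le> (4 * kbound n * C) * L2_norm u" if u: "u \<in> true_fock (Suc n)" for u
  proof -
    have "L2_norm (toeplitz (Suc n) f u) \<le> 4 * kbound n * L2_norm (\<lambda>w. f w * u w)"
      unfolding toeplitz_eq[OF f L(1)[OF u]] by (rule fproj_L2(2)[OF L(2)[OF u]])
    also have "\<dots> \<le> 4 * kbound n * (C * L2_norm u)"
      using mult_L2(2)[OF C L(1)[OF u]] kbound(1)[of n] by (intro mult_left_mono) auto
    finally show ?thesis by (simp add: mult.assoc)
  qed
  moreover have "toeplitz (Suc n) f (\<lambda>z. u z + v z) = (\<lambda>z. toeplitz (Suc n) f u z + toeplitz (Suc n) f v z)"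
    if "u \<in> true_fock (Suc n)" "v \<in> true_fock (Suc n)" for u v
    using that by (simp add: toeplitz_eq f L L2_add distrib_left fproj_add)
  moreover have "toeplitz (Suc n) f (\<lambda>z. c * u z) = (\<lambda>z. c * toeplitz (Suc n) f u z)"
    if "u \<in> true_fock (Suc n)" for u c
    using that by (simp add: toeplitz_eq f L L2_cmult fproj_cmult[symmetric] mult.left_commute)
  moreover have "toeplitz (Suc n) f u \<in> true_fock (Suc n)" if "u \<in> true_fock (Suc n)" for u
    using that by (simp add: toeplitz_eq f L fproj_in)
  ultimately show ?thesis unfolding bounded_ops_def by blast
qed

text \<open>The form lives on all of \<open>L2\<close> and not just on one true Fock space, because
  powers of \<open>cnj w\<close> of every order serve as test vectors in
  \<open>smom_wirt\<close>.\<close>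

lemma mult_form:
  assumes f: "f \<in> Linfty"
  shows "\<exists>M. bounded_form L2 (\<lambda>u v. L2_inner (\<lambda>w. f w * u w) v) M"
proof -
  obtain C where C: "C \<ge> 0" "AE w in gauss. norm (f w) \<le> C" "f \<in> borel_measurable borel"
    using Linfty_bound[OF f] by blast
  have "bounded_form L2 (\<lambda>u v. L2_inner (\<lambda>w. f w * u w) v) C"
  proof
    fix u v h assume uv: "u \<in> L2" "v \<in> L2" "h \<in> L2"
    show "L2_inner (\<lambda>w. f w * (u w + v w)) h = L2_inner (\<lambda>w. f w * u w) h + L2_inner (\<lambda>w. f w * v w) h"
      unfolding distrib_left by (rule L2_inner_add1[OF mult_Linfty_L2[OF f uv(1)] mult_Linfty_L2[OF f uv(2)] uv(3)])
    show "L2_inner (\<lambda>w. f w * h w) (\<lambda>w. u w + v w) = L2_inner (\<lambda>w. f w * h w) u + L2_inner (\<lambda>w. f w * h w) v"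
      by (rule L2_inner_add2[OF uv(1,2) mult_Linfty_L2[OF f uv(3)]])
  next
    fix u h c assume "u \<in> L2" "h \<in> L2"
    show "L2_inner (\<lambda>w. f w * (c * u w)) h = c * L2_inner (\<lambda>w. f w * u w) h"
      unfolding mult.left_commute[of "f _" c] by (rule L2_inner_cmult1)
  next
    fix u v assume uv: "u \<in> L2" "v \<in> L2"
    have "norm (L2_inner (\<lambda>w. f w * u w) v) \<le> L2_norm (\<lambda>w. f w * u w) * L2_norm v"
      by (rule L2_cauchy_schwarz[OF mult_Linfty_L2[OF f uv(1)] uv(2)])
    also have "\<dots> \<le> C * L2_norm u * L2_norm v"
      by (intro mult_right_mono mult_L2 C uv) simp
    finally show "norm (L2_inner (\<lambda>w. f w * u w) v) \<le> C * L2_norm u * L2_norm v" .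
  qed (auto simp: Wt_L2 L2_inner_cmult2 C)
  then show ?thesis ..
qed

lemma op_form:
  assumes A: "A \<in> bounded_ops (Suc n)"
  shows "\<exists>M. bounded_form (true_fock (Suc n)) (\<lambda>u v. L2_inner (A u) v) M"
proof -
  from A have a1: "\<And>f. f \<in> true_fock (Suc n) \<Longrightarrow> A f \<in> true_fock (Suc n)"
    and a2: "\<And>f g. f \<in> true_fock (Suc n) \<Longrightarrow> g \<in> true_fock (Suc n) \<Longrightarrow> A (\<lambda>z. f z + g z) = (\<lambda>z. A f z + A g z)"
    and a3: "\<And>c f. f \<in> true_fock (Suc n) \<Longrightarrow> A (\<lambda>z. c * f z) = (\<lambda>z. c * A f z)"
    by (auto simp: bounded_ops_def)
  from A obtain C where C: "\<And>f. f \<in> true_fock (Suc n) \<Longrightarrow> L2_norm (A f) \<le> C * L2_norm f"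
    unfolding bounded_ops_def by blast
  have C': "L2_norm (A f) \<le> max C 0 * L2_norm f" if "f \<in> true_fock (Suc n)" for f
    using C[OF that] mult_right_mono[of C "max C 0" "L2_norm f"] by simp
  note L = true_fock_L2 true_fock_L2[OF a1]
  have "bounded_form (true_fock (Suc n)) (\<lambda>u v. L2_inner (A u) v) (max C 0)"
  proof
    fix u v assume uv: "u \<in> true_fock (Suc n)" "v \<in> true_fock (Suc n)"
    have "norm (L2_inner (A u) v) \<le> L2_norm (A u) * L2_norm v"
      by (rule L2_cauchy_schwarz) (use uv L in auto)
    also have "\<dots> \<le> max C 0 * L2_norm u * L2_norm v"
      by (intro mult_right_mono C' uv) simp
    finally show "norm (L2_inner (A u) v) \<le> max C 0 * L2_norm u * L2_norm v" .
  qed (auto simp: L a2 a3 L2_inner_add1 L2_inner_add2 L2_inner_cmult1 L2_inner_cmult2 true_fock_add true_fock_cmult Wt_true_fock)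
  then show ?thesis ..
qed

section \<open>Bounded sequences with pointwise limits\<close>

lemma L2_fatou:
  assumes u: "\<And>m::nat. u m \<in> L2" "\<And>m. L2_norm (u m) \<le> M" and lim: "\<And>z. (\<lambda>m. u m z) \<longlonglongrightarrow> v z"
  shows "v \<in> L2" "L2_norm v \<le> M"
proof -
  note [measurable] = L2_measurable[OF u(1)]
  have v [measurable]: "v \<in> borel_measurable borel"
    by (rule borel_measurable_LIMSEQ_metric[where f = u]) (use lim in auto)
  have M: "M \<ge> 0" using u(2)[of 0] L2_norm_nonneg[of "u 0"] by linarith
  have "(\<integral>\<^sup>+z. ennreal ((norm (v z))\<^sup>2) \<partial>gauss) = (\<integral>\<^sup>+z. liminf (\<lambda>m. ennreal ((norm (u m z))\<^sup>2)) \<partial>gauss)"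
  proof (rule nn_integral_cong)
    fix z
    have "(\<lambda>m. ennreal ((norm (u m z))\<^sup>2)) \<longlonglongrightarrow> ennreal ((norm (v z))\<^sup>2)"
      by (intro tendsto_ennrealI tendsto_power tendsto_norm lim)
    from lim_imp_Liminf[OF trivial_limit_sequentially this]
    show "ennreal ((norm (v z))\<^sup>2) = liminf (\<lambda>m. ennreal ((norm (u m z))\<^sup>2))" by (rule sym)
  qed
  also have "\<dots> \<le> liminf (\<lambda>m. \<integral>\<^sup>+z. ennreal ((norm (u m z))\<^sup>2) \<partial>gauss)"
    by (rule nn_integral_liminf) measurable
  also have "\<dots> \<le> liminf (\<lambda>m::nat. ennreal (M\<^sup>2))"
    by (intro Liminf_mono always_eventually allI) (auto simp: nn_L2_norm u intro!: ennreal_leI power_mono)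
  also have "\<dots> = ennreal (M\<^sup>2)" by (simp add: Liminf_const)
  finally show "v \<in> L2" "L2_norm v \<le> M" using L2I_nn[OF v _ M] by auto
qed

lemma true_fock_pointwise:
  assumes u: "u \<in> true_fock (Suc n)"
  shows "norm (u z) \<le> L2_norm u * exp ((norm z)\<^sup>2 / 2)"
proof -
  have "norm (u z) * exp (- ((norm z)\<^sup>2 / 2)) = norm (L2_inner u (nkernel (Suc n) z))"
    using norm_fproj[of n u z] unfolding fproj_true_fock[OF u] .
  also have "\<dots> \<le> L2_norm u" using L2_cauchy_schwarz[OF true_fock_L2[OF u] nkernel_L2[of n z]] by (simp add: nkernel_norm)
  finally have "norm (u z) * exp (- ((norm z)\<^sup>2 / 2)) * exp ((norm z)\<^sup>2 / 2) \<le> L2_norm u * exp ((norm z)\<^sup>2 / 2)"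
    by (intro mult_right_mono) auto
  then show ?thesis by (simp add: mult.assoc exp_add[symmetric])
qed

lemma integrable_gauss_growth:
  assumes [measurable]: "v \<in> borel_measurable borel" and a: "a < 1" and le: "\<And>w. norm (v w) \<le> C * exp (D * norm w + a * (norm (w::complex))\<^sup>2)"
  shows "integrable gauss (\<lambda>w. C * exp (D * norm w + a * (norm (w::complex))\<^sup>2))" "integrable gauss (v :: complex \<Rightarrow> complex)"
proof -
  define b where "b = (1 - a) / 2"
  have b: "b > 0" using a by (simp add: b_def)
  show *: "integrable gauss (\<lambda>w. C * exp (D * norm w + a * (norm (w::complex))\<^sup>2))"
  proof (intro integrable_mult_right, subst integrable_gauss_iff)
    show "integrable lborel (\<lambda>w::complex. (exp (- (norm w)\<^sup>2) / pi) *\<^sub>R exp (D * norm w + a * (norm w)\<^sup>2))"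
    proof (rule Bochner_Integration.integrable_bound)
      show "integrable lborel (\<lambda>w::complex. (exp (D\<^sup>2 / (4 * b)) / pi) * exp (- (b * (norm w)\<^sup>2)))"
        by (intro integrable_mult_right gaussian_scaled b)
      show "AE w in lborel. norm ((exp (- (norm w)\<^sup>2) / pi) *\<^sub>R exp (D * norm w + a * (norm w)\<^sup>2))
          \<le> norm ((exp (D\<^sup>2 / (4 * b)) / pi) * exp (- (b * (norm (w::complex))\<^sup>2)))"
      proof (rule AE_I2)
        fix w :: complex
        have "0 \<le> b * (norm w - D / (2 * b))\<^sup>2" using b by simp
        also have "\<dots> = b * (norm w)\<^sup>2 - D * norm w + D\<^sup>2 / (4 * b)"
          using b by (simp add: power2_eq_square field_simps)
        finally have "D * norm w \<le> b * (norm w)\<^sup>2 + D\<^sup>2 / (4 * b)" by simp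
        moreover have "a * (norm w)\<^sup>2 = (norm w)\<^sup>2 - 2 * (b * (norm w)\<^sup>2)" by (simp add: b_def field_simps)
        ultimately have "- (norm w)\<^sup>2 + (D * norm w + a * (norm w)\<^sup>2) \<le> D\<^sup>2 / (4 * b) + - (b * (norm w)\<^sup>2)" by linarith
        then have "exp (- (norm w)\<^sup>2) * exp (D * norm w + a * (norm w)\<^sup>2) \<le> exp (D\<^sup>2 / (4 * b)) * exp (- (b * (norm w)\<^sup>2))"
          by (simp add: exp_add[symmetric] del: exp_le_cancel_iff) simp
        then show "norm ((exp (- (norm w)\<^sup>2) / pi) *\<^sub>R exp (D * norm w + a * (norm w)\<^sup>2))
          \<le> norm ((exp (D\<^sup>2 / (4 * b)) / pi) * exp (- (b * (norm w)\<^sup>2)))"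
          by (simp add: divide_right_mono)
      qed
    qed measurable
  qed measurable
  show "integrable gauss v"
    by (rule Bochner_Integration.integrable_bound[OF *]) (use le order_trans[OF le abs_ge_self] in auto)
qed

text \<open>The reproducing property bounds elements of norm at most \<open>M\<close> by
  \<open>M * exp ((norm w)\<^sup>2 / 2)\<close>. This spends half of the Gaussian weight; the other
  half dominates the growth of \<open>e\<close>.\<close>

lemma weak_convergence:
  assumes u: "\<And>m::nat. u m \<in> true_fock (Suc n)" "\<And>m. L2_norm (u m) \<le> M" and lim: "\<And>z. (\<lambda>m. u m z) \<longlonglongrightarrow> v z"
    and e: "egrow e"
  shows "(\<lambda>m. L2_inner (u m) e) \<longlonglongrightarrow> L2_inner v e"
proof -
  note [measurable] = L2_measurable[OF true_fock_L2[OF u(1)]] egrow_measurable[OF e]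
  obtain C where C: "C \<ge> 0" "\<And>w. norm (e w) \<le> C * exp (C * norm w)"
    using e unfolding egrow_def by blast
  have [measurable]: "v \<in> borel_measurable borel"
    by (rule borel_measurable_LIMSEQ_metric[where f = u]) (use lim in auto)
  have M: "M \<ge> 0" using u(2)[of 0] L2_norm_nonneg[of "u 0"] by linarith
  let ?w = "\<lambda>w::complex. (M * C) * exp (C * norm w + 1/2 * (norm w)\<^sup>2)"
  have le: "norm (u m w * cnj (e w)) \<le> ?w w" for m w
  proof -
    have "norm (u m w * cnj (e w)) \<le> (M * exp ((norm w)\<^sup>2 / 2)) * (C * exp (C * norm w))"
      unfolding norm_mult complex_mod_cnj using true_fock_pointwise[OF u(1), of m w] u(2)[of m] C M
      by (intro mult_mono) (auto intro: order_trans mult_right_mono)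
    then show ?thesis by (simp add: exp_add mult_ac)
  qed
  show ?thesis
    unfolding L2_inner_def
  proof (rule integral_dominated_convergence[where w = ?w])
    show "integrable gauss ?w"
      by (rule integrable_gauss_growth(1)[of "\<lambda>_. 0"]) (use M C in auto)
    show "AE x in gauss. (\<lambda>m. u m x * cnj (e x)) \<longlonglongrightarrow> v x * cnj (e x)"
      by (intro AE_I2 tendsto_intros lim)
  qed (use le in auto)
qed

text \<open>The limit is in \<open>L2\<close> by Fatou and satisfies \<open>v = fproj n v\<close>,
  because the projection is a pairing with kernels and such pairings converge.\<close>

lemma true_fock_limit:
  assumes u: "\<And>m::nat. u m \<in> true_fock (Suc n)" "\<And>m. L2_norm (u m) \<le> M" and lim: "\<And>z. (\<lambda>m. u m z) \<longlonglongrightarrow> v z"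
  shows "v \<in> true_fock (Suc n)" "L2_norm v \<le> M"
proof -
  have v: "v \<in> L2" and M: "L2_norm v \<le> M"
    using L2_fatou[OF true_fock_L2[OF u(1)] u(2) lim] by auto
  show "L2_norm v \<le> M" by (rule M)
  have "v z = fproj n v z" for z
  proof -
    have "(\<lambda>m. fproj n (u m) z) \<longlonglongrightarrow> fproj n v z"
      unfolding fproj_def by (intro tendsto_mult tendsto_const weak_convergence[OF u lim nkernel_egrow])
    then have "(\<lambda>m. u m z) \<longlonglongrightarrow> fproj n v z" using fproj_true_fock[OF u(1)] by simp
    with lim show ?thesis by (rule LIMSEQ_unique)
  qed
  then have "v = fproj n v" by blast
  then show "v \<in> true_fock (Suc n)" using fproj_in[OF v, of n] by simp
qed

section \<open>Compact operators have vanishing Berezin transform\<close>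

abbreviation l2dist :: "(complex \<Rightarrow> complex) \<Rightarrow> (complex \<Rightarrow> complex) \<Rightarrow> real" where
  "l2dist f g \<equiv> L2_norm (\<lambda>z. f z - g z)"

lemma l2dist_triangle:
  assumes "f \<in> L2" "g \<in> L2" "h \<in> L2" shows "l2dist f h \<le> l2dist f g + l2dist g h"
  using L2_norm_triangle[OF L2_diff[OF assms(1,2)] L2_diff[OF assms(2,3)]] by simp

interpretation tf: Metric_space "true_fock (Suc n)" l2dist for n
proof
  fix f g h assume fgh: "f \<in> true_fock (Suc n)" "g \<in> true_fock (Suc n)" "h \<in> true_fock (Suc n)"
  show "l2dist f h \<le> l2dist f g + l2dist g h" by (rule l2dist_triangle) (use fgh true_fock_L2 in auto)
next
  fix f g assume fg: "f \<in> true_fock (Suc n)" "g \<in> true_fock (Suc n)"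
  show "l2dist f g = 0 \<longleftrightarrow> f = g"
    using true_fock_zero_norm[OF true_fock_diff[OF fg]] by (auto simp: fun_eq_iff)
qed (auto intro: L2_norm_uminus)

text \<open>Bolzano-Weierstrass speaks of limit points of infinite sets, so an injective sequence is
  taken: of two consecutive terms near the limit at least one differs from it.\<close>

lemma (in Metric_space) compact_closure_ofI:
  assumes SM: "S \<subseteq> M" and seq: "\<And>\<sigma>::nat \<Rightarrow> 'a. range \<sigma> \<subseteq> S \<Longrightarrow> \<exists>l r. strict_mono r \<and> limitin mtopology (\<sigma> \<circ> r) l sequentially"
  shows "compactin mtopology (mtopology closure_of S)"
  unfolding compact_closure_of_eq_Bolzano_Weierstrass
proof (intro allI impI)
  fix T assume T: "infinite T \<and> T \<subseteq> S \<and> T \<subseteq> M"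
  then obtain \<sigma> :: "nat \<Rightarrow> 'a" where \<sigma>: "inj \<sigma>" "range \<sigma> \<subseteq> T"
    using infinite_countable_subset[of T] by blast
  then obtain l r where r: "strict_mono r" and lim: "limitin mtopology (\<sigma> \<circ> r) l sequentially"
    using seq[of \<sigma>] T by blast
  have "\<exists>y\<in>T. y \<noteq> l \<and> y \<in> mball l e" if e: "e > 0" for e
  proof -
    from lim e have l: "l \<in> M" and "\<forall>\<^sub>F m in sequentially. \<sigma> (r m) \<in> M \<and> d (\<sigma> (r m)) l < e"
      by (auto simp: limitin_metric)
    then obtain N where N: "\<And>m. m \<ge> N \<Longrightarrow> \<sigma> (r m) \<in> M \<and> d (\<sigma> (r m)) l < e"
      by (auto simp: eventually_sequentially)
    have "\<sigma> (r N) \<noteq> \<sigma> (r (Suc N))"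
      using inj_eq[OF \<sigma>(1)] strict_mono_eq[OF r] by simp
    then obtain m where "m \<ge> N" "\<sigma> (r m) \<noteq> l" by (metis le_SucI order_refl)
    with N[of m] l \<sigma>(2) show ?thesis
      by (intro bexI[of _ "\<sigma> (r m)"]) (auto simp: commute)
  qed
  moreover have "l \<in> M" using lim by (auto simp: limitin_metric)
  ultimately show "mtopology derived_set_of T \<noteq> {}"
    unfolding metric_derived_set_of by blast
qed

lemma inner_nkernels: "L2_inner (nkernel (Suc n) z) (nkernel (Suc n) w) = nkernel (Suc n) z w * exp (- of_real ((norm w)\<^sup>2 / 2))"
  by (rule reproducing[OF nkernel_true_fock])

text \<open>For unit vectors the squared distance is 2 minus twice the real part of the inner
  product, and the reproducing property makes that inner product an explicit continuous function of
  \<open>w\<close>.\<close>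

lemma nkernel_l2_continuous: "((\<lambda>w. l2dist (nkernel (Suc n) w) (nkernel (Suc n) z)) \<longlongrightarrow> 0) (at z)"
proof -
  let ?k = "nkernel (Suc n)"
  have eq: "complex_of_real ((l2dist (?k w) (?k z))\<^sup>2) = 2 - (L2_inner (?k z) (?k w) + cnj (L2_inner (?k z) (?k w)))" for w
    unfolding L2_inner_self[symmetric] L2_inner_diff1[OF nkernel_L2 nkernel_L2 L2_diff[OF nkernel_L2 nkernel_L2]]
      L2_inner_diff2[OF nkernel_L2 nkernel_L2 nkernel_L2] L2_inner_cnj[of "?k w" "?k z"]
    unfolding L2_inner_self nkernel_norm by simp
  have one: "L2_inner (?k z) (?k z) = 1" by (simp add: L2_inner_self nkernel_norm)
  have "((\<lambda>w. L2_inner (?k z) (?k w)) \<longlongrightarrow> L2_inner (?k z) (?k z)) (at z)"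
    unfolding inner_nkernels
    by (intro tendsto_intros continuous_on_tendsto_compose[OF true_fock_continuous[OF nkernel_true_fock]]) auto
  then have "((\<lambda>w. 2 - (L2_inner (?k z) (?k w) + cnj (L2_inner (?k z) (?k w)))) \<longlongrightarrow> 2 - (1 + cnj 1)) (at z)"
    unfolding one by (intro tendsto_intros)
  then have "((\<lambda>w. Re (complex_of_real ((l2dist (?k w) (?k z))\<^sup>2))) \<longlongrightarrow> Re 0) (at z)"
    unfolding eq by (intro tendsto_Re) simp
  then have "((\<lambda>w. sqrt ((l2dist (?k w) (?k z))\<^sup>2)) \<longlongrightarrow> sqrt 0) (at z)"
    by (intro tendsto_real_sqrt) simp
  then show ?thesis by simp
qed

lemma berezin_continuous:
  assumes A: "A \<in> bounded_ops (Suc n)"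
  shows "continuous_on UNIV (berezin (Suc n) A)"
proof -
  obtain M where "bounded_form (true_fock (Suc n)) (\<lambda>u v. L2_inner (A u) v) M"
    using op_form[OF A] by blast
  then interpret F: bounded_form "true_fock (Suc n)" "\<lambda>u v. L2_inner (A u) v" M .
  let ?k = "nkernel (Suc n)"
  have "((\<lambda>w. berezin (Suc n) A w - berezin (Suc n) A z) \<longlongrightarrow> 0) (at z)" for z
  proof (rule Lim_null_comparison)
    show "((\<lambda>w. M * l2dist (?k w) (?k z) + M * l2dist (?k w) (?k z)) \<longlongrightarrow> 0) (at z)"
      by (intro tendsto_add_zero tendsto_mult_right_zero nkernel_l2_continuous)
    show "\<forall>\<^sub>F w in at z. norm (berezin (Suc n) A w - berezin (Suc n) A z) \<le> M * l2dist (?k w) (?k z) + M * l2dist (?k w) (?k z)"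
    proof (intro always_eventually allI)
      fix w
      note t = nkernel_true_fock
      have d: "(\<lambda>x. ?k w x - ?k z x) \<in> true_fock (Suc n)" by (intro true_fock_diff t)
      define \<delta> where "\<delta> = (\<lambda>x. ?k w x - ?k z x)"
      have \<delta>: "\<delta> \<in> true_fock (Suc n)" unfolding \<delta>_def by (rule d)
      have kw: "?k w = (\<lambda>x. \<delta> x + ?k z x)" unfolding \<delta>_def by simp
      have 1: "L2_inner (A (\<lambda>x. \<delta> x + ?k z x)) (?k w) = L2_inner (A \<delta>) (?k w) + L2_inner (A (?k z)) (?k w)"
        by (rule F.B_add1[OF \<delta> t t])
      have 2: "L2_inner (A (?k z)) (\<lambda>x. \<delta> x + ?k z x) = L2_inner (A (?k z)) \<delta> + L2_inner (A (?k z)) (?k z)"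
        by (rule F.B_add2[OF \<delta> t t])
      have "berezin (Suc n) A w - berezin (Suc n) A z = L2_inner (A \<delta>) (?k w) + L2_inner (A (?k z)) \<delta>"
        unfolding berezin_def using 1 2 unfolding kw[symmetric] by simp
      moreover have "norm (L2_inner (A \<delta>) (?k w)) \<le> M * L2_norm \<delta>"
        using F.B_bound[OF \<delta> t] by (simp add: nkernel_norm)
      moreover have "norm (L2_inner (A (?k z)) \<delta>) \<le> M * L2_norm \<delta>"
        using F.B_bound[OF t \<delta>] by (simp add: nkernel_norm)
      ultimately show "norm (berezin (Suc n) A w - berezin (Suc n) A z) \<le> M * l2dist (?k w) (?k z) + M * l2dist (?k w) (?k z)"
        unfolding \<delta>_def[symmetric] using norm_triangle_mono by (simp only:)
    qed
  qed
  then show ?thesis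
    unfolding continuous_on_eq_continuous_at[OF open_UNIV] isCont_def by (simp add: LIM_zero_iff)
qed

text \<open>Weak sequential compactness of balls. Pairings with the kernels are uniformly bounded
  and, by the continuity of the kernels in norm, equicontinuous in the point; so a diagonal
  subsequence that converges on a countable dense set converges everywhere.\<close>

lemma true_fock_subsequence:
  assumes u: "\<And>m::nat. u m \<in> true_fock (Suc n)" "\<And>m. L2_norm (u m) \<le> M"
  shows "\<exists>r v. strict_mono (r :: nat \<Rightarrow> nat) \<and> (\<forall>z. (\<lambda>m. u (r m) z) \<longlonglongrightarrow> v z) \<and> v \<in> true_fock (Suc n) \<and> L2_norm v \<le> M"
proof -
  let ?k = "nkernel (Suc n)"
  define F where "F m z = L2_inner (u m) (?k z)" for m z
  have M: "M \<ge> 0" using u(2)[of 0] L2_norm_nonneg[of "u 0"] by linarith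
  have Fb: "norm (F m z) \<le> M" for m z
    using L2_cauchy_schwarz[OF true_fock_L2[OF u(1)] nkernel_L2[of n z], of m] u(2)[of m]
    by (simp add: F_def nkernel_norm)
  have Fd: "norm (F m w - F m z) \<le> M * l2dist (?k w) (?k z)" for m w z
  proof -
    have "norm (L2_inner (u m) (\<lambda>x. ?k w x - ?k z x)) \<le> L2_norm (u m) * l2dist (?k w) (?k z)"
      by (rule L2_cauchy_schwarz[OF true_fock_L2[OF u(1)] L2_diff[OF nkernel_L2 nkernel_L2]])
    also have "\<dots> \<le> M * l2dist (?k w) (?k z)" by (intro mult_right_mono u) simp
    finally show ?thesis unfolding F_def L2_inner_diff2[OF nkernel_L2 nkernel_L2 true_fock_L2[OF u(1)]] .
  qed
  obtain D :: "complex set" where D: "countable D" "\<And>X. open X \<Longrightarrow> X \<noteq> {} \<Longrightarrow> \<exists>d\<in>D. d \<in> X"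
    using countable_dense_exists by blast
  obtain r where r: "strict_mono (r::nat \<Rightarrow> nat)" and conv: "\<And>z. z \<in> D \<Longrightarrow> \<exists>l. (\<lambda>m. F (r m) z) \<longlonglongrightarrow> l"
    using function_convergent_subsequence[OF D(1), of F M] Fb by blast
  have "Cauchy (\<lambda>m. F (r m) z)" for z
  proof (rule metric_CauchyI)
    fix e :: real assume e: "e > 0"
    have "\<forall>\<^sub>F w in at z. M * l2dist (?k w) (?k z) < e / 3"
      using order_tendstoD(2)[OF tendsto_mult_right_zero[OF nkernel_l2_continuous[of n z], of M], of "e / 3"] e by simp
    then obtain \<delta> where \<delta>: "\<delta> > 0" "\<And>w. w \<noteq> z \<Longrightarrow> dist w z < \<delta> \<Longrightarrow> M * l2dist (?k w) (?k z) < e / 3"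
      unfolding eventually_at by blast
    obtain d where d: "d \<in> D" "d \<in> ball z \<delta>" using D(2)[of "ball z \<delta>"] \<delta>(1) by auto
    have dz: "M * l2dist (?k d) (?k z) < e / 3" using \<delta>(2)[of d] d e by (cases "d = z") (auto simp: dist_commute)
    obtain l where "(\<lambda>m. F (r m) d) \<longlonglongrightarrow> l" using conv[OF d(1)] by blast
    then have "Cauchy (\<lambda>m. F (r m) d)" by (rule LIMSEQ_imp_Cauchy)
    then obtain N where N: "\<And>a b. a \<ge> N \<Longrightarrow> b \<ge> N \<Longrightarrow> dist (F (r a) d) (F (r b) d) < e / 3"
      using metric_CauchyD[of _ "e / 3"] e by (metis divide_pos_pos zero_less_numeral)
    have "dist (F (r a) z) (F (r b) z) < e" if ab: "a \<ge> N" "b \<ge> N" for a b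
    proof -
      have "F (r a) z - F (r b) z = - (F (r a) d - F (r a) z) + (F (r a) d - F (r b) d) + (F (r b) d - F (r b) z)" by simp
      moreover have "norm (- p + q + s) \<le> norm p + norm q + norm s" for p q s :: complex
        using norm_triangle_ineq[of "- p + q" s] norm_triangle_ineq[of "- p" q] by simp
      ultimately have "norm (F (r a) z - F (r b) z) \<le> norm (F (r a) d - F (r a) z) + norm (F (r a) d - F (r b) d) + norm (F (r b) d - F (r b) z)"
        by (simp only:)
      with Fd[of "r a" d z] Fd[of "r b" d z] dz N[OF ab] show ?thesis by (simp add: dist_norm)
    qed
    then show "\<exists>N. \<forall>a\<ge>N. \<forall>b\<ge>N. dist (F (r a) z) (F (r b) z) < e" by blast
  qed
  then have "\<forall>z. \<exists>l. (\<lambda>m. F (r m) z) \<longlonglongrightarrow> l" using Cauchy_convergent convergent_def by blast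
  then obtain L where L: "\<And>z. (\<lambda>m. F (r m) z) \<longlonglongrightarrow> L z" by metis
  define v where "v z = exp (of_real ((norm z)\<^sup>2 / 2)) * L z" for z
  have uF: "u m z = exp (of_real ((norm z)\<^sup>2 / 2)) * F m z" for m z
    using fun_cong[OF fproj_true_fock[OF u(1)], of m z] by (simp add: fproj_def F_def)
  have lim: "(\<lambda>m. u (r m) z) \<longlonglongrightarrow> v z" for z
    unfolding uF v_def by (intro tendsto_mult tendsto_const L)
  show ?thesis
    using r lim true_fock_limit[of "\<lambda>m. u (r m)" n M v, OF u(1) u(2) lim] by blast
qed

lemma L2_tail:
  assumes x: "x \<in> L2" and e: "e > 0"
  shows "\<exists>R. L2_norm (\<lambda>w. indicator {w. R < norm w} w * x w) < e"
proof -
  note [measurable] = L2_measurable[OF x]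
  define t where "t m w = indicator {w. real m < norm w} w * x w" for m w
  have tm: "t m \<in> borel_measurable gauss" for m unfolding t_def[abs_def] measurable_gauss by measurable
  have "(\<lambda>m. LINT w|gauss. (norm (t m w))\<^sup>2) \<longlonglongrightarrow> (LINT w|gauss. 0)"
  proof (rule integral_dominated_convergence[where w = "\<lambda>w. (norm (x w))\<^sup>2"])
    show "integrable gauss (\<lambda>w. (norm (x w))\<^sup>2)" by (rule L2D(2)[OF x])
    show "AE w in gauss. (\<lambda>m. (norm (t m w))\<^sup>2) \<longlonglongrightarrow> 0"
    proof (rule AE_I2)
      fix w :: complex
      obtain N where "norm w \<le> real N" using real_arch_simple by blast
      then have "(norm (t m w))\<^sup>2 = 0" if "m \<ge> N" for m
        using that unfolding t_def by simp
      then have "\<forall>\<^sub>F m in sequentially. (norm (t m w))\<^sup>2 = 0"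
        by (rule eventually_sequentiallyI)
      then show "(\<lambda>m. (norm (t m w))\<^sup>2) \<longlonglongrightarrow> 0" by (rule tendsto_eventually)
    qed
    show "(\<lambda>w. (norm (t m w))\<^sup>2) \<in> borel_measurable gauss" for m using tm[of m] by measurable
    show "AE w in gauss. norm ((norm (t m w))\<^sup>2) \<le> (norm (x w))\<^sup>2" for m
      by (rule AE_I2) (simp add: t_def indicator_def)
  qed simp
  then have "(\<lambda>m. L2_norm (t m)) \<longlonglongrightarrow> sqrt 0"
    unfolding L2_norm_def by (intro tendsto_real_sqrt) simp
  then have "\<forall>\<^sub>F m in sequentially. L2_norm (t m) < e"
    using e by (intro order_tendstoD(2)[of _ "sqrt 0"]) simp_all
  then obtain m where "L2_norm (t m) < e" by (auto simp: eventually_sequentially)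
  then show ?thesis unfolding t_def[abs_def] by blast
qed

text \<open>The kernel at \<open>z\<close> concentrates near \<open>z\<close>. Cutting
  \<open>x\<close> at radius \<open>R\<close> leaves a tail of small norm and a part supported in a
  disc, where the kernel is at most a constant times a Gaussian in the distance from
  \<open>z\<close> to the disc.\<close>

lemma nkernel_weak_null:
  assumes x: "x \<in> L2"
  shows "van (\<lambda>z. L2_inner x (nkernel (Suc n) z))"
  unfolding van_def
proof (intro allI impI)
  let ?k = "nkernel (Suc n)"
  note [measurable] = L2_measurable[OF x]
  fix e :: real assume e: "e > 0"
  obtain R where R: "L2_norm (\<lambda>w. indicator {w. R < norm w} w * x w) < e / 2"
    using L2_tail[OF x, of "e / 2"] e by auto
  define xt where "xt = (\<lambda>w. indicator {w. R < norm w} w * x w)"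
  define xc where "xc = (\<lambda>w. indicator {w. norm w \<le> R} w * x w)"
  have xt: "xt \<in> L2" unfolding xt_def
  proof (rule L2_bound[OF x, where C = 1])
    show "AE w in gauss. norm (indicator {w. R < norm w} w * x w) \<le> 1 * norm (x w)" by (rule AE_I2) (simp add: indicator_def)
  qed measurable
  have xc: "xc \<in> L2" unfolding xc_def
  proof (rule L2_bound[OF x, where C = 1])
    show "AE w in gauss. norm (indicator {w. norm w \<le> R} w * x w) \<le> 1 * norm (x w)" by (rule AE_I2) (simp add: indicator_def)
  qed measurable
  have split: "x = (\<lambda>w. xc w + xt w)" unfolding xt_def xc_def by (rule ext) (auto simp: indicator_def)
  define C where "C = kbound n * exp (R\<^sup>2 / 2) * (LINT w|gauss. norm (x w))"
  have xi: "integrable gauss (\<lambda>w. norm (x w))"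
    using L2_mult_integrable(2)[OF x egrow_L2[OF egrow_const[of 1]]] by simp
  have C: "C \<ge> 0" unfolding C_def by (intro mult_nonneg_nonneg Bochner_Integration.integral_nonneg kbound(1) exp_ge_zero norm_ge_zero)
  have main: "norm (L2_inner xc (?k z)) \<le> C * exp (- ((norm z - \<bar>R\<bar>)\<^sup>2 / 4))" if z: "norm z \<ge> \<bar>R\<bar>" for z
  proof -
    define D where "D = kbound n * exp (R\<^sup>2 / 2) * exp (- ((norm z - \<bar>R\<bar>)\<^sup>2 / 4))"
    have "norm (L2_inner xc (?k z)) \<le> (LINT w|gauss. D * norm (x w))"
      unfolding L2_inner_def
    proof (rule Bochner_Integration.integral_norm_bound_integral)
      show "integrable gauss (\<lambda>w. xc w * cnj (?k z w))" by (rule L2_mult_integrable(1)[OF xc nkernel_L2])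
      show "integrable gauss (\<lambda>w. D * norm (x w))" by (intro integrable_mult_right xi)
      fix w
      show "norm (xc w * cnj (?k z w)) \<le> D * norm (x w)"
      proof (cases "norm w \<le> R")
        case True
        have xw: "norm (xc w * cnj (?k z w)) = norm (x w) * norm (?k z w)"
          using True unfolding xc_def norm_mult complex_mod_cnj by simp
        have w: "norm w \<le> \<bar>R\<bar>" using True by simp
        have "norm z - \<bar>R\<bar> \<le> norm (w - z)" using w norm_triangle_ineq2[of z w] norm_minus_commute[of z w] by linarith
        then have s: "(norm z - \<bar>R\<bar>)\<^sup>2 \<le> (norm (w - z))\<^sup>2" using z by (intro power_mono) auto
        have s2: "(norm w)\<^sup>2 \<le> R\<^sup>2" using power_mono[OF w norm_ge_zero, of 2] by simp
        have "norm (?k z w) \<le> kbound n * exp ((norm w)\<^sup>2 / 2 - (norm (w - z))\<^sup>2 / 4)" by (rule kbound(2))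
        also have "\<dots> \<le> kbound n * exp (R\<^sup>2 / 2 + - ((norm z - \<bar>R\<bar>)\<^sup>2 / 4))"
        proof (rule mult_left_mono[OF _ kbound(1)])
          have "(norm w)\<^sup>2 / 2 - (norm (w - z))\<^sup>2 / 4 \<le> R\<^sup>2 / 2 + - ((norm z - \<bar>R\<bar>)\<^sup>2 / 4)" using s s2 by linarith
          then show "exp ((norm w)\<^sup>2 / 2 - (norm (w - z))\<^sup>2 / 4) \<le> exp (R\<^sup>2 / 2 + - ((norm z - \<bar>R\<bar>)\<^sup>2 / 4))" by (simp only: exp_le_cancel_iff)
        qed
        also have "\<dots> = D" unfolding D_def by (simp only: exp_add mult.assoc)
        finally have "norm (?k z w) \<le> D" .
        then have "norm (x w) * norm (?k z w) \<le> norm (x w) * D" by (rule mult_left_mono) simp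
        then show ?thesis unfolding xw by (simp only: mult.commute)
      next
        case False
        then show ?thesis using kbound(1)[of n] by (simp add: xc_def D_def)
      qed
    qed
    also have "\<dots> = C * exp (- ((norm z - \<bar>R\<bar>)\<^sup>2 / 4))" unfolding C_def D_def by simp
    finally show ?thesis .
  qed
  \<comment> \<open>For \<open>t \<ge> T\<close> the summand 1 gives
    \<open>t \<le> t\<^sup>2\<close>, hence \<open>t\<^sup>2 > 8 * C / e\<close>, and then
    \<open>1 + t\<^sup>2 / 4 \<le> exp (t\<^sup>2 / 4)\<close> suffices.\<close>
  define T where "T = 1 + 8 * C / e"
  have T: "C * exp (- (t\<^sup>2 / 4)) < e / 2" if t: "t \<ge> T" for t
  proof -
    have "0 \<le> 8 * C / e" using C e by simp
    then have t1: "1 \<le> t" "8 * C / e < t" using t unfolding T_def by linarith+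
    then have "t \<le> t\<^sup>2" by (simp add: power2_eq_square)
    then have "8 * C / e < t\<^sup>2" using t1 by linarith
    moreover have "1 + t\<^sup>2 / 4 \<le> exp (t\<^sup>2 / 4)" by (rule exp_ge_add_one_self)
    moreover have "2 * C / e = (8 * C / e) / 4" by simp
    ultimately have "2 * C / e < exp (t\<^sup>2 / 4)" by linarith
    then have "C < e / 2 * exp (t\<^sup>2 / 4)" using e by (simp add: field_simps)
    then show ?thesis by (simp add: exp_minus field_simps)
  qed
  show "\<exists>R. \<forall>z. R \<le> norm z \<longrightarrow> norm (L2_inner x (?k z)) \<le> e"
  proof (intro exI[of _ "\<bar>R\<bar> + \<bar>T\<bar>"] allI impI)
    fix z :: complex assume z: "\<bar>R\<bar> + \<bar>T\<bar> \<le> norm z"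
    have "L2_inner (\<lambda>w. xc w + xt w) (?k z) = L2_inner xc (?k z) + L2_inner xt (?k z)"
      by (rule L2_inner_add1[OF xc xt nkernel_L2])
    then have s: "L2_inner x (?k z) = L2_inner xc (?k z) + L2_inner xt (?k z)" by (simp only: split[symmetric])
    have "norm (L2_inner xt (?k z)) \<le> L2_norm xt"
      using L2_cauchy_schwarz[OF xt nkernel_L2[of n z]] by (simp add: nkernel_norm)
    also have "\<dots> \<le> e / 2" using R unfolding xt_def by (rule less_imp_le)
    finally have 1: "norm (L2_inner xt (?k z)) \<le> e / 2" .
    have "norm (L2_inner xc (?k z)) \<le> C * exp (- ((norm z - \<bar>R\<bar>)\<^sup>2 / 4))" by (rule main) (use z in linarith)
    also have "\<dots> < e / 2" by (rule T) (use z in linarith)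
    finally have 2: "norm (L2_inner xc (?k z)) \<le> e / 2" by (rule less_imp_le)
    show "norm (L2_inner x (?k z)) \<le> e"
      unfolding s using norm_triangle_mono[OF 2 1] by simp
  qed
qed

text \<open>Total boundedness gives a finite net: \<open>A\<close> applied to the kernel at
  \<open>z\<close> stays within \<open>e / 2\<close> of one of finitely many vectors, and the
  pairing of each of these with the kernel tends to 0.\<close>

lemma compact_imp_berezin_van:
  assumes A: "A \<in> compact_ops (Suc n)"
  shows "van (berezin (Suc n) A)"
  unfolding van_def
proof (intro allI impI)
  fix e :: real assume e: "e > 0"
  let ?k = "nkernel (Suc n)" and ?S = "A ` {f \<in> true_fock (Suc n). L2_norm f \<le> 1}"
  from A have Ab: "A \<in> bounded_ops (Suc n)"
    and "compactin (tf.mtopology n) (tf.mtopology n closure_of ?S)"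
    by (auto simp: compact_ops_def fock_topology_def)
  then have a1: "\<And>f. f \<in> true_fock (Suc n) \<Longrightarrow> A f \<in> true_fock (Suc n)"
    and "tf.mtotally_bounded n ?S"
    by (auto simp: bounded_ops_def intro!: tf.compact_closure_of_imp_mtotally_bounded)
  then obtain K where K: "finite K" "K \<subseteq> ?S" "?S \<subseteq> (\<Union>x\<in>K. tf.mball n x (e / 2))"
    unfolding tf.mtotally_bounded_def using e by (meson half_gt_zero)
  have KT: "K \<subseteq> true_fock (Suc n)" using K(2) a1 by blast
  have "\<forall>x\<in>K. \<exists>R. \<forall>z. norm z \<ge> R \<longrightarrow> norm (L2_inner x (?k z)) \<le> e / 2"
    using vanD[OF nkernel_weak_null[OF true_fock_L2]] KT e by (meson half_gt_zero subsetD)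
  then obtain R where R: "\<And>x z. x \<in> K \<Longrightarrow> norm z \<ge> R x \<Longrightarrow> norm (L2_inner x (?k z)) \<le> e / 2" by metis
  show "\<exists>R. \<forall>z. R \<le> norm z \<longrightarrow> norm (berezin (Suc n) A z) \<le> e"
  proof (intro exI[of _ "Max (insert 0 (R ` K))"] allI impI)
    fix z :: complex assume z: "Max (insert 0 (R ` K)) \<le> norm z"
    have "A (?k z) \<in> ?S" using nkernel_true_fock nkernel_norm by (intro imageI) simp
    then obtain x where x: "x \<in> K" "A (?k z) \<in> tf.mball n x (e / 2)" using K(3) by blast
    then have d: "l2dist (A (?k z)) x < e / 2" by (simp add: tf.commute)
    have L: "A (?k z) \<in> L2" "x \<in> L2" using a1[OF nkernel_true_fock] KT x(1) true_fock_L2 by auto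
    have "R x \<le> norm z" using z K(1) x(1) by auto
    then have 1: "norm (L2_inner x (?k z)) \<le> e / 2" by (rule R[OF x(1)])
    have 2: "norm (L2_inner (\<lambda>w. A (?k z) w - x w) (?k z)) \<le> e / 2"
      using L2_cauchy_schwarz[OF L2_diff[OF L] nkernel_L2[of n z]] d by (simp add: nkernel_norm)
    have "berezin (Suc n) A z = L2_inner (\<lambda>w. A (?k z) w - x w) (?k z) + L2_inner x (?k z)"
      unfolding berezin_def L2_inner_diff1[OF L nkernel_L2] by simp
    then show "norm (berezin (Suc n) A z) \<le> e" using norm_triangle_mono[OF 2 1] by simp
  qed
qed

section \<open>A compactness criterion for Toeplitz operators\<close>

text \<open>Contains everything that repeated differentiation of \<open>coef n g 0\<close> can
  produce by \<open>coef_wirt\<close>. If all \<open>coef n g i\<close> vanish at 0, so does every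
  member, as the operations preserve this.\<close>

inductive coef_span :: "nat \<Rightarrow> (complex \<Rightarrow> complex) \<Rightarrow> (complex \<Rightarrow> complex) \<Rightarrow> bool" for n g where
  coef: "coef_span n g (coef n g i)"
| add: "coef_span n g f \<Longrightarrow> coef_span n g h \<Longrightarrow> coef_span n g (\<lambda>z. f z + h z)"
| cmult: "coef_span n g f \<Longrightarrow> coef_span n g (\<lambda>z. c * f z)"
| cnj: "coef_span n g f \<Longrightarrow> coef_span n g (\<lambda>z. cnj z * f z)"

text \<open>The second coefficient \<open>b\<close> is left free: only the first has to remain in
  the span, and it is the complex derivative for the holomorphic functions to which this is
  applied.\<close>

lemma coef_span_wirt:
  assumes g: "g \<in> L2" and f: "coef_span n g f"
  shows "\<exists>f' b. coef_span n g f' \<and> (\<forall>z. wirt f (f' z) (b z) z)"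
  using f
proof (induction rule: coef_span.induct)
  case (coef i)
  have "coef_span n g (\<lambda>z. of_nat (Suc i) * coef n g (Suc i) z + cnj z * coef n g i z)"
    by (intro coef_span.intros)
  then show ?case using coef_wirt[OF g, of n i]
    by (intro exI[of _ "\<lambda>z. of_nat (Suc i) * coef n g (Suc i) z + cnj z * coef n g i z"]
        exI[of _ "\<lambda>z. - (if i = 0 then 0 else coef n g (i - 1) z)"]) blast
next
  case (add f h)
  then obtain f' b h' d where 1: "coef_span n g f'" "\<And>z. wirt f (f' z) (b z) z" "coef_span n g h'" "\<And>z. wirt h (h' z) (d z) z"
    by blast
  show ?case
    by (intro exI[of _ "\<lambda>z. f' z + h' z"] exI[of _ "\<lambda>z. b z + d z"] conjI allI coef_span.add wirt_add 1)
next
  case (cmult f c)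
  then obtain f' b where 1: "coef_span n g f'" "\<And>z. wirt f (f' z) (b z) z" by blast
  show ?case
    by (intro exI[of _ "\<lambda>z. c * f' z"] exI[of _ "\<lambda>z. c * b z"] conjI allI coef_span.cmult wirt_cmult 1)
next
  case (cnj f)
  then obtain f' b where 1: "coef_span n g f'" "\<And>z. wirt f (f' z) (b z) z" by blast
  have "wirt (\<lambda>z. cnj z * f z) (cnj z * f' z) (f z + cnj z * b z) z" for z
    using wirt_mult[OF wirt_id(2) 1(2)[of z]] by simp
  then show ?case
    by (intro exI[of _ "\<lambda>z. cnj z * f' z"] exI[of _ "\<lambda>z. f z + cnj z * b z"] conjI allI coef_span.cnj 1)
qed

lemma coef_span_zero:
  assumes "coef_span n g f" "\<And>i. coef n g i 0 = 0" shows "f 0 = 0"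
  using assms by (induction rule: coef_span.induct) auto

lemma coef_0_holomorphic: "g \<in> L2 \<Longrightarrow> coef n g 0 holomorphic_on UNIV"
  using coef_wirt[of g n 0]
  unfolding holomorphic_on_def wirt_def field_differentiable_def has_field_derivative_def by auto

text \<open>Vanishing of all \<open>coef n g i 0\<close> annihilates every derivative of the entire function \<open>coef n g 0\<close> at the origin.\<close>

lemma Efun_complete:
  assumes g: "g \<in> true_fock (Suc n)" and orth: "\<And>i. L2_inner g (Efun n i) = 0"
  shows "g = (\<lambda>z. 0)"
proof -
  have L: "g \<in> L2" by (rule true_fock_L2[OF g])
  have c0: "coef n g i 0 = 0" for i unfolding coef_def Wt_0 orth by simp
  note hol = coef_0_holomorphic[OF L, of n]
  have "coef_span n g ((deriv ^^ m) (coef n g 0))" for m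
  proof (induction m)
    case 0 show ?case by (simp add: coef_span.coef)
  next
    case (Suc m)
    let ?h = "(deriv ^^ m) (coef n g 0)"
    obtain f' b where f': "coef_span n g f'" "\<And>z. wirt ?h (f' z) (b z) z"
      using coef_span_wirt[OF L Suc] by blast
    have "?h holomorphic_on UNIV" by (rule holomorphic_higher_deriv[OF hol open_UNIV])
    then have "wirt ?h (deriv ?h z) 0 z" for z
      by (intro wirt_holomorphic holomorphic_derivI[OF _ open_UNIV UNIV_I])
    then have "deriv ?h z = f' z" for z
      using wirtD(2)[OF f'(2), of z] wirtD(2)[of ?h "deriv ?h z" 0 z] by simp
    then have "deriv ?h = f'" by (rule ext)
    then show ?case using f'(1) by simp
  qed
  then have "(deriv ^^ m) (coef n g 0) 0 = 0" for m by (rule coef_span_zero[OF _ c0])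
  then have z0: "coef n g 0 = (\<lambda>z. 0)"
    using holomorphic_fun_eq_0_on_connected[OF hol open_UNIV connected_UNIV, of 0] by blast
  have "coef n g i = (\<lambda>z. 0)" for i
  proof (induction i)
    case 0 show ?case by (rule z0)
  next
    case (Suc i)
    have "of_nat (Suc i) * coef n g (Suc i) z = 0" for z
      using wirtD(2)[OF coef_wirt[OF L, of n i z]] wirtD(2)[OF wirt_const[of 0 z]] unfolding Suc by simp
    then show ?case by (auto simp: fun_eq_iff simp del: of_nat_Suc)
  qed
  then have "fproj n g = (\<lambda>z. 0)" unfolding fproj_coef by simp
  then show ?thesis using fproj_true_fock[OF g] by simp
qed

text \<open>The modulus of the inner product of the Toeplitz operator at the kernel of
  \<open>w\<close> with the kernel of \<open>z\<close>. The symbol is moved, conjugated, onto the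
  kernel of \<open>z\<close>, so that as a function of \<open>w\<close> this is the weighted modulus
  of one projected vector.\<close>

definition tkern :: "nat \<Rightarrow> (complex \<Rightarrow> complex) \<Rightarrow> complex \<Rightarrow> complex \<Rightarrow> real" where
  "tkern n f z w = norm (L2_inner (\<lambda>x. cnj (f x) * nkernel (Suc n) z x) (nkernel (Suc n) w))"

lemma tkern_nonneg [simp]: "tkern n f z w \<ge> 0"
  by (simp add: tkern_def)

lemma tkern_measurable:
  assumes [measurable]: "f \<in> borel_measurable borel"
  shows "(\<lambda>p. tkern n f (fst p) (snd p)) \<in> borel_measurable (borel \<Otimes>\<^sub>M borel)"
  unfolding tkern_def L2_inner_def by measurable

lemma tkern_measurable' [measurable (raw)]:
  assumes f: "f \<in> borel_measurable borel" and a: "a \<in> borel_measurable M" "b \<in> borel_measurable M"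
  shows "(\<lambda>x. tkern n f (a x) (b x)) \<in> borel_measurable M"
proof -
  have "(\<lambda>x. (a x, b x)) \<in> M \<rightarrow>\<^sub>M borel \<Otimes>\<^sub>M borel" by (intro measurable_Pair a)
  from measurable_compose[OF this tkern_measurable[OF f]] show ?thesis by simp
qed

lemma parallelogram_midpoint:
  "(norm (x - z))\<^sup>2 + (norm (x - w))\<^sup>2 = 2 * (norm (x - (z + w) / 2))\<^sup>2 + (norm (w - z :: complex))\<^sup>2 / 2"
  unfolding cmod_power2 by (simp add: field_simps power2_eq_square)

lemma tkern_symbol_L2:
  assumes C: "C \<ge> 0" "AE w in gauss. norm (f w) \<le> C" "f \<in> borel_measurable borel"
  shows "(\<lambda>x. cnj (f x) * nkernel (Suc n) z x) \<in> L2" "L2_norm (\<lambda>x. cnj (f x) * nkernel (Suc n) z x) \<le> C"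
proof -
  note [measurable] = C(3)
  have c: "AE w in gauss. norm (cnj (f w)) \<le> C" using C(2) by simp
  have m: "(\<lambda>x. cnj (f x)) \<in> borel_measurable borel" by measurable
  show "(\<lambda>x. cnj (f x) * nkernel (Suc n) z x) \<in> L2" by (rule mult_L2(1)[OF C(1) c m nkernel_L2])
  show "L2_norm (\<lambda>x. cnj (f x) * nkernel (Suc n) z x) \<le> C"
    using mult_L2(2)[OF C(1) c m nkernel_L2, of n z] by (simp add: nkernel_norm)
qed

text \<open>By the median identity the two Gaussian bounds combine to a Gaussian around the
  midpoint, which is integrated out, and the factor
  \<open>exp (- (1/8 * (norm (w - z))\<^sup>2))\<close>. The 2 is the integral
  \<open>pi / (1/2)\<close> divided by the \<open>pi\<close> of the measure.\<close>

lemma tkern_bound: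
  assumes C: "C \<ge> 0" "AE w in gauss. norm (f w) \<le> C" "f \<in> borel_measurable borel"
  shows "tkern n f z w \<le> 2 * C * (kbound n)\<^sup>2 * exp (- (1/8 * (norm (w - z))\<^sup>2))"
proof -
  let ?k = "nkernel (Suc n)"
  note a = tkern_symbol_L2(1)[OF C, of n z]
  note [measurable] = C(3)
  define G where "G = C * (kbound n)\<^sup>2 * exp (- (1/8 * (norm (w - z))\<^sup>2))"
  define E where "E x = exp (- (1/2 * (norm (x - (z + w) / 2))\<^sup>2))" for x
  have G: "G \<ge> 0" unfolding G_def using C(1) by simp
  have E: "E x \<ge> 0" for x unfolding E_def by simp
  have pt: "exp (- (norm x)\<^sup>2) / pi * (norm (cnj (f x) * ?k z x) * norm (?k w x)) \<le> G / pi * E x" if f: "norm (f x) \<le> C" for x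
  proof -
    have 1: "norm (?k z x) * norm (?k w x) \<le> (kbound n * exp ((norm x)\<^sup>2 / 2 - (norm (x - z))\<^sup>2 / 4)) * (kbound n * exp ((norm x)\<^sup>2 / 2 - (norm (x - w))\<^sup>2 / 4))"
      by (rule mult_mono[OF kbound(2) kbound(2) mult_nonneg_nonneg[OF kbound(1) exp_ge_zero] norm_ge_zero])
    have "norm (cnj (f x) * ?k z x) * norm (?k w x) = norm (f x) * (norm (?k z x) * norm (?k w x))"
      by (simp add: norm_mult)
    also have "\<dots> \<le> C * ((kbound n * exp ((norm x)\<^sup>2 / 2 - (norm (x - z))\<^sup>2 / 4)) * (kbound n * exp ((norm x)\<^sup>2 / 2 - (norm (x - w))\<^sup>2 / 4)))"
      by (rule mult_mono[OF f 1 C(1)]) simp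
    also have "\<dots> = C * (kbound n)\<^sup>2 * (exp ((norm x)\<^sup>2 / 2 - (norm (x - z))\<^sup>2 / 4) * exp ((norm x)\<^sup>2 / 2 - (norm (x - w))\<^sup>2 / 4))"
      unfolding power2_eq_square by (simp only: mult_ac)
    also have "exp ((norm x)\<^sup>2 / 2 - (norm (x - z))\<^sup>2 / 4) * exp ((norm x)\<^sup>2 / 2 - (norm (x - w))\<^sup>2 / 4)
        = exp (((norm x)\<^sup>2 + - (1/8 * (norm (w - z))\<^sup>2)) + - (1/2 * (norm (x - (z + w) / 2))\<^sup>2))"
      unfolding exp_add[symmetric] using parallelogram_midpoint[of x z w] by (intro arg_cong[where f = exp]) linarith
    also have "\<dots> = exp ((norm x)\<^sup>2) * exp (- (1/8 * (norm (w - z))\<^sup>2)) * E x" unfolding E_def exp_add ..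
    also have "C * (kbound n)\<^sup>2 * (exp ((norm x)\<^sup>2) * exp (- (1/8 * (norm (w - z))\<^sup>2)) * E x) = exp ((norm x)\<^sup>2) * (G * E x)"
      unfolding G_def by (simp only: mult_ac)
    finally have 2: "norm (cnj (f x) * ?k z x) * norm (?k w x) \<le> exp ((norm x)\<^sup>2) * (G * E x)" .
    have "exp (- (norm x)\<^sup>2) / pi * (norm (cnj (f x) * ?k z x) * norm (?k w x)) \<le> exp (- (norm x)\<^sup>2) / pi * (exp ((norm x)\<^sup>2) * (G * E x))"
      by (rule mult_left_mono[OF 2]) simp
    also have "\<dots> = G / pi * E x" by (simp add: exp_minus)
    finally show ?thesis .
  qed
  have "ennreal (tkern n f z w) \<le> (\<integral>\<^sup>+x. ennreal (norm (cnj (f x) * ?k z x) * norm (?k w x)) \<partial>gauss)"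
    unfolding tkern_def by (rule nn_L2_inner[OF a nkernel_L2])
  also have "\<dots> = (\<integral>\<^sup>+x. ennreal (exp (- (norm x)\<^sup>2) / pi) * ennreal (norm (cnj (f x) * ?k z x) * norm (?k w x)) \<partial>lborel)"
    by (rule nn_integral_gauss) measurable
  also have "\<dots> \<le> (\<integral>\<^sup>+x. ennreal (G / pi) * ennreal (E x) \<partial>lborel)"
  proof (rule nn_integral_mono_AE)
    have "AE x in lborel. norm (f x) \<le> C" using C(2) by (simp add: AE_gauss_iff)
    then show "AE x in lborel. ennreal (exp (- (norm x)\<^sup>2) / pi) * ennreal (norm (cnj (f x) * ?k z x) * norm (?k w x)) \<le> ennreal (G / pi) * ennreal (E x)"
    proof (rule AE_mp, intro AE_I2 impI)
      fix x assume "norm (f x) \<le> C"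
      from ennreal_leI[OF pt[OF this]]
      show "ennreal (exp (- (norm x)\<^sup>2) / pi) * ennreal (norm (cnj (f x) * ?k z x) * norm (?k w x)) \<le> ennreal (G / pi) * ennreal (E x)"
        unfolding ennreal_mult''[OF E] ennreal_mult''[OF mult_nonneg_nonneg[OF norm_ge_zero norm_ge_zero]] .
    qed
  qed
  also have "\<dots> = ennreal (G / pi) * (\<integral>\<^sup>+x. ennreal (E x) \<partial>lborel)"
    unfolding E_def by (rule nn_integral_cmult) measurable
  also have "(\<integral>\<^sup>+x. ennreal (E x) \<partial>lborel) = ennreal (pi / (1/2))"
    unfolding E_def by (rule nn_integral_gaussian_shift) simp
  also have "ennreal (G / pi) * ennreal (pi / (1/2)) = ennreal (G / pi * (pi / (1/2)))"
    by (rule ennreal_mult''[symmetric]) simp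
  also have "G / pi * (pi / (1/2)) = 2 * G" by simp
  finally have "tkern n f z w \<le> 2 * G" using G by (subst (asm) ennreal_le_iff) simp_all
  then show ?thesis unfolding G_def by (simp only: mult.assoc)
qed

text \<open>The value at \<open>z\<close> is a pairing of \<open>u\<close> with \<open>cnj f\<close>
  times the kernel. As \<open>u\<close> is in the space, that vector may be replaced by its
  projection, whose weighted modulus at \<open>w\<close> is \<open>tkern n f z w\<close>.\<close>

lemma toeplitz_tkern:
  assumes f: "f \<in> Linfty" and u: "u \<in> true_fock (Suc n)"
  shows "ennreal (norm (toeplitz (Suc n) f u z) * exp (- ((norm z)\<^sup>2 / 2)))
    \<le> (\<integral>\<^sup>+w. ennreal (tkern n f z w / pi) * ennreal (norm (u w) * exp (- ((norm w)\<^sup>2 / 2))) \<partial>lborel)"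
proof -
  obtain C where C: "C \<ge> 0" "AE w in gauss. norm (f w) \<le> C" "f \<in> borel_measurable borel"
    using Linfty_bound[OF f] by blast
  note [measurable] = C(3) L2_measurable[OF true_fock_L2[OF u]]
  let ?k = "nkernel (Suc n)"
  define a where "a = (\<lambda>x. cnj (f x) * ?k z x)"
  have a: "a \<in> L2" unfolding a_def by (rule tkern_symbol_L2(1)[OF C])
  note uL = true_fock_L2[OF u]
  note Pa = fproj_L2(1)[OF a, of n]
  have eq1: "L2_inner (\<lambda>x. f x * u x) (?k z) = L2_inner u a"
    unfolding L2_inner_def a_def by (simp add: mult.left_commute mult.assoc)
  have eq2: "L2_inner u a = L2_inner u (fproj n a)"
    using fproj_inner[OF a u] L2_inner_cnj[of u a] L2_inner_cnj[of u "fproj n a"] by simp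
  have pt: "exp (- (norm w)\<^sup>2) / pi * (norm (u w) * norm (fproj n a w)) = tkern n f z w / pi * (norm (u w) * exp (- ((norm w)\<^sup>2 / 2)))" for w
  proof -
    have "tkern n f z w = norm (fproj n a w) * exp (- ((norm w)\<^sup>2 / 2))"
      unfolding tkern_def a_def[symmetric] norm_fproj ..
    then show ?thesis unfolding exp_half_square power2_eq_square[of "exp _"] by simp
  qed
  have "norm (toeplitz (Suc n) f u z) * exp (- ((norm z)\<^sup>2 / 2)) = norm (L2_inner u (fproj n a))"
    unfolding toeplitz_eq[OF f uL] norm_fproj eq1 eq2 ..
  then have "ennreal (norm (toeplitz (Suc n) f u z) * exp (- ((norm z)\<^sup>2 / 2))) \<le> (\<integral>\<^sup>+w. ennreal (norm (u w) * norm (fproj n a w)) \<partial>gauss)"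
    using nn_L2_inner[OF uL Pa] by simp
  also have "\<dots> = (\<integral>\<^sup>+w. ennreal (exp (- (norm w)\<^sup>2) / pi) * ennreal (norm (u w) * norm (fproj n a w)) \<partial>lborel)"
    using L2_measurable[OF Pa] by (intro nn_integral_gauss) measurable
  also have "\<dots> = (\<integral>\<^sup>+w. ennreal (tkern n f z w / pi) * ennreal (norm (u w) * exp (- ((norm w)\<^sup>2 / 2))) \<partial>lborel)"
  proof (rule nn_integral_cong)
    fix w
    have "ennreal (exp (- (norm w)\<^sup>2) / pi) * ennreal (norm (u w) * norm (fproj n a w)) = ennreal (exp (- (norm w)\<^sup>2) / pi * (norm (u w) * norm (fproj n a w)))"
      by (rule ennreal_mult''[symmetric]) simp
    also have "\<dots> = ennreal (tkern n f z w / pi) * ennreal (norm (u w) * exp (- ((norm w)\<^sup>2 / 2)))"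
      unfolding pt by (rule ennreal_mult'') simp
    finally show "ennreal (exp (- (norm w)\<^sup>2) / pi) * ennreal (norm (u w) * norm (fproj n a w)) = ennreal (tkern n f z w / pi) * ennreal (norm (u w) * exp (- ((norm w)\<^sup>2 / 2)))" .
  qed
  finally show ?thesis .
qed

text \<open>Schur's test for the kernel cut off to \<open>R < norm z\<close>: rows are small by
  hypothesis and columns are bounded by \<open>8 * D\<close>, the integral of
  \<open>D / pi * exp (- (1/8 * (norm y)\<^sup>2))\<close>. The geometric mean is still
  small.\<close>

lemma toeplitz_tail:
  assumes f: "f \<in> Linfty" and u: "u \<in> true_fock (Suc n)"
    and small: "\<And>z. R < norm z \<Longrightarrow> (\<integral>\<^sup>+w. ennreal (tkern n f z w) \<partial>lborel) \<le> ennreal \<epsilon>" and e: "\<epsilon> \<ge> 0"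
    and D: "D \<ge> 0" "\<And>z w. tkern n f z w \<le> D * exp (- (1/8 * (norm (w - z))\<^sup>2))"
  shows "L2_norm (\<lambda>z. indicator {z. R < norm z} z * toeplitz (Suc n) f u z) \<le> sqrt (\<epsilon> / pi * (8 * D)) * L2_norm u"
proof -
  have fm: "f \<in> borel_measurable borel" using f by (simp add: Linfty_def)
  note [measurable] = fm
  have T: "toeplitz (Suc n) f u \<in> true_fock (Suc n)"
    using toeplitz_bounded[OF f, of n] u by (auto simp: bounded_ops_def)
  note [measurable] = L2_measurable[OF true_fock_L2[OF T]]
  define \<kappa> where "\<kappa> z w = ennreal (indicator {z. R < norm z} z) * ennreal (tkern n f z w / pi)" for z w
  have m: "case_prod \<kappa> \<in> borel_measurable (borel \<Otimes>\<^sub>M borel)" unfolding \<kappa>_def by measurable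
  show ?thesis
  proof (rule schur_gauss(2)[OF true_fock_L2[OF u] _ m])
    show "(\<lambda>z. indicator {z. R < norm z} z * toeplitz (Suc n) f u z) \<in> borel_measurable borel" by measurable
    fix z :: complex
    show "ennreal (norm (indicator {z. R < norm z} z * toeplitz (Suc n) f u z) * exp (- ((norm z)\<^sup>2 / 2)))
      \<le> (\<integral>\<^sup>+w. \<kappa> z w * ennreal (norm (u w) * exp (- ((norm w)\<^sup>2 / 2))) \<partial>lborel)"
      using toeplitz_tkern[OF f u, of z] by (cases "R < norm z") (simp_all add: \<kappa>_def)
    have div: "(\<integral>\<^sup>+x. ennreal (F x / pi) \<partial>lborel) = (\<integral>\<^sup>+x. ennreal (F x) \<partial>lborel) * ennreal (1 / pi)"
      if "F \<in> borel_measurable borel" for F :: "complex \<Rightarrow> real"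
    proof -
      have "ennreal (F x / pi) = ennreal (F x) * ennreal (1 / pi)" for x
        using ennreal_mult''[of "1 / pi" "F x"] by simp
      then show ?thesis using that by (simp add: nn_integral_multc)
    qed
    show "(\<integral>\<^sup>+w. \<kappa> z w \<partial>lborel) \<le> ennreal (\<epsilon> / pi)"
    proof (cases "R < norm z")
      case True
      then have "(\<integral>\<^sup>+w. \<kappa> z w \<partial>lborel) = (\<integral>\<^sup>+w. ennreal (tkern n f z w / pi) \<partial>lborel)" by (simp add: \<kappa>_def)
      also have "\<dots> = (\<integral>\<^sup>+w. ennreal (tkern n f z w) \<partial>lborel) * ennreal (1 / pi)" by (rule div) measurable
      also have "\<dots> \<le> ennreal \<epsilon> * ennreal (1 / pi)" by (rule mult_right_mono[OF small[OF True] zero_le])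
      also have "\<dots> = ennreal (\<epsilon> / pi)" using ennreal_mult''[of "1 / pi" \<epsilon>] by simp
      finally show ?thesis .
    next
      case False
      then show ?thesis by (simp add: \<kappa>_def)
    qed
    fix w :: complex
    have "(\<integral>\<^sup>+z. \<kappa> z w \<partial>lborel) \<le> (\<integral>\<^sup>+z. ennreal (D / pi) * ennreal (exp (- (1/8 * (norm (z - w))\<^sup>2))) \<partial>lborel)"
    proof (rule nn_integral_mono)
      fix z :: complex
      have "\<kappa> z w \<le> ennreal (tkern n f z w / pi)" unfolding \<kappa>_def by (cases "R < norm z") simp_all
      also have "\<dots> \<le> ennreal (D / pi * exp (- (1/8 * (norm (z - w))\<^sup>2)))"
        using divide_right_mono[OF D(2)[of z w], of pi] by (intro ennreal_leI) (simp add: norm_minus_commute)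
      also have "\<dots> = ennreal (D / pi) * ennreal (exp (- (1/8 * (norm (z - w))\<^sup>2)))" by (rule ennreal_mult'') simp
      finally show "\<kappa> z w \<le> ennreal (D / pi) * ennreal (exp (- (1/8 * (norm (z - w))\<^sup>2)))" .
    qed
    also have "\<dots> = ennreal (D / pi) * (\<integral>\<^sup>+z. ennreal (exp (- (1/8 * (norm (z - w))\<^sup>2))) \<partial>lborel)"
      by (rule nn_integral_cmult) measurable
    also have "(\<integral>\<^sup>+z. ennreal (exp (- (1/8 * (norm (z - w))\<^sup>2))) \<partial>lborel) = ennreal (pi / (1/8))"
      by (rule nn_integral_gaussian_shift) simp
    also have "ennreal (D / pi) * ennreal (pi / (1/8)) = ennreal (D / pi * (pi / (1/8)))"
      by (rule ennreal_mult''[symmetric]) simp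
    also have "D / pi * (pi / (1/8)) = 8 * D" by simp
    finally show "(\<integral>\<^sup>+z. \<kappa> z w \<partial>lborel) \<le> ennreal (8 * D)" .
  qed (use e D(1) in simp_all)
qed


text \<open>The projections of \<open>cnj f\<close> times the kernel at \<open>\<zeta> m\<close> are
  moved back to the origin by Weyl operators. They are bounded, so a subsequence converges weakly to
  some \<open>v\<close>; hypothesis \<open>S\<close> makes \<open>v\<close> orthogonal to the whole
  basis, hence zero. Pairing with the kernel at \<open>y\<close> returns \<open>tkern\<close> at the
  shifted point, up to a phase.\<close>

lemma tkern_diagonal:
  assumes C: "C \<ge> 0" "AE w in gauss. norm (f w) \<le> C" "f \<in> borel_measurable borel" and f: "f \<in> Linfty"
    and S: "\<And>i. van (\<lambda>z. L2_inner (\<lambda>w. f w * Wt z (Efun n i) w) (Wt z (Efun n n)))"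
    and \<zeta>: "filterlim (\<lambda>n. norm (\<zeta> n)) at_top sequentially"
  shows "\<exists>r. strict_mono (r :: nat \<Rightarrow> nat) \<and> (\<forall>y. (\<lambda>m. tkern n f (\<zeta> (r m)) (\<zeta> (r m) + y)) \<longlonglongrightarrow> 0)"
proof -
  let ?k = "nkernel (Suc n)"
  note EL = egrow_L2[OF egrow_Efun]
  define a where "a m = (\<lambda>x. cnj (f x) * ?k (\<zeta> m) x)" for m
  have a: "a m \<in> L2" "L2_norm (a m) \<le> C" for m unfolding a_def by (rule tkern_symbol_L2[OF C])+
  define h where "h m = fproj n (a m)" for m
  have h: "h m \<in> true_fock (Suc n)" for m unfolding h_def by (rule fproj_in[OF a(1)])
  define g where "g m = Wt (- \<zeta> m) (h m)" for m
  have g: "g m \<in> true_fock (Suc n)" for m unfolding g_def by (rule Wt_true_fock[OF h])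
  have gn: "L2_norm (g m) \<le> 4 * kbound n * C" for m
  proof -
    have "L2_norm (g m) = L2_norm (h m)" unfolding g_def by (rule L2_norm_Wt[OF true_fock_L2[OF h]])
    also have "\<dots> \<le> 4 * kbound n * L2_norm (a m)" unfolding h_def by (rule fproj_L2(2)[OF a(1)])
    also have "\<dots> \<le> 4 * kbound n * C" using kbound(1)[of n] by (intro mult_left_mono a) simp
    finally show ?thesis .
  qed
  have gi: "L2_inner (g m) u = L2_inner (a m) (Wt (\<zeta> m) u)" if u: "u \<in> true_fock (Suc n)" for m u
  proof -
    have "L2_inner (g m) u = L2_inner (h m) (Wt (- (- \<zeta> m)) u)"
      unfolding g_def by (rule L2_inner_Wt_left[OF true_fock_L2[OF h] true_fock_L2[OF u]])
    also have "\<dots> = L2_inner (h m) (Wt (\<zeta> m) u)" by simp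
    also have "\<dots> = L2_inner (a m) (Wt (\<zeta> m) u)"
      unfolding h_def by (rule fproj_inner[OF a(1) Wt_true_fock[OF u]])
    finally show ?thesis .
  qed
  obtain r v where r: "strict_mono (r :: nat \<Rightarrow> nat)" and lim: "\<And>z. (\<lambda>m. g (r m) z) \<longlonglongrightarrow> v z" and v: "v \<in> true_fock (Suc n)"
    using true_fock_subsequence[of g n, OF g gn] by blast
  note wk = weak_convergence[of "\<lambda>m. g (r m)", OF g gn lim]
  have \<zeta>r: "filterlim (\<lambda>m. norm (\<zeta> (r m))) at_top sequentially"
    by (rule filterlim_compose[OF \<zeta> filterlim_subseq[OF r]])
  have "L2_inner v (Efun n i) = 0" for i
  proof (rule LIMSEQ_unique[OF wk[OF egrow_Efun]])
    define s where "s z = L2_inner (\<lambda>w. f w * Wt z (Efun n i) w) (Wt z (Efun n n))" for z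
    have "L2_inner (g m) (Efun n i) = (-1) ^ n * cnj (s (\<zeta> m))" for m
    proof -
      have k: "?k (\<zeta> m) = (\<lambda>w. (-1) ^ n * Wt (\<zeta> m) (Efun n n) w)"
        unfolding nkernel_Wt K0_Efun[abs_def] Wt_cmult ..
      have "L2_inner (a m) (Wt (\<zeta> m) (Efun n i)) = cnj (L2_inner (Wt (\<zeta> m) (Efun n i)) (a m))"
        by (rule L2_inner_cnj)
      also have "L2_inner (Wt (\<zeta> m) (Efun n i)) (a m) = L2_inner (\<lambda>w. f w * Wt (\<zeta> m) (Efun n i) w) (?k (\<zeta> m))"
        unfolding L2_inner_def a_def by (simp add: mult.left_commute mult.assoc)
      also have "\<dots> = cnj ((-1) ^ n) * s (\<zeta> m)" unfolding k L2_inner_cmult2 s_def ..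
      finally show ?thesis unfolding gi[OF Efun_true_fock] by simp
    qed
    moreover have "(\<lambda>m. s (\<zeta> (r m))) \<longlonglongrightarrow> 0"
      using van_seqD[OF S \<zeta>r] unfolding s_def .
    then have "(\<lambda>m. (-1) ^ n * cnj (s (\<zeta> (r m)))) \<longlonglongrightarrow> (-1) ^ n * cnj 0" by (intro tendsto_intros)
    ultimately show "(\<lambda>m. L2_inner (g (r m)) (Efun n i)) \<longlonglongrightarrow> 0" by simp
  qed
  then have v0: "v = (\<lambda>z. 0)" by (rule Efun_complete[OF v])
  have "tkern n f (\<zeta> m) (\<zeta> m + y) = norm (L2_inner (g m) (?k y))" for m y
  proof -
    define c where "c = exp (of_real (Im (\<zeta> m * cnj y)) * - \<i>)"
    have c: "norm c = 1" unfolding c_def norm_exp_eq_Re by simp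
    have W: "Wt (\<zeta> m) (?k y) = (\<lambda>w. c * ?k (\<zeta> m + y) w)"
      unfolding c_def nkernel_Wt by (rule ext) (rule Wt_Wt)
    have "L2_inner (g m) (?k y) = cnj c * L2_inner (a m) (?k (\<zeta> m + y))"
      unfolding gi[OF nkernel_true_fock] W L2_inner_cmult2 ..
    then show ?thesis unfolding tkern_def a_def[symmetric] by (simp add: norm_mult c)
  qed
  moreover have "(\<lambda>m. norm (L2_inner (g (r m)) (?k y))) \<longlonglongrightarrow> 0" for y
    using tendsto_norm[OF wk[OF nkernel_egrow[of n y]]] unfolding v0 by simp
  ultimately show ?thesis using r by (intro exI[of _ r]) simp
qed

text \<open>\<open>tkern_diagonal\<close> gives pointwise convergence along a subsequence,
  \<open>tkern_bound\<close> a majorant independent of the base point, and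
  \<open>van_subseqI\<close> accepts subsequences.\<close>

lemma tkern_integral_van:
  assumes C: "C \<ge> 0" "AE w in gauss. norm (f w) \<le> C" "f \<in> borel_measurable borel" and f: "f \<in> Linfty"
    and S: "\<And>i. van (\<lambda>z. L2_inner (\<lambda>w. f w * Wt z (Efun n i) w) (Wt z (Efun n n)))" and e: "e > 0"
  shows "\<exists>R. \<forall>z. R \<le> norm z \<longrightarrow> (\<integral>\<^sup>+w. ennreal (tkern n f z w) \<partial>lborel) \<le> ennreal e"
proof -
  note [measurable] = C(3)
  define D where "D = 2 * C * (kbound n)\<^sup>2"
  define rho where "rho z = (LINT y|lborel. tkern n f z (z + y))" for z
  have bd: "norm (tkern n f z (z + y)) \<le> D * exp (- (1/8 * (norm y)\<^sup>2))" for z y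
    using tkern_bound[OF C, of n z "z + y"] unfolding D_def by simp
  have Gi: "integrable lborel (\<lambda>y::complex. D * exp (- (1/8 * (norm y)\<^sup>2)))"
    by (intro integrable_mult_right gaussian_scaled(1)) simp
  have meas: "(\<lambda>y. tkern n f z (z + y)) \<in> borel_measurable lborel" for z by measurable
  have int: "integrable lborel (\<lambda>y. tkern n f z (z + y))" for z
  proof (rule Bochner_Integration.integrable_bound[OF Gi meas], rule AE_I2)
    fix y
    show "norm (tkern n f z (z + y)) \<le> norm (D * exp (- (1/8 * (norm y)\<^sup>2)))"
      by (rule order_trans[OF bd]) (simp only: real_norm_def abs_ge_self)
  qed
  have nn: "(\<integral>\<^sup>+w. ennreal (tkern n f z w) \<partial>lborel) = ennreal (rho z)" for z
  proof -
    have "(\<integral>\<^sup>+w. ennreal (tkern n f z w) \<partial>lborel) = (\<integral>\<^sup>+y. ennreal (tkern n f z (z + y)) \<partial>lborel)"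
      by (rule nn_integral_translate[symmetric]) measurable
    also have "\<dots> = ennreal (rho z)" unfolding rho_def by (rule nn_integral_eq_integral[OF int]) simp
    finally show ?thesis .
  qed
  have "van (\<lambda>z. complex_of_real (rho z))"
  proof (rule van_subseqI)
    fix \<zeta> :: "nat \<Rightarrow> complex" assume \<zeta>: "filterlim (\<lambda>n. norm (\<zeta> n)) at_top sequentially"
    obtain r where r: "strict_mono (r :: nat \<Rightarrow> nat)" and lim: "\<And>y. (\<lambda>m. tkern n f (\<zeta> (r m)) (\<zeta> (r m) + y)) \<longlonglongrightarrow> 0"
      using tkern_diagonal[OF C f S \<zeta>] by blast
    have "(\<lambda>m. rho (\<zeta> (r m))) \<longlonglongrightarrow> (LINT y|(lborel :: complex measure). 0)"
      unfolding rho_def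
      by (rule integral_dominated_convergence[OF _ meas Gi]) (simp_all only: lim bd AE_I2 borel_measurable_const)
    then have "(\<lambda>m. complex_of_real (rho (\<zeta> (r m)))) \<longlonglongrightarrow> of_real 0" by (intro tendsto_of_real) simp
    then show "\<exists>r. strict_mono (r :: nat \<Rightarrow> nat) \<and> (\<lambda>m. complex_of_real (rho (\<zeta> (r m)))) \<longlonglongrightarrow> 0"
      using r by (intro exI[of _ r]) simp
  qed
  from vanD[OF this e] obtain R where R: "\<And>z. R \<le> norm z \<Longrightarrow> \<bar>rho z\<bar> \<le> e" by auto
  show ?thesis unfolding nn using R by (intro exI[of _ R] allI impI ennreal_leI) (meson abs_le_D1)
qed

text \<open>On the disc of radius \<open>R\<close> the functions are uniformly bounded by the
  reproducing property, so dominated convergence applies. Outside, the sequence has small norm, and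
  by Fatou so has its limit.\<close>

lemma l2dist_tail_convergence:
  assumes s: "\<And>m::nat. s m \<in> true_fock (Suc n)" "\<And>m. L2_norm (s m) \<le> M" and v: "v \<in> true_fock (Suc n)" "L2_norm v \<le> M"
    and lim: "\<And>z. (\<lambda>m. s m z) \<longlonglongrightarrow> v z"
    and tail: "\<And>e. e > 0 \<Longrightarrow> \<exists>R. \<forall>m. L2_norm (\<lambda>z. indicator {z. R < norm z} z * s m z) \<le> e"
  shows "(\<lambda>m. l2dist (s m) v) \<longlonglongrightarrow> 0"
proof (rule LIMSEQ_I)
  fix e :: real assume e: "e > 0"
  obtain R where R: "\<And>m. L2_norm (\<lambda>z. indicator {z. R < norm z} z * s m z) \<le> e / 4"
    using tail[of "e / 4"] e by auto
  note [measurable] = L2_measurable[OF true_fock_L2[OF s(1)]] L2_measurable[OF true_fock_L2[OF v(1)]]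
  define st where "st m z = indicator {z. R < norm z} z * s m z" for m z
  define vt where "vt z = indicator {z. R < norm z} z * v z" for z
  define c where "c m z = indicator {z. norm z \<le> R} z * (s m z - v z)" for m z
  have st: "st m \<in> L2" for m unfolding st_def[abs_def]
  proof (rule L2_bound[OF true_fock_L2[OF s(1)[of m]], where C = 1])
    show "AE w in gauss. norm (indicator {z. R < norm z} w * s m w) \<le> 1 * norm (s m w)" by (rule AE_I2) (simp add: indicator_def)
  qed measurable
  have stR: "L2_norm (st m) \<le> e / 4" for m using R[of m] unfolding st_def .
  have "(\<lambda>m. st m z) \<longlonglongrightarrow> vt z" for z unfolding st_def vt_def by (intro tendsto_intros lim)
  from L2_fatou[OF st stR this] have vt: "vt \<in> L2" "L2_norm vt \<le> e / 4" by auto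
  have dL: "(\<lambda>z. s m z - v z) \<in> L2" for m by (rule L2_diff[OF true_fock_L2[OF s(1)] true_fock_L2[OF v(1)]])
  have cL: "c m \<in> L2" for m unfolding c_def[abs_def]
  proof (rule L2_bound[OF dL[of m], where C = 1])
    show "AE w in gauss. norm (indicator {z. norm z \<le> R} w * (s m w - v w)) \<le> 1 * norm (s m w - v w)" by (rule AE_I2) (simp add: indicator_def)
  qed measurable
  define K where "K = 2 * M * exp (R\<^sup>2 / 2)"
  have M: "M \<ge> 0" using v(2) L2_norm_nonneg[of v] by linarith
  have K: "K \<ge> 0" unfolding K_def using M by simp
  have cb: "norm (c m z) \<le> K" for m z
  proof (cases "norm z \<le> R")
    case True
    then have "(norm z)\<^sup>2 \<le> R\<^sup>2" by (intro power_mono) auto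
    then have le: "M * exp ((norm z)\<^sup>2 / 2) \<le> M * exp (R\<^sup>2 / 2)" using M by (intro mult_left_mono) auto
    have "norm (s m z) \<le> L2_norm (s m) * exp ((norm z)\<^sup>2 / 2)" by (rule true_fock_pointwise[OF s(1)])
    also have "\<dots> \<le> M * exp ((norm z)\<^sup>2 / 2)" by (rule mult_right_mono[OF s(2)]) simp
    finally have 1: "norm (s m z) \<le> M * exp ((norm z)\<^sup>2 / 2)" .
    have "norm (v z) \<le> L2_norm v * exp ((norm z)\<^sup>2 / 2)" by (rule true_fock_pointwise[OF v(1)])
    also have "\<dots> \<le> M * exp ((norm z)\<^sup>2 / 2)" by (rule mult_right_mono[OF v(2)]) simp
    finally have 2: "norm (v z) \<le> M * exp ((norm z)\<^sup>2 / 2)" .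
    have "norm (s m z - v z) \<le> K" unfolding K_def using norm_triangle_ineq4[of "s m z" "v z"] 1 2 le by linarith
    then show ?thesis using True by (simp add: c_def)
  next
    case False
    then show ?thesis using K by (simp add: c_def)
  qed
  have cm: "c m \<in> borel_measurable gauss" for m unfolding measurable_gauss by (rule L2_measurable[OF cL])
  have "(\<lambda>m. LINT z|gauss. (norm (c m z))\<^sup>2) \<longlonglongrightarrow> (LINT z|gauss. 0)"
  proof (rule integral_dominated_convergence[where w = "\<lambda>z. K\<^sup>2"])
    show "integrable gauss (\<lambda>z. K\<^sup>2)" by simp
    show "(\<lambda>z. (norm (c m z))\<^sup>2) \<in> borel_measurable gauss" for m using cm[of m] by measurable
    show "AE z in gauss. norm ((norm (c m z))\<^sup>2) \<le> K\<^sup>2" for m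
      by (rule AE_I2) (use power_mono[OF cb norm_ge_zero, of m _ 2] in simp)
    show "AE z in gauss. (\<lambda>m. (norm (c m z))\<^sup>2) \<longlonglongrightarrow> 0"
    proof (rule AE_I2)
      fix z
      have "(\<lambda>m. (norm (c m z))\<^sup>2) \<longlonglongrightarrow> (norm (indicator {z. norm z \<le> R} z * (v z - v z)))\<^sup>2"
        unfolding c_def by (intro tendsto_intros lim)
      then show "(\<lambda>m. (norm (c m z))\<^sup>2) \<longlonglongrightarrow> 0" by simp
    qed
  qed simp
  then have "(\<lambda>m. L2_norm (c m)) \<longlonglongrightarrow> sqrt 0" unfolding L2_norm_def by (intro tendsto_real_sqrt) simp
  then have "\<forall>\<^sub>F m in sequentially. L2_norm (c m) < e / 4" using e by (intro order_tendstoD(2)[of _ "sqrt 0"]) simp_all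
  then obtain N where N: "\<And>m. m \<ge> N \<Longrightarrow> L2_norm (c m) < e / 4" by (auto simp: eventually_sequentially)
  have "norm (l2dist (s m) v - 0) < e" if m: "m \<ge> N" for m
  proof -
    have eq: "(\<lambda>z. s m z - v z) = (\<lambda>z. c m z + (st m z - vt z))"
      unfolding c_def st_def vt_def by (rule ext) (simp add: indicator_def algebra_simps)
    have "l2dist (s m) v \<le> L2_norm (c m) + l2dist (st m) vt"
      unfolding eq by (rule L2_norm_triangle[OF cL L2_diff[OF st vt(1)]])
    moreover have "l2dist (st m) vt \<le> L2_norm (st m) + L2_norm vt"
      using l2dist_triangle[OF st L2_zero vt(1), of m] L2_norm_uminus[of "\<lambda>_. 0" vt] by simp
    ultimately show ?thesis using N[OF m] stR[of m] vt(2) e by simp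
  qed
  then show "\<exists>N. \<forall>m\<ge>N. norm (l2dist (s m) v - 0) < e" by blast
qed

text \<open>Tails that are small uniformly on the image of the unit ball upgrade pointwise
  convergence of a subsequence to norm convergence. In \<open>S\<close> the second vector is
  \<open>Efun n n\<close>, since that is the kernel up to sign.\<close>

lemma toeplitz_compactI:
  assumes f: "f \<in> Linfty"
    and S: "\<And>i. van (\<lambda>z. L2_inner (\<lambda>w. f w * Wt z (Efun n i) w) (Wt z (Efun n n)))"
  shows "toeplitz (Suc n) f \<in> compact_ops (Suc n)"
proof -
  obtain C where C: "C \<ge> 0" "AE w in gauss. norm (f w) \<le> C" "f \<in> borel_measurable borel"
    using Linfty_bound[OF f] by blast
  define D where "D = 2 * C * (kbound n)\<^sup>2"
  have D: "D \<ge> 0" "\<And>z w. tkern n f z w \<le> D * exp (- (1/8 * (norm (w - z))\<^sup>2))"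
    unfolding D_def using C(1) tkern_bound[OF C] by auto
  let ?T = "toeplitz (Suc n) f"
  let ?S = "?T ` {f \<in> true_fock (Suc n). L2_norm f \<le> 1}"
  note Tb = toeplitz_bounded[OF f, of n]
  then have T: "\<And>u. u \<in> true_fock (Suc n) \<Longrightarrow> ?T u \<in> true_fock (Suc n)" by (auto simp: bounded_ops_def)
  obtain M0 where M0: "\<And>u. u \<in> true_fock (Suc n) \<Longrightarrow> L2_norm (?T u) \<le> M0 * L2_norm u"
    using Tb unfolding bounded_ops_def by blast
  have tail: "\<exists>R. \<forall>u\<in>{f \<in> true_fock (Suc n). L2_norm f \<le> 1}. L2_norm (\<lambda>z. indicator {z. R < norm z} z * ?T u z) \<le> e" if e: "e > 0" for e
  proof -
    \<comment> \<open>Chosen so that \<open>sqrt (\<epsilon> / pi * (8 * D)) \<le> e\<close>; the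
      added 1 covers \<open>D = 0\<close>.\<close>
    define \<epsilon> where "\<epsilon> = e\<^sup>2 * pi / (8 * D + 1)"
    have \<epsilon>: "\<epsilon> > 0" unfolding \<epsilon>_def using e D(1) by simp
    obtain R where R: "\<And>z. R \<le> norm z \<Longrightarrow> (\<integral>\<^sup>+w. ennreal (tkern n f z w) \<partial>lborel) \<le> ennreal \<epsilon>"
      using tkern_integral_van[OF C f S \<epsilon>] by blast
    have "\<epsilon> / pi * (8 * D) \<le> e\<^sup>2"
    proof -
      have "\<epsilon> / pi * (8 * D) = e\<^sup>2 * (8 * D / (8 * D + 1))" unfolding \<epsilon>_def by simp
      also have "\<dots> \<le> e\<^sup>2 * 1" using D(1) by (intro mult_left_mono) (simp_all add: divide_le_eq)
      finally show ?thesis by simp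
    qed
    then have sq: "sqrt (\<epsilon> / pi * (8 * D)) \<le> e" using e by (intro real_le_lsqrt) simp_all
    show ?thesis
    proof (intro exI[of _ R] ballI)
      fix u assume u: "u \<in> {f \<in> true_fock (Suc n). L2_norm f \<le> 1}"
      have "L2_norm (\<lambda>z. indicator {z. R < norm z} z * ?T u z) \<le> sqrt (\<epsilon> / pi * (8 * D)) * L2_norm u"
        by (rule toeplitz_tail[OF f _ R _ D]) (use u \<epsilon> in auto)
      also have "\<dots> \<le> e * 1" using u e by (intro mult_mono sq) auto
      finally show "L2_norm (\<lambda>z. indicator {z. R < norm z} z * ?T u z) \<le> e" by simp
    qed
  qed
  have "compactin (tf.mtopology n) (tf.mtopology n closure_of ?S)"
  proof (rule tf.compact_closure_ofI)
    show "?S \<subseteq> true_fock (Suc n)" using T by blast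
    fix \<sigma> :: "nat \<Rightarrow> complex \<Rightarrow> complex" assume \<sigma>: "range \<sigma> \<subseteq> ?S"
    have "\<forall>m. \<exists>u. u \<in> true_fock (Suc n) \<and> L2_norm u \<le> 1 \<and> \<sigma> m = ?T u" using \<sigma> by blast
    then obtain u where u: "\<And>m. u m \<in> true_fock (Suc n)" "\<And>m. L2_norm (u m) \<le> 1" "\<And>m. \<sigma> m = ?T (u m)" by metis
    have s1: "\<sigma> m \<in> true_fock (Suc n)" for m unfolding u(3) by (rule T[OF u(1)])
    have s2: "L2_norm (\<sigma> m) \<le> \<bar>M0\<bar>" for m
    proof -
      have "L2_norm (\<sigma> m) \<le> M0 * L2_norm (u m)" unfolding u(3) by (rule M0[OF u(1)])
      also have "\<dots> \<le> \<bar>M0\<bar> * 1" by (intro mult_mono u) auto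
      finally show ?thesis by simp
    qed
    obtain r v where r: "strict_mono (r :: nat \<Rightarrow> nat)" and lim: "\<And>z. (\<lambda>m. \<sigma> (r m) z) \<longlonglongrightarrow> v z"
      and v: "v \<in> true_fock (Suc n)" "L2_norm v \<le> \<bar>M0\<bar>"
      using true_fock_subsequence[of \<sigma>, OF s1 s2] by blast
    have "(\<lambda>m. l2dist (\<sigma> (r m)) v) \<longlonglongrightarrow> 0"
    proof (rule l2dist_tail_convergence[OF s1 s2 v lim])
      fix e :: real assume "e > 0"
      from tail[OF this] show "\<exists>R. \<forall>m. L2_norm (\<lambda>z. indicator {z. R < norm z} z * \<sigma> (r m) z) \<le> e"
        unfolding u(3) using u(1,2) by blast
    qed
    then have "limitin (tf.mtopology n) (\<sigma> \<circ> r) v sequentially"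
      unfolding tf.limitin_metric_dist_null using v(1) s1 by simp
    then show "\<exists>l r. strict_mono r \<and> limitin (tf.mtopology n) (\<sigma> \<circ> r) l sequentially" using r by blast
  qed
  then show ?thesis using Tb unfolding compact_ops_def fock_topology_def by blast
qed

section \<open>Narrowing Gaussian averages\<close>

text \<open>The index \<open>j\<close> is carried along because narrowing the Gaussian produces
  higher powers of the squared norm.\<close>

definition gker :: "real \<Rightarrow> nat \<Rightarrow> complex \<Rightarrow> real" where
  "gker s j y = ((norm y)\<^sup>2) ^ j * exp (- (s * (norm y)\<^sup>2))"

lemma gker_nonneg [simp]: "gker s j y \<ge> 0"
  by (simp add: gker_def)

lemma gker_measurable [measurable]: "gker s j \<in> borel_measurable borel"
  unfolding gker_def[abs_def] by measurable

lemma nn_gauss_power: "(\<integral>\<^sup>+y. ennreal (((norm y)\<^sup>2) ^ j) \<partial>gauss) = ennreal (fact j)"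
proof -
  have L: "(\<lambda>y. cnj y ^ j) \<in> L2" unfolding Efun_0[symmetric] by (rule egrow_L2[OF egrow_Efun])
  have "complex_of_real ((L2_norm (\<lambda>y. cnj y ^ j))\<^sup>2) = complex_of_real (fact j)"
    using moment_fact[of j] unfolding moment_def L2_inner_self by simp
  then have n: "(L2_norm (\<lambda>y. cnj y ^ j))\<^sup>2 = fact j" by (simp only: of_real_eq_iff)
  have "((norm y)\<^sup>2) ^ j = (norm (cnj y ^ j))\<^sup>2" for y :: complex
    by (simp add: norm_power power_mult[symmetric] mult.commute)
  then show ?thesis using nn_L2_norm[OF L] unfolding n by simp
qed

lemma nn_gker:
  assumes s: "s > 0"
  shows "(\<integral>\<^sup>+y. ennreal (gker s j y) \<partial>lborel) = ennreal (pi * fact j / s ^ Suc j)"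
proof -
  define r where "r = 1 / sqrt s"
  have r: "r > 0" "r\<^sup>2 = 1 / s" unfolding r_def using s by (simp_all add: power_divide)
  have m1: "(\<lambda>y. ennreal (gker s j y)) \<in> borel_measurable borel" by measurable
  have e: "ennreal (gker s j (of_real r * y)) = ennreal (pi / s ^ j) * (ennreal (exp (- (norm y)\<^sup>2) / pi) * ennreal (((norm y)\<^sup>2) ^ j))" for y
  proof -
    have n: "(norm (of_real r * y))\<^sup>2 = (norm y)\<^sup>2 / s"
      unfolding norm_mult power_mult_distrib norm_of_real power2_abs r(2) by simp
    have "gker s j (of_real r * y) = pi / s ^ j * (exp (- (norm y)\<^sup>2) / pi * ((norm y)\<^sup>2) ^ j)"
      unfolding gker_def n using s by (simp add: power_divide)
    also have "ennreal \<dots> = ennreal (pi / s ^ j) * ennreal (exp (- (norm y)\<^sup>2) / pi * ((norm y)\<^sup>2) ^ j)"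
      by (rule ennreal_mult'') simp
    also have "ennreal (exp (- (norm y)\<^sup>2) / pi * ((norm y)\<^sup>2) ^ j) = ennreal (exp (- (norm y)\<^sup>2) / pi) * ennreal (((norm y)\<^sup>2) ^ j)"
      by (rule ennreal_mult'') simp
    finally show ?thesis .
  qed
  have "(\<integral>\<^sup>+y. ennreal (gker s j y) \<partial>lborel) = ennreal (r\<^sup>2) * (\<integral>\<^sup>+y. ennreal (gker s j (of_real r * y)) \<partial>lborel)"
    by (rule nn_integral_scale_complex[OF m1 r(1)])
  also have "(\<integral>\<^sup>+y. ennreal (gker s j (of_real r * y)) \<partial>lborel)
      = ennreal (pi / s ^ j) * (\<integral>\<^sup>+y. ennreal (exp (- (norm (y :: complex))\<^sup>2) / pi) * ennreal (((norm y)\<^sup>2) ^ j) \<partial>lborel)"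
    unfolding e by (rule nn_integral_cmult) measurable
  also have "(\<integral>\<^sup>+y. ennreal (exp (- (norm (y :: complex))\<^sup>2) / pi) * ennreal (((norm y)\<^sup>2) ^ j) \<partial>lborel) = ennreal (fact j)"
    unfolding nn_gauss_power[symmetric] by (rule nn_integral_gauss[symmetric]) measurable
  also have "ennreal (r\<^sup>2) * (ennreal (pi / s ^ j) * ennreal (fact j)) = ennreal (1 / s * (pi / s ^ j * fact j))"
  proof -
    have "ennreal (1 / s * (pi / s ^ j * fact j)) = ennreal (1 / s) * ennreal (pi / s ^ j * fact j)"
      by (rule ennreal_mult'') (use s in simp)
    also have "ennreal (pi / s ^ j * fact j) = ennreal (pi / s ^ j) * ennreal (fact j)"
      by (rule ennreal_mult'') simp
    finally show ?thesis unfolding r(2) ..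
  qed
  also have "1 / s * (pi / s ^ j * fact j) = pi * fact j / s ^ Suc j" by simp
  finally show ?thesis .
qed

lemma gker_integral:
  assumes s: "s > 0"
  shows "integrable lborel (gker s j)" "(LINT y|lborel. gker s j y) = pi * fact j / s ^ Suc j"
proof -
  have m: "gker s j \<in> borel_measurable lborel" by measurable
  show i: "integrable lborel (gker s j)"
  proof (rule integrableI_nonneg[OF m])
    show "AE y in lborel. 0 \<le> gker s j y" by (rule AE_I2) (rule gker_nonneg)
    show "(\<integral>\<^sup>+y. ennreal (gker s j y) \<partial>lborel) < \<infinity>" unfolding nn_gker[OF s] by simp
  qed
  have "ennreal (LINT y|lborel. gker s j y) = ennreal (pi * fact j / s ^ Suc j)"
    unfolding nn_gker[OF s, symmetric]
    by (rule nn_integral_eq_integral[OF i, symmetric]) (rule AE_I2, rule gker_nonneg)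
  then show "(LINT y|lborel. gker s j y) = pi * fact j / s ^ Suc j"
    using s by (subst (asm) ennreal_inj) (auto intro!: Bochner_Integration.integral_nonneg)
qed

definition gconv :: "real \<Rightarrow> nat \<Rightarrow> (complex \<Rightarrow> complex) \<Rightarrow> complex \<Rightarrow> complex" where
  "gconv s j a z = (LINT y|lborel. of_real (gker s j y) * a (z + y))"

lemma gconv_integrable:
  fixes a :: "complex \<Rightarrow> complex"
  assumes s: "s > 0" and m: "a \<in> borel_measurable borel" and C: "\<And>z. norm (a z) \<le> C"
  shows "integrable lborel (\<lambda>y. of_real (gker s j y) * a (z + y))"
proof (rule Bochner_Integration.integrable_bound)
  note [measurable] = m
  show "integrable lborel (\<lambda>y. C * gker s j y)" by (intro integrable_mult_right gker_integral s)
  show "(\<lambda>y. of_real (gker s j y) * a (z + y)) \<in> borel_measurable lborel" by measurable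
  have C0: "C \<ge> 0" using C[of 0] norm_ge_zero[of "a 0"] by linarith
  show "AE y in lborel. norm (of_real (gker s j y) * a (z + y)) \<le> norm (C * gker s j y)"
  proof (rule AE_I2)
    fix y
    have "norm (of_real (gker s j y) * a (z + y)) = gker s j y * norm (a (z + y))" by (simp add: norm_mult)
    also have "\<dots> \<le> gker s j y * C" by (rule mult_left_mono[OF C]) simp
    also have "\<dots> = norm (C * gker s j y)" using C0 by (simp add: mult.commute)
    finally show "norm (of_real (gker s j y) * a (z + y)) \<le> norm (C * gker s j y)" .
  qed
qed

text \<open>Ratio test. The base 3 is the quotient of the rates \<open>3/4 * s\<close> and
  \<open>s / 4\<close> in \<open>gconv_step\<close>.\<close>

lemma factorial_ratio_null: "(\<lambda>N. fact (j + N) / (fact N * 3 ^ N) :: real) \<longlonglongrightarrow> 0"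
proof (rule summable_LIMSEQ_zero, rule summable_ratio_test)
  show "(1/2::real) < 1" by simp
  fix N assume N: "N \<ge> 2 * j"
  let ?c = "\<lambda>N. fact (j + N) / (fact N * 3 ^ N) :: real"
  have "?c (Suc N) = ?c N * ((real j + real N + 1) / (3 * (real N + 1)))"
    by (simp add: field_simps)
  moreover have "(real j + real N + 1) / (3 * (real N + 1)) \<le> 1/2"
    using N by (simp add: field_simps)
  ultimately show "norm (?c (Suc N)) \<le> 1/2 * norm (?c N)"
    using mult_left_mono[of "(real j + real N + 1) / (3 * (real N + 1))" "1/2" "?c N"] by simp
qed

lemma exp_minus_taylor:
  fixes x :: real
  assumes "x \<ge> 0" shows "\<bar>exp (- x) - (\<Sum>m<N. (- x) ^ m / fact m)\<bar> \<le> exp x * x ^ N / fact N"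
proof -
  obtain t where t: "\<bar>t\<bar> \<le> \<bar>- x\<bar>" "exp (- x) = (\<Sum>m<N. (- x) ^ m / fact m) + exp t / fact N * (- x) ^ N"
    using Maclaurin_exp_le[of "- x" N] by blast
  have "exp t \<le> exp x" using t(1) assms by simp
  then have "exp t * x ^ N / fact N \<le> exp x * x ^ N / fact N"
    using assms by (intro divide_right_mono mult_right_mono) simp_all
  then show ?thesis unfolding t(2) using assms by (simp add: abs_mult power_abs)
qed

lemma van_sum: "(\<And>i. i < N \<Longrightarrow> van (f i)) \<Longrightarrow> van (\<lambda>z. \<Sum>i<(N::nat). f i z)"
proof (induction N)
  case 0
  then show ?case by (simp add: van_def)
next
  case (Suc N)
  then show ?case using van_add[of "\<lambda>z. \<Sum>i<N. f i z" "f N"] by simp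
qed

text \<open>The additional factor \<open>exp (- x)\<close> with
  \<open>x = s / 4 * (norm y)\<^sup>2\<close> is replaced by a Taylor polynomial, which turns the
  narrower kernel into a finite combination of kernels \<open>gker s (j + m)\<close>. The remainder
  carries \<open>exp x\<close>, which costs \<open>s / 4\<close> of the decay and leaves the rate
  \<open>3/4 * s\<close>; its integral is a constant times
  \<open>fact (j + N) / (fact N * 3 ^ N)\<close>. A step to \<open>5/4 * s\<close> is short enough,
  as \<open>1/4\<close> is smaller than \<open>3/4\<close>.\<close>

lemma gconv_step:
  assumes s: "s > 0" and m: "a \<in> borel_measurable borel" and C: "\<And>z. norm (a z) \<le> C"
    and v: "\<And>j. van (gconv s j a)"
  shows "van (gconv (5/4 * s) j a)"
  unfolding van_def
proof (intro allI impI)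
  fix e :: real assume e: "e > 0"
  have C0: "C \<ge> 0" using C[of 0] norm_ge_zero[of "a 0"] by linarith
  have s': "3/4 * s > 0" "5/4 * s > 0" using s by simp_all
  define D where "D = C * (pi / (3/4 * s) ^ Suc j)"
  have "(\<lambda>N. D * (fact (j + N) / (fact N * 3 ^ N))) \<longlonglongrightarrow> 0"
    by (rule tendsto_mult_right_zero[OF factorial_ratio_null])
  then have "\<forall>\<^sub>F N in sequentially. D * (fact (j + N) / (fact N * 3 ^ N)) < e / 2"
    using e by (intro order_tendstoD(2)[of _ 0]) simp_all
  then obtain N where N: "D * (fact (j + N) / (fact N * 3 ^ N)) < e / 2" by (auto simp: eventually_sequentially)
  define c where "c m = (- (s / 4)) ^ m / fact m" for m :: nat
  define F where "F z = (\<Sum>m<N. of_real (c m) * gconv s (j + m) a z)" for z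
  have "van F" unfolding F_def[abs_def] by (intro van_sum van_cmult v)
  then obtain R where R: "\<And>z. R \<le> norm z \<Longrightarrow> norm (F z) \<le> e / 2" using vanD[of F "e / 2"] e by auto
  have pt: "\<bar>gker (5/4 * s) j y - (\<Sum>m<N. c m * gker s (j + m) y)\<bar> \<le> (s / 4) ^ N / fact N * gker (3/4 * s) (j + N) y" for y
  proof -
    define x where "x = s / 4 * (norm y)\<^sup>2"
    have x: "x \<ge> 0" unfolding x_def using s by simp
    have 1: "gker (5/4 * s) j y = gker s j y * exp (- x)"
      unfolding gker_def x_def mult.assoc exp_add[symmetric] by (simp add: field_simps)
    have 2: "c m * gker s (j + m) y = gker s j y * ((- x) ^ m / fact m)" for m
    proof -
      have "- x = - (s / 4) * (norm y)\<^sup>2" unfolding x_def by simp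
      then have "(- x) ^ m = (- (s / 4)) ^ m * ((norm y)\<^sup>2) ^ m" by (simp only: power_mult_distrib)
      then show ?thesis unfolding c_def gker_def power_add by simp
    qed
    have 3: "gker s j y * (exp x * x ^ N / fact N) = (s / 4) ^ N / fact N * gker (3/4 * s) (j + N) y"
    proof -
      have "exp (- (3/4 * s * (norm y)\<^sup>2)) = exp (- (s * (norm y)\<^sup>2)) * exp x"
        unfolding x_def exp_add[symmetric] by (simp add: field_simps)
      moreover have "x ^ N = (s / 4) ^ N * ((norm y)\<^sup>2) ^ N" unfolding x_def by (simp only: power_mult_distrib)
      ultimately show ?thesis unfolding gker_def power_add by simp
    qed
    have "gker (5/4 * s) j y - (\<Sum>m<N. c m * gker s (j + m) y) = gker s j y * (exp (- x) - (\<Sum>m<N. (- x) ^ m / fact m))"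
      unfolding 1 2 sum_distrib_left[symmetric] by (simp only: right_diff_distrib)
    then have "\<bar>gker (5/4 * s) j y - (\<Sum>m<N. c m * gker s (j + m) y)\<bar> = gker s j y * \<bar>exp (- x) - (\<Sum>m<N. (- x) ^ m / fact m)\<bar>"
      by (simp add: abs_mult)
    also have "\<dots> \<le> gker s j y * (exp x * x ^ N / fact N)" by (rule mult_left_mono[OF exp_minus_taylor[OF x] gker_nonneg])
    finally show ?thesis unfolding 3 .
  qed
  have err: "norm (gconv (5/4 * s) j a z - F z) \<le> e / 2" for z
  proof -
    let ?t = "\<lambda>m y. of_real (c m) * (of_real (gker s (j + m) y) * a (z + y))"
    have it: "integrable lborel (?t m)" for m by (rule integrable_mult_right[OF gconv_integrable[OF s m C]])
    have isum: "integrable lborel (\<lambda>y. \<Sum>m<N. ?t m y)" by (rule Bochner_Integration.integrable_sum) (rule it)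
    have i5: "integrable lborel (\<lambda>y. of_real (gker (5/4 * s) j y) * a (z + y))" by (rule gconv_integrable[OF s'(2) m C])
    have "F z = (\<Sum>m<N. (LINT y|lborel. ?t m y))" unfolding F_def gconv_def by (simp only: integral_mult_right_zero)
    also have "\<dots> = (LINT y|lborel. (\<Sum>m<N. ?t m y))" by (rule Bochner_Integration.integral_sum[symmetric]) (rule it)
    finally have "gconv (5/4 * s) j a z - F z = (LINT y|lborel. of_real (gker (5/4 * s) j y) * a (z + y) - (\<Sum>m<N. ?t m y))"
      unfolding gconv_def Bochner_Integration.integral_diff[OF i5 isum] by simp
    also have "norm \<dots> \<le> (LINT y|lborel. C * ((s / 4) ^ N / fact N) * gker (3/4 * s) (j + N) y)"
    proof (rule Bochner_Integration.integral_norm_bound_integral)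
      show "integrable lborel (\<lambda>y. of_real (gker (5/4 * s) j y) * a (z + y) - (\<Sum>m<N. ?t m y))" by (rule Bochner_Integration.integrable_diff[OF i5 isum])
      show "integrable lborel (\<lambda>y. C * ((s / 4) ^ N / fact N) * gker (3/4 * s) (j + N) y)" by (intro integrable_mult_right gker_integral s')
      fix y
      have "of_real (gker (5/4 * s) j y) * a (z + y) - (\<Sum>m<N. ?t m y) = of_real (gker (5/4 * s) j y - (\<Sum>m<N. c m * gker s (j + m) y)) * a (z + y)"
        by (simp add: left_diff_distrib sum_distrib_right mult.assoc)
      then have "norm (of_real (gker (5/4 * s) j y) * a (z + y) - (\<Sum>m<N. ?t m y)) = \<bar>gker (5/4 * s) j y - (\<Sum>m<N. c m * gker s (j + m) y)\<bar> * norm (a (z + y))"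
        by (simp only: norm_mult norm_of_real)
      also have "\<dots> \<le> ((s / 4) ^ N / fact N * gker (3/4 * s) (j + N) y) * C"
        by (rule mult_mono[OF pt C]) (use s in simp_all)
      finally show "norm (of_real (gker (5/4 * s) j y) * a (z + y) - (\<Sum>m<N. ?t m y)) \<le> C * ((s / 4) ^ N / fact N) * gker (3/4 * s) (j + N) y"
        by (simp only: mult_ac)
    qed
    also have "\<dots> = C * ((s / 4) ^ N / fact N) * (pi * fact (j + N) / (3/4 * s) ^ Suc (j + N))"
      unfolding integral_mult_right_zero gker_integral(2)[OF s'(1)] ..
    also have "\<dots> = D * (fact (j + N) / (fact N * 3 ^ N))"
    proof -
      have p: "(3/4 * s) ^ Suc (j + N) = (3/4 * s) ^ Suc j * (3 ^ N * (s / 4) ^ N)"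
        unfolding power_mult_distrib[symmetric] by (simp add: power_add power_mult_distrib)
      have "s \<noteq> 0" using s by simp
      then show ?thesis unfolding D_def p by (simp add: mult_ac)
    qed
    finally show ?thesis using N by linarith
  qed
  show "\<exists>R. \<forall>z. R \<le> norm z \<longrightarrow> norm (gconv (5/4 * s) j a z) \<le> e"
  proof (intro exI[of _ R] allI impI)
    fix z :: complex assume "R \<le> norm z"
    then have "norm (F z + (gconv (5/4 * s) j a z - F z)) \<le> e / 2 + e / 2" by (intro norm_triangle_mono R err)
    then show "norm (gconv (5/4 * s) j a z) \<le> e" by simp
  qed
qed

text \<open>Iterated steps make the Gaussian arbitrarily narrow, and a Lipschitz function differs
  little from its narrow averages. The hypothesis covers all \<open>j\<close>, since each step at
  \<open>j\<close> draws on higher indices.\<close>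

lemma gconv_sharpen:
  assumes m: "a \<in> borel_measurable borel" and C: "\<And>z. norm (a z) \<le> C"
    and L: "L \<ge> 0" "\<And>z w. norm (a z - a w) \<le> L * norm (z - w)"
    and v: "\<And>j. van (gconv 1 j a)"
  shows "van a"
  unfolding van_def
proof (intro allI impI)
  fix e :: real assume e: "e > 0"
  have all: "van (gconv ((5/4) ^ k) j a)" for k j
  proof (induction k arbitrary: j)
    case 0 then show ?case using v by simp
  next
    case (Suc k)
    have "(0::real) < (5/4) ^ k" by simp
    from gconv_step[OF this m C Suc] show ?case by simp
  qed
  \<comment> \<open>The error will be half of \<open>L * \<delta>\<close> plus half of
    \<open>L / (\<delta> * s)\<close>, relative to the mass \<open>pi / s\<close>. First
    \<open>\<delta>\<close> and then the number \<open>k\<close> of steps bring each of the two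
    terms to at most \<open>e / 2\<close>.\<close>
  define \<delta> where "\<delta> = e / (2 * (L + 1))"
  have \<delta>: "\<delta> > 0" unfolding \<delta>_def using e L(1) by simp
  have L\<delta>: "L * \<delta> \<le> e / 2" unfolding \<delta>_def using e L(1) by (simp add: field_simps)
  obtain k where k: "2 * L / (\<delta> * e) < (5/4 :: real) ^ k" using real_arch_pow[of "5/4"] by auto
  define s :: real where "s = (5/4) ^ k"
  have s: "s > 0" unfolding s_def by simp
  have Ls: "L / (\<delta> * s) \<le> e / 2"
    using k \<delta> e s unfolding s_def[symmetric] by (simp add: field_simps)
  obtain R where R: "\<And>z. R \<le> norm z \<Longrightarrow> norm (gconv s 0 a z) \<le> e / 2 * (pi / s)"
    using vanD[OF all[of k 0], of "e / 2 * (pi / s)"] e s unfolding s_def[symmetric] by auto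
  have g0: "(LINT y|lborel. gker s 0 y) = pi / s" "(LINT y|lborel. gker s 1 y) = pi / s / s"
    using gker_integral(2)[OF s, of 0] gker_integral(2)[OF s, of 1] by simp_all
  have err: "norm (gconv s 0 a z - of_real (pi / s) * a z) \<le> e / 2 * (pi / s)" for z
  proof -
    have ia: "integrable lborel (\<lambda>y. of_real (gker s 0 y) * a (z + y))" by (rule gconv_integrable[OF s m C])
    have ig: "integrable lborel (\<lambda>y. complex_of_real (gker s 0 y) * a z)"
      by (intro integrable_mult_left integrable_of_real gker_integral(1) s)
    have "of_real (pi / s) * a z = (LINT y|lborel. complex_of_real (gker s 0 y) * a z)"
      unfolding integral_mult_left_zero integral_complex_of_real g0 ..
    then have "gconv s 0 a z - of_real (pi / s) * a z = (LINT y|lborel. of_real (gker s 0 y) * a (z + y) - of_real (gker s 0 y) * a z)"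
      unfolding gconv_def Bochner_Integration.integral_diff[OF ia ig] by simp
    also have "norm \<dots> \<le> (LINT y|lborel. L * \<delta> / 2 * gker s 0 y + L / (2 * \<delta>) * gker s 1 y)"
    proof (rule Bochner_Integration.integral_norm_bound_integral)
      show "integrable lborel (\<lambda>y. of_real (gker s 0 y) * a (z + y) - of_real (gker s 0 y) * a z)" by (rule Bochner_Integration.integrable_diff[OF ia ig])
      show "integrable lborel (\<lambda>y. L * \<delta> / 2 * gker s 0 y + L / (2 * \<delta>) * gker s 1 y)"
        by (intro Bochner_Integration.integrable_add integrable_mult_right gker_integral(1) s)
      fix y :: complex
      \<comment> \<open>Trades the odd moment \<open>norm y\<close> for even ones, whose Gaussian
        integrals are known.\<close>
      have q: "norm y \<le> \<delta> / 2 + (norm y)\<^sup>2 / (2 * \<delta>)"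
      proof -
        have "0 \<le> (norm y - \<delta>)\<^sup>2 / (2 * \<delta>)" using \<delta> by simp
        also have "\<dots> = \<delta> / 2 + (norm y)\<^sup>2 / (2 * \<delta>) - norm y" using \<delta> by (simp add: power2_eq_square field_simps)
        finally show ?thesis by simp
      qed
      have "norm (of_real (gker s 0 y) * a (z + y) - of_real (gker s 0 y) * a z) = gker s 0 y * norm (a (z + y) - a z)"
        unfolding right_diff_distrib[symmetric] by (simp add: norm_mult)
      also have "\<dots> \<le> gker s 0 y * (L * norm y)" using L(2)[of "z + y" z] by (intro mult_left_mono) simp_all
      also have "\<dots> \<le> gker s 0 y * (L * (\<delta> / 2 + (norm y)\<^sup>2 / (2 * \<delta>)))" by (intro mult_left_mono q L(1)) simp
      also have "\<dots> = L * \<delta> / 2 * gker s 0 y + L / (2 * \<delta>) * gker s 1 y" by (simp add: gker_def algebra_simps)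
      finally show "norm (of_real (gker s 0 y) * a (z + y) - of_real (gker s 0 y) * a z) \<le> L * \<delta> / 2 * gker s 0 y + L / (2 * \<delta>) * gker s 1 y" .
    qed
    also have "\<dots> = L * \<delta> / 2 * (pi / s) + L / (2 * \<delta>) * (pi / s / s)"
      using Bochner_Integration.integral_add[OF integrable_mult_right[OF gker_integral(1)[OF s, of 0], of "L * \<delta> / 2"] integrable_mult_right[OF gker_integral(1)[OF s, of 1], of "L / (2 * \<delta>)"]]
      unfolding integral_mult_right_zero g0 by simp
    also have "\<dots> = (L * \<delta> / 2 + L / (\<delta> * s) / 2) * (pi / s)" unfolding distrib_right by (simp add: mult_ac)
    also have "\<dots> \<le> (e / 2) * (pi / s)"
    proof (rule mult_right_mono)
      show "L * \<delta> / 2 + L / (\<delta> * s) / 2 \<le> e / 2" by (rule order_trans[OF add_mono[OF divide_right_mono[OF L\<delta>] divide_right_mono[OF Ls]]]) simp_all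
    qed (use s in simp)
    finally show ?thesis .
  qed
  show "\<exists>R. \<forall>z. R \<le> norm z \<longrightarrow> norm (a z) \<le> e"
  proof (intro exI[of _ R] allI impI)
    fix z :: complex assume z: "R \<le> norm z"
    have "norm (of_real (pi / s) * a z) \<le> norm (gconv s 0 a z) + norm (gconv s 0 a z - of_real (pi / s) * a z)"
      using norm_triangle_ineq4[of "gconv s 0 a z" "gconv s 0 a z - of_real (pi / s) * a z"] by simp
    also have "\<dots> \<le> e / 2 * (pi / s) + e / 2 * (pi / s)" by (intro add_mono R z err)
    finally have "(pi / s) * norm (a z) \<le> (pi / s) * e" using s by (simp add: norm_mult norm_divide mult.commute)
    then show "norm (a z) \<le> e" by (rule mult_left_le_imp_le) (use s in simp)
  qed
qed

section \<open>Convolution with the Gaussian and the Laguerre recurrence\<close>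

definition conv :: "(complex \<Rightarrow> complex) \<Rightarrow> complex \<Rightarrow> complex" where
  "conv f z = (LINT w|gauss. f (z + w))"

lemma conv_integrable: "Bs n f \<Longrightarrow> integrable gauss (\<lambda>w. f (z + w))"
proof -
  assume f: "Bs n f"
  obtain M where M: "\<And>z. norm (f z) \<le> M" using Bs_bound[OF f] by blast
  have "(\<lambda>w. f (z + w)) \<in> borel_measurable borel"
  proof (rule borel_measurable_continuous_onI, rule continuous_on_compose2[OF Bs_continuous[OF f]])
    show "continuous_on UNIV ((+) z)" by (intro continuous_intros)
  qed simp
  then have "(\<lambda>w. f (z + w)) \<in> borel_measurable gauss" unfolding measurable_gauss .
  moreover have "AE w in gauss. norm (f (z + w)) \<le> M" by (rule AE_I2) (rule M)
  ultimately show ?thesis by (intro gauss.integrable_const_bound)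
qed

lemma conv_wirt:
  assumes f: "Bs 2 f" shows "wirt (conv f) (conv (dz f) z) (conv (dbar f) z) z"
proof -
  obtain M where M: "M \<ge> 0" "\<And>z \<delta>. norm (f (z + \<delta>) - f z - (dz f z * \<delta> + dbar f z * cnj \<delta>)) \<le> M * (norm \<delta>)\<^sup>2"
    using Bs_taylor[OF f] by blast
  have f2: "Bs 1 (dz f)" "Bs 1 (dbar f)" using f by (simp_all add: numeral_2_eq_2)
  show ?thesis
  proof (rule wirtI_second_order)
    fix \<delta> :: complex
    note i = conv_integrable[OF f, of "z + \<delta>"] conv_integrable[OF f, of z]
      conv_integrable[OF f2(1), of z] conv_integrable[OF f2(2), of z]
    let ?I = "\<lambda>w. f (z + \<delta> + w) - f (z + w) - (dz f (z + w) * \<delta> + dbar f (z + w) * cnj \<delta>)"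
    have iI: "integrable gauss ?I"
      by (intro Bochner_Integration.integrable_diff Bochner_Integration.integrable_add integrable_mult_left i)
    have "conv f (z + \<delta>) - conv f z - (conv (dz f) z * \<delta> + conv (dbar f) z * cnj \<delta>) = (LINT w|gauss. ?I w)"
      unfolding conv_def using i by simp
    also have "norm \<dots> \<le> (LINT w|gauss. M * (norm \<delta>)\<^sup>2)"
    proof (rule Bochner_Integration.integral_norm_bound_integral[OF iI])
      show "integrable gauss (\<lambda>w. M * (norm \<delta>)\<^sup>2)" by simp
      fix w show "norm (?I w) \<le> M * (norm \<delta>)\<^sup>2" using M(2)[of "z + w" \<delta>] by (simp only: add.assoc add.commute[of w])
    qed
    also have "\<dots> = M * (norm \<delta>)\<^sup>2" by (simp add: gauss.prob_space)
    finally show "norm (conv f (z + \<delta>) - conv f z - (conv (dz f) z * \<delta> + conv (dbar f) z * cnj \<delta>)) \<le> M * (norm \<delta>)\<^sup>2" .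
  qed
qed

lemma conv_bounded: "Bs n f \<Longrightarrow> bounded (range (conv f))"
proof -
  assume f: "Bs n f"
  obtain M where M: "\<And>z. norm (f z) \<le> M" using Bs_bound[OF f] by blast
  have "norm (conv f z) \<le> M" for z
  proof -
    have "norm (conv f z) \<le> (LINT w|gauss. M)"
      unfolding conv_def by (rule Bochner_Integration.integral_norm_bound_integral[OF conv_integrable[OF f]]) (simp_all add: M)
    then show ?thesis by (simp add: gauss.prob_space)
  qed
  then show ?thesis by (auto simp: bounded_iff)
qed

lemma Binf_conv: assumes "Binf f" shows "Binf (conv f)"
proof -
  have "Bs n (conv f)" if "Binf f" for n f
    using that
  proof (induction n arbitrary: f)
    case 0
    have "conv f differentiable (at z)" for z by (rule wirtD(1)[OF conv_wirt[OF BinfD[OF 0]]])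
    then have "continuous_on UNIV (conv f)" by (auto intro!: differentiable_imp_continuous_on simp: differentiable_on_def)
    then show ?case using conv_bounded[OF BinfD[OF 0]] by simp
  next
    case (Suc n)
    show ?case
      by (rule Bs_SucI[OF conv_bounded[OF BinfD[OF Suc.prems]] conv_wirt[OF BinfD[OF Suc.prems]]
            Suc.IH[OF Binf_dz[OF Suc.prems]] Suc.IH[OF Binf_dbar[OF Suc.prems]]])
  qed
  then show ?thesis using assms by (simp add: Binf_def)
qed

lemma Lap_conv: "Binf f \<Longrightarrow> Lap (conv f) = conv (Lap f)"
  unfolding Lap_def using wirt_funD[OF conv_wirt[OF BinfD]] Binf_dbar by metis

lemma lapoly_conv: assumes f: "Binf f" shows "lapoly p (conv f) = conv (lapoly p f)"
proof
  fix z
  have pw: "(Lap ^^ i) (conv f) = conv ((Lap ^^ i) f)" for i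
    by (induction i) (simp_all add: Lap_conv Binf_Lap_pow[OF f])
  note i = conv_integrable[OF BinfD[OF Binf_Lap_pow[OF f]]]
  have "conv (lapoly p f) z = (LINT w|gauss. (\<Sum>i\<le>degree p. coeff p i * (Lap ^^ i) f (z + w)))"
    unfolding conv_def lapoly_def ..
  also have "\<dots> = (\<Sum>i\<le>degree p. (LINT w|gauss. coeff p i * (Lap ^^ i) f (z + w)))"
    by (rule Bochner_Integration.integral_sum) (rule integrable_mult_right[OF i])
  also have "\<dots> = lapoly p (conv f) z" unfolding lapoly_def pw unfolding conv_def by simp
  finally show "lapoly p (conv f) z = conv (lapoly p f) z" ..
qed

text \<open>The polynomials must depend on \<open>n\<close> alone, hence the quantifier over
  \<open>G\<close> inside. Two consecutive members are carried through the induction because the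
  recurrence has three terms. At \<open>j = 0\<close> the member at \<open>j - 1\<close> has
  coefficient 0.\<close>

lemma laguerre_recurrence:
  "\<exists>p q. \<forall>G. (\<forall>j. Binf (G j)) \<longrightarrow>
    (\<forall>j z. Lap (G j) z = of_nat (Suc j) * G (Suc j) z - of_nat (2 * j + 1) * G j z + of_nat j * G (j - 1) z) \<longrightarrow>
    G n = lapoly p (G 0) \<and> G (Suc n) = lapoly q (G 0)"
proof (induction n)
  case 0
  have one: "lapoly 1 u = u" for u by (simp add: lapoly_def fun_eq_iff)
  have "G (Suc 0) = lapoly [:1, 1:] (G 0)" if G: "\<forall>j. Binf (G j)"
    and rec: "\<forall>j z. Lap (G j) z = of_nat (Suc j) * G (Suc j) z - of_nat (2 * j + 1) * G j z + of_nat j * G (j - 1) z" for G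
  proof
    fix z
    have "lapoly [:1, 1:] (G 0) z = Lap (G 0) z + G 0 z" using lapoly_linear[of "G 0" "-1" z] G by simp
    then show "G (Suc 0) z = lapoly [:1, 1:] (G 0) z" using rec[rule_format, of 0 z] by simp
  qed
  then show ?case by (intro exI[of _ 1] exI[of _ "[:1, 1:]"]) (simp add: one)
next
  case (Suc n)
  then obtain p q where pq: "\<And>G. (\<forall>j. Binf (G j)) \<Longrightarrow>
    (\<forall>j z. Lap (G j) z = of_nat (Suc j) * G (Suc j) z - of_nat (2 * j + 1) * G j z + of_nat j * G (j - 1) z) \<Longrightarrow>
    G n = lapoly p (G 0) \<and> G (Suc n) = lapoly q (G 0)" by blast
  define c where "c = (of_nat (2 * Suc n + 1) :: complex)"
  define r where "r = smult (1 / of_nat (Suc (Suc n))) ([:c, 1:] * q + smult (- of_nat (Suc n)) p)"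
  have "G (Suc (Suc n)) = lapoly r (G 0)" if G: "\<forall>j. Binf (G j)"
    and rec: "\<forall>j z. Lap (G j) z = of_nat (Suc j) * G (Suc j) z - of_nat (2 * j + 1) * G j z + of_nat j * G (j - 1) z" for G
  proof
    fix z
    have eqs: "G n = lapoly p (G 0)" "G (Suc n) = lapoly q (G 0)" using pq[OF G rec] by auto
    have G0: "Binf (G 0)" using G by blast
    have lin: "lapoly [:c, 1:] (G (Suc n)) z = Lap (G (Suc n)) z + c * G (Suc n) z"
      using lapoly_linear[of "G (Suc n)" "- c" z] G by simp
    have "lapoly r (G 0) z = 1 / of_nat (Suc (Suc n)) * (lapoly [:c, 1:] (G (Suc n)) z + - of_nat (Suc n) * G n z)"
      unfolding r_def lapoly_smult lapoly_add lapoly_mult[OF G0] eqs ..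
    also have "\<dots> = 1 / of_nat (Suc (Suc n)) * (of_nat (Suc (Suc n)) * G (Suc (Suc n)) z)"
      unfolding lin unfolding rec[rule_format, of "Suc n" z] c_def by (simp add: algebra_simps)
    also have "\<dots> = G (Suc (Suc n)) z" by (simp del: of_nat_Suc)
    finally show "G (Suc (Suc n)) z = lapoly r (G 0) z" ..
  qed
  with pq have "G (Suc n) = lapoly q (G 0) \<and> G (Suc (Suc n)) = lapoly r (G 0)" if "\<forall>j. Binf (G j)"
    "\<forall>j z. Lap (G j) z = of_nat (Suc j) * G (Suc j) z - of_nat (2 * j + 1) * G j z + of_nat j * G (j - 1) z" for G
    using that by (intro conjI) simp_all
  then show ?case by (intro exI[of _ q] exI[of _ r] allI impI)
qed

section \<open>The Berezin transform\<close>

lemma van_Lap: "Binf f \<Longrightarrow> van f \<Longrightarrow> van (Lap f)"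
  unfolding Lap_def by (intro van_deriv(1) BinfD Binf_dbar van_deriv(2))

definition laguerre_rec :: "(nat \<Rightarrow> complex \<Rightarrow> complex) \<Rightarrow> bool" where
  "laguerre_rec G \<longleftrightarrow> (\<forall>j. Binf (G j)) \<and>
    (\<forall>j z. Lap (G j) z = of_nat (Suc j) * G (Suc j) z - of_nat (2 * j + 1) * G j z + of_nat j * G (j - 1) z)"

text \<open>Named by choice, since what matters is its independence of \<open>G\<close>: one
  polynomial has to serve both the basis of the true Fock space and the powers of
  \<open>cnj w\<close>.\<close>

definition lagp :: "nat \<Rightarrow> complex poly" where
  "lagp n = (SOME p. \<forall>G. laguerre_rec G \<longrightarrow> G n = lapoly p (G 0))"

lemma lagp: "laguerre_rec G \<Longrightarrow> G n = lapoly (lagp n) (G 0)"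
proof -
  have "\<exists>p. \<forall>G. laguerre_rec G \<longrightarrow> G n = lapoly p (G 0)"
    using laguerre_recurrence[of n] unfolding laguerre_rec_def by blast
  from someI_ex[OF this] show "laguerre_rec G \<Longrightarrow> G n = lapoly (lagp n) (G 0)" unfolding lagp_def by blast
qed

text \<open>The recurrence is solved for its highest member, and \<open>Lap\<close> preserves
  vanishing at infinity on \<open>Binf\<close>.\<close>

lemma laguerre_rec_van:
  assumes G: "laguerre_rec G" and v: "van (G 0)"
  shows "van (G j)"
proof -
  have B: "Binf (G j)" for j using G by (simp add: laguerre_rec_def)
  have rec: "Lap (G j) z = of_nat (Suc j) * G (Suc j) z - of_nat (2 * j + 1) * G j z + of_nat j * G (j - 1) z" for j z
    using G by (simp add: laguerre_rec_def)
  have step: "van (G (Suc j))" if "van (G j)" "van (G (j - 1))" for j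
  proof -
    have "van (\<lambda>z. Lap (G j) z + of_nat (2 * j + 1) * G j z - of_nat j * G (j - 1) z)"
      by (intro van_add van_diff van_cmult van_Lap B that)
    moreover have "Lap (G j) z + of_nat (2 * j + 1) * G j z - of_nat j * G (j - 1) z = of_nat (Suc j) * G (Suc j) z" for z
      unfolding rec by simp
    ultimately have "van (\<lambda>z. of_nat (Suc j) * G (Suc j) z)" by (simp only:)
    then show ?thesis by (subst (asm) van_cmult_iff) (simp_all del: of_nat_Suc)
  qed
  have "van (G j) \<and> van (G (j - 1))"
  proof (induction j)
    case 0 show ?case using v by simp
  next
    case (Suc j) then show ?case using step[of j] by simp
  qed
  then show ?thesis ..
qed

context bounded_form
begin

lemma sym_Efun_wirt:
  assumes EX: "\<And>i. Efun n i \<in> X"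
  shows "wirt (sym (Efun n a) (Efun n b))
    (of_nat (Suc b) * sym (Efun n a) (Efun n (Suc b)) z - (if a = 0 then 0 else sym (Efun n (a - 1)) (Efun n b) z))
    (of_nat (Suc a) * sym (Efun n (Suc a)) (Efun n b) z - (if b = 0 then 0 else sym (Efun n a) (Efun n (b - 1)) z)) z"
proof -
  define q where "q i = (\<lambda>w. if i = 0 then 0 else Efun n (i - 1) w)" for i :: nat
  have q0: "q 0 = (\<lambda>w. 0 * Efun n 0 w)" and qS: "i \<noteq> 0 \<Longrightarrow> q i = Efun n (i - 1)" for i
    unfolding q_def by (simp_all add: fun_eq_iff)
  have qX: "q i \<in> X" for i by (cases "i = 0") (simp_all add: q0 qS X_cmult[OF EX, of 0, simplified] EX)
  have s1: "sym (q i) (Efun n b) z = (if i = 0 then 0 else sym (Efun n (i - 1)) (Efun n b) z)" for i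
    using sym_cmult1[OF EX[of 0] EX[of b], of 0 z] by (cases "i = 0") (simp_all add: q0 qS)
  have s2: "sym (Efun n a) (q i) z = (if i = 0 then 0 else sym (Efun n a) (Efun n (i - 1)) z)" for i
    using sym_cmult2[OF EX[of 0] EX[of a], of 0 z] by (cases "i = 0") (simp_all add: q0 qS)
  have "wirt (sym (Efun n a) (Efun n b))
     (sym (Efun n a) (\<lambda>w. of_nat (Suc b) * Efun n (Suc b) w) z - sym (q a) (Efun n b) z)
     (sym (\<lambda>w. of_nat (Suc a) * Efun n (Suc a) w) (Efun n b) z - sym (Efun n a) (q b) z) z"
    by (rule sym_wirt[OF lad_Efun[of n a, folded q_def] lad_Efun[of n b, folded q_def] EX X_cmult[OF EX] qX EX X_cmult[OF EX] qX])
  then show ?thesis unfolding sym_cmult1[OF EX EX] sym_cmult2[OF EX EX] s1 s2 complex_cnj_of_nat .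
qed

lemma sym_Efun_Binf:
  assumes EX: "\<And>i. Efun n i \<in> X"
  shows "Binf (sym (Efun n a) (Efun n b))"
proof (rule sym_Binf[where V = "{f. \<exists>c i. f = (\<lambda>w. c * Efun n i w)}"])
  show "{f. \<exists>c i. f = (\<lambda>w. c * Efun n i w)} \<subseteq> X" using X_cmult[OF EX] by blast
  have E: "Efun n i \<in> {f. \<exists>c i. f = (\<lambda>w. c * Efun n i w)}" for i
    by (intro CollectI exI[of _ 1] exI[of _ i]) simp
  show "Efun n a \<in> {f. \<exists>c i. f = (\<lambda>w. c * Efun n i w)}" "Efun n b \<in> {f. \<exists>c i. f = (\<lambda>w. c * Efun n i w)}" by (rule E)+
  fix f assume "f \<in> {f. \<exists>c i. f = (\<lambda>w. c * Efun n i w)}"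
  then obtain c i where f: "f = (\<lambda>w. c * Efun n i w)" by blast
  have p: "(\<lambda>w. c * (of_nat (Suc i) * Efun n (Suc i) w)) = (\<lambda>w. (c * of_nat (Suc i)) * Efun n (Suc i) w)"
    by (simp only: mult.assoc)
  have q: "(\<lambda>w. c * (if i = 0 then 0 else Efun n (i - 1) w)) = (\<lambda>w. (if i = 0 then 0 else c) * Efun n (i - 1) w)"
    by (simp add: fun_eq_iff)
  from lad_cmult[OF lad_Efun[of n i], of c]
  show "\<exists>f1\<in>{f. \<exists>c i. f = (\<lambda>w. c * Efun n i w)}. \<exists>f2\<in>{f. \<exists>c i. f = (\<lambda>w. c * Efun n i w)}. lad f f1 f2"
    unfolding f p q by blast
qed

lemma sym_Efun_Lap:
  assumes EX: "\<And>i. Efun n i \<in> X"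
  shows "Lap (sym (Efun n j) (Efun n j)) z = (of_nat (Suc j))\<^sup>2 * sym (Efun n (Suc j)) (Efun n (Suc j)) z
    - of_nat (2 * j + 1) * sym (Efun n j) (Efun n j) z + (if j = 0 then 0 else sym (Efun n (j - 1)) (Efun n (j - 1)) z)"
proof -
  note W = sym_Efun_wirt[OF EX]
  note db = wirt_funD(2)[OF W, of j j]
  show ?thesis
  proof (cases "j = 0")
    case True
    have "dbar (sym (Efun n 0) (Efun n 0)) = (\<lambda>z. of_nat (Suc 0) * sym (Efun n (Suc 0)) (Efun n 0) z)"
      using db unfolding True by simp
    then have "Lap (sym (Efun n 0) (Efun n 0)) z = of_nat (Suc 0) * (of_nat (Suc 0) * sym (Efun n (Suc 0)) (Efun n (Suc 0)) z - sym (Efun n 0) (Efun n 0) z)"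
      unfolding Lap_def using wirtD(2)[OF wirt_cmult[OF W[of "Suc 0" 0 z], of "of_nat (Suc 0)"]] by simp
    then show ?thesis unfolding True by simp
  next
    case False
    then have "dbar (sym (Efun n j) (Efun n j)) = (\<lambda>z. of_nat (Suc j) * sym (Efun n (Suc j)) (Efun n j) z - sym (Efun n j) (Efun n (j - 1)) z)"
      using db by simp
    then have "Lap (sym (Efun n j) (Efun n j)) z = of_nat (Suc j) * (of_nat (Suc j) * sym (Efun n (Suc j)) (Efun n (Suc j)) z - sym (Efun n j) (Efun n j) z)
      - (of_nat (Suc (j - 1)) * sym (Efun n j) (Efun n (Suc (j - 1))) z - sym (Efun n (j - 1)) (Efun n (j - 1)) z)"
      unfolding Lap_def using wirtD(2)[OF wirt_diff[OF wirt_cmult[OF W[of "Suc j" j z], of "of_nat (Suc j)"] W[of j "j - 1" z]]] False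
      by (simp del: of_nat_Suc)
    then show ?thesis using False by (simp add: power2_eq_square algebra_simps)
  qed
qed

text \<open>The squared norm of \<open>Efun n j\<close> is \<open>fact n / fact j\<close>, so
  \<open>fact j\<close> normalizes these vectors up to a factor independent of \<open>j\<close>. It
  turns the weight \<open>(of_nat (Suc j))\<^sup>2\<close> into the symmetric Laguerre form.\<close>

lemma sym_Efun_rec:
  assumes EX: "\<And>i. Efun n i \<in> X"
  shows "laguerre_rec (\<lambda>j z. fact j * sym (Efun n j) (Efun n j) z)"
  unfolding laguerre_rec_def
proof (intro conjI allI)
  fix j z
  show "Binf (\<lambda>z. fact j * sym (Efun n j) (Efun n j) z)" by (intro Binf_cmult sym_Efun_Binf EX)
  have "Lap (\<lambda>z. fact j * sym (Efun n j) (Efun n j) z) z = fact j * Lap (sym (Efun n j) (Efun n j)) z"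
    using Lap_cmult[OF sym_Efun_Binf[OF EX]] by simp
  then show "Lap (\<lambda>z. fact j * sym (Efun n j) (Efun n j) z) z = of_nat (Suc j) * (fact (Suc j) * sym (Efun n (Suc j)) (Efun n (Suc j)) z)
    - of_nat (2 * j + 1) * (fact j * sym (Efun n j) (Efun n j) z) + of_nat j * (fact (j - 1) * sym (Efun n (j - 1)) (Efun n (j - 1)) z)"
    unfolding sym_Efun_Lap[OF EX] by (cases j) (simp_all add: power2_eq_square algebra_simps)
qed

lemma sym_Efun_lapoly:
  assumes EX: "\<And>i. Efun n i \<in> X"
  shows "(\<lambda>z. fact n * sym (Efun n n) (Efun n n) z) = lapoly (lagp n) (sym (Efun n 0) (Efun n 0))"
  using lagp[OF sym_Efun_rec[OF EX], of n] by simp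

text \<open>By \<open>sym_Efun_wirt\<close>, \<open>dz\<close> raises the second index and
  \<open>dbar\<close> the first, up to terms already treated, and \<open>van_deriv\<close> passes
  vanishing at infinity to these derivatives.\<close>

lemma sym_Efun_van:
  assumes EX: "\<And>i. Efun n i \<in> X" and v: "van (sym (Efun n 0) (Efun n 0))"
  shows "van (sym (Efun n a) (Efun n b))"
proof (induction a arbitrary: b)
  case 0
  show ?case
  proof (induction b)
    case 0 show ?case by (rule v)
  next
    case (Suc b)
    have "van (dz (sym (Efun n 0) (Efun n b)))" by (rule van_deriv(1)[OF BinfD[OF sym_Efun_Binf[OF EX]] Suc])
    then have "van (\<lambda>z. of_nat (Suc b) * sym (Efun n 0) (Efun n (Suc b)) z)"
      using wirt_funD(1)[OF sym_Efun_wirt[OF EX], of 0 b] by simp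
    then show ?case by (subst (asm) van_cmult_iff) (simp_all del: of_nat_Suc)
  qed
next
  case (Suc a)
  have 1: "van (dbar (sym (Efun n a) (Efun n b)))" by (rule van_deriv(2)[OF BinfD[OF sym_Efun_Binf[OF EX]] Suc])
  have 2: "van (\<lambda>z. if b = 0 then 0 else sym (Efun n a) (Efun n (b - 1)) z)"
    using Suc[of "b - 1"] by (cases "b = 0") (simp_all add: van_def)
  have "van (\<lambda>z. of_nat (Suc a) * sym (Efun n (Suc a)) (Efun n b) z)"
    using van_add[OF 1 2] unfolding wirt_funD(2)[OF sym_Efun_wirt[OF EX], of a b] by simp
  then show ?case by (subst (asm) van_cmult_iff) (simp_all del: of_nat_Suc)
qed

end

text \<open>The symbol of multiplication by \<open>f\<close> for the vectors
  \<open>cnj w ^ i\<close> and \<open>cnj w ^ j\<close>. At indices 0 it is the convolution of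
  \<open>f\<close> with the Gaussian.\<close>

definition smom :: "(complex \<Rightarrow> complex) \<Rightarrow> nat \<Rightarrow> nat \<Rightarrow> complex \<Rightarrow> complex" where
  "smom f i j z = (LINT w|gauss. f (z + w) * (cnj w ^ i * w ^ j))"

lemma Efun_L2: "Efun n i \<in> L2"
  by (rule egrow_L2[OF egrow_Efun])

lemma mult_sym:
  assumes "f \<in> borel_measurable borel" "u \<in> borel_measurable borel" "v \<in> borel_measurable borel"
  shows "L2_inner (\<lambda>w. f w * Wt z u w) (Wt z v) = (LINT w|gauss. f (z + w) * (u w * cnj (v w)))"
  unfolding L2_inner_def mult.assoc by (rule integral_mult_Wt[OF assms])

text \<open>\<open>cnj w ^ i\<close> is \<open>Efun i 0\<close>: annihilation kills it, and creation
  gives \<open>Efun i 1\<close>, that is, \<open>w * cnj w ^ i\<close> minus a lower power. As the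
  form is multiplication by a function, the factor \<open>w\<close> moves to the other argument as a
  factor \<open>cnj w\<close>, so the derivatives stay within the family.\<close>

lemma smom_wirt:
  assumes f: "f \<in> Linfty"
  shows "wirt (smom f i j) (smom f (Suc i) j z - of_nat j * smom f i (j - 1) z) (smom f i (Suc j) z - of_nat i * smom f (i - 1) j z) z"
proof -
  have m: "f \<in> borel_measurable borel" using f by (simp add: Linfty_def)
  obtain M where "bounded_form L2 (\<lambda>u v. L2_inner (\<lambda>w. f w * u w) v) M" using mult_form[OF f] by blast
  then interpret F: bounded_form L2 "\<lambda>u v. L2_inner (\<lambda>w. f w * u w) v" M .
  have sy: "F.sym u v z = (LINT w|gauss. f (z + w) * (u w * cnj (v w)))" if "u \<in> L2" "v \<in> L2" for u v z
    unfolding F.sym_def by (rule mult_sym[OF m L2_measurable[OF that(1)] L2_measurable[OF that(2)]])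
  let ?m = "\<lambda>i. Efun i 0"
  have S: "smom f i j = F.sym (?m i) (?m j)" for i j
    unfolding smom_def[abs_def] sy[OF Efun_L2 Efun_L2] by (simp add: Efun_0)
  let ?w = "\<lambda>i w. w * cnj w ^ i :: complex"
  have wL: "?w i \<in> L2" for i by (intro egrow_L2 egrow_mult egrow_id egrow_power egrow_cnj)
  have E1: "Efun i (Suc 0) = (\<lambda>w. ?w i w - of_nat i * ?m (i - 1) w)" for i
    using Efun_1[of i] by (simp add: Efun_0 fun_eq_iff)
  have mL: "?m i \<in> L2" for i by (rule Efun_L2)
  have w1: "F.sym (?w i) (?m j) z = F.sym (?m i) (?m (Suc j)) z" for i j
    unfolding sy[OF wL mL] sy[OF mL mL] by (simp add: Efun_0 mult_ac)
  have w2: "F.sym (?m i) (?w j) z = F.sym (?m (Suc i)) (?m j) z" for i j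
    unfolding sy[OF mL wL] sy[OF mL mL] by (simp add: Efun_0 mult_ac)
  have e1: "F.sym (Efun i (Suc 0)) (?m j) z = F.sym (?m i) (?m (Suc j)) z - of_nat i * F.sym (?m (i - 1)) (?m j) z" for i j
    unfolding E1 F.sym_diff1[OF wL L2_cmult[OF mL] mL] F.sym_cmult1[OF mL mL] w1 ..
  have e2: "F.sym (?m i) (Efun j (Suc 0)) z = F.sym (?m (Suc i)) (?m j) z - of_nat j * F.sym (?m i) (?m (j - 1)) z" for i j
    unfolding E1 F.sym_diff2[OF wL L2_cmult[OF mL] mL] F.sym_cmult2[OF mL mL] w2 complex_cnj_of_nat ..
  have l: "lad (?m i) (Efun i (Suc 0)) (\<lambda>w. 0)" for i using lad_Efun[of i 0] by simp
  have z1: "F.sym (\<lambda>w. 0) (?m j) z = 0" for j using F.sym_cmult1[OF mL[of 0] mL[of j], of 0 z] by simp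
  have z2: "F.sym (?m j) (\<lambda>w. 0) z = 0" for j using F.sym_cmult2[OF mL[of 0] mL[of j], of 0 z] by simp
  have "wirt (F.sym (?m i) (?m j)) (F.sym (?m i) (Efun j (Suc 0)) z - F.sym (\<lambda>w. 0) (?m j) z) (F.sym (Efun i (Suc 0)) (?m j) z - F.sym (?m i) (\<lambda>w. 0) z) z"
    by (rule F.sym_wirt[OF l l mL Efun_L2 L2_zero mL Efun_L2 L2_zero])
  then show ?thesis unfolding S z1 z2 e1 e2 by simp
qed

lemma smom_Binf:
  assumes f: "f \<in> Linfty" shows "Binf (smom f j j)"
proof -
  have m: "f \<in> borel_measurable borel" using f by (simp add: Linfty_def)
  obtain M where "bounded_form L2 (\<lambda>u v. L2_inner (\<lambda>w. f w * u w) v) M" using mult_form[OF f] by blast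
  then interpret F: bounded_form L2 "\<lambda>u v. L2_inner (\<lambda>w. f w * u w) v" M .
  have "smom f j j = F.sym (Efun j 0) (Efun j 0)"
    unfolding smom_def[abs_def] F.sym_def[abs_def] mult_sym[OF m L2_measurable[OF Efun_L2] L2_measurable[OF Efun_L2]] by (simp add: Efun_0)
  then show ?thesis using F.sym_Efun_Binf[OF Efun_L2, of j 0 0] by simp
qed

text \<open>The counterpart of \<open>sym_Efun_rec\<close> for the powers of \<open>cnj w\<close>:
  here the squared norm is \<open>fact j\<close> (\<open>moment_fact\<close>), so the normalizing
  factor is its reciprocal, and the same recurrence results.\<close>

lemma smom_rec:
  assumes f: "f \<in> Linfty"
  shows "laguerre_rec (\<lambda>j z. (1 / fact j) * smom f j j z)"
  unfolding laguerre_rec_def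
proof (intro conjI allI)
  fix j z
  show "Binf (\<lambda>z. (1 / fact j) * smom f j j z)" by (intro Binf_cmult smom_Binf f)
  note W = smom_wirt[OF f]
  have L: "Lap (smom f j j) z = (smom f (Suc j) (Suc j) z - of_nat (Suc j) * smom f j j z) - of_nat j * (smom f (Suc (j - 1)) j z - of_nat j * smom f (j - 1) (j - 1) z)"
    unfolding Lap_def wirt_funD(2)[OF W]
    using wirtD(2)[OF wirt_diff[OF W[of j "Suc j" z] wirt_cmult[OF W[of "j - 1" j z], of "of_nat j"]]] by (simp del: of_nat_Suc)
  have "Lap (\<lambda>z. (1 / fact j) * smom f j j z) z = (1 / fact j) * Lap (smom f j j) z"
    by (rule fun_cong[OF Lap_cmult[OF smom_Binf[OF f]]])
  then show "Lap (\<lambda>z. (1 / fact j) * smom f j j z) z = of_nat (Suc j) * ((1 / fact (Suc j)) * smom f (Suc j) (Suc j) z)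
    - of_nat (2 * j + 1) * ((1 / fact j) * smom f j j z) + of_nat j * ((1 / fact (j - 1)) * smom f (j - 1) (j - 1) z)"
  proof (cases j)
    case 0
    then show ?thesis using \<open>Lap (\<lambda>z. (1 / fact j) * smom f j j z) z = (1 / fact j) * Lap (smom f j j) z\<close> unfolding L by simp
  next
    case (Suc i)
    have 1: "of_nat (Suc j) * ((1 / fact (Suc j)) * smom f (Suc j) (Suc j) z) = (1 / fact j) * smom f (Suc j) (Suc j) z"
      by (simp add: field_simps del: of_nat_Suc)
    have 2: "of_nat j * ((1 / fact (j - 1)) * smom f (j - 1) (j - 1) z) = (1 / fact j) * (of_nat j * of_nat j * smom f (j - 1) (j - 1) z)"
      unfolding Suc by (simp add: field_simps del: of_nat_Suc)
    show ?thesis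
      unfolding \<open>Lap (\<lambda>z. (1 / fact j) * smom f j j z) z = (1 / fact j) * Lap (smom f j j) z\<close> L 1 2
      using Suc by (simp add: algebra_simps add_divide_distrib)
  qed
qed

lemma lapoly_const: "lapoly [:c:] u = (\<lambda>z. c * u z)"
  by (simp add: lapoly_def fun_eq_iff)

lemma nkernel_Efun: "nkernel (Suc n) z = (\<lambda>w. (-1) ^ n * Wt z (Efun n n) w)"
  unfolding nkernel_Wt K0_Efun[abs_def] Wt_cmult ..

lemma minus_one_power_cnj: "(-1) ^ n * cnj ((-1) ^ n) = (1 :: complex)"
  by (simp add: power_mult_distrib[symmetric])

lemma berezin_toeplitz:
  assumes f: "f \<in> Linfty"
  shows "berezin (Suc n) (toeplitz (Suc n) f) z = L2_inner (\<lambda>w. f w * Wt z (Efun n n) w) (Wt z (Efun n n))"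
proof -
  have "berezin (Suc n) (toeplitz (Suc n) f) z = L2_inner (\<lambda>w. f w * nkernel (Suc n) z w) (nkernel (Suc n) z)"
    unfolding berezin_def by (rule toeplitz_inner[OF f nkernel_L2 nkernel_true_fock])
  also have "\<dots> = L2_inner (\<lambda>w. (-1) ^ n * (f w * Wt z (Efun n n) w)) (\<lambda>w. (-1) ^ n * Wt z (Efun n n) w)"
    unfolding nkernel_Efun by (simp only: mult.left_commute)
  also have "\<dots> = ((-1) ^ n * cnj ((-1) ^ n)) * L2_inner (\<lambda>w. f w * Wt z (Efun n n) w) (Wt z (Efun n n))"
    unfolding L2_inner_cmult1 L2_inner_cmult2 by (simp only: mult.assoc)
  finally show ?thesis unfolding minus_one_power_cnj by simp
qed

text \<open>The two ladders meet at the vector \<open>cnj w ^ n\<close>, which is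
  \<open>Efun n 0\<close>. The moments lead from \<open>smom f 0 0\<close> to it, and the basis
  leads from it to the kernel \<open>Efun n n\<close>; each contributes \<open>lagp n\<close>, and
  the factorials cancel. The result has exactly the form that \<open>tauber_poly\<close>
  treats.\<close>

lemma berezin_toeplitz_lapoly:
  assumes f: "f \<in> Linfty"
  shows "berezin (Suc n) (toeplitz (Suc n) f) = lapoly (lagp n) (lapoly (lagp n) (smom f 0 0))"
    and "van (lapoly (lagp n) (smom f 0 0)) \<Longrightarrow> toeplitz (Suc n) f \<in> compact_ops (Suc n)"
proof -
  have m: "f \<in> borel_measurable borel" using f by (simp add: Linfty_def)
  obtain M where "bounded_form L2 (\<lambda>u v. L2_inner (\<lambda>w. f w * u w) v) M" using mult_form[OF f] by blast
  then interpret F: bounded_form L2 "\<lambda>u v. L2_inner (\<lambda>w. f w * u w) v" M .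
  let ?p = "lagp n" and ?u = "smom f 0 0"
  have u: "Binf ?u" by (rule smom_Binf[OF f])
  have "(\<lambda>z. (1 / fact n) * smom f n n z) = lapoly ?p ?u" using lagp[OF smom_rec[OF f], of n] by simp
  then have "(1 / fact n) * smom f n n z = lapoly ?p ?u z" for z by (simp add: fun_eq_iff)
  then have s: "smom f n n z = fact n * lapoly ?p ?u z" for z by (simp add: field_simps)
  have "smom f n n = F.sym (Efun n 0) (Efun n 0)"
    unfolding smom_def[abs_def] F.sym_def[abs_def] mult_sym[OF m L2_measurable[OF Efun_L2] L2_measurable[OF Efun_L2]] by (simp add: Efun_0)
  then have S0: "F.sym (Efun n 0) (Efun n 0) = lapoly [:fact n:] (lapoly ?p ?u)"
    unfolding lapoly_const by (simp add: s fun_eq_iff)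
  have "(\<lambda>z. fact n * F.sym (Efun n n) (Efun n n) z) = lapoly [:fact n:] (lapoly ?p (lapoly ?p ?u))"
    unfolding F.sym_Efun_lapoly[OF Efun_L2] S0 by (rule lapoly_lapoly_commute[OF Binf_lapoly[OF u]])
  then have "fact n * F.sym (Efun n n) (Efun n n) z = fact n * lapoly ?p (lapoly ?p ?u) z" for z
    unfolding lapoly_const by (simp add: fun_eq_iff)
  then have "F.sym (Efun n n) (Efun n n) z = lapoly ?p (lapoly ?p ?u) z" for z by simp
  then show "berezin (Suc n) (toeplitz (Suc n) f) = lapoly ?p (lapoly ?p ?u)"
    unfolding F.sym_def by (simp add: berezin_toeplitz[OF f] fun_eq_iff)
  assume "van (lapoly ?p ?u)"
  then have "van (F.sym (Efun n 0) (Efun n 0))" unfolding S0 lapoly_const by (rule van_cmult)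
  then have "van (F.sym (Efun n i) (Efun n n))" for i by (rule F.sym_Efun_van[OF Efun_L2])
  then show "toeplitz (Suc n) f \<in> compact_ops (Suc n)" by (intro toeplitz_compactI[OF f]) (simp add: F.sym_def[abs_def])
qed

text \<open>For a general operator only the ladder along the basis is available, hence a single
  factor \<open>lagp n\<close>. The function \<open>h\<close> is the symbol of
  \<open>Efun n 0\<close> divided by \<open>fact n\<close>.\<close>

lemma berezin_lapoly:
  assumes A: "A \<in> bounded_ops (Suc n)"
  shows "\<exists>h. Binf h \<and> berezin (Suc n) A = lapoly (lagp n) h"
proof -
  obtain M where "bounded_form (true_fock (Suc n)) (\<lambda>u v. L2_inner (A u) v) M" using op_form[OF A] by blast
  then interpret F: bounded_form "true_fock (Suc n)" "\<lambda>u v. L2_inner (A u) v" M .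
  let ?S = "F.sym (Efun n 0) (Efun n 0)"
  have W: "Wt z (Efun n n) \<in> true_fock (Suc n)" for z by (rule Wt_true_fock[OF Efun_true_fock])
  have "berezin (Suc n) A z = F.sym (Efun n n) (Efun n n) z" for z
  proof -
    have "berezin (Suc n) A z = (-1) ^ n * (cnj ((-1) ^ n) * L2_inner (A (Wt z (Efun n n))) (Wt z (Efun n n)))"
      unfolding berezin_def nkernel_Efun F.B_cmult1[OF W true_fock_cmult[OF W]] F.B_cmult2[OF W W] ..
    then show ?thesis unfolding F.sym_def mult.assoc[symmetric] minus_one_power_cnj by simp
  qed
  then have b: "berezin (Suc n) A = F.sym (Efun n n) (Efun n n)" by (rule ext)
  have B: "Binf ?S" by (rule F.sym_Efun_Binf[OF Efun_true_fock])
  have "berezin (Suc n) A = lapoly [:1 / fact n:] (lapoly (lagp n) ?S)"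
    unfolding b lapoly_const F.sym_Efun_lapoly[OF Efun_true_fock, symmetric] by simp
  also have "\<dots> = lapoly (lagp n) (lapoly [:1 / fact n:] ?S)" by (rule lapoly_lapoly_commute[OF B])
  finally show ?thesis using Binf_lapoly[OF B] by blast
qed

section \<open>Recovering a symbol from its Gaussian average\<close>

lemma Binf_Linfty: "Binf a \<Longrightarrow> a \<in> Linfty"
proof -
  assume a: "Binf a"
  obtain C where C: "\<And>z. norm (a z) \<le> C" using Bs_bound[OF BinfD[OF a, of 0]] by blast
  have "a \<in> borel_measurable borel" by (rule borel_measurable_continuous_onI[OF Bs_continuous[OF BinfD[OF a, of 0]]])
  then show ?thesis using C by (auto simp: Linfty_def)
qed

text \<open>Dominated convergence. It verifies the hypothesis of \<open>toeplitz_compactI\<close>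
  for symbols that vanish at infinity.\<close>

lemma translate_van:
  assumes a: "Binf a" "van a" and u: "u \<in> L2" and v: "v \<in> L2"
  shows "van (\<lambda>z. LINT w|gauss. a (z + w) * (u w * cnj (v w)))"
proof (rule van_seqI)
  fix \<zeta> :: "nat \<Rightarrow> complex" assume \<zeta>: "filterlim (\<lambda>n. norm (\<zeta> n)) at_top sequentially"
  obtain C where C: "\<And>z. norm (a z) \<le> C" using Bs_bound[OF BinfD[OF a(1), of 0]] by blast
  have m: "a \<in> borel_measurable borel" by (rule borel_measurable_continuous_onI[OF Bs_continuous[OF BinfD[OF a(1), of 0]]])
  note [measurable] = m L2_measurable[OF u] L2_measurable[OF v]
  have "(\<lambda>m. LINT w|gauss. a (\<zeta> m + w) * (u w * cnj (v w))) \<longlonglongrightarrow> (LINT w|gauss. 0)"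
  proof (rule integral_dominated_convergence[where w = "\<lambda>w. C * (norm (u w) * norm (v w))"])
    show "integrable gauss (\<lambda>w. C * (norm (u w) * norm (v w)))"
      by (intro integrable_mult_right L2_mult_integrable(2) u v)
    show "(\<lambda>w. a (\<zeta> m + w) * (u w * cnj (v w))) \<in> borel_measurable gauss" for m
      unfolding measurable_gauss by measurable
    show "AE w in gauss. norm (a (\<zeta> m + w) * (u w * cnj (v w))) \<le> C * (norm (u w) * norm (v w))" for m
    proof (rule AE_I2)
      fix w
      show "norm (a (\<zeta> m + w) * (u w * cnj (v w))) \<le> C * (norm (u w) * norm (v w))"
        unfolding norm_mult complex_mod_cnj by (rule mult_right_mono[OF C]) simp
    qed
    show "AE w in gauss. (\<lambda>m. a (\<zeta> m + w) * (u w * cnj (v w))) \<longlonglongrightarrow> 0"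
    proof (rule AE_I2)
      fix w
      have "filterlim (\<lambda>m. norm (\<zeta> m + w)) at_top sequentially"
      proof (rule filterlim_at_top_mono)
        show "filterlim (\<lambda>m. - norm w + norm (\<zeta> m)) at_top sequentially"
          by (rule filterlim_tendsto_add_at_top[OF tendsto_const \<zeta>])
        show "\<forall>\<^sub>F m in sequentially. - norm w + norm (\<zeta> m) \<le> norm (\<zeta> m + w)"
          by (intro always_eventually allI) (use norm_triangle_ineq4[of "\<zeta> _ + w" w] in \<open>simp add: algebra_simps\<close>)
      qed
      from tendsto_mult_right[OF van_seqD[OF a(2) this], of "u w * cnj (v w)"]
      show "(\<lambda>m. a (\<zeta> m + w) * (u w * cnj (v w))) \<longlonglongrightarrow> 0" by simp
    qed
  qed simp
  then show "(\<lambda>m. LINT w|gauss. a (\<zeta> m + w) * (u w * cnj (v w))) \<longlonglongrightarrow> 0" by simp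
qed

lemma gconv_smom:
  assumes m: "a \<in> borel_measurable borel"
  shows "gconv 1 j a z = of_real pi * smom a j j z"
proof -
  note [measurable] = m
  have e: "of_real (gker 1 j y) * a (z + y) = of_real pi * ((exp (- (norm y)\<^sup>2) / pi) *\<^sub>R (a (z + y) * (cnj y ^ j * y ^ j)))" for y
  proof -
    have "cnj y ^ j * y ^ j = (y * cnj y) ^ j" by (simp only: power_mult_distrib mult.commute)
    also have "\<dots> = of_real (((norm y)\<^sup>2) ^ j)" unfolding complex_norm_square[symmetric] of_real_power ..
    finally have c: "cnj y ^ j * y ^ j = of_real (((norm y)\<^sup>2) ^ j)" .
    show ?thesis unfolding c gker_def scaleR_conv_of_real by simp
  qed
  have "smom a j j z = (LINT y|lborel. (exp (- (norm y)\<^sup>2) / pi) *\<^sub>R (a (z + y) * (cnj y ^ j * y ^ j)))"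
    unfolding smom_def by (rule integral_gauss) measurable
  then show ?thesis unfolding gconv_def e by (simp only: integral_mult_right_zero)
qed

text \<open>The recurrence carries vanishing from the Gaussian average to all radial moments; these
  are, up to constants, the averages \<open>gconv 1 j a\<close> required by
  \<open>gconv_sharpen\<close>.\<close>

lemma van_of_smom_van:
  assumes a: "Binf a" and v: "van (smom a 0 0)"
  shows "van a"
proof -
  have aL: "a \<in> Linfty" by (rule Binf_Linfty[OF a])
  have m: "a \<in> borel_measurable borel" using aL by (simp add: Linfty_def)
  obtain C where C: "\<And>z. norm (a z) \<le> C" using Bs_bound[OF BinfD[OF a, of 0]] by blast
  obtain L where L: "L \<ge> 0" "\<And>z w. norm (a z - a w) \<le> L * norm (z - w)" using Bs_lipschitz[OF BinfD[OF a]] by blast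
  have v0: "van (\<lambda>z. (1 / fact 0) * smom a 0 0 z)" using v by simp
  have "van (gconv 1 j a)" for j
  proof -
    have "van (\<lambda>z. (1 / fact j) * smom a j j z)" by (rule laguerre_rec_van[OF smom_rec[OF aL] v0])
    then have "van (\<lambda>z. (of_real pi * fact j) * ((1 / fact j) * smom a j j z))" by (rule van_cmult)
    moreover have "gconv 1 j a = (\<lambda>z. (of_real pi * fact j) * ((1 / fact j) * smom a j j z))"
      by (rule ext) (simp add: gconv_smom[OF m])
    ultimately show ?thesis by (simp only:)
  qed
  then show ?thesis by (rule gconv_sharpen[OF m C L])
qed

lemma C0_iff: "f \<in> C0 \<longleftrightarrow> continuous_on UNIV f \<and> van f"
  by (simp add: C0_def van_iff_tendsto)

lemma toeplitz_compact_iff: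
  assumes f: "f \<in> Linfty"
  shows "toeplitz (Suc n) f \<in> compact_ops (Suc n) \<longleftrightarrow> van (berezin (Suc n) (toeplitz (Suc n) f))"
proof
  assume "van (berezin (Suc n) (toeplitz (Suc n) f))"
  then have "van (lapoly (lagp n) (smom f 0 0))"
    unfolding berezin_toeplitz_lapoly(1)[OF f] by (rule tauber_poly[OF smom_Binf[OF f]])
  then show "toeplitz (Suc n) f \<in> compact_ops (Suc n)" by (rule berezin_toeplitz_lapoly(2)[OF f])
qed (rule compact_imp_berezin_van)

lemma berezin_van_iff:
  assumes A: "A \<in> bounded_ops (Suc n)"
  shows "van (berezin (Suc n) A) \<longleftrightarrow> toeplitz (Suc n) (berezin (Suc n) A) \<in> compact_ops (Suc n)"
proof -
  obtain h where h: "Binf h" "berezin (Suc n) A = lapoly (lagp n) h" using berezin_lapoly[OF A] by blast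
  define a where "a = berezin (Suc n) A"
  have a: "Binf a" unfolding a_def h(2) by (rule Binf_lapoly[OF h(1)])
  have aL: "a \<in> Linfty" by (rule Binf_Linfty[OF a])
  have m: "a \<in> borel_measurable borel" using aL by (simp add: Linfty_def)
  have "van a \<longleftrightarrow> toeplitz (Suc n) a \<in> compact_ops (Suc n)"
  proof
    assume v: "van a"
    show "toeplitz (Suc n) a \<in> compact_ops (Suc n)"
    proof (rule toeplitz_compactI[OF aL])
      fix i
      show "van (\<lambda>z. L2_inner (\<lambda>w. a w * Wt z (Efun n i) w) (Wt z (Efun n n)))"
        unfolding mult_sym[OF m L2_measurable[OF Efun_L2] L2_measurable[OF Efun_L2]]
        by (rule translate_van[OF a v Efun_L2 Efun_L2])
    qed
  next
    let ?p = "lagp n"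
    assume "toeplitz (Suc n) a \<in> compact_ops (Suc n)"
    then have "van (lapoly ?p (lapoly ?p (smom a 0 0)))"
      unfolding toeplitz_compact_iff[OF aL] berezin_toeplitz_lapoly(1)[OF aL] .
    then have 1: "van (lapoly ?p (smom a 0 0))" by (rule tauber_poly[OF smom_Binf[OF aL]])
    \<comment> \<open>Convolution commutes with \<open>Lap\<close>, so the average of
      \<open>a\<close> is \<open>lapoly ?p\<close> of the average of \<open>h\<close>. Inserted in
      \<open>1\<close>, this is again a doubled factor, which permits the second
      cancellation.\<close>
    have s: "smom a 0 0 = lapoly ?p (conv h)"
      unfolding lapoly_conv[OF h(1)] h(2)[symmetric] a_def[symmetric] by (simp add: smom_def conv_def fun_eq_iff)
    have "van (smom a 0 0)" using 1 unfolding s by (rule tauber_poly[OF Binf_conv[OF h(1)]])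
    then show "van a" by (rule van_of_smom_van[OF a])
  qed
  then show ?thesis unfolding a_def .
qed

theorem theorem3p11:
  fixes k :: nat
  assumes "k \<ge> 1"
  shows "(\<forall>f \<in> Linfty. toeplitz k f \<in> compact_ops k \<longleftrightarrow> berezin k (toeplitz k f) \<in> C0) \<and>
    (\<forall>A \<in> bounded_ops k. berezin k A \<in> C0 \<longleftrightarrow> toeplitz k (berezin k A) \<in> compact_ops k)"
proof -
  obtain n where k: "k = Suc n" using assms by (cases k) auto
  show ?thesis
    unfolding k C0_iff
    using toeplitz_compact_iff berezin_van_iff berezin_continuous toeplitz_bounded by blast
qed

end
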